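(* Let $\tau>0$. As point processes on $\mathbb R$, $$\left\{\lambda\in\mathbb R:\ x^{\lambda/\tau}(\tau)=\mathcal V(\infty)\right\}\ \stackrel{d}{=}\ \mathrm{Sch}^*_\tau,$$ where $x^\lambda$ is the Brownian carousel driven by the hyperbolic Brownian motion $\mathcal V$ and $\mathrm{Sch}^*_\tau=\mathrm{Sch}_\tau+U$ with $U$ uniform on $[0,2\pi]$ and independent of $\mathrm{Sch}_\tau$.
   Context: Definition of $\mathrm{Sch}_\tau$: let $\mathcal B,\mathcal B_2,\mathcal B_3$ be independent standard real Brownian motions, $\mathcal W=\frac1{\sqrt2}(\mathcal B_2+i\mathcal B_3)$, and let $\varphi^\lambda(t)$, $\lambda\in\mathbb R$, be the solutions (all driven by the same $\mathcal B,\mathcal W$, in the version continuous in $\lambda$) of $d\varphi^\lambda=\lambda\,dt+d\mathcal B+\mathrm{Re}[e^{-i\varphi^\lambda}d\mathcal W]$, $\varphi^\lambda(0)=0$. Then $\mathrm{Sch}_\tau=\{\lambda\in\mathbb R:\varphi^{\lambda/\tau}(\tau)\in2\pi\mathbb Z\}$. Brownian carousel: let $\mathcal V(t)$, $t\ge0$, be Brownian motion on the hyperbolic plane $\mathbb H$; it converges a.s. to a boundary point $\mathcal V(\infty)\in\partial\mathbb H$. Fix a boundary point $x_0$, set $x^\lambda(0)=x_0$ for all $\lambda\in\mathbb R$, and let $x^\lambda(t)$ be the trajectory of this point rotated continuously about the moving center $\mathcal V(t)$ at angular speed $\lambda$. In the Poincaré disk model (with normalization used here): $d\mathcal V=\frac{1-|\mathcal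 V|^2}{2}d\mathcal Y$, $\mathcal V(0)=0$, where $\mathcal Y$ is a standard complex Brownian motion (real and imaginary parts independent Brownian motions each of variance $t/2$); $x_0=1$; and $x^\lambda(t)=e^{i\gamma^\lambda(t)}$ with $\partial_t\gamma^\lambda=\lambda\frac{|e^{i\gamma^\lambda}-\mathcal V|^2}{1-|\mathcal V|^2}$, $\gamma^\lambda(0)=0$. *)

theory Defs
  imports "HOL-Probability.Probability"
begin

section \<open>Brownian motion\<close>

text \<open>Time is modelled by \<open>real\<close>; a process is a function of type
  \<open>real \<Rightarrow> 'w \<Rightarrow> _\<close> of which only the times \<open>t \<ge> 0\<close> are relevant.\<close>

definition standard_BM :: "'w measure \<Rightarrow> (real \<Rightarrow> 'w \<Rightarrow> real) \<Rightarrow> bool" where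
  "standard_BM M B \<longleftrightarrow>
     (\<forall>t\<ge>0. B t \<in> borel_measurable M) \<and>
     (AE \<omega> in M. B 0 \<omega> = 0) \<and>
     (AE \<omega> in M. continuous_on {0..} (\<lambda>t. B t \<omega>)) \<and>
     (\<forall>s\<ge>0. \<forall>t>s. distributed M lborel (\<lambda>\<omega>. B t \<omega> - B s \<omega>) (normal_density 0 (sqrt (t - s)))) \<and>
     (\<forall>n. \<forall>u :: nat \<Rightarrow> real. 0 \<le> u 0 \<and> mono u \<longrightarrow>
        prob_space.indep_vars M (\<lambda>_. borel) (\<lambda>k \<omega>. B (u (Suc k)) \<omega> - B (u k) \<omega>) {..<n})"

definition independent_BMs :: "'w measure \<Rightarrow> 'i set \<Rightarrow> ('i \<Rightarrow> real \<Rightarrow> 'w \<Rightarrow> real) \<Rightarrow> bool" where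
  "independent_BMs M I B \<longleftrightarrow>
     (\<forall>i\<in>I. standard_BM M (B i)) \<and>
     prob_space.indep_vars M (\<lambda>_. \<Pi>\<^sub>M t\<in>{0..}. borel) (\<lambda>i \<omega>. \<lambda>t\<in>{0..}. B i t \<omega>) I"

text \<open>The filtration \<open>F\<close> is admissible for the Brownian motions \<open>B i\<close>, \<open>i \<in> I\<close>: they are adapted,
  and at each time \<open>s\<close> the increments after \<open>s\<close> are jointly independent of \<open>F s\<close>. The filtration
  may be larger than the one generated by the \<open>B i\<close>, in particular it may contain null sets.\<close>

definition BM_filtration ::
  "'w measure \<Rightarrow> (real \<Rightarrow> 'w measure) \<Rightarrow> 'i set \<Rightarrow> ('i \<Rightarrow> real \<Rightarrow> 'w \<Rightarrow> real) \<Rightarrow> bool" where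
  "BM_filtration M F I B \<longleftrightarrow>
     filtration (space M) F \<and>
     (\<forall>t. subalgebra M (F t)) \<and>
     (\<forall>i\<in>I. \<forall>t\<ge>0. B i t \<in> borel_measurable (F t)) \<and>
     (\<forall>s\<ge>0. prob_space.indep_set M (sets (F s))
        {(\<lambda>\<omega>. \<lambda>(i, t) \<in> I \<times> {s..}. B i t \<omega> - B i s \<omega>) -` A \<inter> space M | A.
           A \<in> sets (\<Pi>\<^sub>M j \<in> I \<times> {s..}. (borel :: real measure))})"

text \<open>Normalization: real and imaginary part have variance \<open>t / 2\<close> at time \<open>t\<close>.\<close>

definition complex_BM ::
  "(real \<Rightarrow> 'w \<Rightarrow> real) \<Rightarrow> (real \<Rightarrow> 'w \<Rightarrow> real) \<Rightarrow> real \<Rightarrow> 'w \<Rightarrow> complex" where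
  "complex_BM X Y t \<omega> = (complex_of_real (X t \<omega>) + \<i> * complex_of_real (Y t \<omega>)) / complex_of_real (sqrt 2)"


section \<open>The Ito integral\<close>

text \<open>A simple process is given by times \<open>u 0 \<le> u 1 \<le> \<dots> \<le> u n\<close> and bounded random variables
  \<open>\<xi> k\<close> measurable at time \<open>u k\<close>, which is its value on the interval \<open>(u k, u (k+1)]\<close>.\<close>

definition simple_process ::
  "(real \<Rightarrow> 'w measure) \<Rightarrow> nat \<Rightarrow> (nat \<Rightarrow> real) \<Rightarrow> (nat \<Rightarrow> 'w \<Rightarrow> complex) \<Rightarrow> bool" where
  "simple_process F n u \<xi> \<longleftrightarrow>
     0 \<le> u 0 \<and> (\<forall>k<n. u k \<le> u (Suc k)) \<and>
     (\<forall>k<n. \<xi> k \<in> borel_measurable (F (u k)) \<and> (\<exists>C. \<forall>\<omega>\<in>space (F (u k)). cmod (\<xi> k \<omega>) \<le> C))"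

definition simple_value ::
  "nat \<Rightarrow> (nat \<Rightarrow> real) \<Rightarrow> (nat \<Rightarrow> 'w \<Rightarrow> complex) \<Rightarrow> real \<Rightarrow> 'w \<Rightarrow> complex" where
  "simple_value n u \<xi> s \<omega> = (\<Sum>k<n. \<xi> k \<omega> * indicator {u k <.. u (Suc k)} s)"

definition simple_integral ::
  "nat \<Rightarrow> (nat \<Rightarrow> real) \<Rightarrow> (nat \<Rightarrow> 'w \<Rightarrow> complex) \<Rightarrow> (real \<Rightarrow> 'w \<Rightarrow> complex) \<Rightarrow> real \<Rightarrow> 'w \<Rightarrow> complex" where
  "simple_integral n u \<xi> X t \<omega> =
     (\<Sum>k<n. \<xi> k \<omega> * (X (min (u (Suc k)) t) \<omega> - X (min (u k) t) \<omega>))"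

text \<open>\<open>J t\<close> is (a version of) the integral of the process \<open>H\<close> against the Brownian motion \<open>X\<close>
  over \<open>[0, t]\<close>: the \<open>L\<^sup>2\<close>-limit of integrals of simple processes that approximate \<open>H\<close>
  in \<open>L\<^sup>2([0, t] \<times> \<Omega>)\<close>. By the isometry it is almost surely unique. All integrands used below are
  bounded, adapted and almost surely continuous.\<close>

definition has_ito_integral ::
  "'w measure \<Rightarrow> (real \<Rightarrow> 'w measure) \<Rightarrow> (real \<Rightarrow> 'w \<Rightarrow> complex) \<Rightarrow> (real \<Rightarrow> 'w \<Rightarrow> complex)
     \<Rightarrow> (real \<Rightarrow> 'w \<Rightarrow> complex) \<Rightarrow> bool" where
  "has_ito_integral M F H X J \<longleftrightarrow>
     (\<forall>t\<ge>0. H t \<in> borel_measurable (F t)) \<and>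
     (\<forall>t\<ge>0. J t \<in> borel_measurable M) \<and>
     (\<forall>t\<ge>0. \<exists>n u \<xi>.
        (\<forall>j :: nat. simple_process F (n j) (u j) (\<xi> j)) \<and>
        (\<lambda>j. \<integral>\<^sup>+ s\<in>{0..t}. (\<integral>\<^sup>+ \<omega>. ennreal ((cmod (simple_value (n j) (u j) (\<xi> j) s \<omega> - H s \<omega>))\<^sup>2) \<partial>M) \<partial>lborel)
          \<longlonglongrightarrow> 0 \<and>
        (\<lambda>j. \<integral>\<^sup>+ \<omega>. ennreal ((cmod (simple_integral (n j) (u j) (\<xi> j) X t \<omega> - J t \<omega>))\<^sup>2) \<partial>M)
          \<longlonglongrightarrow> 0)"


section \<open>Point processes on the line\<close>

text \<open>A point configuration is a set of reals; the \<open>\<sigma>\<close>-algebra is the usual one,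
  generated by the numbers of points in Borel sets.\<close>

definition config_space :: "real set measure" where
  "config_space = sigma UNIV {{S. finite (S \<inter> A) \<and> card (S \<inter> A) = k} | A k. A \<in> sets borel}"

text \<open>The random sets below are determined by the driving processes only up to null sets,
  hence measurability refers to the completion of the probability space.\<close>

definition point_process :: "'w measure \<Rightarrow> ('w \<Rightarrow> real set) \<Rightarrow> bool" where
  "point_process M S \<longleftrightarrow>
     S \<in> measurable (completion M) config_space \<and>
     (AE \<omega> in M. \<forall>a b. finite (S \<omega> \<inter> {a..b}))"

definition pp_law :: "'w measure \<Rightarrow> ('w \<Rightarrow> real set) \<Rightarrow> real set measure" where
  "pp_law M S = distr (completion M) config_space S"

definition pp_eq_law :: "'v measure \<Rightarrow> ('v \<Rightarrow> real set) \<Rightarrow> 'w measure \<Rightarrow> ('w \<Rightarrow> real set) \<Rightarrow> bool" where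
  "pp_eq_law M S N T \<longleftrightarrow> point_process M S \<and> point_process N T \<and> pp_law M S = pp_law N T"


section \<open>The process \<open>Sch\<close>\<close>

text \<open>\<open>\<phi>\<close> is the family of solutions, continuous in \<open>\<lambda>\<close>, of
  \<open>d\<phi>\<^sup>\<lambda> = \<lambda> dt + dB + Re (exp (- i \<phi>\<^sup>\<lambda>) dW)\<close>, \<open>\<phi>\<^sup>\<lambda>(0) = 0\<close>; the argument \<open>B\<close> lists the three real
  Brownian motions, of which the last two form \<open>W\<close>.\<close>

definition sch_flow ::
  "'w measure \<Rightarrow> (real \<Rightarrow> 'w measure) \<Rightarrow> (nat \<Rightarrow> real \<Rightarrow> 'w \<Rightarrow> real) \<Rightarrow> (real \<Rightarrow> real \<Rightarrow> 'w \<Rightarrow> real) \<Rightarrow> bool" where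
  "sch_flow M F B \<phi> \<longleftrightarrow>
     independent_BMs M {1, 2, 3} B \<and> BM_filtration M F {1, 2, 3} B \<and>
     (\<forall>l. \<forall>t\<ge>0. \<phi> l t \<in> borel_measurable (F t)) \<and>
     (AE \<omega> in M. (\<forall>l. continuous_on {0..} (\<lambda>t. \<phi> l t \<omega>)) \<and>
                   (\<forall>t\<ge>0. continuous_on UNIV (\<lambda>l. \<phi> l t \<omega>))) \<and>
     (\<forall>l. AE \<omega> in M. \<phi> l 0 \<omega> = 0) \<and>
     (\<forall>l. \<exists>J. has_ito_integral M F (\<lambda>t \<omega>. exp (- \<i> * complex_of_real (\<phi> l t \<omega>))) (complex_BM (B 2) (B 3)) J \<and>
              (\<forall>t\<ge>0. AE \<omega> in M. \<phi> l t \<omega> = l * t + B 1 t \<omega> + Re (J t \<omega>)))"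

definition Sch :: "(real \<Rightarrow> real \<Rightarrow> 'w \<Rightarrow> real) \<Rightarrow> real \<Rightarrow> 'w \<Rightarrow> real set" where
  "Sch \<phi> \<tau> \<omega> = {l. \<exists>k::int. \<phi> (l / \<tau>) \<tau> \<omega> = 2 * pi * of_int k}"

definition Sch_star :: "(real \<Rightarrow> real \<Rightarrow> 'w \<Rightarrow> real) \<Rightarrow> ('w \<Rightarrow> real) \<Rightarrow> real \<Rightarrow> 'w \<Rightarrow> real set" where
  "Sch_star \<phi> U \<tau> \<omega> = (\<lambda>l. l + U \<omega>) ` Sch \<phi> \<tau> \<omega>"

definition independent_uniform_shift :: "'w measure \<Rightarrow> ('w \<Rightarrow> real) \<Rightarrow> ('w \<Rightarrow> real set) \<Rightarrow> bool" where
  "independent_uniform_shift M U S \<longleftrightarrow>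
     U \<in> borel_measurable M \<and>
     distr M borel U = uniform_measure lborel {0..2 * pi} \<and>
     prob_space.indep_set (completion M)
       {U -` A \<inter> space M | A. A \<in> sets borel} {S -` C \<inter> space M | C. C \<in> sets config_space}"


section \<open>The Brownian carousel\<close>

text \<open>Hyperbolic Brownian motion in the disk model, started at \<open>0\<close>:
  \<open>dV = (1 - |V|\<^sup>2) / 2 dY\<close> with \<open>Y = (B 1 + i B 2) / sqrt 2\<close>.\<close>

definition hyperbolic_BM ::
  "'w measure \<Rightarrow> (real \<Rightarrow> 'w measure) \<Rightarrow> (nat \<Rightarrow> real \<Rightarrow> 'w \<Rightarrow> real) \<Rightarrow> (real \<Rightarrow> 'w \<Rightarrow> complex) \<Rightarrow> bool" where
  "hyperbolic_BM M F B V \<longleftrightarrow>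
     independent_BMs M {1, 2} B \<and> BM_filtration M F {1, 2} B \<and>
     (\<forall>t\<ge>0. V t \<in> borel_measurable (F t)) \<and>
     (AE \<omega> in M. continuous_on {0..} (\<lambda>t. V t \<omega>)) \<and>
     (AE \<omega> in M. \<forall>t\<ge>0. cmod (V t \<omega>) < 1) \<and>
     (AE \<omega> in M. V 0 \<omega> = 0) \<and>
     (\<exists>J. has_ito_integral M F (\<lambda>t \<omega>. complex_of_real ((1 - (cmod (V t \<omega>))\<^sup>2) / 2)) (complex_BM (B 1) (B 2)) J \<and>
          (\<forall>t\<ge>0. AE \<omega> in M. V t \<omega> = J t \<omega>))"

text \<open>The limit exists almost surely; elsewhere the value is arbitrary.\<close>

definition V_infinity :: "(real \<Rightarrow> 'w \<Rightarrow> complex) \<Rightarrow> 'w \<Rightarrow> complex" where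
  "V_infinity V \<omega> = Lim at_top (\<lambda>t. V t \<omega>)"

definition carousel_point :: "(real \<Rightarrow> real \<Rightarrow> 'w \<Rightarrow> real) \<Rightarrow> real \<Rightarrow> real \<Rightarrow> 'w \<Rightarrow> complex" where
  "carousel_point \<gamma> l t \<omega> = exp (\<i> * complex_of_real (\<gamma> l t \<omega>))"

text \<open>\<open>\<gamma> l\<close> is the continuous angle of the boundary point that starts at \<open>1\<close> and is rotated about
  the moving center \<open>V\<close> at angular speed \<open>l\<close>.\<close>

definition carousel_angle ::
  "'w measure \<Rightarrow> (real \<Rightarrow> 'w \<Rightarrow> complex) \<Rightarrow> (real \<Rightarrow> real \<Rightarrow> 'w \<Rightarrow> real) \<Rightarrow> bool" where
  "carousel_angle M V \<gamma> \<longleftrightarrow>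
     (AE \<omega> in M. \<forall>l. \<gamma> l 0 \<omega> = 0 \<and>
        (\<forall>t\<ge>0. ((\<lambda>s. \<gamma> l s \<omega>) has_real_derivative
            l * ((cmod (carousel_point \<gamma> l t \<omega> - V t \<omega>))\<^sup>2 / (1 - (cmod (V t \<omega>))\<^sup>2)))
          (at t within {0..})))"

end

theory Submission
  imports Defs
begin

text \<open>Both point sets are level sets, at a uniform level, of one and the same random increasing function.

 Let \<open>angle v g\<close> be the argument of the image of \<open>cis g\<close> under the Moebius map of the disk that moves
 \<open>v\<close> to \<open>0\<close>. It increases in \<open>g\<close> at the rate \<open>poisson v g\<close>, while the carousel moves the boundary point at
 the speed \<open>l / poisson v g\<close>; so, seen from the moving center, the point turns at the constant speed \<open>l\<close>. With
 \<open>alpha\<close> the angle of this point seen from the center, minus the angle of the boundary point \<open>1\<close>, an expansion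
 in \<open>dV\<close> gives \<open>d alpha = l dt + Re ((cis (- alpha) - 1) rho dY)\<close>, where \<open>rho\<close> is an adapted unit complex number.
 There is no Ito correction, since the angle is the imaginary part of a function holomorphic in \<open>v\<close>.

 On the other side \<open>phi l - phi l0\<close> satisfies the same equation with drift \<open>l - l0\<close> and with \<open>rho\<close> replaced by
 \<open>cis (- phi l0)\<close>. Complex Gaussian noise keeps its law when its increments are multiplied by an adapted unit
 complex number (\<open>noise_seq_law\<close>). So the Euler schemes of the two equations have the same law, jointly for all
 drifts, and since they converge (\<open>scheme_converges\<close>) the families \<open>alpha\<close> and \<open>phi - phi 0\<close> have the same law
 (\<open>relative_law\<close>). Likewise the law of \<open>phi (l + c) - c t\<close>, as a family in \<open>l\<close>, does not depend on \<open>c\<close>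
 (\<open>translation_invariance\<close>). The error is measured by \<open>eta e = e\<^sup>2 / (1 + e\<^sup>2)\<close>: this is bounded, and
 Taylor's inequality for it needs no moments, so that no stopping times are required.

 The limit of \<open>V\<close> on the circle, seen from \<open>V t\<close>, is uniform and independent of the past (\<open>harmonic_measure\<close>):
 \<open>V\<close> and its powers are martingales because the square of the complex noise has mean \<open>0\<close>, and this determines
 the moments. Hence \<open>x = V \<infinity>\<close> says that \<open>alpha\<close> meets an independent uniform level modulo \<open>2 * pi\<close>
 (\<open>carousel_law\<close>).

 Finally \<open>Sch + u\<close> is the set where \<open>phi ((l - u) / t) + u\<close> equals \<open>u\<close> modulo \<open>2 * pi\<close>. By translation
 invariance it has the law of the set where \<open>phi (l / t)\<close> equals \<open>u\<close>, and averaging over \<open>u\<close> makes the level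
 uniform, so that \<open>phi 0\<close> may be subtracted (\<open>shifted_law\<close>). As \<open>U\<close> is independent of the configuration \<open>Sch\<close>
 only, and not of the flow, the shifted set is constructed from the configuration alone, through an enumeration
 of its points.\<close>

notation (input) LIMSEQ ("(_)/ ----> (_)" [60, 60] 60)

abbreviation L2sq :: "'a measure => ('a => complex) => ennreal" where
 "L2sq M f \<equiv> \<integral>\<^sup>+x. ennreal ((cmod (f x))^2) \<partial>M"

abbreviation Cx :: "real => complex" where
 "Cx \<equiv> of_real"

abbreviation (in prob_space) mean :: "('a => 'b :: {banach, second_countable_topology}) => 'b" where
 "mean \<equiv> integral\<^sup>L M"

hide_fact (open)
 Henstock_Kurzweil_Integration.integrable_bound
 Henstock_Kurzweil_Integration.integral_nonneg
 Henstock_Kurzweil_Integration.integral_sum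
 Henstock_Kurzweil_Integration.integral_add
 Henstock_Kurzweil_Integration.integral_cong
 Henstock_Kurzweil_Integration.integrable_add
 Henstock_Kurzweil_Integration.integrable_sum
 Henstock_Kurzweil_Integration.integral_diff
 Henstock_Kurzweil_Integration.integral_cnj
 Henstock_Kurzweil_Integration.integrable_cong

section \<open>Complex Gaussian noise\<close>

abbreviation complex_point :: "real => real => complex" where
 "complex_point x y \<equiv> Complex x y / Cx (sqrt 2)"

definition gauss :: "real => real measure" where
 "gauss h = density lborel (normal_density 0 (sqrt h))"

definition cgauss :: "real => complex measure" where
 "cgauss h = distr (gauss h \<Otimes>\<^sub>M gauss h) borel (%(x, y). complex_point x y)"

lemma sets_gauss [measurable_cong, simp]: "sets (gauss h) = sets borel"
 by (simp add: gauss_def)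

lemma space_gauss [simp]: "space (gauss h) = UNIV"
 by (simp add: gauss_def)

lemma prob_space_gauss: "h > 0 ==> prob_space (gauss h)"
 unfolding gauss_def by (rule prob_space_normal_density) simp

lemma borel_measurable_Complex [measurable (raw)]:
 assumes "f \<in> borel_measurable M" "g \<in> borel_measurable M"
 shows "(%x. Complex (f x) (g x)) \<in> borel_measurable M"
 unfolding Complex_eq using assms by measurable

lemma sets_cgauss [measurable_cong, simp]: "sets (cgauss h) = sets borel"
 by (simp add: cgauss_def)

lemma space_cgauss [simp]: "space (cgauss h) = UNIV"
 by (simp add: cgauss_def)

lemma prob_space_cgauss: assumes "h > 0" shows "prob_space (cgauss h)"
proof -
 interpret prob_space "gauss h" by (rule prob_space_gauss[OF assms])
 interpret P: pair_prob_space "gauss h" "gauss h" ..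
 show ?thesis unfolding cgauss_def
  by (rule P.prob_space_distr) (simp add: case_prod_beta')
qed

lemma nn_integral_gauss:
 assumes [measurable]: "f \<in> borel_measurable borel"
 shows "(\<integral>\<^sup>+x. f x \<partial>gauss h) = (\<integral>\<^sup>+x. ennreal (normal_density 0 (sqrt h) x) * f x \<partial>lborel)"
 unfolding gauss_def by (subst nn_integral_density) auto

text \<open>The order of integration is fixed once and for all; \<open>lborel_swap\<close> exchanges it.\<close>

abbreviation plane_integral :: "(real => real => ennreal) => ennreal" where
 "plane_integral f \<equiv> \<integral>\<^sup>+y. \<integral>\<^sup>+x. f x y \<partial>lborel \<partial>lborel"

lemma nn_integral_cgauss:
 assumes h: "h > 0" and [measurable]: "f \<in> borel_measurable borel"
 shows "(\<integral>\<^sup>+z. f z \<partial>cgauss h) =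
  plane_integral (%x y. ennreal (normal_density 0 (sqrt h) x * normal_density 0 (sqrt h) y) *
    f (complex_point x y))"
proof -
 let ?n = "normal_density 0 (sqrt h)"
 interpret prob_space "gauss h" by (rule prob_space_gauss[OF h])
 interpret P: pair_sigma_finite "gauss h" "gauss h" ..
 have "(\<integral>\<^sup>+z. f z \<partial>cgauss h) = (\<integral>\<^sup>+y. \<integral>\<^sup>+x. f (complex_point x y) \<partial>gauss h \<partial>gauss h)"
  unfolding cgauss_def
  by (subst nn_integral_distr) (auto simp: case_prod_beta' P.nn_integral_snd[symmetric])
 also have "... = (\<integral>\<^sup>+y. ennreal (?n y) * (\<integral>\<^sup>+x. f (complex_point x y) \<partial>gauss h) \<partial>lborel)"
  by (subst nn_integral_gauss) auto
 also have "... = (\<integral>\<^sup>+y. ennreal (?n y) * (\<integral>\<^sup>+x. ennreal (?n x) * f (complex_point x y) \<partial>lborel) \<partial>lborel)"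
  by (subst (1) nn_integral_gauss) auto
 also have "... = plane_integral (%x y. ennreal (?n x * ?n y) * f (complex_point x y))"
  by (simp add: nn_integral_cmult[symmetric] ennreal_mult' mult_ac)
 finally show ?thesis .
qed

lemma shear1:
 assumes [measurable]: "f \<in> borel_measurable (borel \<Otimes>\<^sub>M borel)"
 shows "plane_integral (%x y. f (x + a * y, y)) = plane_integral (%x y. f (x, y))"
proof -
 have "(\<integral>\<^sup>+x. f (x + a * y, y) \<partial>lborel) = (\<integral>\<^sup>+x. f (x, y) \<partial>lborel)" for y
  using nn_integral_real_affine[of "%x. f (x, y)" 1 "a * y"] by (simp add: add.commute)
 thus ?thesis by simp
qed

lemma lborel_swap:
 assumes [measurable]: "f \<in> borel_measurable (borel \<Otimes>\<^sub>M borel)"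
 shows "plane_integral (%x y. f (x, y)) = (\<integral>\<^sup>+x. \<integral>\<^sup>+y. f (x, y::real) \<partial>lborel \<partial>(lborel :: real measure))"
 using lborel_pair.Fubini[of f] by simp

lemma shear2:
 assumes [measurable]: "f \<in> borel_measurable (borel \<Otimes>\<^sub>M borel)"
 shows "plane_integral (%x y. f (x, y + a * x)) = plane_integral (%x y. f (x, y))"
proof -
 have "plane_integral (%x y. f (x, y + a * x)) = (\<integral>\<^sup>+x. \<integral>\<^sup>+y. f (x, y + a * x) \<partial>lborel \<partial>lborel)"
  using lborel_swap[of "%(x,y). f (x, y + a * x)"] by simp
 also have "... = (\<integral>\<^sup>+x. \<integral>\<^sup>+y. f (x, y) \<partial>lborel \<partial>lborel)"
  using shear1[of "%(x,y). f (y, x)" a] by simp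
 also have "... = plane_integral (%x y. f (x, y))"
  using lborel_swap[of f] by simp
 finally show ?thesis .
qed

text \<open>A rotation is a product of three shears, and a shear preserves Lebesgue measure by translation invariance
 in one variable; this avoids the general change of variables.\<close>

lemma nn_integral_rotate:
 fixes c s :: real
 assumes f[measurable]: "f \<in> borel_measurable (borel \<Otimes>\<^sub>M borel)" and cs: "c\<^sup>2 + s\<^sup>2 = 1" "c ~= -1"
 shows "plane_integral (%x y. f (c * x - s * y, s * x + c * y)) = plane_integral (%x y. f (x, y))"
proof -
 \<comment> \<open>the tangent of half the angle\<close>
 define t where "t = s / (1 + c)"
 have c1: "1 + c ~= 0" using cs by auto
 have t: "1 - s * t = c" "t + c * t = s"
 proof -
  have "(1 + c) * t = s" using c1 by (simp add: t_def)
  thus "t + c * t = s" by (simp add: algebra_simps)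
  have "s * t = (s * s) / (1 + c)" by (simp add: t_def)
  also have "s * s = (1 - c) * (1 + c)" using cs by (simp add: power2_eq_square algebra_simps)
  finally show "1 - s * t = c" using c1 by simp
 qed
 let ?g = "%(x, y). f (x - t * y, y)"
 let ?k = "%(x, y). ?g (x, y + s * x)"
 have "plane_integral (%x y. f (x, y)) = plane_integral (%x y. ?g (x, y))"
  using shear1[of f "- t"] by simp
 also have "... = plane_integral (%x y. ?k (x, y))"
  using shear2[of ?g s] by simp
 also have "... = plane_integral (%x y. ?k (x + (- t) * y, y))"
  by (rule shear1[symmetric]) simp
 also have "... = plane_integral (%x y. f (c * x - s * y, s * x + c * y))"
 proof -
  have e1: "x - t * y - t * (y + s * (x - t * y)) = c * x - s * y" for x y
  proof -
   have "x - t * y - t * (y + s * (x - t * y)) = (1 - s * t) * x - (t + (1 - s * t) * t) * y"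
    by (simp add: algebra_simps)
   thus ?thesis unfolding t(1) using t(2) by simp
  qed
  have e2: "y + s * (x - t * y) = s * x + c * y" for x y
  proof -
   have "y + s * (x - t * y) = s * x + (1 - s * t) * y" by (simp add: algebra_simps)
   thus ?thesis unfolding t(1) by simp
  qed
  have e2': "y + s * (x + (- t) * y) = s * x + c * y" for x y using e2[of y x] by simp
  have "?k (x + (- t) * y, y) = f (c * x - s * y, s * x + c * y)" for x y
   unfolding prod.case e2' using e1[of x y] e2[of y x] by simp
  thus ?thesis by simp
 qed
 finally show ?thesis by simp
qed


lemma normal_density_rotate:
 fixes c s :: real
 assumes "c^2 + s^2 = 1"
 shows "normal_density 0 r (c * x - s * y) * normal_density 0 r (s * x + c * y) =
  normal_density 0 r x * normal_density 0 r y"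
proof -
 have "(c * x - s * y)^2 + (s * x + c * y)^2 = (c^2 + s^2) * (x^2 + y^2)"
  by (simp add: power2_eq_square algebra_simps)
 hence "(c * x - s * y)^2 + (s * x + c * y)^2 = x^2 + y^2" using assms by simp
 hence "- (c * x - s * y)\<^sup>2 / (2 * r\<^sup>2) + - (s * x + c * y)\<^sup>2 / (2 * r\<^sup>2) = - x\<^sup>2 / (2 * r\<^sup>2) + - y\<^sup>2 / (2 * r\<^sup>2)"
  by (metis (no_types, lifting) add_divide_distrib minus_add_distrib)
 hence "exp (- (c * x - s * y)\<^sup>2 / (2 * r\<^sup>2)) * exp (- (s * x + c * y)\<^sup>2 / (2 * r\<^sup>2)) = exp (- x\<^sup>2 / (2 * r\<^sup>2)) * exp (- y\<^sup>2 / (2 * r\<^sup>2))"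
  by (simp only: exp_add[symmetric])
 thus ?thesis by (simp add: normal_density_def mult_ac)
qed

lemma nn_integral_cgauss_rotate:
 assumes h: "h > 0" and [measurable]: "f \<in> borel_measurable borel" and w: "cmod w = 1"
 shows "(\<integral>\<^sup>+z. f (w * z) \<partial>cgauss h) = (\<integral>\<^sup>+z. f z \<partial>cgauss h)"
proof -
 have gen: "(\<integral>\<^sup>+z. f (w * z) \<partial>cgauss h) = (\<integral>\<^sup>+z. f z \<partial>cgauss h)"
  if [measurable]: "f \<in> borel_measurable borel" and w: "cmod w = 1" "Re w ~= -1" for f :: "complex => ennreal" and w
 proof -
  let ?n = "normal_density 0 (sqrt h)"
  let ?F = "%(x, y). ennreal (?n x * ?n y) * f (complex_point x y)"
  have cs: "(Re w)^2 + (Im w)^2 = 1" using w by (simp add: cmod_def)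
  have e: "w * (complex_point x y) = complex_point (Re w * x - Im w * y) (Im w * x + Re w * y)" for x y
   by (simp add: complex_eq_iff diff_divide_distrib add_divide_distrib)
  have "(\<integral>\<^sup>+z. f (w * z) \<partial>cgauss h) = plane_integral (%x y. ?F (Re w * x - Im w * y, Im w * x + Re w * y))"
   by (subst nn_integral_cgauss[OF h]) (auto simp: normal_density_rotate[OF cs] e simp del: times_divide_eq_right)
  also have "... = plane_integral (%x y. ?F (x, y))"
   by (rule nn_integral_rotate) (use cs w in simp_all)
  also have "... = (\<integral>\<^sup>+z. f z \<partial>cgauss h)"
   by (subst nn_integral_cgauss[OF h]) auto
  finally show ?thesis .
 qed
 show ?thesis
 proof (cases "Re w = -1")
  case False
  thus ?thesis using gen[of f w] w by simp
 next
  case True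
  \<comment> \<open>The shears degenerate for the half turn, which is therefore done in two quarter turns.\<close>
  have "(Re w)^2 + (Im w)^2 = 1" using w by (simp add: cmod_def)
  hence "w = \<i> * \<i>" using True by (simp add: complex_eq_iff)
  hence "(\<integral>\<^sup>+z. f (w * z) \<partial>cgauss h) = (\<integral>\<^sup>+z. f (\<i> * (\<i> * z)) \<partial>cgauss h)" by (simp add: mult.assoc)
  also have "... = (\<integral>\<^sup>+z. f (\<i> * z) \<partial>cgauss h)"
   by (rule gen[of "%z. f (\<i> * z)" \<i>]) auto
  also have "... = (\<integral>\<^sup>+z. f z \<partial>cgauss h)"
   by (rule gen) auto
  finally show ?thesis .
 qed
qed

text \<open>The rotation invariance on which the comparison of the two models rests.\<close>

lemma distr_cgauss_rotate:
 assumes "h > 0" "cmod w = 1"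
 shows "distr (cgauss h) borel (%z. w * z) = cgauss h"
proof (rule measure_eqI)
 fix A assume "A \<in> sets (distr (cgauss h) borel (%z. w * z))"
 hence [measurable]: "A \<in> sets borel" by simp
 have "emeasure (distr (cgauss h) borel (%z. w * z)) A = (\<integral>\<^sup>+z. indicator A z \<partial>distr (cgauss h) borel (%z. w * z))"
  by simp
 also have "... = (\<integral>\<^sup>+z. indicator A (w * z) \<partial>cgauss h)" by (subst nn_integral_distr) auto
 also have "... = (\<integral>\<^sup>+z. indicator A z \<partial>cgauss h)"
  by (rule nn_integral_cgauss_rotate) (use assms in auto)
 finally show "emeasure (distr (cgauss h) borel (%z. w * z)) A = emeasure (cgauss h) A" by simp
qed simp

lemma gauss_moments:
 assumes h: "h > 0"
 shows "integrable (gauss h) (%x. x^2)" "(\<integral>x. x^2 \<partial>gauss h) = h"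
  "integrable (gauss h) (%x. x ^ 4)" "(\<integral>x. x ^ 4 \<partial>gauss h) = 3 * h^2"
proof -
 have s: "sqrt h > 0" using h by simp
 have s2: "(sqrt h)^2 = h" using h by simp
 have "(sqrt h) ^ 4 = ((sqrt h)^2)^2" by (simp flip: power_mult)
 hence s4: "(sqrt h) ^ 4 = h^2" using s2 by simp
 have f4: "fact 4 = (24::real)" "fact 2 = (2::real)" by (simp_all add: fact_numeral)
 show "integrable (gauss h) (%x. x^2)" "integrable (gauss h) (%x. x ^ 4)"
  unfolding gauss_def using integrable_normal_moment[OF s, of 0 2] integrable_normal_moment[OF s, of 0 4]
  by (simp_all add: integrable_density)
 show "(\<integral>x. x^2 \<partial>gauss h) = h" "(\<integral>x. x ^ 4 \<partial>gauss h) = 3 * h^2"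
  unfolding gauss_def using integral_normal_moment_even[OF s, of 0 1] integral_normal_moment_even[OF s, of 0 2]
  by (simp_all add: integral_density s4 s2 f4 power_divide)
qed

text \<open>The first and the second complex moment vanish because a quarter turn multiplies them by \<open>\<i>\<close> and by \<open>- 1\<close>.\<close>

lemma cgauss_moments:
 assumes h: "h > 0"
 shows "integrable (cgauss h) (%z. z)" "(\<integral>z. z \<partial>cgauss h) = 0"
  "integrable (cgauss h) (%z. z^2)" "(\<integral>z. z^2 \<partial>cgauss h) = 0"
  "integrable (cgauss h) (%z. (cmod z)^2)" "(\<integral>z. (cmod z)^2 \<partial>cgauss h) = h"
  "integrable (cgauss h) (%z. (cmod z) ^ 4)" "(\<integral>z. (cmod z) ^ 4 \<partial>cgauss h) <= 3 * h^2"
proof -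
 let ?G = "gauss h \<Otimes>\<^sub>M gauss h"
 let ?c = "%p. complex_point (fst p) (snd p)"
 interpret G: prob_space "gauss h" by (rule prob_space_gauss[OF h])
 interpret P: pair_prob_space "gauss h" "gauss h" ..
 interpret C: prob_space "cgauss h" by (rule prob_space_cgauss[OF h])
 have meas: "(%(x, y). complex_point x y) \<in> borel_measurable ?G"
  by (simp add: case_prod_beta')
 have c2: "(cmod (complex_point x y))^2 = (x^2 + y^2) / 2" for x y
  by (simp add: norm_divide power_divide cmod_power2)
 have fst: "integrable ?G (%p. f (fst p))" "(\<integral>p. f (fst p) \<partial>?G) = (\<integral>x. f x \<partial>gauss h)"
  if "integrable (gauss h) f" for f :: "real => real"
 proof -
  have m: "f \<in> borel_measurable (gauss h)" using that by simp
  have d: "distr ?G (gauss h) fst = gauss h" by (rule G.distr_pair_fst)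
  show "integrable ?G (%p. f (fst p))"
   using that m integrable_distr_eq[of fst "?G" "gauss h" f] unfolding d by simp
  show "(\<integral>p. f (fst p) \<partial>?G) = (\<integral>x. f x \<partial>gauss h)"
   using m integral_distr[of fst "?G" "gauss h" f] unfolding d by simp
 qed
 have snd: "integrable ?G (%p. f (snd p))" "(\<integral>p. f (snd p) \<partial>?G) = (\<integral>x. f x \<partial>gauss h)"
  if "integrable (gauss h) f" for f :: "real => real"
 proof -
  have m[measurable]: "f \<in> borel_measurable (gauss h)" using that by simp
  show "integrable ?G (%p. f (snd p))"
   using P.integrable_product_swap[OF fst(1)[OF that]] by (simp add: case_prod_beta')
  show "(\<integral>p. f (snd p) \<partial>?G) = (\<integral>x. f x \<partial>gauss h)"
   using P.integral_product_swap[of "%p. f (fst p)"] fst(2)[OF that] by (simp add: case_prod_beta')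
 qed
 note m = gauss_moments[OF h]
 have cg: "integrable (cgauss h) g \<longleftrightarrow> integrable ?G (%p. g (?c p))"
  "(\<integral>z. g z \<partial>cgauss h) = (\<integral>p. g (?c p) \<partial>?G)"
  if [measurable]: "g \<in> borel_measurable borel" for g :: "complex => real"
  unfolding cgauss_def using meas
  by (auto simp: integrable_distr_eq integral_distr case_prod_beta')
 show i2: "integrable (cgauss h) (%z. (cmod z)^2)"
  unfolding cg(1)[of "%z. (cmod z)^2", simplified] c2 using fst(1)[OF m(1)] snd(1)[OF m(1)] by simp
 show "(\<integral>z. (cmod z)^2 \<partial>cgauss h) = h"
  unfolding cg(2)[of "%z. (cmod z)^2", simplified] c2 using fst[OF m(1)] snd[OF m(1)] m(2) by simp
 have c4: "(cmod (complex_point x y)) ^ 4 <= (x ^ 4 + y ^ 4) / 2" for x y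
 proof -
  have "(cmod (complex_point x y)) ^ 4 = ((x^2 + y^2) / 2)^2"
   unfolding c2[symmetric] by (simp flip: power_mult)
  also have "... <= ((x^2)^2 + (y^2)^2) / 2"
   using sum_squares_bound[of "x^2" "y^2"] by (simp add: power_divide power2_sum)
  finally show ?thesis by (simp flip: power_mult)
 qed
 have i44: "integrable ?G (%p. ((fst p) ^ 4 + (snd p) ^ 4) / 2)"
  using fst(1)[OF m(3)] snd(1)[OF m(3)] by simp
 have i4: "integrable ?G (%p. cmod (?c p) ^ 4)"
  by (rule integrable_bound[OF i44]) (use c4 in \<open>auto simp: abs_of_nonneg intro!: order_trans[OF c4]\<close>)
 thus "integrable (cgauss h) (%z. (cmod z) ^ 4)"
  by (subst cg(1)) simp_all
 have "(\<integral>z. (cmod z) ^ 4 \<partial>cgauss h) = (\<integral>p. cmod (?c p) ^ 4 \<partial>?G)"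
  by (subst cg(2)) simp_all
 also have "... <= (\<integral>p. ((fst p) ^ 4 + (snd p) ^ 4) / 2 \<partial>?G)"
  using c4 by (intro integral_mono i4 i44) auto
 also have "... = 3 * h^2"
  using fst[OF m(3)] snd[OF m(3)] m(4) by simp
 finally show "(\<integral>z. (cmod z) ^ 4 \<partial>cgauss h) <= 3 * h^2" .
 show i1: "integrable (cgauss h) (%z. z)"
 proof (rule integrable_bound)
  show "integrable (cgauss h) (%z. 1 + (cmod z)^2)" using i2 by simp
  have "cmod z <= 1 + (cmod z)^2" for z
   using sum_squares_bound[of "1/2" "cmod z"] zero_le_power2[of "cmod z"] by (simp add: power2_eq_square)
  thus "AE z in cgauss h. cmod z <= norm (1 + (cmod z)^2)" by (simp add: abs_of_nonneg)
 qed simp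
 show i12: "integrable (cgauss h) (%z. z^2)"
  by (rule integrable_bound[OF i2]) (simp_all add: norm_power)
 have "(\<integral>z. z \<partial>cgauss h) = (\<integral>z. z \<partial>distr (cgauss h) borel (%z. \<i> * z))"
  by (simp add: distr_cgauss_rotate h)
 also have "... = \<i> * (\<integral>z. z \<partial>cgauss h)" by (subst integral_distr) auto
 finally have "(1 - \<i>) * (\<integral>z. z \<partial>cgauss h) = 0" by (simp add: algebra_simps)
 moreover have "1 - \<i> ~= 0" by (simp add: complex_eq_iff)
 ultimately show "(\<integral>z. z \<partial>cgauss h) = 0" by (metis mult_eq_0_iff)
 have "(\<integral>z. z^2 \<partial>cgauss h) = (\<integral>z. z^2 \<partial>distr (cgauss h) borel (%z. \<i> * z))"
  by (simp add: distr_cgauss_rotate h)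
 also have "... = - (\<integral>z. z\<^sup>2 \<partial>cgauss h)" by (subst integral_distr) (auto simp: power_mult_distrib)
 finally show "(\<integral>z. z^2 \<partial>cgauss h) = 0" by simp
qed

section \<open>Noise adapted to a filtration\<close>

lemma borel_measurable_cnj [measurable]: "cnj \<in> borel_measurable borel"
 by (intro borel_measurable_continuous_onI continuous_intros)

lemma (in prob_space) integrable_bounded_mult:
 fixes f g :: "'a => 'b :: {real_normed_field, banach, second_countable_topology}"
 assumes "integrable M f" "g \<in> borel_measurable M" "!!x. x \<in> space M ==> norm (g x) <= C"
 shows "integrable M (%x. g x * f x)"
proof (rule integrable_bound)
 show "integrable M (%x. C * norm (f x))" using assms(1) by simp
 show "AE x in M. norm (g x * f x) <= norm (C * norm (f x))"
  using assms(3) by (intro AE_I2) (auto simp: norm_mult abs_mult intro!: mult_right_mono order_trans[OF _ abs_ge_self])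
qed (use assms in measurable)

lemma (in prob_space) norm_bound_nonneg: "(!!w. w \<in> space M ==> norm (g w) <= K) ==> 0 <= K"
 using not_empty norm_ge_zero order_trans by blast

text \<open>The driving noise of both models: \<open>X\<close> is a complex Brownian motion for \<open>F\<close>, and \<open>Xi\<close> is an additional real
 noise that is independent of it, with increments of law \<open>m h\<close> over a time \<open>h\<close>. For the flow it is a Brownian
 motion, for the carousel it is \<open>0\<close>.\<close>

locale noise = prob_space M for M :: "'w measure" +
 fixes F :: "real => 'w measure" and X :: "real => 'w => complex"
  and Xi :: "real => 'w => real" and m :: "real => real measure"
 assumes subalg: "!!t. subalgebra M (F t)"
  and F_mono: "!!s t. s <= t ==> sets (F s) \<subseteq> sets (F t)"
  and X_adapted: "!!t. 0 <= t ==> X t \<in> borel_measurable (F t)"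
  and Xi_adapted: "!!t. 0 <= t ==> Xi t \<in> borel_measurable (F t)"
  and prob_m: "!!h. 0 < h ==> prob_space (m h)"
  and sets_m [simp, measurable_cong]: "!!h. sets (m h) = sets borel"
  and increment: "!!s t A D. [|0 <= s; s < t; A \<in> sets (F s); D \<in> sets (borel \<Otimes>\<^sub>M borel)|] ==>
   emeasure M (A Int {w\<in>space M. (X t w - X s w, Xi t w - Xi s w) \<in> D})
   = emeasure M A * emeasure (cgauss (t - s) \<Otimes>\<^sub>M m (t - s)) D"
begin

lemma space_F [simp]: "space (F t) = space M"
 using subalg[of t] by (simp add: subalgebra_def)

lemma sets_FM: "A \<in> sets (F t) ==> A \<in> sets M"
 using subalg[of t] by (auto simp: subalgebra_def)

lemma measurable_F_mono: "f \<in> measurable (F s) E ==> s <= t ==> f \<in> measurable (F t) E"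
 using F_mono[of s t] by (auto simp: measurable_def)

lemma measurable_F_M: "f \<in> measurable (F s) E ==> f \<in> measurable M E"
 using subalg[of s] by (auto simp: measurable_def subalgebra_def)

lemma X_meas [measurable]: "0 <= t ==> X t \<in> borel_measurable M"
 by (rule measurable_F_M[OF X_adapted])

lemma Xi_meas [measurable]: "0 <= t ==> Xi t \<in> borel_measurable M"
 by (rule measurable_F_M[OF Xi_adapted])

text \<open>Independence of events is turned into independence of arbitrary random variables of the past, which allows
 to integrate over the increment with the past frozen.\<close>

lemma increment_law:
 assumes st: "0 <= s" "s < t" and Z: "Z \<in> measurable (F s) E"
 shows "distr M (E \<Otimes>\<^sub>M (borel \<Otimes>\<^sub>M borel)) (%w. (Z w, X t w - X s w, Xi t w - Xi s w))
  = distr M E Z \<Otimes>\<^sub>M (cgauss (t - s) \<Otimes>\<^sub>M m (t - s))" (is "?L = ?R")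
proof -
 note [measurable] = measurable_F_M[OF Z]
 have t0: "0 <= t" and h: "t - s > 0" using st by auto
 interpret C: prob_space "cgauss (t - s)" by (rule prob_space_cgauss[OF h])
 interpret m: prob_space "m (t - s)" by (rule prob_m[OF h])
 interpret CM: pair_prob_space "cgauss (t - s)" "m (t - s)" ..
 interpret Z: prob_space "distr M E Z" by (rule prob_space_distr) measurable
 have meas[measurable]: "(%w. (Z w, X t w - X s w, Xi t w - Xi s w)) \<in> measurable M (E \<Otimes>\<^sub>M (borel \<Otimes>\<^sub>M borel))"
  using st t0 by measurable
 have "?R = ?L"
 proof (rule pair_measure_eqI)
  show "sigma_finite_measure (distr M E Z)" ..
  show "sigma_finite_measure (cgauss (t - s) \<Otimes>\<^sub>M m (t - s))" ..
  show "sets ?R = sets ?L" by (simp cong: sets_pair_measure_cong)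
  fix A D assume A: "A \<in> sets (distr M E Z)" and D: "D \<in> sets (cgauss (t - s) \<Otimes>\<^sub>M m (t - s))"
  have D': "D \<in> sets (borel \<Otimes>\<^sub>M borel)" using D by (simp cong: sets_pair_measure_cong)
  have "emeasure ?L (A \<times> D) = emeasure M ((%w. (Z w, X t w - X s w, Xi t w - Xi s w)) -` (A \<times> D) Int space M)"
   using A D' by (intro emeasure_distr) auto
  also have "... = emeasure M ((Z -` A Int space M) Int {w\<in>space M. (X t w - X s w, Xi t w - Xi s w) \<in> D})"
   by (intro arg_cong[where f="emeasure M"]) auto
  also have "... = emeasure M (Z -` A Int space M) * emeasure (cgauss (t - s) \<Otimes>\<^sub>M m (t - s)) D"
   using measurable_sets[OF Z, of A] A D' st by (intro increment) auto
  also have "emeasure M (Z -` A Int space M) = emeasure (distr M E Z) A"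
   using A by (subst emeasure_distr) auto
  finally show "emeasure (distr M E Z) A * emeasure (cgauss (t - s) \<Otimes>\<^sub>M m (t - s)) D = emeasure ?L (A \<times> D)" by simp
 qed
 thus ?thesis by simp
qed

text \<open>For a frozen past the factor \<open>rho\<close> is a constant rotation, which the Gaussian law absorbs.\<close>

lemma rotated_increment:
 assumes st: "0 <= s" "s < t" and A: "A \<in> sets (F s)"
  and rho: "rho \<in> borel_measurable (F s)" "!!w. w \<in> space M ==> cmod (rho w) = 1"
  and D: "D \<in> sets (borel \<Otimes>\<^sub>M borel)"
 shows "emeasure M (A Int {w\<in>space M. (rho w * (X t w - X s w), Xi t w - Xi s w) \<in> D})
   = emeasure M A * emeasure (cgauss (t - s) \<Otimes>\<^sub>M m (t - s)) D"
proof -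
 let ?E = "A Int {w\<in>space M. (rho w * (X t w - X s w), Xi t w - Xi s w) \<in> D}"
 let ?B = "borel \<Otimes>\<^sub>M borel"
 have t0: "0 <= t" and h: "t - s > 0" using st by auto
 interpret C: prob_space "cgauss (t - s)" by (rule prob_space_cgauss[OF h])
 interpret m: prob_space "m (t - s)" by (rule prob_m[OF h])
 interpret CM: pair_prob_space "cgauss (t - s)" "m (t - s)" ..
 let ?G = "cgauss (t - s) \<Otimes>\<^sub>M m (t - s)"
 define Z where "Z w = (indicator A w :: ennreal, rho w)" for w
 have Z: "Z \<in> measurable (F s) ?B"
  unfolding Z_def using rho(1) A by measurable
 note [measurable] = measurable_F_M[OF Z] D
 interpret Z: prob_space "distr M ?B Z" by (rule prob_space_distr) measurable
 let ?f = "%p :: (ennreal \<times> complex) \<times> (complex \<times> real). fst (fst p) * indicator D (snd (fst p) * fst (snd p), snd (snd p))"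
 have "emeasure M ?E
  = (\<integral>\<^sup>+w. indicator ?E w \<partial>M)"
 proof (rule nn_integral_indicator[symmetric])
  have [measurable]: "A \<in> sets M" "rho \<in> borel_measurable M" using sets_FM[OF A] measurable_F_M[OF rho(1)] .
  show "?E \<in> sets M"
   using st t0 by measurable
 qed
 also have "... = (\<integral>\<^sup>+w. ?f (Z w, X t w - X s w, Xi t w - Xi s w) \<partial>M)"
  by (intro nn_integral_cong) (auto simp: Z_def indicator_def)
 also have "... = (\<integral>\<^sup>+p. ?f p \<partial>distr M (?B \<Otimes>\<^sub>M ?B) (%w. (Z w, X t w - X s w, Xi t w - Xi s w)))"
  using st t0 by (subst nn_integral_distr) measurable
 also have "... = (\<integral>\<^sup>+p. ?f p \<partial>(distr M ?B Z \<Otimes>\<^sub>M ?G))"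
  by (subst increment_law[OF st Z]) simp
 also have "... = (\<integral>\<^sup>+z. \<integral>\<^sup>+p. ?f (z, p) \<partial>?G \<partial>distr M ?B Z)"
  by (subst CM.nn_integral_fst[symmetric]) (auto cong: measurable_cong_sets sets_pair_measure_cong)
 also have "... = (\<integral>\<^sup>+w. \<integral>\<^sup>+p. ?f (Z w, p) \<partial>?G \<partial>M)"
  by (subst nn_integral_distr) auto
 also have "... = (\<integral>\<^sup>+w. indicator A w * emeasure ?G D \<partial>M)"
 proof (rule nn_integral_cong)
  fix w assume w: "w \<in> space M"
  have "(\<integral>\<^sup>+p. ?f (Z w, p) \<partial>?G) = (\<integral>\<^sup>+y. \<integral>\<^sup>+x. ?f (Z w, (x, y)) \<partial>cgauss (t - s) \<partial>m (t - s))"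
   by (subst CM.nn_integral_snd[symmetric]) auto
  also have "... = (\<integral>\<^sup>+y. \<integral>\<^sup>+x. indicator A w * indicator D (x, y) \<partial>cgauss (t - s) \<partial>m (t - s))"
   unfolding Z_def fst_conv snd_conv
   by (intro nn_integral_cong nn_integral_cgauss_rotate[OF h, where f="%x. indicator A w * indicator D (x, _)"] rho(2) w) simp
  also have "... = (\<integral>\<^sup>+p. indicator A w * indicator D p \<partial>?G)"
   by (subst CM.nn_integral_snd[symmetric]) auto
  also have "... = indicator A w * emeasure ?G D"
   by (subst nn_integral_cmult) auto
  finally show "(\<integral>\<^sup>+p. ?f (Z w, p) \<partial>?G) = indicator A w * emeasure ?G D" .
 qed
 also have "... = emeasure M A * emeasure ?G D"
  using sets_FM[OF A] by (simp add: nn_integral_multc)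
 finally show ?thesis .
qed

lemma increment_expectation:
 fixes f :: "complex => complex"
 assumes st: "0 <= s" "s < t" and g: "g \<in> borel_measurable (F s)" "integrable M g"
  and f: "integrable (cgauss (t - s)) f"
 shows "integrable M (%w. g w * f (X t w - X s w))"
  "mean (%w. g w * f (X t w - X s w)) = mean g * (\<integral>z. f z \<partial>cgauss (t - s))"
proof -
 let ?X = "%w. X t w - X s w"
 let ?x = "%w. X t w - X s w"
 let ?G = "cgauss (t - s)"
 have t0: "0 <= t" and h: "t - s > 0" using st by auto
 have fm[measurable]: "f \<in> borel_measurable borel" using borel_measurable_integrable[OF f] by (simp cong: measurable_cong_sets)
 note [measurable] = measurable_F_M[OF g(1)]
 have [measurable]: "?X \<in> borel_measurable M" using st t0 by measurable
 interpret C: prob_space "?G" by (rule prob_space_cgauss[OF h])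
 interpret m: prob_space "m (t - s)" by (rule prob_m[OF h])
 interpret CM: pair_prob_space "?G" "m (t - s)" ..
 interpret Z: prob_space "distr M borel g" by (rule prob_space_distr) measurable
 have law: "emeasure M (A Int {w\<in>space M. ?x w \<in> B}) = emeasure M A * emeasure ?G B"
  if "A \<in> sets (F s)" "B \<in> sets borel" for A B
 proof -
  have "emeasure M (A Int {w\<in>space M. ?x w \<in> B}) = emeasure M (A Int {w\<in>space M. (?x w, Xi t w - Xi s w) \<in> B \<times> UNIV})"
   by simp
  also have "... = emeasure M A * emeasure (?G \<Otimes>\<^sub>M m (t - s)) (B \<times> UNIV)"
   using that st by (intro increment) auto
  also have "emeasure (?G \<Otimes>\<^sub>M m (t - s)) (B \<times> UNIV) = emeasure ?G B * emeasure (m (t - s)) UNIV"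
   using that by (intro m.emeasure_pair_measure_Times) (auto simp: sets.top[of "m (t - s)", simplified])
  also have "emeasure (m (t - s)) UNIV = 1" using m.emeasure_space_1 sets_eq_imp_space_eq[OF sets_m] by simp
  finally show ?thesis by simp
 qed
 have d: "distr M borel ?X = ?G"
 proof (rule measure_eqI)
  fix B assume "B \<in> sets (distr M borel ?X)"
  hence B: "B \<in> sets borel" by simp
  have "emeasure (distr M borel ?X) B = emeasure M (space M Int {w\<in>space M. ?x w \<in> B})"
   using B by (subst emeasure_distr) (auto intro!: arg_cong[where f="emeasure M"])
  also have "... = emeasure ?G B"
   using law[of "space M" B] B sets.top[of "F s"] by (simp add: emeasure_space_1)
  finally show "emeasure (distr M borel ?X) B = emeasure ?G B" .
 qed simp
 have ind: "indep_var borel g borel ?X"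
  unfolding indep_var_distribution_eq
 proof (intro conjI)
  show "distr M borel g \<Otimes>\<^sub>M distr M borel ?X = distr M (borel \<Otimes>\<^sub>M borel) (%w. (g w, ?x w))"
   unfolding d
  proof (rule pair_measure_eqI)
   show "sigma_finite_measure (distr M borel g)" "sigma_finite_measure ?G" ..
   show "sets (distr M borel g \<Otimes>\<^sub>M ?G) = sets (distr M (borel \<Otimes>\<^sub>M borel) (%w. (g w, ?x w)))"
    by (simp cong: sets_pair_measure_cong)
   fix A B assume "A \<in> sets (distr M borel g)" "B \<in> sets ?G"
   hence A: "A \<in> sets borel" and B: "B \<in> sets borel" by auto
   have "emeasure (distr M (borel \<Otimes>\<^sub>M borel) (%w. (g w, ?x w))) (A \<times> B)
    = emeasure M ((g -` A Int space M) Int {w\<in>space M. ?x w \<in> B})"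
    using A B by (subst emeasure_distr) (auto intro!: arg_cong[where f="emeasure M"])
   also have "... = emeasure M (g -` A Int space M) * emeasure ?G B"
    using measurable_sets[OF g(1) A] B by (intro law) auto
   also have "emeasure M (g -` A Int space M) = emeasure (distr M borel g) A"
    using A by (subst emeasure_distr) auto
   finally show "emeasure (distr M borel g) A * emeasure ?G B = emeasure (distr M (borel \<Otimes>\<^sub>M borel) (%w. (g w, ?x w))) (A \<times> B)" by simp
  qed
 qed measurable
 have ind': "indep_var borel g borel (%w. f (?x w))"
  using indep_var_compose[OF ind, of "%x. x" borel f borel] by (simp add: comp_def)
 have fi: "integrable M (%w. f (?x w))"
  using f unfolding d[symmetric] by (subst (asm) integrable_distr_eq) auto
 have fe: "mean (%w. f (?x w)) = (\<integral>z. f z \<partial>?G)"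
  unfolding d[symmetric] by (subst integral_distr) auto
 show "integrable M (%w. g w * f (?x w))"
  by (rule indep_var_integrable[OF ind' g(2) fi])
 show "mean (%w. g w * f (?x w)) = mean g * (\<integral>z. f z \<partial>?G)"
  by (subst indep_var_lebesgue_integral[OF ind' g(2) fi]) (simp add: fe)
qed

end

section \<open>Integrals of step processes\<close>

lemma (in prob_space) L2sq_sum:
 assumes "!!k l. [|k \<in> K; l \<in> K|] ==> integrable M (%w. f k w * cnj (f l w))"
 defines "S \<equiv> \<Sum>k\<in>K. \<Sum>l\<in>K. Re (mean (%w. f k w * cnj (f l w)))"
 shows "L2sq M (%w. \<Sum>k\<in>K. f k w) = ennreal S" "0 <= S"
proof -
 let ?S = "%w. (cmod (\<Sum>k\<in>K. f k w))^2"
 have e: "Cx (?S w) = (\<Sum>k\<in>K. \<Sum>l\<in>K. f k w * cnj (f l w))" for w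
  by (simp only: complex_norm_square sum_product cnj_sum)
 have i: "integrable M (%w. Cx (?S w))"
  unfolding e by (intro integrable_sum assms)
 have "Cx (mean ?S) = (\<Sum>k\<in>K. \<Sum>l\<in>K. mean (%w. f k w * cnj (f l w)))"
  unfolding integral_complex_of_real[symmetric] e
  by (simp add: integral_sum integrable_sum assms)
 from arg_cong[OF this, of Re] have E: "mean ?S = S" by (simp add: S_def)
 show "0 <= S" unfolding E[symmetric] by (rule integral_nonneg) simp
 show "L2sq M (%w. \<Sum>k\<in>K. f k w) = ennreal S"
  unfolding E[symmetric] using i complex_of_real_integrable_eq[of M ?S] by (intro nn_integral_eq_integral) auto
qed

context noise
begin

lemma increment_moments:
 fixes g :: "'w => complex"
 assumes st: "0 <= s" "s <= t" and g: "g \<in> borel_measurable (F s)" "integrable M g"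
 shows "integrable M (%w. g w * (X t w - X s w))" (is ?i1)
  "mean (%w. g w * (X t w - X s w)) = 0" (is ?e1)
  "integrable M (%w. g w * cnj (X t w - X s w))" (is ?i2)
  "mean (%w. g w * cnj (X t w - X s w)) = 0" (is ?e2)
  "integrable M (%w. g w * (X t w - X s w)^2)" (is ?i3)
  "mean (%w. g w * (X t w - X s w)^2) = 0" (is ?e3)
  "integrable M (%w. g w * Cx ((cmod (X t w - X s w))^2))" (is ?i4)
  "mean (%w. g w * Cx ((cmod (X t w - X s w))^2)) = mean g * Cx (t - s)" (is ?e4)
proof -
 have "?i1 & ?e1 & ?i2 & ?e2 & ?i3 & ?e3 & ?i4 & ?e4"
 proof (cases "s = t")
  case True thus ?thesis by simp
 next
  case False
  hence lt: "s < t" and h: "t - s > 0" using st by auto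
  note E = increment_expectation[OF st(1) lt g]
  note m = cgauss_moments[OF h]
  have c: "integrable (cgauss (t - s)) cnj" using integrable_cnj[OF m(1)] by simp
  have c0: "(\<integral>z. cnj z \<partial>cgauss (t - s)) = 0" using integral_cnj[of "cgauss (t - s)" "%z. z"] m(2) by simp
  have q: "integrable (cgauss (t - s)) (%z. Cx ((cmod z)^2))" using integrable_of_real[OF m(5), where 'a=complex] by simp
  have q0: "(\<integral>z. Cx ((cmod z)^2) \<partial>cgauss (t - s)) = Cx (t - s)"
   by (subst integral_complex_of_real) (simp only: m(6))
  show ?thesis
   using E[OF m(1)] m(2) E[OF c] c0 E[OF m(3)] m(4) E[OF q] q0 by simp
 qed
 thus ?i1 ?e1 ?i2 ?e2 ?i3 ?e3 ?i4 ?e4 by auto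
qed

lemma increment_integrable:
 assumes "0 <= s" "s <= t" shows "integrable M (%w. X t w - X s w)"
proof -
 have g: "(%_. 1::complex) \<in> borel_measurable (F s)" "integrable M (%_. 1::complex)" by auto
 show ?thesis using increment_moments(1)[OF assms g] unfolding mult_1 .
qed

lemma increment_real_moment:
 fixes f :: "complex => real"
 assumes st: "0 <= s" "s < t" and f: "integrable (cgauss (t - s)) f"
 shows "integrable M (%w. f (X t w - X s w))" "mean (%w. f (X t w - X s w)) = (\<integral>z. f z \<partial>cgauss (t - s))"
proof -
 have g: "(%_. 1::complex) \<in> borel_measurable (F s)" "integrable M (%_. 1::complex)" by auto
 note E = increment_expectation[OF st g integrable_of_real[OF f, where 'a=complex], unfolded mult_1
   complex_of_real_integrable_eq integral_complex_of_real]
 show "integrable M (%w. f (X t w - X s w))" by (rule E)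
 show "mean (%w. f (X t w - X s w)) = (\<integral>z. f z \<partial>cgauss (t - s))" using E(2) by (simp add: prob_space)
qed

lemma increment_sq:
 assumes "0 <= s" "s <= t"
 shows "integrable M (%w. (cmod (X t w - X s w))^2)" "mean (%w. (cmod (X t w - X s w))^2) = t - s"
 using increment_real_moment[of s t "%z. (cmod z)^2"] cgauss_moments(5,6)[of "t - s"] assms by (cases "s = t"; simp)+

lemma increment_fourth:
 assumes "0 <= s" "s <= t"
 shows "integrable M (%w. (cmod (X t w - X s w)) ^ 4)" "mean (%w. (cmod (X t w - X s w)) ^ 4) <= 3 * (t - s)^2"
 using increment_real_moment[of s t "%z. (cmod z) ^ 4"] cgauss_moments(7,8)[of "t - s"] assms by (cases "s = t"; simp)+

definition bdd_meas :: "real => ('w => complex) => bool" where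
 "bdd_meas t g \<longleftrightarrow> g \<in> borel_measurable (F t) & (EX C. \<forall>w\<in>space M. cmod (g w) <= C)"

lemma bdd_meas_mono: "bdd_meas s g ==> s <= t ==> bdd_meas t g"
 unfolding bdd_meas_def using measurable_F_mono by blast

lemma bdd_meas_measD: "bdd_meas s g ==> g \<in> borel_measurable (F s)"
 by (simp add: bdd_meas_def)

lemma bdd_meas_measM: "bdd_meas s g ==> g \<in> borel_measurable M"
 unfolding bdd_meas_def using measurable_F_M by blast

lemma bdd_meas_const [simp, intro]: "bdd_meas s (%_. c)"
 by (auto simp: bdd_meas_def)

lemma bdd_meas_add [intro]:
 assumes "bdd_meas s f" "bdd_meas s g" shows "bdd_meas s (%w. f w + g w)"
proof -
 from assms obtain C D where "\<forall>w\<in>space M. cmod (f w) <= C" "\<forall>w\<in>space M. cmod (g w) <= D"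
  by (auto simp: bdd_meas_def)
 hence "\<forall>w\<in>space M. cmod (f w + g w) <= C + D"
  by (meson add_mono norm_triangle_ineq order_trans)
 thus ?thesis using assms unfolding bdd_meas_def by auto
qed

lemma bdd_meas_mult [intro]:
 assumes "bdd_meas s f" "bdd_meas s g" shows "bdd_meas s (%w. f w * g w)"
proof -
 from assms obtain C D where "\<forall>w\<in>space M. cmod (f w) <= C" "\<forall>w\<in>space M. cmod (g w) <= D"
  by (auto simp: bdd_meas_def)
 hence "\<forall>w\<in>space M. cmod (f w * g w) <= C * D"
  by (auto simp: norm_mult intro!: mult_mono')
 thus ?thesis using assms unfolding bdd_meas_def by auto
qed

lemma bdd_meas_uminus [intro]: "bdd_meas s f ==> bdd_meas s (%w. - f w)"
 by (auto simp: bdd_meas_def)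

lemma bdd_meas_diff [intro]: "bdd_meas s f ==> bdd_meas s g ==> bdd_meas s (%w. f w - g w)"
 using bdd_meas_add[of s f "%w. - g w"] by auto

lemma bdd_meas_cnj [intro]: "bdd_meas s f ==> bdd_meas s (%w. cnj (f w))"
 by (auto simp: bdd_meas_def)

lemma bdd_meas_integrable_mult:
 assumes "bdd_meas s g" "integrable M f" shows "integrable M (%w. g w * f w)"
proof -
 from assms(1) obtain C where "\<forall>w\<in>space M. cmod (g w) <= C" by (auto simp: bdd_meas_def)
 thus ?thesis
  by (intro integrable_bounded_mult[OF assms(2) bdd_meas_measM[OF assms(1)], of C]) auto
qed

lemma bdd_meas_integrable: "bdd_meas s f ==> integrable M f"
 using bdd_meas_integrable_mult[of s f "%_. 1"] by simp

abbreviation dX :: "real => real => 'w => complex" where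
 "dX s t w \<equiv> X t w - X s w"

text \<open>Both increments are cut at the ends of the overlap of the two intervals. In every product but that of the overlap
 with itself one factor lies in the future of the others and has mean \<open>0\<close>.\<close>

lemma cross_ordered:
 assumes pq: "0 <= p" "p <= q" and pq': "p <= p'" "p' <= q'"
  and xi: "bdd_meas p xi" and xi': "bdd_meas p' xi'"
 shows "integrable M (%w. xi w * dX p q w * cnj (xi' w * dX p' q' w))" (is ?I)
  and "mean (%w. xi w * dX p q w * cnj (xi' w * dX p' q' w)) =
   mean (%w. xi w * cnj (xi' w)) * Cx (max 0 (min q q' - p'))" (is ?E)
proof -
 have p'0: "0 <= p'" and q0: "0 <= q" and q'0: "0 <= q'" using assms by auto
 let ?g = "%w. xi w * cnj (xi' w)"
 have g: "bdd_meas p' ?g" using bdd_meas_mono[OF xi, of p'] xi' pq' by auto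
 \<comment> \<open>an increment of the past against one of the future\<close>
 have inc: "dX a b \<in> borel_measurable (F c)" "integrable M (dX a b)" if "0 <= a" "a <= b" "b <= c" for a b c
 proof -
  have "0 <= b" "a <= c" using that by auto
  note [measurable] = measurable_F_mono[OF X_adapted[OF this(1)] that(3)] measurable_F_mono[OF X_adapted[OF that(1)] this(2)]
  show "dX a b \<in> borel_measurable (F c)" by measurable
  show "integrable M (dX a b)" by (rule increment_integrable[OF that(1,2)])
 qed
 have off: "integrable M (%w. ?g w * Y w * cnj (dX c d w)) & mean (%w. ?g w * Y w * cnj (dX c d w)) = 0"
   "integrable M (%w. ?g w * Y w * dX c d w) & mean (%w. ?g w * Y w * dX c d w) = 0"
  if Y: "Y \<in> borel_measurable (F c)" "integrable M Y" and c: "0 <= c" "c <= d" "p' <= c" for Y c d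
  using increment_moments(1-4)[OF c(1,2) borel_measurable_times[OF bdd_meas_measD[OF bdd_meas_mono[OF g c(3)]] Y(1)]
   bdd_meas_integrable_mult[OF g Y(2)]] by auto
 have past: "integrable M (%w. ?g w * dX a b w * cnj (dX c d w)) & mean (%w. ?g w * dX a b w * cnj (dX c d w)) = 0"
  if "0 <= a" "a <= b" "b <= c" "c <= d" "p' <= c" for a b c d
  using off(1)[OF inc[OF that(1-3)], of d] that by simp
 have future: "integrable M (%w. ?g w * dX c d w * cnj (dX a b w)) & mean (%w. ?g w * dX c d w * cnj (dX a b w)) = 0"
  if "0 <= a" "a <= b" "b <= c" "c <= d" "p' <= c" for a b c d
 proof -
  note i = inc[OF that(1-3)]
  show ?thesis using off(2)[OF measurable_compose[OF i(1) borel_measurable_cnj] integrable_cnj[OF i(2)], of d] that by (simp add: mult_ac)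
 qed
 have same: "integrable M (%w. ?g w * dX a b w * cnj (dX a b w)) &
   mean (%w. ?g w * dX a b w * cnj (dX a b w)) = mean ?g * Cx (b - a)"
  if "p' <= a" "a <= b" for a b
 proof -
  have a0: "0 <= a" using that p'0 by auto
  show ?thesis
   using increment_moments(7,8)[OF a0 that(2) bdd_meas_measD[OF bdd_meas_mono[OF g that(1)]] bdd_meas_integrable[OF g],
     unfolded complex_norm_square mult.assoc[symmetric]]
   by simp
 qed
 have "?I & ?E"
 proof (cases "q <= p'")
  case True
  have *: "xi w * dX p q w * cnj (xi' w * dX p' q' w) = ?g w * dX p q w * cnj (dX p' q' w)" for w
   by (simp add: mult_ac)
  show ?thesis unfolding * using past[of p q p' q'] True assms by auto
 next
  case False
  define a where "a = min q q'"
  have a: "p' <= a" "a <= q" "a <= q'" "a = q \<or> a = q'" using False pq' by (auto simp: a_def)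
  have a0: "0 <= a" using a p'0 by linarith
  let ?t1 = "%w. ?g w * dX p p' w * cnj (dX p' q' w)" and ?t2 = "%w. ?g w * dX p' a w * cnj (dX p' a w)"
   and ?t3 = "%w. ?g w * dX p' a w * cnj (dX a q' w)" and ?t4 = "%w. ?g w * dX a q w * cnj (dX p' a w)"
  have "dX p q w = dX p p' w + dX p' a w + dX a q w" "dX p' q' w = dX p' a w + dX a q' w"
   "dX a q w * cnj (dX a q' w) = 0" for w using a(4) by auto
  hence *: "xi w * dX p q w * cnj (xi' w * dX p' q' w) = ?t1 w + ?t2 w + ?t3 w + ?t4 w" for w
  proof -
   have "xi w * dX p q w * cnj (xi' w * dX p' q' w) = ?g w * (dX p q w * cnj (dX p' q' w))" by (simp add: mult_ac)
   also have "dX p q w * cnj (dX p' q' w) = dX p p' w * cnj (dX p' q' w) + dX p' a w * cnj (dX p' a w) + dX p' a w * cnj (dX a q' w) + dX a q w * cnj (dX p' a w)"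
    using `dX a q w * cnj (dX a q' w) = 0` by (simp add: algebra_simps)
   finally show ?thesis by (simp add: distrib_left mult.assoc)
  qed
  note T = past[of p p' p' q'] same[of p' a] past[of p' a a q'] future[of p' a a q]
  have "max 0 (min q q' - p') = a - p'" using a by (simp add: a_def)
  thus ?thesis unfolding * using T a assms p'0 a0 by auto
 qed
 thus ?I ?E by auto
qed

lemma cross:
 assumes pq: "0 <= p" "p <= q" and pq': "0 <= p'" "p' <= q'"
  and xi: "bdd_meas p xi" and xi': "bdd_meas p' xi'"
 shows "integrable M (%w. xi w * dX p q w * cnj (xi' w * dX p' q' w))" (is ?I)
  and "mean (%w. xi w * dX p q w * cnj (xi' w * dX p' q' w)) =
   mean (%w. xi w * cnj (xi' w)) * Cx (max 0 (min q q' - max p p'))" (is ?E)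
proof -
 have "?I & ?E"
 proof (cases "p <= p'")
  case True
  thus ?thesis using cross_ordered[of p q p' q' xi xi'] assms by (auto simp: max_absorb2)
 next
  case False
  hence *: "p' <= p" by simp
  let ?f = "%w. xi' w * dX p' q' w * cnj (xi w * dX p q w)"
  note c = cross_ordered[OF pq' * pq(2) xi' xi]
  have e: "(%w. xi w * dX p q w * cnj (xi' w * dX p' q' w)) = (%w. cnj (?f w))"
   by (simp add: fun_eq_iff mult_ac)
  have e': "(%w. xi w * cnj (xi' w)) = (%w. cnj (xi' w * cnj (xi w)))" by (simp add: fun_eq_iff mult_ac)
  have "max p p' = p" "min q q' = min q' q" using * by auto
  have ?I unfolding e by (rule integrable_cnj[OF c(1)])
  moreover have ?E
   unfolding e e' integral_cnj c(2) using `max p p' = p` `min q q' = min q' q` by simp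
  ultimately show ?thesis ..
 qed
 thus ?I ?E by auto
qed

definition step :: "'k set => ('k => 'w => complex) => ('k => real) => ('k => real) => bool" where
 "step K xi p q \<longleftrightarrow> finite K & (\<forall>k\<in>K. 0 <= p k & p k <= q k & bdd_meas (p k) (xi k))"

text \<open>Expanding both squares reduces the isometry to pairs of steps, where both sides contain the length of the
 overlap. No common refinement of the intervals is needed.\<close>

lemma step_isometry:
 assumes "step K xi p q"
 shows "L2sq M (%w. \<Sum>k\<in>K. xi k w * dX (p k) (q k) w) =
  (\<integral>\<^sup>+r. L2sq M (%w. \<Sum>k\<in>K. xi k w * indicator {p k<..q k} r) \<partial>lborel)"
proof -
 have k: "!!k. k \<in> K ==> 0 <= p k" "!!k. k \<in> K ==> p k <= q k" "!!k. k \<in> K ==> bdd_meas (p k) (xi k)"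
  using assms by (auto simp: step_def)
 let ?e = "%k l. Re (mean (%w. xi k w * cnj (xi l w)))"
 let ?o = "%k l. max 0 (min (q k) (q l) - max (p k) (p l))"
 let ?i = "%k l r. indicator ({p k<..q k} Int {p l<..q l}) r :: real"
 let ?S = "%r. \<Sum>k\<in>K. \<Sum>l\<in>K. ?e k l * ?i k l r"
 have R: "L2sq M (%w. \<Sum>k\<in>K. xi k w * indicator {p k<..q k} r) = ennreal (?S r)" "0 <= ?S r" for r
 proof -
  have e: "xi k w * indicator {p k<..q k} r * cnj (xi l w * indicator {p l<..q l} r) = xi k w * cnj (xi l w) * Cx (?i k l r)" for k l w
   by (auto simp: indicator_def)
  have "integrable M (%w. xi k w * cnj (xi l w) * Cx (?i k l r))" if "k \<in> K" "l \<in> K" for k l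
   by (intro integrable_mult_left bdd_meas_integrable_mult[OF k(3)[OF that(1)] bdd_meas_integrable[OF bdd_meas_cnj[OF k(3)[OF that(2)]]]])
  from L2sq_sum[of K "%k w. xi k w * indicator {p k<..q k} r", unfolded e, OF this]
  show "L2sq M (%w. \<Sum>k\<in>K. xi k w * indicator {p k<..q k} r) = ennreal (?S r)" "0 <= ?S r" by simp_all
 qed
 have oi: "{p k<..q k} Int {p l<..q l} = {max (p k) (p l)<..min (q k) (q l)}" for k l by auto
 have oe: "emeasure lborel {a<..b} = ennreal (max 0 (b - a))" for a b :: real
  by (cases "a <= b") auto
 have ii: "integrable lborel (?i k l)" for k l unfolding oi by (rule integrable_real_indicator) (auto simp: oe)
 have io: "(\<integral>r. ?i k l r \<partial>lborel) = ?o k l" for k l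
  unfolding oi by (simp add: measure_def oe del: ennreal_max_0 ennreal_max_0')
 have "(\<integral>\<^sup>+r. L2sq M (%w. \<Sum>k\<in>K. xi k w * indicator {p k<..q k} r) \<partial>lborel) = ennreal (\<integral>r. ?S r \<partial>lborel)"
  unfolding R(1) by (intro nn_integral_eq_integral integrable_sum integrable_mult_right ii AE_I2 R)
 also have "(\<integral>r. ?S r \<partial>lborel) = (\<Sum>k\<in>K. \<Sum>l\<in>K. ?e k l * ?o k l)"
  by (simp only: integral_sum integrable_sum integrable_mult_right[OF ii] ii integral_mult_right_zero io)
 also have "... = (\<Sum>k\<in>K. \<Sum>l\<in>K. Re (mean (%w. xi k w * dX (p k) (q k) w * cnj (xi l w * dX (p l) (q l) w))))"
  using k by (intro sum.cong refl) (subst cross(2), auto)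
 also have "ennreal ... = L2sq M (%w. \<Sum>k\<in>K. xi k w * dX (p k) (q k) w)"
  by (rule L2sq_sum(1)[symmetric]) (use k in \<open>intro cross\<close>)
 finally show ?thesis ..
qed

lemma step_mean:
 assumes "step K xi p q" and g: "bdd_meas s g" and s: "!!k. k \<in> K ==> s <= p k \<or> p k = q k"
 shows "integrable M (%w. g w * (\<Sum>k\<in>K. xi k w * dX (p k) (q k) w))"
  "mean (%w. g w * (\<Sum>k\<in>K. xi k w * dX (p k) (q k) w)) = 0"
proof -
 have K: "finite K" and k: "!!k. k \<in> K ==> 0 <= p k" "!!k. k \<in> K ==> p k <= q k" "!!k. k \<in> K ==> bdd_meas (p k) (xi k)"
  using assms by (auto simp: step_def)
 have *: "integrable M (%w. g w * (xi k w * dX (p k) (q k) w)) & mean (%w. g w * (xi k w * dX (p k) (q k) w)) = 0" if "k \<in> K" for k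
 proof (cases "p k = q k")
  case False
  hence "bdd_meas (p k) (%w. g w * xi k w)" using bdd_meas_mono[OF g] s[OF that] k[OF that] by auto
  thus ?thesis using increment_moments(1,2)[OF k(1,2)[OF that] bdd_meas_measD bdd_meas_integrable, of "%w. g w * xi k w"]
   by (simp add: mult.assoc)
 qed simp
 show "integrable M (%w. g w * (\<Sum>k\<in>K. xi k w * dX (p k) (q k) w))"
  "mean (%w. g w * (\<Sum>k\<in>K. xi k w * dX (p k) (q k) w)) = 0"
  unfolding sum_distrib_left using * by (simp_all add: integral_sum)
qed

end

section \<open>Estimates for the Ito integral\<close>

lemma floor_grid_tendsto:
 fixes r :: real
 assumes c: "filterlim c at_top sequentially" "!!n. 0 < c n"
 shows "(%n. of_int \<lfloor>c n * r\<rfloor> / c n) ----> r" "of_int \<lfloor>c n * r\<rfloor> / c n <= r"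
proof -
 have b: "r - 1 / c n <= of_int \<lfloor>c n * r\<rfloor> / c n & of_int \<lfloor>c n * r\<rfloor> / c n <= r" for n
 proof -
  have "c n * r - 1 <= of_int \<lfloor>c n * r\<rfloor>" "of_int \<lfloor>c n * r\<rfloor> <= c n * r" by linarith+
  from this[THEN divide_right_mono, OF less_imp_le[OF c(2)[of n]]] show ?thesis using less_imp_neq[OF c(2)[of n]] by (simp add: diff_divide_distrib)
 qed
 thus "of_int \<lfloor>c n * r\<rfloor> / c n <= r" by blast
 have "(%n. 1 / c n) ----> 0"
  by (rule tendsto_divide_0[OF tendsto_const filterlim_at_top_imp_at_infinity[OF c(1)]])
 from tendsto_diff[OF tendsto_const this, of r] have l: "(%n. r - 1 / c n) ----> r" by (simp only: diff_0_right)
 show "(%n. of_int \<lfloor>c n * r\<rfloor> / c n) ----> r"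
  by (rule tendsto_sandwich[OF _ _ l tendsto_const]) (intro always_eventually allI conjunct1[OF b] conjunct2[OF b])+
qed

lemma filterlim_real_Suc: "filterlim (%n. real (Suc n)) at_top sequentially"
 by (rule filterlim_compose[OF filterlim_real_sequentially filterlim_Suc])

lemma cmod_add_sq: "(cmod (a + b))^2 <= 2 * (cmod a)^2 + 2 * (cmod b)^2"
proof -
 have "(cmod (a + b))^2 <= (cmod a + cmod b)^2" by (intro power_mono norm_triangle_ineq) simp
 also have "... <= 2 * (cmod a)^2 + 2 * (cmod b)^2"
  using sum_squares_bound[of "cmod a" "cmod b"] by (simp add: power2_sum)
 finally show ?thesis .
qed

lemma nn_sq_triangle:
 assumes [measurable]: "f \<in> borel_measurable M" "g \<in> borel_measurable M"
 shows "L2sq M (%w. f w + g w) <=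
  2 * L2sq M f + 2 * L2sq M g"
proof -
 have "L2sq M (%w. f w + g w) <= (\<integral>\<^sup>+w. 2 * ennreal ((cmod (f w))^2) + 2 * ennreal ((cmod (g w))^2) \<partial>M)"
 proof (rule nn_integral_mono)
  fix w
  have "2 * ennreal ((cmod (f w))^2) + 2 * ennreal ((cmod (g w))^2) = ennreal (2 * (cmod (f w))^2 + 2 * (cmod (g w))^2)"
   by (simp add: ennreal_mult ennreal_plus)
  thus "ennreal ((cmod (f w + g w))^2) <= 2 * ennreal ((cmod (f w))^2) + 2 * ennreal ((cmod (g w))^2)"
   by (simp only:) (intro ennreal_leI cmod_add_sq)
 qed
 also have "... = 2 * L2sq M f + 2 * L2sq M g"
  by (simp add: nn_integral_add nn_integral_cmult)
 finally show ?thesis .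
qed

context noise
begin

text \<open>Pairs of a step integral and its integrand that live after the time \<open>a\<close>; closed under sums, so that integrals
 of different simple processes can be compared.\<close>

inductive step_int :: "real => ('w => complex) => (real => 'w => complex) => bool" for a where
 zero: "step_int a (%_. 0) (%_ _. 0)"
| add: "step_int a I v ==> a <= p ==> 0 <= p ==> p <= q ==> bdd_meas p xi ==>
  step_int a (%w. I w + xi w * dX p q w) (%r w. v r w + xi w * indicator {p<..q} r)"

lemma step_int_single: "a <= p ==> 0 <= p ==> p <= q ==> bdd_meas p xi ==>
  step_int a (%w. xi w * dX p q w) (%r w. xi w * indicator {p<..q} r)"
 using step_int.add[OF step_int.zero, of a p q xi] by simp

lemma step_int_plus:
 assumes "step_int a I' v'" "step_int a I v"
 shows "step_int a (%w. I w + I' w) (%r w. v r w + v' r w)"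
 using assms
proof (induction rule: step_int.induct)
 case zero thus ?case by simp
next
 case (add I' v' p q xi)
 show ?case using step_int.add[OF add.IH[OF add.prems] add.hyps(2-5)] by (simp add: add.assoc)
qed

lemma step_int_uminus:
 assumes "step_int a I v"
 shows "step_int a (%w. - I w) (%r w. - v r w)"
 using assms
proof (induction rule: step_int.induct)
 case zero thus ?case using step_int.zero by simp
next
 case (add I v p q xi)
 show ?case using step_int.add[OF add.IH add.hyps(2-4) bdd_meas_uminus[OF add.hyps(5)]] by simp
qed

lemma step_int_sum:
 assumes "finite K" "!!k. k \<in> K ==> step_int a (I k) (v k)"
 shows "step_int a (%w. \<Sum>k\<in>K. I k w) (%r w. \<Sum>k\<in>K. v k r w)"
 using assms
proof (induction K)
 case empty thus ?case using step_int.zero by simp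
next
 case (insert x K)
 hence *: "step_int a (I x) (v x)" "step_int a (%w. \<Sum>k\<in>K. I k w) (%r w. \<Sum>k\<in>K. v k r w)" by auto
 show ?case using step_int_plus[OF *(2,1)] insert.hyps by simp
qed

lemma step_int_family:
 assumes "step_int a I v"
 shows "\<exists>n::nat. \<exists>xi p q. step {..<n} xi p q & (\<forall>k<n. a <= p k) &
  (ALL w. I w = (\<Sum>k<n. xi k w * dX (p k) (q k) w)) & (ALL r w. v r w = (\<Sum>k<n. xi k w * indicator {p k<..q k} r))"
 using assms
proof (induction rule: step_int.induct)
 case zero
 show ?case by (rule exI[of _ 0]) (simp add: step_def)
next
 case (add I v p' q' xi')
 then obtain n :: nat and xi p q where *: "step {..<n} xi p q" "\<forall>k<n. a <= p k"
  "ALL w. I w = (\<Sum>k<n. xi k w * dX (p k) (q k) w)" "ALL r w. v r w = (\<Sum>k<n. xi k w * indicator {p k<..q k} r)" by blast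
 show ?case
  by (rule exI[of _ "Suc n"], rule exI[of _ "xi(n := xi')"], rule exI[of _ "p(n := p')"], rule exI[of _ "q(n := q')"])
   (use * add.hyps in \<open>auto simp: step_def less_Suc_eq\<close>)
qed

lemma step_int_isometry:
 assumes "step_int a I v"
 shows "L2sq M I = (\<integral>\<^sup>+r. L2sq M (v r) \<partial>lborel)"
 using step_int_family[OF assms] step_isometry by fastforce

lemma step_int_mean:
 assumes "step_int s I v" "bdd_meas s g"
 shows "integrable M (%w. g w * I w)" "mean (%w. g w * I w) = 0"
proof -
 from step_int_family[OF assms(1)] obtain n :: nat and xi p q where *: "step {..<n} xi p q" "\<forall>k<n. s <= p k"
  "ALL w. I w = (\<Sum>k<n. xi k w * dX (p k) (q k) w)" by blast
 thus "integrable M (%w. g w * I w)" "mean (%w. g w * I w) = 0"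
  using step_mean[OF *(1) assms(2)] by auto
qed

lemma step_int_measurable: "step_int a I v ==> I \<in> borel_measurable M"
proof (induction rule: step_int.induct)
 case (add I v p q xi)
 note [measurable] = add.IH bdd_meas_measM[OF add.hyps(5)] X_meas[OF add.hyps(3)]
 have [measurable]: "X q \<in> borel_measurable M" using add.hyps by (intro X_meas) auto
 show ?case by measurable
qed simp

lemma step_int_value_measurable: "step_int a I v ==> (%(r, w). v r w) \<in> borel_measurable (borel \<Otimes>\<^sub>M M)"
proof (induction rule: step_int.induct)
 case (add I v p q xi)
 note [measurable] = add.IH bdd_meas_measM[OF add.hyps(5)]
 show ?case using add.IH by (simp add: case_prod_beta')
qed simp

lemma step_int_value_bounded: "step_int a I v ==> EX C. ALL r. \<forall>w\<in>space M. cmod (v r w) <= C"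
proof (induction rule: step_int.induct)
 case zero show ?case by auto
next
 case (add I v p q xi)
 then obtain C D where *: "ALL r. \<forall>w\<in>space M. cmod (v r w) <= C" "\<forall>w\<in>space M. cmod (xi w) <= D"
  by (auto simp: bdd_meas_def)
 have "cmod (v r w + xi w * indicator {p<..q} r) <= C + D" if "w \<in> space M" for r w
 proof -
  have "cmod (xi w * indicator {p<..q} r) <= cmod (xi w)" by (simp add: indicator_def)
  also have "... <= D" using * that by auto
  finally have "cmod (xi w * indicator {p<..q} r) <= D" .
  moreover have "cmod (v r w) <= C" using * that by auto
  ultimately show ?thesis using norm_triangle_ineq[of "v r w" "xi w * indicator {p<..q} r"] by linarith
 qed
 thus ?case by blast
qed

lemma simple_process_times:
 assumes s: "simple_process F n u xi" and "k <= n" shows "0 <= u k"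
 using assms(2)
proof (induction k)
 case (Suc k)
 hence "u k <= u (Suc k)" "0 <= u k" using s by (auto simp: simple_process_def)
 thus ?case by linarith
qed (use s in \<open>auto simp: simple_process_def\<close>)

lemma simple_integral_0: "simple_process F n u xi ==> simple_integral n u xi X 0 w = 0"
 unfolding simple_integral_def
 by (rule sum.neutral) (use simple_process_times[of n u xi] in \<open>auto simp: min_absorb2 Suc_le_eq\<close>)

lemma simple_step:
 assumes s: "simple_process F n u xi" and st: "0 <= s" "s <= t"
 shows "step_int s (%w. simple_integral n u xi X t w - simple_integral n u xi X s w)
  (%r w. simple_value n u xi r w * indicator {s<..t} r)"
proof -
 define c where "c a = max s (min a t)" for a
 define zeta where "zeta k = (if u k <= t then xi k else (%_. 0))" for k
 have u: "u k <= u (Suc k)" if "k < n" for k using s that by (auto simp: simple_process_def)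
 have b: "bdd_meas (u k) (xi k)" if "k < n" for k
  using s that by (auto simp: simple_process_def bdd_meas_def)
 have "step_int s (%w. zeta k w * dX (c (u k)) (c (u (Suc k))) w) (%r w. zeta k w * indicator {c (u k)<..c (u (Suc k))} r)"
  if "k \<in> {..<n}" for k
  using that u[of k] st b[of k]
  by (intro step_int_single) (auto simp: c_def zeta_def intro: bdd_meas_mono)
 from step_int_sum[OF finite_lessThan this]
 have "step_int s (%w. \<Sum>k<n. zeta k w * dX (c (u k)) (c (u (Suc k))) w) (%r w. \<Sum>k<n. zeta k w * indicator {c (u k)<..c (u (Suc k))} r)" .
 moreover have "(\<Sum>k<n. zeta k w * dX (c (u k)) (c (u (Suc k))) w) = simple_integral n u xi X t w - simple_integral n u xi X s w" for w
 proof -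
  have X: "X (c a) w = X (min a t) w - X (min a s) w + X s w" for a
   using st by (auto simp: c_def min_def max_def)
  have "zeta k w * dX (c (u k)) (c (u (Suc k))) w = xi k w * (X (min (u (Suc k)) t) w - X (min (u k) t) w) - xi k w * (X (min (u (Suc k)) s) w - X (min (u k) s) w)"
   if "k < n" for k
  proof (cases "u k <= t")
   case True thus ?thesis unfolding X by (simp add: zeta_def algebra_simps)
  next
   case False thus ?thesis using u[OF that] st by (auto simp: zeta_def min_def)
  qed
  thus ?thesis unfolding simple_integral_def by (simp add: sum_subtractf)
 qed
 moreover have "(\<Sum>k<n. zeta k w * indicator {c (u k)<..c (u (Suc k))} r) = simple_value n u xi r w * indicator {s<..t} r" for r w
  unfolding simple_value_def sum_distrib_right
  by (intro sum.cong refl) (auto simp: zeta_def c_def indicator_def)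
 ultimately show ?thesis by simp
qed

end

locale ito_integrand = noise M F X Xi m
 for M :: "'w measure" and F X Xi m +
 fixes H :: "real => 'w => complex" and J :: "real => 'w => complex" and C :: real
 assumes ito: "has_ito_integral M F H X J"
  and H_bound: "!!t w. [|0 <= t; w \<in> space M|] ==> cmod (H t w) <= C"
  and H_cont: "AE w in M. continuous_on {0..} (%t. H t w)"
begin

lemma H_adapted: "0 <= t ==> H t \<in> borel_measurable (F t)"
 using ito by (simp add: has_ito_integral_def)

lemma H_meas [measurable]: "0 <= t ==> H t \<in> borel_measurable M"
 by (rule measurable_F_M[OF H_adapted])

lemma J_meas [measurable]: "0 <= t ==> J t \<in> borel_measurable M"
 using ito by (simp add: has_ito_integral_def)

text \<open>\<open>H\<close> is jointly measurable only up to null sets, as a limit of its values on finer and finer grids; this suffices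
 for the distance, which is an integral over the probability space.\<close>

lemma distance_measurable:
 assumes "step_int a I v"
 shows "(%r. L2sq M (%w. v r w - H r w) * indicator {0..t} r) \<in> borel_measurable borel"
proof -
 note [measurable] = step_int_value_measurable[OF assms]
 obtain D where D: "!!r w. w \<in> space M ==> cmod (v r w) <= D"
  using step_int_value_bounded[OF assms] by blast
 define Hn where "Hn n r w = H (max 0 (of_int \<lfloor>real (Suc n) * r\<rfloor> / real (Suc n))) w" for n r w
 have Hn_meas[measurable]: "(%(r, w). Hn n r w) \<in> borel_measurable (borel \<Otimes>\<^sub>M M)" for n
 proof -
  have "(%p. (%i::int. %p. H (max 0 (of_int i / real (Suc n))) (snd p)) \<lfloor>real (Suc n) * fst p\<rfloor> p) \<in> borel_measurable (borel \<Otimes>\<^sub>M M)"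
   by (rule measurable_compose_countable) measurable
  thus ?thesis by (simp add: Hn_def case_prod_beta')
 qed
 let ?g = "%n r. L2sq M (%w. v r w - Hn n r w) * indicator {0..t} r"
 show ?thesis
 proof (rule borel_measurable_LIMSEQ_order)
  show "?g n \<in> borel_measurable borel" for n by measurable
  fix r :: real assume "r \<in> space borel"
  show "(%n. ?g n r) ----> L2sq M (%w. v r w - H r w) * indicator {0..t} r"
  proof (cases "r \<in> {0..t}")
   case False thus ?thesis by simp
  next
   case True
   hence r: "0 <= r" by simp
   have "0 <= of_int \<lfloor>real (Suc n) * r\<rfloor> / real (Suc n)" for n using r by simp
   hence lim: "(%n. max 0 (of_int \<lfloor>real (Suc n) * r\<rfloor> / real (Suc n))) ----> r"
    using floor_grid_tendsto(1)[OF filterlim_real_Suc, of r] by (simp only: max_absorb2 of_nat_0_less_iff zero_less_Suc)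
   have "(%n. L2sq M (%w. v r w - Hn n r w)) ----> L2sq M (%w. v r w - H r w)"
   proof (rule nn_integral_dominated_convergence[where w="%_. ennreal ((D + C)^2)"])
    show "(%w. ennreal ((cmod (v r w - Hn n r w))^2)) \<in> borel_measurable M" for n by measurable
    have [measurable]: "H r \<in> borel_measurable M" using r by simp
    show "(%w. ennreal ((cmod (v r w - H r w))^2)) \<in> borel_measurable M" by measurable
    show "(%_. ennreal ((D + C)^2)) \<in> borel_measurable M" by simp
    show "(\<integral>\<^sup>+w. ennreal ((D + C)^2) \<partial>M) < \<infinity>" by (simp add: emeasure_space_1)
    show "AE w in M. ennreal ((cmod (v r w - Hn n r w))^2) <= ennreal ((D + C)^2)" for n
    proof (rule AE_I2)
     fix w assume w: "w \<in> space M"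
     have "cmod (v r w - Hn n r w) <= D + C"
      using D[OF w, of r] H_bound[OF _ w, of "max 0 (of_int \<lfloor>real (Suc n) * r\<rfloor> / real (Suc n))"]
       norm_triangle_ineq4[of "v r w" "Hn n r w"] by (simp add: Hn_def)
     thus "ennreal ((cmod (v r w - Hn n r w))^2) <= ennreal ((D + C)^2)" by (intro ennreal_leI power_mono) auto
    qed
    show "AE w in M. (%n. ennreal ((cmod (v r w - Hn n r w))^2)) ----> ennreal ((cmod (v r w - H r w))^2)"
     using H_cont
    proof eventually_elim
     case (elim w)
     have "(%n. Hn n r w) ----> H r w"
      unfolding Hn_def
      by (rule continuous_on_tendsto_compose[OF elim lim]) (use r in auto)
     thus ?case by (intro tendsto_ennrealI tendsto_intros)
    qed
   qed
   thus ?thesis using True by simp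
  qed
 qed
qed

lemma simple_distance_measurable:
 assumes s: "simple_process F n u xi" and t: "0 <= t"
 shows "(%r. L2sq M (%w. simple_value n u xi r w - H r w) * indicator {0..t} r) \<in> borel_measurable borel"
proof -
 note u = simple_process_times[OF s]
 have "simple_value n u xi 0 w = 0" for w
  unfolding simple_value_def using u[OF less_imp_le] by (intro sum.neutral) (force simp: indicator_def)
 hence e: "L2sq M (%w. simple_value n u xi r w - H r w) * indicator {0..t} r
   = L2sq M (%w. simple_value n u xi r w * indicator {0<..t} r - H r w) * indicator {0..t} r" for r
  by (cases "r = 0") (auto simp: indicator_def)
 show ?thesis unfolding e by (rule distance_measurable[OF simple_step[OF s order.refl t]])
qed

lemma simple_value_measurable: "simple_process F n u xi ==> simple_value n u xi r \<in> borel_measurable M"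
 unfolding simple_value_def
 by (intro borel_measurable_sum borel_measurable_times) (auto simp: simple_process_def intro: measurable_F_M)

text \<open>The integrals at the times \<open>s\<close> and \<open>t\<close> may come from unrelated approximations. At time \<open>s\<close> both approximate the
 same process, so by the isometry their integrals have the same limit, and the sequence for \<open>t\<close> serves both.\<close>

lemma ito_approx:
 assumes st: "0 <= s" "s <= t"
 obtains I v where "!!j :: nat. step_int s (I j) (%r w. v j r w * indicator {s<..t} r)"
  "!!j. (%r. L2sq M (%w. v j r w - H r w) * indicator {0..t} r) \<in> borel_measurable borel"
  "!!j r. (v j r) \<in> borel_measurable M"
  "(%j. \<integral>\<^sup>+ r\<in>{0..t}. L2sq M (%w. v j r w - H r w) \<partial>lborel) ----> 0"
  "(%j. L2sq M (%w. I j w - (J t w - J s w))) ----> 0"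
proof -
 have t0: "0 <= t" using st by simp
 have *: "\<exists>n u xi. (\<forall>j :: nat. simple_process F (n j) (u j) (xi j)) &
    (%j. \<integral>\<^sup>+ s\<in>{0..t}. (L2sq M (%w. simple_value (n j) (u j) (xi j) s w - H s w)) \<partial>lborel) ----> 0 &
    (%j. L2sq M (%w. simple_integral (n j) (u j) (xi j) X t w - J t w)) ----> 0" if "0 <= t" for t
  using ito that unfolding has_ito_integral_def by blast
 obtain n u xi where a: "!!j :: nat. simple_process F (n j) (u j) (xi j)"
  "(%j. \<integral>\<^sup>+ r\<in>{0..t}. (L2sq M (%w. simple_value (n j) (u j) (xi j) r w - H r w)) \<partial>lborel) ----> 0"
  "(%j. L2sq M (%w. simple_integral (n j) (u j) (xi j) X t w - J t w)) ----> 0"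
  using *[OF t0] by blast
 obtain n' u' xi' where a': "!!j :: nat. simple_process F (n' j) (u' j) (xi' j)"
  "(%j. \<integral>\<^sup>+ r\<in>{0..s}. (L2sq M (%w. simple_value (n' j) (u' j) (xi' j) r w - H r w)) \<partial>lborel) ----> 0"
  "(%j. L2sq M (%w. simple_integral (n' j) (u' j) (xi' j) X s w - J s w)) ----> 0"
  using *[OF st(1)] by blast
 let ?I = "%j. simple_integral (n j) (u j) (xi j) X" and ?I' = "%j. simple_integral (n' j) (u' j) (xi' j) X"
 let ?v = "%j. simple_value (n j) (u j) (xi j)" and ?v' = "%j. simple_value (n' j) (u' j) (xi' j)"
 let ?d = "%v r. L2sq M (%w. v r w - H r w)"
 have I0: "?I j 0 w = 0" "?I' j 0 w = 0" for j w using simple_integral_0[OF a(1)] simple_integral_0[OF a'(1)] by auto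
 have step_s: "step_int 0 (?I j s) (%r w. ?v j r w * indicator {0<..s} r)" "step_int 0 (?I' j s) (%r w. ?v' j r w * indicator {0<..s} r)" for j
  using simple_step[OF a(1) order.refl st(1), of j] simple_step[OF a'(1) order.refl st(1), of j] I0 by simp_all
 have step_t: "step_int 0 (?I j t) (%r w. ?v j r w * indicator {0<..t} r)" for j
  using simple_step[OF a(1) order.refl t0, of j] I0 by simp
 note [measurable] = step_int_measurable[OF step_s(1)] step_int_measurable[OF step_s(2)] step_int_measurable[OF step_t]
  J_meas[OF st(1)] J_meas[OF t0]
 note vm[measurable] = simple_value_measurable[OF a(1)] simple_value_measurable[OF a'(1)]
 have dm[measurable]: "(%r. ?d (?v j) r * indicator {0..t} r) \<in> borel_measurable borel"
  "(%r. ?d (?v j) r * indicator {0..s} r) \<in> borel_measurable borel"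
  "(%r. ?d (?v' j) r * indicator {0..s} r) \<in> borel_measurable borel" for j
  using simple_distance_measurable a(1) a'(1) st t0 by blast+
 let ?A = "%j. (\<integral>\<^sup>+ r\<in>{0..t}. ?d (?v j) r \<partial>lborel)" and ?A' = "%j. (\<integral>\<^sup>+ r\<in>{0..s}. ?d (?v' j) r \<partial>lborel)"
 \<comment> \<open>both approximations have the same limit at time \<open>s\<close>\<close>
 have cmp: "L2sq M (%w. ?I j s w - ?I' j s w) <= 2 * ?A j + 2 * ?A' j" for j
 proof -
  have "step_int 0 (%w. ?I j s w - ?I' j s w) (%r w. (?v j r w - ?v' j r w) * indicator {0<..s} r)"
   using step_int_plus[OF step_int_uminus[OF step_s(2)] step_s(1), of j j] by (simp add: algebra_simps)
  hence "L2sq M (%w. ?I j s w - ?I' j s w)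
   = (\<integral>\<^sup>+r. (L2sq M (%w. (?v j r w - ?v' j r w) * indicator {0<..s} r)) \<partial>lborel)"
   by (rule step_int_isometry)
  also have "... <= (\<integral>\<^sup>+r. 2 * (?d (?v j) r * indicator {0..t} r) + 2 * (?d (?v' j) r * indicator {0..s} r) \<partial>lborel)"
  proof (rule nn_integral_mono)
   fix r
   show "L2sq M (%w. (?v j r w - ?v' j r w) * indicator {0<..s} r) <= 2 * (?d (?v j) r * indicator {0..t} r) + 2 * (?d (?v' j) r * indicator {0..s} r)"
   proof (cases "r \<in> {0<..s}")
    case True
    hence [measurable]: "H r \<in> borel_measurable M" by simp
    have "L2sq M (%w. (?v j r w - H r w) + (H r w - ?v' j r w)) <= 2 * ?d (?v j) r + 2 * L2sq M (%w. H r w - ?v' j r w)"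
     by (rule nn_sq_triangle) measurable
    thus ?thesis using True st by (simp add: norm_minus_commute)
   qed simp
  qed
  also have "... = 2 * ?A j + 2 * ?A' j"
   using dm by (simp add: nn_integral_add nn_integral_cmult)
  finally show ?thesis .
 qed
 let ?K = "%j w. ?I j t w - ?I j s w"
 have "step_int s (?K j) (%r w. ?v j r w * indicator {s<..t} r)" for j
  by (rule simple_step[OF a(1) st])
 moreover have "(%j. L2sq M (%w. ?K j w - (J t w - J s w))) ----> 0"
 proof (rule tendsto_sandwich[OF _ _ tendsto_const])
  let ?P = "%j. L2sq M (%w. ?I j t w - J t w)" and ?P' = "%j. L2sq M (%w. ?I' j s w - J s w)"
  let ?B = "%j. 2 * ?P j + 2 * (2 * (2 * ?A j + 2 * ?A' j) + 2 * ?P' j)"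
  have "L2sq M (%w. ?K j w - (J t w - J s w)) <= ?B j" for j
  proof -
   have "L2sq M (%w. ?K j w - (J t w - J s w))
    = L2sq M (%w. (?I j t w - J t w) + (J s w - ?I j s w))"
    by (simp add: algebra_simps)
   also have "... <= 2 * ?P j + 2 * L2sq M (%w. J s w - ?I j s w)"
    by (rule nn_sq_triangle) measurable
   also have "L2sq M (%w. J s w - ?I j s w) = L2sq M (%w. (?I j s w - ?I' j s w) + (?I' j s w - J s w))"
    by (simp add: norm_minus_commute)
   also have "... <= 2 * L2sq M (%w. ?I j s w - ?I' j s w) + 2 * ?P' j"
    by (rule nn_sq_triangle) measurable
   also have "... <= 2 * (2 * ?A j + 2 * ?A' j) + 2 * ?P' j"
    by (intro add_mono mult_left_mono cmp) auto
   finally show ?thesis by (simp add: add_mono mult_left_mono)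
  qed
  thus "\<forall>\<^sub>F j in sequentially. (L2sq M (%w. ?K j w - (J t w - J s w))) <= ?B j" by simp
  have "?B ----> 2 * 0 + 2 * (2 * (2 * 0 + 2 * 0) + 2 * 0)"
   using a(2,3) a'(2,3) by (intro tendsto_add ennreal_tendsto_cmult) auto
  thus "?B ----> 0" by simp
 qed simp
 ultimately show ?thesis
  using that[of ?K ?v] dm(1) vm(1) a(2) by blast
qed

text \<open>The cost of freezing the integrand. The exact isometry would give \<open>c * (t - s)\<close>; the factor \<open>4\<close> comes from using
 \<open>nn_sq_triangle\<close> twice instead of the triangle inequality in \<open>L\<^sup>2\<close>.\<close>

lemma ito_estimate:
 assumes st: "0 <= s" "s <= t" and eta: "bdd_meas s eta" and c: "0 <= c"
  "!!r. s <= r ==> r <= t ==> L2sq M (%w. H r w - eta w) <= ennreal c"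
 shows "L2sq M (%w. J t w - J s w - eta w * dX s t w) <= ennreal (4 * c * (t - s))"
proof -
 let ?E = "%w. J t w - J s w - eta w * dX s t w"
 obtain I v where iv: "!!j :: nat. step_int s (I j) (%r w. v j r w * indicator {s<..t} r)"
  "!!j. (%r. L2sq M (%w. v j r w - H r w) * indicator {0..t} r) \<in> borel_measurable borel"
  "!!j r. (v j r) \<in> borel_measurable M"
  "(%j. \<integral>\<^sup>+ r\<in>{0..t}. L2sq M (%w. v j r w - H r w) \<partial>lborel) ----> 0"
  "(%j. L2sq M (%w. I j w - (J t w - J s w))) ----> 0"
  using ito_approx[OF st] by blast
 let ?D = "%j w. I j w - eta w * dX s t w"
 let ?d' = "%j w. J t w - J s w - I j w"
 have t0: "0 <= t" using st by simp
 note [measurable] = step_int_measurable[OF iv(1)] iv(2,3) J_meas[OF st(1)] J_meas[OF t0] bdd_meas_measM[OF eta] X_meas[OF st(1)] X_meas[OF t0]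
 let ?d = "%j r. L2sq M (%w. v j r w - H r w)"
 let ?A = "%j. (\<integral>\<^sup>+ r\<in>{0..t}. ?d j r \<partial>lborel)"
 have cmp: "L2sq M (?D j) <= 2 * ?A j + 2 * ennreal (c * (t - s))" for j
 proof -
  have "step_int s (%w. ?D j w) (%r w. (v j r w - eta w) * indicator {s<..t} r)"
   using step_int_plus[OF step_int_uminus[OF step_int_single[OF order.refl st eta]] iv(1)[of j]] by (simp add: algebra_simps)
  hence "L2sq M (?D j)
   = (\<integral>\<^sup>+r. (L2sq M (%w. (v j r w - eta w) * indicator {s<..t} r)) \<partial>lborel)"
   by (rule step_int_isometry)
  also have "... <= (\<integral>\<^sup>+r. 2 * (?d j r * indicator {0..t} r) + 2 * (ennreal c * indicator {s<..t} r) \<partial>lborel)"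
  proof (rule nn_integral_mono)
   fix r
   show "L2sq M (%w. (v j r w - eta w) * indicator {s<..t} r) <= 2 * (?d j r * indicator {0..t} r) + 2 * (ennreal c * indicator {s<..t} r)"
   proof (cases "r \<in> {s<..t}")
    case True
    hence [measurable]: "H r \<in> borel_measurable M" using st by simp
    have "L2sq M (%w. (v j r w - H r w) + (H r w - eta w)) <= 2 * ?d j r + 2 * L2sq M (%w. H r w - eta w)"
     by (rule nn_sq_triangle) measurable
    also have "... <= 2 * ?d j r + 2 * ennreal c"
     using True by (intro add_mono mult_left_mono c) auto
    finally show ?thesis using True st by simp
   qed simp
  qed
  also have "... = 2 * ?A j + 2 * (ennreal c * ennreal (t - s))"
   using iv(2) st by (simp add: nn_integral_add nn_integral_cmult)
  finally show ?thesis using c(1) by (simp add: ennreal_mult')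
 qed
 let ?P = "%j. L2sq M (%w. I j w - (J t w - J s w))"
 let ?B = "%j. 2 * ?P j + 2 * (2 * ?A j + 2 * ennreal (c * (t - s)))"
 have "L2sq M ?E <= ?B j" for j
 proof -
  have "L2sq M (%w. (?d' j w) + (?D j w))
   <= 2 * L2sq M (?d' j) + 2 * L2sq M (?D j)"
   by (rule nn_sq_triangle) measurable
  also have "... <= 2 * L2sq M (?d' j) + 2 * (2 * ?A j + 2 * ennreal (c * (t - s)))"
   by (intro add_mono mult_left_mono cmp) auto
  finally have *: "L2sq M (%w. (?d' j w) + (?D j w))
   <= 2 * L2sq M (?d' j) + 2 * (2 * ?A j + 2 * ennreal (c * (t - s)))" .
  have e1: "cmod (?d' j w) = cmod (I j w - (J t w - J s w))" for w by (rule norm_minus_commute)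
  have e2: "(?d' j w) + (?D j w) = ?E w" for w by simp
  show ?thesis using * unfolding e1 e2 .
 qed
 moreover have "?B ----> 2 * 0 + 2 * (2 * 0 + 2 * ennreal (c * (t - s)))"
  using iv(4,5) by (intro tendsto_add ennreal_tendsto_cmult tendsto_const) auto
 ultimately have "L2sq M ?E <= 2 * 0 + 2 * (2 * 0 + 2 * ennreal (c * (t - s)))"
  by (intro LIMSEQ_le_const) auto
 also have "2 * 0 + 2 * (2 * 0 + 2 * ennreal (c * (t - s))) = ennreal (4 * c * (t - s))"
 proof -
  have "(4::ennreal) = ennreal 4" by simp
  hence "4 * ennreal (c * (t - s)) = ennreal (4 * (c * (t - s)))" by (simp only: ennreal_mult')
  thus ?thesis by (simp add: mult.assoc[symmetric])
 qed
 finally show ?thesis .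
qed

lemma ito_estimate_expectation:
 assumes st: "0 <= s" "s <= t" and eta: "bdd_meas s eta" and c: "0 <= c"
  "!!r. s <= r ==> r <= t ==> mean (%w. (cmod (H r w - eta w))^2) <= c"
 shows "integrable M (%w. (cmod (J t w - J s w - eta w * dX s t w))^2)"
  "mean (%w. (cmod (J t w - J s w - eta w * dX s t w))^2) <= 4 * c * (t - s)"
proof -
 let ?D = "%w. J t w - J s w - eta w * dX s t w"
 let ?d = "%r w. H r w - eta w"
 have t0: "0 <= t" using st by simp
 note [measurable] = J_meas[OF st(1)] J_meas[OF t0] bdd_meas_measM[OF eta] X_meas[OF st(1)] X_meas[OF t0]
 have nn: "L2sq M ?D <= ennreal (4 * c * (t - s))"
 proof (rule ito_estimate[OF st eta c(1)])
  fix r assume r: "s <= r" "r <= t"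
  hence r0: "0 <= r" using st by simp
  obtain K where K: "!!w. w \<in> space M ==> cmod (eta w) <= K" using eta by (auto simp: bdd_meas_def)
  have "integrable M (%w. (cmod (?d r w))^2)"
  proof (rule integrable_const_bound[where B="(C + K)^2"])
   have "cmod (?d r w) <= C + K" if "w \<in> space M" for w
    using norm_triangle_ineq4[of "H r w" "eta w"] H_bound[OF r0 that] K[OF that] by linarith
   thus "AE w in M. norm ((cmod (?d r w))^2) <= (C + K)^2"
    by (intro AE_I2) (simp add: power_mono)
   show "(%w. (cmod (?d r w))^2) \<in> borel_measurable M" using H_meas[OF r0] by measurable
  qed
  hence "L2sq M (?d r) = ennreal (mean (%w. (cmod (?d r w))^2))"
   by (intro nn_integral_eq_integral) auto
  thus "L2sq M (?d r) <= ennreal c"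
   using c(2)[OF r] by (simp add: ennreal_leI)
 qed
 show i: "integrable M (%w. (cmod (?D w))^2)"
  by (rule integrableI_bounded) (use nn in \<open>auto intro: le_less_trans\<close>)
 have "ennreal (mean (%w. (cmod (?D w))^2)) = L2sq M ?D"
  using i by (intro nn_integral_eq_integral[symmetric]) auto
 also note nn
 finally show "mean (%w. (cmod (?D w))^2) <= 4 * c * (t - s)"
  using c(1) st by (subst (asm) ennreal_le_iff) auto
qed

lemma ito_sq:
 assumes st: "0 <= s" "s <= t"
 shows "integrable M (%w. (cmod (J t w - J s w))^2)" "mean (%w. (cmod (J t w - J s w))^2) <= 4 * C^2 * (t - s)"
proof -
 have "mean (%w. (cmod (H r w - 0))^2) <= C^2" if "s <= r" "r <= t" for r
 proof -
  have r0: "0 <= r" using that st by simp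
  have "mean (%w. (cmod (H r w - 0))^2) <= mean (%_. C^2)"
   by (rule integral_mono') (use H_bound[OF r0] in \<open>auto intro!: power_mono\<close>)
  thus ?thesis by (simp add: prob_space)
 qed
 thus "integrable M (%w. (cmod (J t w - J s w))^2)" "mean (%w. (cmod (J t w - J s w))^2) <= 4 * C^2 * (t - s)"
  using ito_estimate_expectation[OF st bdd_meas_const[of s 0], of "C^2"] by auto
qed

end

lemma (in prob_space) integrable_of_square:
 fixes f :: "'a => 'b :: {real_normed_field, banach, second_countable_topology}"
 assumes [measurable]: "f \<in> borel_measurable M" and "integrable M (%w. (norm (f w))^2)"
 shows "integrable M f"
proof (rule integrable_bound)
 show "integrable M (%w. 1 + (norm (f w))^2)" using assms(2) by simp
 have "norm z <= 1 + (norm z)^2" for z :: 'b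
  using sum_squares_bound[of "1/2" "norm z"] zero_le_power2[of "norm z"] by (simp add: power2_eq_square)
 thus "AE w in M. norm (f w) <= norm (1 + (norm (f w))^2)" by simp
qed measurable

context ito_integrand
begin

text \<open>For step integrals after time \<open>s\<close> this is \<open>step_int_mean\<close>; the \<open>L\<^sup>2\<close>-limit preserves it.\<close>

lemma ito_mean:
 assumes st: "0 <= s" "s <= t" and g: "bdd_meas s g"
 shows "integrable M (%w. g w * (J t w - J s w))" "mean (%w. g w * (J t w - J s w)) = 0"
proof -
 let ?D = "%w. J t w - J s w"
 have t0: "0 <= t" using st by simp
 obtain I v where iv: "!!j :: nat. step_int s (I j) (%r w. v j r w * indicator {s<..t} r)"
  "(%j. L2sq M (%w. I j w - ?D w)) ----> 0"
  by (rule ito_approx[OF st], rule that)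
 note [measurable] = J_meas[OF st(1)] J_meas[OF t0] bdd_meas_measM[OF g] step_int_measurable[OF iv(1)]
 obtain K where K: "!!w. w \<in> space M ==> cmod (g w) <= K" using g by (auto simp: bdd_meas_def)
 have K0: "0 <= K" by (rule norm_bound_nonneg[OF K])
 have D: "integrable M ?D" by (rule integrable_of_square[OF _ ito_sq(1)[OF st]]) measurable
 show i: "integrable M (%w. g w * ?D w)" by (rule bdd_meas_integrable_mult[OF g D])
 have "cmod (mean (%w. g w * ?D w)) <= e" if "e > 0" for e
 proof -
  define delta where "delta = e / (2 * (K + 1))"
  have delta: "delta > 0" "2 * K * delta <= e"
   using that K0 by (simp_all add: delta_def field_simps)
  have "ennreal (delta^2) > 0" using delta by simp
  then obtain j where j: "L2sq M (%w. I j w - ?D w) < ennreal (delta^2)"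
   using order_tendstoD(2)[OF iv(2), of "ennreal (delta^2)"] by (auto simp: eventually_sequentially)
  have sq: "integrable M (%w. (cmod (I j w - ?D w))^2)"
   by (rule integrableI_bounded) (use j in \<open>auto intro: less_trans\<close>)
  have "ennreal (mean (%w. (cmod (I j w - ?D w))^2)) < ennreal (delta^2)"
   using j nn_integral_eq_integral[OF sq] by simp
  hence sq2: "mean (%w. (cmod (I j w - ?D w))^2) <= delta^2"
   by (simp add: ennreal_less_iff integral_nonneg)
  have int: "integrable M (%w. I j w - ?D w)" by (rule integrable_of_square[OF _ sq]) measurable
  have gi: "integrable M (%w. g w * (I j w - ?D w))" by (rule bdd_meas_integrable_mult[OF g int])
  have "mean (%w. g w * I j w) - mean (%w. g w * ?D w) = mean (%w. g w * (I j w - ?D w))"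
   by (subst integral_diff[symmetric, OF step_int_mean(1)[OF iv(1) g] i]) (simp add: right_diff_distrib)
  hence "cmod (mean (%w. g w * ?D w)) = cmod (mean (%w. g w * (I j w - ?D w)))"
   unfolding step_int_mean(2)[OF iv(1) g] by (metis diff_0 norm_minus_cancel)
  also have "... <= mean (%w. cmod (g w * (I j w - ?D w)))"
   by (rule integral_norm_bound)
  also have "... <= mean (%w. K * (delta / 2 + (cmod (I j w - ?D w))^2 / (2 * delta)))"
  proof (rule integral_mono)
   show "integrable M (%w. cmod (g w * (I j w - ?D w)))" using gi by simp
   show "integrable M (%w. K * (delta / 2 + (cmod (I j w - ?D w))^2 / (2 * delta)))" using sq by simp
   fix w assume w: "w \<in> space M"
   have "x <= delta / 2 + x^2 / (2 * delta)" for x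
    using sum_squares_bound[of delta x] delta by (simp add: field_simps power2_eq_square)
   thus "cmod (g w * (I j w - ?D w)) <= K * (delta / 2 + (cmod (I j w - ?D w))^2 / (2 * delta))"
    unfolding norm_mult using K[OF w] by (intro mult_mono') auto
  qed
  also have "... = K * (delta / 2 + mean (%w. (cmod (I j w - ?D w))^2) / (2 * delta))"
   using sq by (simp add: prob_space)
  also have "... <= K * (delta / 2 + delta^2 / (2 * delta))"
   using sq2 K0 delta by (intro mult_left_mono add_left_mono divide_right_mono) auto
  also have "... = K * delta" using delta by (simp add: power2_eq_square)
  also have "... <= 2 * K * delta" using delta K0 by simp
  also have "... <= e" by (rule delta(2))
  finally show ?thesis .
 qed
 hence "cmod (mean (%w. g w * ?D w)) <= 0" by (rule field_le_epsilon[of _ 0, simplified])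
 thus "mean (%w. g w * ?D w) = 0" by simp
qed

end

section \<open>The Euler scheme\<close>

text \<open>A bounded substitute for the square \<open>e\<^sup>2\<close>; \<open>eta'\<close> is its derivative.\<close>

definition eta :: "real => real" where "eta e = e^2 / (1 + e^2)"

lemma eta_bounds: "0 <= eta e" "eta e <= 1"
proof -
 have "0 < 1 + e^2" using zero_le_power2[of e] by linarith
 thus "0 <= eta e" "eta e <= 1" by (simp_all add: eta_def divide_le_eq_1_pos)
qed

lemma eta_0 [simp]: "eta 0 = 0" by (simp add: eta_def)

lemma eta_measurable [measurable]: "eta \<in> borel_measurable borel"
 unfolding eta_def by measurable

definition eta' :: "real => real" where "eta' e = 2 * e / (1 + e^2)^2"

lemma eta'_measurable [measurable]: "eta' \<in> borel_measurable borel"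
 unfolding eta'_def by measurable

lemma eta'_bound: "\<bar>eta' e\<bar> <= 1"
proof -
 have p: "1 <= 1 + e^2" by simp
 have "2 * \<bar>e\<bar> <= 1 + e^2" using sum_squares_bound[of 1 "\<bar>e\<bar>"] by simp
 also have "... <= (1 + e^2)^2" using self_le_power[OF p, of 2] by simp
 finally show ?thesis by (simp add: eta'_def abs_mult divide_le_eq)
qed

text \<open>A second order Taylor inequality with constant \<open>1\<close> and without remainder.\<close>

lemma eta_step: "eta (e + d) <= eta e + eta' e * d + d^2"
proof -
 define a where "a = 1 + e^2"
 define b where "b = 1 + (e + d)^2"
 have a: "a \<ge> 1" and b: "b \<ge> 1" by (auto simp: a_def b_def)
 have ab: "b = a + 2 * e * d + d^2" by (simp add: a_def b_def power2_eq_square algebra_simps)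
 have e1: "eta e = 1 - 1 / a" "eta (e + d) = 1 - 1 / b"
 proof -
  have "x / (1 + x) = 1 - 1 / (1 + x)" if "0 <= x" for x :: real using that by (simp add: field_simps)
  thus "eta e = 1 - 1 / a" "eta (e + d) = 1 - 1 / b" by (simp_all add: eta_def a_def b_def)
 qed
 have "a - 4 * e^2 - 2 * e * d <= b"
 proof -
  have "b - (a - 4 * e^2 - 2 * e * d) = (2 * e + d)^2" unfolding ab by (simp add: power2_eq_square algebra_simps)
  thus ?thesis using zero_le_power2[of "2 * e + d"] by linarith
 qed
 also have "b <= a^2 * b" using mult_right_mono[of 1 "a^2" b] one_le_power[OF a, of 2] b by simp
 finally have k: "a - 4 * e^2 - 2 * e * d <= a^2 * b" .
 have "1 / a - 1 / b - 2 * e * d / a^2 = d^2 * (a - 4 * e^2 - 2 * e * d) / (a^2 * b)"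
 proof -
  have "1 / a - 1 / b - 2 * e * d / a^2 = (a * b - a^2 - 2 * e * d * b) / (a^2 * b)"
   using a b by (simp add: field_simps power2_eq_square)
  also have "a * b - a^2 - 2 * e * d * b = d^2 * (a - 4 * e^2 - 2 * e * d)"
   unfolding ab by (simp add: power2_eq_square algebra_simps)
  finally show ?thesis .
 qed
 also have "... <= d^2 * (a^2 * b) / (a^2 * b)"
  using k a b by (intro divide_right_mono mult_left_mono) auto
 also have "... = d^2" using a b by simp
 finally have "1 / a - 1 / b - 2 * e * d / a^2 <= d^2" .
 thus ?thesis unfolding e1 eta'_def a_def[symmetric] by (simp add: algebra_simps)
qed

lemma sq3: "(x + y + z)^2 <= 3 * x^2 + 3 * y^2 + 3 * (z::real)^2"
proof -
 have "3 * x^2 + 3 * y^2 + 3 * z^2 - (x + y + z)^2 = (x - y)^2 + (y - z)^2 + (x - z)^2"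
  by (simp add: power2_eq_square algebra_simps)
 thus ?thesis using zero_le_power2[of "x - y"] zero_le_power2[of "y - z"] zero_le_power2[of "x - z"] by linarith
qed

lemma discrete_gronwall:
 fixes q :: "nat => real"
 assumes "q 0 <= 0" "!!k. k < n ==> q (Suc k) <= (1 + a) * q k + b" "0 <= a" "0 <= b"
 shows "q n <= real n * b * exp (real n * a)"
proof -
 have "q k <= real k * b * (1 + a) ^ k" if "k <= n" for k
  using that
 proof (induction k)
  case 0 thus ?case using assms(1) by simp
 next
  case (Suc k)
  have "q (Suc k) <= (1 + a) * q k + b" using assms(2) Suc.prems by simp
  also have "... <= (1 + a) * (real k * b * (1 + a) ^ k) + b * (1 + a) ^ Suc k"
   using Suc assms(3,4) by (intro add_mono mult_left_mono) (auto simp: mult_le_cancel_left1 not_less intro!: one_le_power simp del: power_Suc)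
  also have "... = real (Suc k) * b * (1 + a) ^ Suc k" by (simp add: algebra_simps)
  finally show ?case .
 qed
 hence "q n <= real n * b * (1 + a) ^ n" by simp
 also have "... <= real n * b * exp (real n * a)"
  using assms(3,4) exp_ge_add_one_self[of a]
  by (intro mult_left_mono) (auto simp: exp_of_nat_mult intro!: power_mono)
 finally show ?thesis .
qed

definition (in prob_space) small_on :: "'a set => ('a => real) => real => bool" where
 "small_on A f b \<longleftrightarrow> integrable M (%w. indicator A w * f w) & mean (%w. indicator A w * f w) <= b"

lemma (in prob_space) eta_integrable:
 assumes "A \<in> events" "e \<in> borel_measurable M"
 shows "integrable M (%w. indicator A w * eta (e w))"
proof (rule integrable_const_bound[where B=1])
 show "AE w in M. norm (indicat_real A w * eta (e w)) <= 1"
  using eta_bounds by (intro AE_I2) (simp add: indicator_def)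
qed (use assms in measurable)

text \<open>One step of the error has four parts: its previous value, the difference \<open>D\<close> of the noise terms, a remainder \<open>S\<close> that
 is small in mean square and, like \<open>D\<close>, almost centred, and a bounded remainder \<open>r\<close> that is small in mean. Inserted into \<open>eta_step\<close>,
 the linear terms in \<open>D\<close> and \<open>S\<close> are controlled by centring and the others by their size. The events \<open>A k\<close> decrease,
 so that they localize without a stopping time.\<close>

lemma (in prob_space) error_recursion:
 fixes e D S r :: "nat => 'a => real" and A :: "nat => 'a set"
 defines "q \<equiv> %k. mean (%w. indicator (A k) w * eta (e k w))"
 assumes A: "!!k. k <= n ==> A k \<in> events" "!!k. k < n ==> A (Suc k) \<subseteq> A k"
  and e: "!!k. e k \<in> borel_measurable M" "AE w in M. e 0 w = 0"
  and step: "!!k. k < n ==> AE w in M. w \<in> A (Suc k) -->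
   e (Suc k) w = e k w + (D k w + S k w + r k w) & \<bar>r k w\<bar> <= 1"
  and small: "!!k. k < n ==> small_on (A k) (%w. (D k w)^2) (c * q k) & small_on (A k) (%w. (S k w)^2) d &
   small_on (A k) (%w. eta' (e k w) * (D k w + S k w)) d & small_on (A (Suc k)) (%w. \<bar>r k w\<bar>) d"
  and cd: "0 <= c" "0 <= d"
 shows "q n <= real n * (8 * d) * exp (real n * (3 * c))"
proof (rule discrete_gronwall[of q])
 have "q 0 = mean (%_. 0)"
  unfolding q_def using e A(1)[of 0] by (intro integral_cong_AE) auto
 thus "q 0 <= 0" by simp
next
 fix k assume k: "k < n"
 let ?I = "indicat_real (A k)" and ?I' = "indicat_real (A (Suc k))" and ?eta = "%w. eta' (e k w) * (D k w + S k w)"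
 let ?B = "%w. ?I w * eta (e k w) + ?I w * ?eta w + 4 * (?I' w * \<bar>r k w\<bar>) + 3 * (?I w * (D k w)^2) + 3 * (?I w * (S k w)^2)"
 note small = small[OF k, unfolded small_on_def]
 have qi: "integrable M (%w. indicator (A k) w * eta (e k w))" if "k <= n" for k
  by (rule eta_integrable[OF A(1)[OF that] e(1)])
 have "q (Suc k) <= mean ?B"
  unfolding q_def
 proof (rule integral_mono_AE)
  show "integrable M (%w. ?I' w * eta (e (Suc k) w))" "integrable M ?B" using qi small k by auto
  show "AE w in M. ?I' w * eta (e (Suc k) w) <= ?B w"
   using step[OF k]
  proof eventually_elim
   case (elim w)
   show ?case
   proof (cases "w \<in> A (Suc k)")
    case True
    hence st: "e (Suc k) w = e k w + (D k w + S k w + r k w)" "\<bar>r k w\<bar> <= 1" and k1: "w \<in> A k" using elim A(2)[OF k] by auto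
    have "(r k w)^2 <= \<bar>r k w\<bar>" using mult_right_mono[OF st(2), of "\<bar>r k w\<bar>"] by (simp add: power2_eq_square)
    moreover have "eta' (e k w) * r k w <= \<bar>r k w\<bar>"
     using mult_right_mono[OF eta'_bound, of "\<bar>r k w\<bar>" "e k w"] abs_ge_self[of "eta' (e k w) * r k w"] by (simp add: abs_mult)
    ultimately show ?thesis using True k1 eta_step[of "e k w" "D k w + S k w + r k w"] sq3[of "D k w" "S k w" "r k w"]
     unfolding st(1) by (simp add: distrib_left)
   next
    case False
    have "0 <= eta (e k w) + ?eta w + (3 * (D k w)^2 + 3 * (S k w)^2)"
     using eta_bounds(1)[of "e k w + (D k w + S k w)"] eta_step[of "e k w" "D k w + S k w"] sq3[of "D k w" "S k w" 0] by simp
    thus ?thesis using False by (simp add: indicator_def)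
   qed
  qed
 qed
 also have "... = q k + mean (%w. ?I w * ?eta w) + 4 * mean (%w. ?I' w * \<bar>r k w\<bar>)
  + 3 * mean (%w. ?I w * (D k w)^2) + 3 * mean (%w. ?I w * (S k w)^2)"
  unfolding q_def using qi small k
  by (simp only: integral_add integrable_add integrable_mult_right integral_mult_right_zero less_imp_le)
 also have "... <= (1 + 3 * c) * q k + 8 * d" using small by (simp add: algebra_simps)
 finally show "q (Suc k) <= (1 + 3 * c) * q k + 8 * d" .
qed (use cd in auto)

text \<open>The Euler scheme for \<open>dx = d dt + Re (\<sigma> x dz)\<close>, as a function of the increments \<open>z\<close> of the noise.\<close>

primrec euler :: "(real => complex) => real => (nat => complex) => nat => real" where
 "euler \<sigma> d z 0 = 0"
| "euler \<sigma> d z (Suc k) = euler \<sigma> d z k + d + Re (\<sigma> (euler \<sigma> d z k) * z k)"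

context noise
begin

definition noise_seq :: "real => (nat => 'w => complex) => nat => 'w => complex \<times> real" where
 "noise_seq h rho k w = (rho k w * dX (real k * h) (real (Suc k) * h) w, Xi (real (Suc k) * h) w - Xi (real k * h) w)"

definition phase :: "real => (nat => 'w => complex) => bool" where
 "phase h rho \<longleftrightarrow> (ALL k. rho k \<in> borel_measurable (F (real k * h)) & (\<forall>w\<in>space M. cmod (rho k w) = 1))"

lemma noise_seq_adapted:
 assumes "h > 0" "phase h rho"
 shows "noise_seq h rho k \<in> measurable (F (real (Suc k) * h)) (borel \<Otimes>\<^sub>M borel)"
proof -
 have le: "real k * h <= real (Suc k) * h" "0 <= real k * h" "0 <= real (Suc k) * h" using assms(1) by auto
 have "rho k \<in> borel_measurable (F (real k * h))" using assms(2) by (simp add: phase_def)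
 note [measurable] = measurable_F_mono[OF this le(1)] measurable_F_mono[OF X_adapted[OF le(2)] le(1)] X_adapted[OF le(3)]
  measurable_F_mono[OF Xi_adapted[OF le(2)] le(1)] Xi_adapted[OF le(3)]
 show ?thesis unfolding noise_seq_def by measurable
qed

text \<open>Step by step by \<open>rotated_increment\<close>: the factor \<open>rho k\<close> and all earlier terms belong to the past of the next increment.\<close>

lemma noise_seq_law:
 assumes h: "h > 0" and rho: "phase h rho"
 shows "distr M (\<Pi>\<^sub>M k\<in>{..<n}. borel \<Otimes>\<^sub>M borel) (%w. \<lambda>k\<in>{..<n}. noise_seq h rho k w) = (\<Pi>\<^sub>M k\<in>{..<n}. cgauss h \<Otimes>\<^sub>M m h)"
proof -
 let ?f = "%w. \<lambda>k\<in>{..<n}. noise_seq h rho k w"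
 let ?B = "\<Pi>\<^sub>M k\<in>{..<n}. borel \<Otimes>\<^sub>M borel"
 let ?m = "cgauss h \<Otimes>\<^sub>M m h"
 interpret C: prob_space "cgauss h" by (rule prob_space_cgauss[OF h])
 interpret m: prob_space "m h" by (rule prob_m[OF h])
 interpret CM: pair_prob_space "cgauss h" "m h" ..
 interpret P: product_sigma_finite "%_::nat. ?m" ..
 have sets: "sets ?m = sets (borel \<Otimes>\<^sub>M borel)" by (simp cong: sets_pair_measure_cong)
 note ad = noise_seq_adapted[OF h rho]
 show ?thesis
 proof (rule P.PiM_eqI)
  show "finite {..<n}" by simp
  show "sets (distr M ?B ?f) = sets (\<Pi>\<^sub>M k\<in>{..<n}. ?m)"
   using sets by (simp cong: sets_PiM_cong)
  fix A assume A: "!!i. i \<in> {..<n} ==> A i \<in> sets ?m"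
  let ?E = "%j. {w\<in>space M. \<forall>k<j. noise_seq h rho k w \<in> A k}"
  have E: "?E j \<in> sets (F (real j * h)) & emeasure M (?E j) = (\<Prod>k<j. emeasure ?m (A k))" if "j <= n" for j
   using that
  proof (induction j)
   case 0
   have "?E 0 = space (F 0)" by simp
   thus ?case using sets.top[of "F 0"] by (simp add: emeasure_space_1)
  next
   case (Suc j)
   note IH = conjunct1[OF Suc.IH[OF Suc_leD[OF Suc.prems]]] conjunct2[OF Suc.IH[OF Suc_leD[OF Suc.prems]]]
   have Aj: "A j \<in> sets (borel \<Otimes>\<^sub>M borel)" using A[of j] Suc.prems sets by simp
   have le: "real j * h <= real (Suc j) * h" using h by simp
   have *: "?E (Suc j) = ?E j Int {w\<in>space M. noise_seq h rho j w \<in> A j}" by (auto simp: less_Suc_eq)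
   have m1: "?E j \<in> sets (F (real (Suc j) * h))" by (rule subsetD[OF F_mono[OF le] IH(1)])
   have "noise_seq h rho j -` A j Int space (F (real (Suc j) * h)) \<in> sets (F (real (Suc j) * h))"
    by (rule measurable_sets[OF ad Aj])
   moreover have "{w\<in>space M. noise_seq h rho j w \<in> A j} = noise_seq h rho j -` A j Int space (F (real (Suc j) * h))" by auto
   ultimately have m2: "{w\<in>space M. noise_seq h rho j w \<in> A j} \<in> sets (F (real (Suc j) * h))" by simp
   have d: "real (Suc j) * h - real j * h = h" by (simp add: algebra_simps)
   have "emeasure M (?E (Suc j)) = emeasure M (?E j) * emeasure ?m (A j)"
   proof -
    have r: "rho j \<in> borel_measurable (F (real j * h))" "!!w. w \<in> space M ==> cmod (rho j w) = 1"
     using rho by (simp_all add: phase_def)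
    have lt: "0 <= real j * h" "real j * h < real (Suc j) * h" using h by simp_all
    show ?thesis unfolding * using rotated_increment[OF lt IH(1) r Aj] unfolding d noise_seq_def[symmetric] .
   qed
   hence "emeasure M (?E (Suc j)) = (\<Prod>k<Suc j. emeasure ?m (A k))"
    unfolding IH(2) by (simp only: prod.lessThan_Suc)
   moreover have "?E (Suc j) \<in> sets (F (real (Suc j) * h))" unfolding * by (rule sets.Int[OF m1 m2])
   ultimately show ?case by blast
  qed
  have meas: "?f \<in> measurable M ?B"
   by (rule measurable_restrict) (rule measurable_F_M[OF ad])
  have "emeasure (distr M ?B ?f) (Pi\<^sub>E {..<n} A)
   = emeasure M (?f -` Pi\<^sub>E {..<n} A Int space M)"
   using A sets by (intro emeasure_distr[OF meas] sets_PiM_I_finite) auto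
  also have "?f -` Pi\<^sub>E {..<n} A Int space M = ?E n"
  proof (rule set_eqI)
   fix w
   have r: "restrict f {..<n} \<in> Pi\<^sub>E {..<n} A \<longleftrightarrow> (\<forall>k<n. f k \<in> A k)" for f
    unfolding PiE_iff by (simp add: Ball_def)
   show "(w \<in> ?f -` Pi\<^sub>E {..<n} A Int space M) = (w \<in> ?E n)"
    unfolding vimage_def Int_iff mem_Collect_eq r by (rule conj_commute)
  qed
  also have "emeasure M (?E n) = (\<Prod>k<n. emeasure ?m (A k))" by (rule conjunct2[OF E[OF order.refl]])
  finally show "emeasure (distr M ?B ?f) (Pi\<^sub>E {..<n} A)
   = (\<Prod>i\<in>{..<n}. emeasure ?m (A i))" .
 qed
qed

end

context noise
begin

text \<open>One step of the equation \<open>dY = l dt + Re (\<sigma> Y rho dX)\<close> up to errors of order \<open>eps * h\<close>: a remainder \<open>S\<close> that is almost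
 orthogonal to the past and a remainder \<open>r\<close> without cancellation. The former is controlled on an event \<open>A\<close> of the past,
 the latter on an event \<open>A'\<close> that may look at the whole step.\<close>

definition local_step :: "real => (real => complex) => (real => 'w => complex) => (real => 'w => real) => real => real
 => real => 'w set => 'w set => ('w => real) => ('w => real) => bool" where
 "local_step l \<sigma> rho Y eps h t A A' S r \<longleftrightarrow> S \<in> borel_measurable M &
  (AE w in M. w \<in> A' --> Y (t + h) w = Y t w + l * h + Re (\<sigma> (Y t w) * (rho t w * dX t (t + h) w)) + S w + r w & \<bar>r w\<bar> <= 1) &
  small_on A (%w. (S w)^2) (eps * h) & small_on A' (%w. \<bar>r w\<bar>) (eps * h) &
  (ALL g. g \<in> borel_measurable (F t) & (\<forall>w\<in>space M. \<bar>g w\<bar> <= 1) --> mean (%w. indicator A w * g w * S w) <= eps * h)"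

definition local_expansion :: "real => real => (real => complex) => (real => 'w => complex) => (real => 'w => real) => real => real
 => (real => 'w set) => (real => 'w => real) => (real => 'w => real) => bool" where
 "local_expansion T l \<sigma> rho Y eps h A S r \<longleftrightarrow>
  (ALL t. 0 <= t & t <= T --> A t \<in> sets (F t)) & (ALL s t. 0 <= s & s <= t & t <= T --> A t \<subseteq> A s) & prob (A T) \<ge> 1 - eps &
  (ALL t. 0 <= t & t + h <= T --> local_step l \<sigma> rho Y eps h t (A t) (A (t + h)) (S t) (r t))"

lemma increment_square:
 assumes s: "0 <= s" "s <= t" and G: "bdd_meas s G" and A: "A \<in> sets (F s)"
 shows "small_on A (%w. (Re (G w * dX s t w))^2) ((t - s) * mean (%w. indicator A w * (cmod (G w))^2))"
proof -
 let ?h = "%w. indicat_real A w * (cmod (G w))^2"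
 have "bdd_meas s (%w. Cx (indicator A w))"
  unfolding bdd_meas_def using A by (auto simp: indicator_def intro!: exI[of _ 1])
 hence "bdd_meas s (%w. Cx (indicator A w) * (G w * cnj (G w)))"
  by (intro bdd_meas_mult bdd_meas_cnj G)
 hence g: "bdd_meas s (%w. Cx (?h w))" unfolding of_real_mult complex_norm_square .
 note inc = increment_moments(7,8)[OF s bdd_meas_measD[OF g] bdd_meas_integrable[OF g], unfolded of_real_mult[symmetric]
   complex_of_real_integrable_eq integral_complex_of_real of_real_eq_iff]
 have le: "indicator A w * (Re (G w * dX s t w))^2 <= ?h w * (cmod (dX s t w))^2" for w
  using abs_Re_le_cmod[of "G w * dX s t w"] 
  by (auto simp: indicator_def norm_mult simp flip: power_mult_distrib abs_le_square_iff)
 have [measurable]: "G \<in> borel_measurable M" "A \<in> events" "X s \<in> borel_measurable M" "X t \<in> borel_measurable M"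
  using bdd_meas_measM[OF G] sets_FM[OF A] s by (auto intro!: X_meas)
 have i: "integrable M (%w. indicator A w * (Re (G w * dX s t w))^2)"
  by (rule integrable_bound[OF inc(1)]) (measurable, intro AE_I2, use le in \<open>simp add: abs_mult\<close>)
 show ?thesis unfolding small_on_def using i integral_mono[OF i inc(1) le] inc(2) by (simp add: mult.commute)
qed

lemma increment_centred:
 assumes s: "0 <= s" "s <= t" and G: "bdd_meas s G"
 shows "integrable M (%w. Re (G w * dX s t w))" "mean (%w. Re (G w * dX s t w)) = 0"
proof -
 note inc = increment_moments(1,2)[OF s bdd_meas_measD[OF G] bdd_meas_integrable[OF G]]
 show "integrable M (%w. Re (G w * dX s t w))" "mean (%w. Re (G w * dX s t w)) = 0"
  using integrable_Re[OF inc(1)] integral_Re[OF inc(1)] inc(2) by simp_all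
qed

definition drive :: "(real => 'w => complex) => real => nat => 'w => complex" where
 "drive rho h k w = rho (real k * h) w * dX (real k * h) (real (Suc k) * h) w"

lemma drive_adapted:
 assumes h: "h > 0" and rho: "!!t. 0 <= t ==> rho t \<in> borel_measurable (F t)"
 shows "drive rho h k \<in> borel_measurable (F (real (Suc k) * h))"
proof -
 have le: "real k * h <= real (Suc k) * h" "0 <= real k * h" "0 <= real (Suc k) * h" using h by auto
 note [measurable] = measurable_F_mono[OF rho[OF le(2)] le(1)] measurable_F_mono[OF X_adapted[OF le(2)] le(1)] X_adapted[OF le(3)]
 show ?thesis unfolding drive_def by measurable
qed

lemma euler_adapted:
 assumes h: "h > 0" and rho: "!!t. 0 <= t ==> rho t \<in> borel_measurable (F t)" and [measurable]: "\<sigma> \<in> borel_measurable borel"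
 shows "(%w. euler \<sigma> d (%k. drive rho h k w) k) \<in> borel_measurable (F (real k * h))"
proof (induction k)
 case (Suc k)
 have le: "real k * h <= real (Suc k) * h" using h by auto
 note [measurable] = measurable_F_mono[OF Suc.IH le] drive_adapted[OF h rho, of k]
 show ?case unfolding euler.simps by measurable
qed simp

text \<open>\<open>error_recursion\<close> for the difference of \<open>Y\<close> and its Euler scheme: both use the same noise, so the noise terms differ by
 \<open>\<sigma> Y - \<sigma> x\<close>, which \<open>eta\<close> of the error bounds.\<close>

lemma scheme_error:
 assumes h: "h > 0" "real n * h = T"
  and rho: "!!t. 0 <= t ==> rho t \<in> borel_measurable (F t)" "!!t w. 0 <= t ==> w \<in> space M ==> cmod (rho t w) = 1"
  and \<sigma>: "\<sigma> \<in> borel_measurable borel" "!!x y. (cmod (\<sigma> x - \<sigma> y))^2 <= L * eta (x - y)" "0 <= L"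
  and Y: "!!t. 0 <= t ==> Y t \<in> borel_measurable (F t)" "AE w in M. Y 0 w = 0"
  and eps: "0 <= eps" and loc: "local_expansion T l \<sigma> rho Y eps h A S r"
 shows "mean (%w. eta (Y T w - euler \<sigma> (l * h) (%k. drive rho h k w) n)) <= eps * (8 * T * exp (3 * L * T) + 1)"
proof -
 define t where "t k = real k * h" for k
 have t0: "0 <= t k" for k using h by (simp add: t_def)
 have tS: "t (Suc k) = t k + h" for k by (simp add: t_def algebra_simps)
 have tk: "t k <= t (Suc k)" for k using h by (simp add: tS)
 have tT: "t n = T" using h by (simp add: t_def)
 have tn: "t k <= T" if "k <= n" for k
  using that h(1) unfolding tT[symmetric] t_def by (intro mult_right_mono) auto
 let ?x = "%k w. euler \<sigma> (l * h) (%k. drive rho h k w) k"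
 define e where "e k w = Y (t k) w - ?x k w" for k w
 \<comment> \<open>the diffusion coefficients differ by a bounded adapted factor\<close>
 define G where "G k w = (\<sigma> (Y (t k) w) - \<sigma> (?x k w)) * rho (t k) w" for k w
 let ?D = "%k w. Re (G k w * dX (t k) (t (Suc k)) w)"
 note [measurable] = Y(1)[OF t0] \<sigma>(1) rho(1)[OF t0]
  euler_adapted[where rho=rho and \<sigma>=\<sigma> and d="l * h", OF h(1) rho(1) \<sigma>(1), folded t_def]
 have eF[measurable]: "e k \<in> borel_measurable (F (t k))" for k unfolding e_def by measurable
 note eM = measurable_F_M[OF eF]
 have AF: "A (t k) \<in> sets (F (t k))" if "k <= n" for k
  using loc t0[of k] tn[OF that] unfolding local_expansion_def by blast
 note AM = sets_FM[OF AF]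
 have Gn: "(cmod (G k w))^2 <= L * eta (e k w)" if "w \<in> space M" for k w
  using \<sigma>(2)[of "Y (t k) w" "?x k w"] rho(2)[OF t0 that, of k] by (simp add: G_def e_def norm_mult)
 have Gb: "bdd_meas (t k) (G k)" for k
 proof -
  have "cmod (G k w) <= 1 + L" if "w \<in> space M" for w
  proof (rule power2_le_imp_le)
   have "L * eta (e k w) <= L * 1" by (intro mult_left_mono eta_bounds \<sigma>(3))
   also have "L * 1 <= (1 + L)^2" using \<sigma>(3) by (simp add: power2_eq_square algebra_simps)
   finally show "(cmod (G k w))^2 <= (1 + L)^2" using Gn[OF that, of k] by simp
  qed (use \<sigma>(3) in simp)
  moreover have "G k \<in> borel_measurable (F (t k))" unfolding G_def by measurable
  ultimately show ?thesis unfolding bdd_meas_def by blast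
 qed
 let ?q = "%k. mean (%w. indicator (A (t k)) w * eta (e k w))"
 have main: "?q n <= real n * (8 * (eps * h)) * exp (real n * (3 * (L * h)))"
 proof (rule error_recursion[where A="%k. A (t k)" and D="?D" and S="%k. S (t k)" and r="%k. r (t k)"])
  show "AE w in M. e 0 w = 0" using Y(2) by (simp add: e_def t_def)
  show "e k \<in> borel_measurable M" for k by (rule eM)
 next
  fix k assume k: "k < n"
  have tkn: "t k + h <= T" using tn[of "Suc k"] k tS by simp
  show "A (t (Suc k)) \<subseteq> A (t k)"
   using loc t0[of k] tkn tk[of k] unfolding local_expansion_def tS by blast
  have "local_step l \<sigma> rho Y eps h (t k) (A (t k)) (A (t (Suc k))) (S (t k)) (r (t k))"
   using loc t0[of k] tkn unfolding local_expansion_def tS by blast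
  note L = this[unfolded local_step_def tS[symmetric]]
  have "AE w in M. w \<in> A (t (Suc k)) --> Y (t (Suc k)) w = Y (t k) w + l * h + Re (\<sigma> (Y (t k) w) * (rho (t k) w * dX (t k) (t (Suc k)) w)) + S (t k) w + r (t k) w & \<bar>r (t k) w\<bar> <= 1"
   using L by blast
  thus "AE w in M. w \<in> A (t (Suc k)) --> e (Suc k) w = e k w + (?D k w + S (t k) w + r (t k) w) & \<bar>r (t k) w\<bar> <= 1"
  proof eventually_elim
   case (elim w)
   have "drive rho h k w = rho (t k) w * dX (t k) (t (Suc k)) w" by (simp only: drive_def t_def)
   thus ?case using elim unfolding e_def euler.simps(2) G_def left_diff_distrib minus_complex.simps mult.assoc by auto
  qed
  let ?I = "indicat_real (A (t k))" and ?S = "S (t k)"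
  have A: "A (t k) \<in> sets (F (t k))" using AF k by simp
  note [measurable] = A sets_FM[OF A] bdd_meas_measM[OF Gb[of k]] eM[of k]
  have D: "small_on (A (t k)) (%w. (?D k w)^2) (L * h * ?q k)"
  proof -
   have "mean (%w. ?I w * (cmod (G k w))^2) <= mean (%w. L * (?I w * eta (e k w)))"
   proof (rule integral_mono)
    show i: "integrable M (%w. L * (?I w * eta (e k w)))" by (intro integrable_mult_right eta_integrable) measurable
    show le: "?I w * (cmod (G k w))^2 <= L * (?I w * eta (e k w))" if "w \<in> space M" for w
     using Gn[OF that, of k] by (simp add: indicator_def)
    show "integrable M (%w. ?I w * (cmod (G k w))^2)"
     by (rule integrable_bound[OF i]) (measurable, intro AE_I2, use le eta_bounds \<sigma>(3) in \<open>auto simp: abs_mult\<close>)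
   qed
   hence "h * mean (%w. ?I w * (cmod (G k w))^2) <= h * (L * ?q k)" using h by (intro mult_left_mono) auto
   thus ?thesis using increment_square[OF t0 tk Gb A] by (simp add: small_on_def tS mult_ac)
  qed
  have DS: "small_on (A (t k)) (%w. eta' (e k w) * (?D k w + ?S w)) (eps * h)"
  proof -
   let ?g = "%w. ?I w * eta' (e k w)"
   have etaF: "(%w. eta' (e k w)) \<in> borel_measurable (F (t k))" by measurable
   have "cmod (Cx (?g w)) <= 1" for w using eta'_bound[of "e k w"] unfolding norm_of_real by (simp add: indicator_def)
   hence "bdd_meas (t k) (%w. Cx (?g w))" unfolding bdd_meas_def by auto
   note inc = increment_centred[OF t0 tk bdd_meas_mult[OF this Gb[of k]]]
   have re: "Re (Cx (?g w) * G k w * dX (t k) (t (Suc k)) w) = ?g w * ?D k w" for w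
    unfolding mult.assoc by simp
   note inc = inc[unfolded re]
   have SM: "?S \<in> borel_measurable M" "integrable M (%w. ?I w * (?S w)^2)" using L by (auto simp: small_on_def)
   have "integrable M (%w. ?I w * ?S w)"
   proof (rule integrable_of_square)
    have "(norm (?I w * ?S w))^2 = ?I w * (?S w)^2" for w by (simp add: indicator_def)
    thus "integrable M (%w. (norm (?I w * ?S w))^2)" using SM(2) by (simp only:)
   qed (use SM(1) in measurable)
   hence "integrable M (%w. eta' (e k w) * (?I w * ?S w))"
    by (rule integrable_bounded_mult[of _ _ 1]) (use eM[of k] eta'_bound in auto)
   moreover have "mean (%w. ?g w * ?S w) <= eps * h" using L etaF eta'_bound by blast
   ultimately show ?thesis unfolding small_on_def using inc by (simp add: distrib_left mult_ac)
  qed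
  show "small_on (A (t k)) (%w. (?D k w)^2) (L * h * ?q k) & small_on (A (t k)) (%w. (?S w)^2) (eps * h) &
   small_on (A (t k)) (%w. eta' (e k w) * (?D k w + ?S w)) (eps * h) & small_on (A (t (Suc k))) (%w. \<bar>r (t k) w\<bar>) (eps * h)"
   using D DS L by blast
 qed (use AM \<sigma>(3) h eps in auto)
 have [measurable]: "A T \<in> events" "e n \<in> borel_measurable M" using AM[of n] tT eM by auto
 have i: "integrable M (%w. indicator (A T) w * eta (e n w))" "integrable M (%w. eta (e n w))" "integrable M (indicat_real (space M - A T))"
  using integrable_const_bound[of "indicat_real (space M - A T)" 1] eta_integrable[of "A T" "e n"] eta_integrable[of "space M" "e n"] by (simp_all cong: integrable_cong)
 have "mean (%w. eta (e n w)) <= mean (%w. indicator (A T) w * eta (e n w) + indicator (space M - A T) w)"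
  by (intro integral_mono integrable_add i) (use eta_bounds in \<open>auto simp: indicator_def\<close>)
 also have "... = ?q n + prob (space M - A T)" using i tT by simp
 also have "prob (space M - A T) <= eps"
  using loc prob_compl[of "A T"] unfolding local_expansion_def by simp
 also note main
 also have "real n * (8 * (eps * h)) * exp (real n * (3 * (L * h))) + eps = eps * (8 * T * exp (3 * L * T) + 1)"
  unfolding h(2)[symmetric] by (simp add: algebra_simps)
 finally show ?thesis unfolding e_def tT by simp
qed

end

section \<open>The angle of a boundary point seen from a point of the disk\<close>

abbreviation moebius :: "complex => complex => complex" where
 "moebius v z \<equiv> (z - v) / (1 - cnj v * z  )"

text \<open>The argument of the image of \<open>cis g\<close> under the Moebius map that takes \<open>v\<close> to \<open>0\<close> (see \<open>cis_angle\<close>). As \<open>1 - v * cis (- g)\<close> has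
 positive real part, the principal branch gives a version that is continuous in both arguments.\<close>

definition angle :: "complex => real => real" where
 "angle v g = g + 2 * Im (Ln (1 - v * cis (- g)))"

text \<open>The Poisson kernel of the disk: the density of harmonic measure seen from \<open>v\<close>.\<close>

definition poisson :: "complex => real => real" where
 "poisson v g = (1 - (cmod v)^2) / (cmod (cis g - v))^2"

lemma Re_one_minus_pos: "cmod x < 1 ==> 0 < Re (1 - x)"
 using abs_Re_le_cmod[of x] by simp

lemma one_minus_nz: "cmod x < 1 ==> 1 - x ~= 0"
 by auto

lemma cis_angle:
 assumes v: "cmod v < 1"
 shows "cis (angle v g) = (cis g - v) / (1 - cnj v * cis g)"
proof -
 let ?w = "1 - v * cis (- g)"
 have w: "?w ~= 0" using v by (intro one_minus_nz) (simp add: norm_mult)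
 have "cis (2 * Im (Ln ?w)) = exp (Ln ?w - cnj (Ln ?w))"
  by (simp add: cis_conv_exp complex_diff_cnj mult.commute)
 also have "... = ?w / cnj ?w"
  using exp_Ln[OF w] by (metis exp_diff exp_cnj)
 also have "cnj ?w = 1 - cnj v * cis g" by (simp add: cis_cnj)
 finally have "cis (angle v g) = cis g * (?w / (1 - cnj v * cis g))"
  by (simp add: angle_def flip: cis_mult)
 also have "cis g * (?w / (1 - cnj v * cis g)) = (cis g * ?w) / (1 - cnj v * cis g)" by simp
 also have "cis g * ?w = cis g - v" by (simp add: right_diff_distrib cis_mult mult.left_commute)
 finally show ?thesis .
qed

text \<open>This combination is the coefficient of the noise in the equation of the angle.\<close>

lemma cis_minus_angle:
 assumes v: "cmod v < 1"
 shows "cis (- angle v g) + cnj v = cis (- g) * Cx (1 - (cmod v)\<^sup>2) / (1 - v * cis (- g))"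
proof -
 have w: "1 - v * cis (- g) ~= 0" using v by (intro one_minus_nz) (simp add: norm_mult)
 have "cis (- angle v g) = cnj (cis (angle v g))" by (simp add: cis_cnj)
 also have "... = (cis (- g) - cnj v) / (1 - v * cis (- g))"
  unfolding cis_angle[OF v] by (simp add: cis_cnj)
 finally have "cis (- angle v g) + cnj v = (cis (- g) - cnj v + cnj v * (1 - v * cis (- g))) / (1 - v * cis (- g))"
  using w by (simp add: add_divide_distrib)
 also have "cis (- g) - cnj v + cnj v * (1 - v * cis (- g)) = cis (- g) * (1 - v * cnj v)"
  by (simp add: algebra_simps)
 also have "1 - v * cnj v = Cx (1 - (cmod v)^2)"
  unfolding of_real_diff of_real_1 complex_norm_square ..
 finally show ?thesis .
qed

lemma poisson_pos: "cmod v < 1 ==> 0 < poisson v g"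
proof -
 assume v: "cmod v < 1"
 have "cis g - v ~= 0" using v by (metis eq_iff_diff_eq_0 less_irrefl norm_cis)
 moreover have "(cmod v)^2 < 1" using v by (simp add: power_less_one_iff abs_square_less_1)
 ultimately show ?thesis by (simp add: poisson_def)
qed

lemma Re_cayley:
 assumes "x ~= 1" shows "1 + 2 * Re (x / (1 - x)) = (1 - (cmod x)^2) / (cmod (1 - x))^2"
proof -
 have nz: "(cmod (1 - x))^2 ~= 0" using assms by simp
 have "x / (1 - x) = x * cnj (1 - x) / Cx ((cmod (1 - x))^2)"
  using complex_div_cnj[of x "1 - x"] by simp
 hence "Re (x / (1 - x)) = Re (x * cnj (1 - x)) / (cmod (1 - x))^2"
  by (simp only: Re_divide_of_real)
 moreover have "(cmod (1 - x))^2 + 2 * Re (x * cnj (1 - x)) = 1 - (cmod x)^2"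
  unfolding cmod_power2 by (simp add: power2_eq_square algebra_simps)
 ultimately show ?thesis using nz by (simp add: field_simps)
qed

lemma cmod_cis_diff: "cmod (cis g - v) = cmod (1 - v * cis (- g))"
proof -
 have "cis g - v = cis g * (1 - v * cis (- g))"
  by (simp add: right_diff_distrib cis_mult mult.left_commute)
 thus ?thesis by (simp only: norm_mult norm_cis mult_1)
qed

lemma angle_deriv:
 assumes v: "cmod v < 1"
 shows "(angle v has_real_derivative poisson v g) (at g within S)"
proof -
 let ?c = "cis (- g)"
 have n: "cmod (v * ?c) < 1" using v by (simp add: norm_mult)
 have nR: "1 - v * ?c \<notin> \<real>\<^sub>\<le>\<^sub>0" using Re_one_minus_pos[OF n] by (auto simp: complex_nonpos_Reals_iff)
 have cis_exp: "cis (- x) = exp (- \<i> * Cx x)" for x by (simp add: cis_conv_exp)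
 have "((%z. Ln (1 - v * exp (- \<i> * z))) has_field_derivative (\<i> * (v * ?c)) / (1 - v * ?c)) (at (Cx g))"
 proof -
  have "((%z. 1 - v * exp (- \<i> * z)) has_field_derivative \<i> * (v * ?c)) (at (Cx g))"
   unfolding cis_exp by (auto intro!: derivative_eq_intros)
  moreover have "(Ln has_field_derivative inverse (1 - v * ?c)) (at (1 - v * exp (- \<i> * Cx g)))"
   using has_field_derivative_Ln[OF nR] unfolding cis_exp .
  ultimately show ?thesis using DERIV_chain2 by (fastforce simp: divide_inverse mult.commute)
 qed
 hence "((%x. Ln (1 - v * exp (- \<i> * Cx x))) has_vector_derivative (\<i> * (v * ?c)) / (1 - v * ?c)) (at g within S)"
  by (rule has_vector_derivative_real_field)
 hence "((%x. Im (Ln (1 - v * cis (- x)))) has_vector_derivative Im ((\<i> * (v * ?c)) / (1 - v * ?c))) (at g within S)"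
  unfolding cis_exp by (rule bounded_linear.has_vector_derivative[OF bounded_linear_Im])
 hence d: "((%x. Im (Ln (1 - v * cis (- x)))) has_real_derivative Re (v * ?c / (1 - v * ?c))) (at g within S)"
  unfolding has_real_derivative_iff_has_vector_derivative[symmetric] by (simp add: Im_i_times flip: times_divide_eq_right)
 have "(angle v has_real_derivative 1 + 2 * Re (v * ?c / (1 - v * ?c))) (at g within S)"
  unfolding angle_def by (intro DERIV_add DERIV_ident DERIV_cmult d)
 also have "1 + 2 * Re (v * ?c / (1 - v * ?c)) = poisson v g"
 proof -
  have "v * ?c ~= 1" using n by (metis less_irrefl norm_one)
  from Re_cayley[OF this] show ?thesis by (simp add: poisson_def cmod_cis_diff norm_mult)
 qed
 finally show ?thesis .
qed

lemma angle_strict_mono: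
 assumes "cmod v < 1" shows "strict_mono (angle v)"
proof (rule strict_monoI)
 fix x y :: real assume "x < y"
 thus "angle v x < angle v y"
  using angle_deriv[OF assms] poisson_pos[OF assms]
  by (intro DERIV_pos_imp_increasing[of x y "angle v"]) blast+
qed

lemma angle_continuous: "cmod v < 1 ==> continuous_on S (angle v)"
 by (meson DERIV_isCont angle_deriv continuous_at_imp_continuous_on)

lemma angle_near:
 assumes "cmod v < 1" shows "\<bar>angle v g - g\<bar> <= 2 * pi"
proof -
 have "1 - v * cis (- g) ~= 0" using assms by (intro one_minus_nz) (simp add: norm_mult)
 hence "\<bar>Im (Ln (1 - v * cis (- g)))\<bar> <= pi"
  using mpi_less_Im_Ln[of "1 - v * cis (- g)"] Im_Ln_le_pi[of "1 - v * cis (- g)"] by linarith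
 thus ?thesis by (simp add: angle_def abs_mult)
qed

text \<open>As the logarithm is holomorphic in \<open>v\<close>, the second order term is a square, not a modulus squared.\<close>

lemma angle_expansion:
 fixes v v' :: complex and g :: real
 defines "b \<equiv> cis (- g) / (1 - v * cis (- g))"
 assumes r: "cmod v <= r" "cmod v' <= r" "r < 1"
 shows "\<bar>angle v' g - angle v g - 2 * Im (- b * (v' - v) - b\<^sup>2 * (v' - v)\<^sup>2 / 2)\<bar> <= 2 * (cmod (v' - v)) ^ 3 / (1 - r) ^ 3"
proof -
 let ?c = "cis (- g)"
 let ?T = "- b * (v' - v) - b\<^sup>2 * (v' - v)\<^sup>2 / 2"
 let ?R = "Ln (1 - v' * ?c) - (Ln (1 - v * ?c) - b * (v' - v) - b^2 * (v' - v)^2 / 2)"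
 define f where "f = (%i::nat. %x. if i = 0 then Ln (1 - x * ?c) else if i = 1 then - ?c / (1 - x * ?c) else if i = 2 then - ?c\<^sup>2 / (1 - x * ?c)\<^sup>2 else - 2 * ?c ^ 3 / (1 - x * ?c) ^ 3)"
 have n: "1 - r <= cmod (1 - x * ?c)" "cmod (x * ?c) < 1" if "x \<in> cball 0 r" for x
  using that r(3) norm_triangle_ineq2[of 1 "x * ?c"] by (auto simp: norm_mult)
 have "cmod (f 0 v' - (\<Sum>i\<le>2. f i v * (v' - v) ^ i / fact i)) <= (2 / (1 - r) ^ 3) * cmod (v' - v) ^ Suc 2 / fact 2"
 proof (rule complex_Taylor[of "cball 0 r"])
  show "convex (cball (0::complex) r)" by (rule convex_cball)
  show "v \<in> cball 0 r" "v' \<in> cball 0 r" using r by auto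
  fix i :: nat and x :: complex assume x: "x \<in> cball 0 r" and i: "i <= 2"
  have nz: "1 - x * ?c ~= 0" using n(2)[OF x] by (rule one_minus_nz)
  have nR: "1 - x * ?c \<notin> \<real>\<^sub>\<le>\<^sub>0" using Re_one_minus_pos[OF n(2)[OF x]] by (auto simp: complex_nonpos_Reals_iff)
  let ?at = "at x within cball 0 r"
  consider "i = 0" | "i = 1" | "i = 2" using i by linarith
  thus "(f i has_field_derivative f (Suc i) x) ?at"
  proof cases
   case 1
   have "((%x. Ln (1 - x * ?c)) has_field_derivative - ?c / (1 - x * ?c)) ?at"
    by (rule derivative_eq_intros refl | use nR nz in \<open>simp add: field_simps\<close>)+
   thus ?thesis using 1 by (simp add: f_def)
  next
   case 2
   have "((%x. - ?c / (1 - x * ?c)) has_field_derivative - ?c\<^sup>2 / (1 - x * ?c)\<^sup>2) ?at"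
    by (rule derivative_eq_intros refl | use nz in \<open>simp add: field_simps power2_eq_square\<close>)+
   thus ?thesis using 2 by (simp add: f_def)
  next
   case 3
   have "((%x. - ?c\<^sup>2 / (1 - x * ?c)\<^sup>2) has_field_derivative - 2 * ?c ^ 3 / (1 - x * ?c) ^ 3) ?at"
   proof -
    have "((%x. 1 - x * ?c) has_field_derivative - ?c) ?at"
     by (auto intro!: derivative_eq_intros)
    from DERIV_power[OF DERIV_inverse'[OF this nz], of 2]
    have "((%x. (inverse (1 - x * ?c))^2) has_field_derivative 2 * ?c * inverse (1 - x * ?c) ^ 3) ?at"
     by (simp add: power3_eq_cube power2_eq_square mult_ac)
    from DERIV_cmult[OF this, of "- ?c\<^sup>2"] show ?thesis
     by (simp add: divide_inverse power_inverse power3_eq_cube power2_eq_square mult_ac)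
   qed
   thus ?thesis using 3 by (simp add: f_def)
  qed
 next
  fix x :: complex assume x: "x \<in> cball 0 r"
  have "cmod (f (Suc 2) x) = 2 / cmod (1 - x * ?c) ^ 3"
   by (simp add: f_def norm_divide norm_mult norm_power)
  also have "... <= 2 / (1 - r) ^ 3"
   using n(1)[OF x] r(3) by (intro divide_left_mono power_mono mult_pos_pos zero_less_power) auto
  finally show "cmod (f (Suc 2) x) <= 2 / (1 - r) ^ 3" .
 qed
 also have "(\<Sum>i\<le>2. f i v * (v' - v) ^ i / fact i) = Ln (1 - v * ?c) - b * (v' - v) - b^2 * (v' - v)^2 / 2"
  by (simp add: f_def b_def numeral_2_eq_2 power_divide)
 finally have "cmod ?R <= cmod (v' - v) ^ 3 / (1 - r) ^ 3"
  by (simp add: f_def numeral_2_eq_2 numeral_3_eq_3)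
 hence B: "\<bar>Im ?R\<bar> <= cmod (v' - v) ^ 3 / (1 - r) ^ 3"
  using abs_Im_le_cmod order_trans by blast
 have E: "angle v' g - angle v g - 2 * Im ?T
  = 2 * Im ?R"
  by (simp add: angle_def algebra_simps)
 show ?thesis unfolding E abs_mult using mult_left_mono[OF B, of 2] by (simp only: abs_numeral times_divide_eq_right)
qed

text \<open>Controls the change of the angular speed when the center moves during a time step.\<close>

lemma poisson_ratio:
 assumes r: "cmod v <= r" "cmod v' <= r" "r < 1"
 shows "\<bar>poisson v' g / poisson v g - 1\<bar> <= 12 * cmod (v' - v) / (1 - r) ^ 3"
proof -
 define a a' b b' where "a = 1 - (cmod v)^2" and "a' = 1 - (cmod v')^2" and "b = (cmod (cis g - v))^2" and "b' = (cmod (cis g - v'))^2"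
 have r0: "0 <= r" using r(1) norm_ge_zero[of v] by linarith
 let ?d = "cmod (v' - v)"
 have sq: "\<bar>x^2 - y^2\<bar> <= (x + y) * \<bar>x - y\<bar>" if "0 <= x" "0 <= y" for x y :: real
  using that by (simp add: power2_eq_square square_diff_square_factored abs_mult)
 have a: "1 - r <= a" "a <= 1"
 proof -
  have "(cmod v)^2 <= cmod v" using r by (simp add: power2_eq_square mult_left_le_one_le)
  thus "1 - r <= a" using r by (simp add: a_def)
 qed (simp add: a_def)
 have bb: "1 - r <= cmod (cis g - v)" "cmod (cis g - v) <= 2" "1 - r <= cmod (cis g - v')" "cmod (cis g - v') <= 2"
  using norm_triangle_ineq2[of "cis g" v] norm_triangle_ineq2[of "cis g" v'] norm_triangle_ineq4[of "cis g" v] norm_triangle_ineq4[of "cis g" v'] r by auto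
 have b: "(1 - r)^2 <= b" "b <= 4" "(1 - r)^2 <= b'"
  using bb r power_mono[OF bb(1), of 2] power_mono[OF bb(3), of 2] power_mono[OF bb(2), of 2] by (auto simp: b_def b'_def)
 have pos: "0 < a" "0 < b" "0 < b'"
  using a b r by (auto intro: less_le_trans[of 0 "(1 - r)^2"])
 have da: "\<bar>a' - a\<bar> <= 2 * ?d"
 proof -
  have "\<bar>a' - a\<bar> = \<bar>(cmod v)^2 - (cmod v')^2\<bar>" by (simp add: a_def a'_def)
  also have "... <= (cmod v + cmod v') * \<bar>cmod v - cmod v'\<bar>" by (rule sq) auto
  also have "... <= 2 * ?d" using r norm_triangle_ineq3[of v v'] by (intro mult_mono) (auto simp: norm_minus_commute)
  finally show ?thesis .
 qed
 have db: "\<bar>b - b'\<bar> <= 4 * ?d"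
 proof -
  have "\<bar>b - b'\<bar> <= (cmod (cis g - v) + cmod (cis g - v')) * \<bar>cmod (cis g - v) - cmod (cis g - v')\<bar>"
   unfolding b_def b'_def by (rule sq) auto
  also have "... <= 4 * ?d" using bb norm_triangle_ineq3[of "cis g - v" "cis g - v'"] by (intro mult_mono) auto
  finally show ?thesis .
 qed
 have "poisson v' g / poisson v g - 1 = (a' * b - a * b') / (a * b')"
  using pos by (simp add: poisson_def flip: a_def a'_def b_def b'_def) (simp add: field_simps)
 also have "a' * b - a * b' = (a' - a) * b + a * (b - b')" by (simp add: algebra_simps)
 finally have "\<bar>poisson v' g / poisson v g - 1\<bar> = \<bar>(a' - a) * b + a * (b - b')\<bar> / (a * b')"
  using pos by (simp add: abs_mult)
 also have "... <= (12 * ?d) / (a * b')"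
 proof (rule divide_right_mono)
  have "\<bar>(a' - a) * b + a * (b - b')\<bar> <= \<bar>a' - a\<bar> * b + a * \<bar>b - b'\<bar>"
   using pos abs_triangle_ineq[of "(a' - a) * b" "a * (b - b')"] by (simp add: abs_mult)
  also have "... <= (2 * ?d) * 4 + 1 * (4 * ?d)" using da db a b pos by (intro add_mono mult_mono) auto
  finally show "\<bar>(a' - a) * b + a * (b - b')\<bar> <= 12 * ?d" by simp
 qed (use pos in simp)
 also have "... <= (12 * ?d) / (1 - r) ^ 3"
 proof (rule divide_left_mono)
  show "(1 - r) ^ 3 <= a * b'"
   using mult_mono[OF a(1) b(3)] r pos by (simp add: power3_eq_cube power2_eq_square mult.assoc)
 qed (use r pos in auto)
 finally show ?thesis .
qed

lemma poisson_lower: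
 assumes r: "cmod v <= r" "r < 1"
 shows "(1 - r) / 4 <= poisson v g" "1 / poisson v g <= 4 / (1 - r)"
proof -
 have v: "cmod v < 1" using r by simp
 have a: "1 - r <= 1 - (cmod v)^2"
 proof -
  have "(cmod v)^2 <= cmod v" using v by (simp add: power2_eq_square mult_left_le_one_le)
  thus ?thesis using r by simp
 qed
 have b: "(cmod (cis g - v))^2 <= 4"
  using power_mono[of "cmod (cis g - v)" 2 2] norm_triangle_ineq4[of "cis g" v] v by simp
 have "cis g - v ~= 0" using v by (metis eq_iff_diff_eq_0 less_irrefl norm_cis)
 hence b0: "0 < (cmod (cis g - v))^2" by simp
 have "(1 - r) / 4 <= (1 - r) / (cmod (cis g - v))^2" using b b0 r by (intro divide_left_mono) auto
 also have "... <= poisson v g" unfolding poisson_def using a b0 by (intro divide_right_mono) auto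
 finally show *: "(1 - r) / 4 <= poisson v g" .
 have "1 / poisson v g <= 1 / ((1 - r) / 4)" using * r poisson_pos[OF v] by (intro divide_left_mono) auto
 thus "1 / poisson v g <= 4 / (1 - r)" by simp
qed

section \<open>Increments of hyperbolic Brownian motion\<close>

locale disk_bm = noise M F X Xi m
 for M :: "'w measure" and F X Xi m +
 fixes V J :: "real => 'w => complex"
 assumes V_adapted: "!!t. 0 <= t ==> V t \<in> borel_measurable (F t)"
  and V_disk: "!!t w. [|0 <= t; w \<in> space M|] ==> cmod (V t w) < 1"
  and V_cont: "AE w in M. continuous_on {0..} (%t. V t w)"
  and V_0: "AE w in M. V 0 w = 0"
  and V_ito: "has_ito_integral M F (%t w. Cx ((1 - (cmod (V t w))^2) / 2)) X J"
  and V_J: "!!t. 0 <= t ==> AE w in M. V t w = J t w"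
begin

definition H :: "real => 'w => complex" where
 "H t w = Cx ((1 - (cmod (V t w))^2) / 2)"

lemma V_meas [measurable]: "0 <= t ==> V t \<in> borel_measurable M"
 by (rule measurable_F_M[OF V_adapted])

lemma cmod_sq_le_1: "0 <= t ==> w \<in> space M ==> (cmod (V t w))^2 <= 1"
 using V_disk[of t w] by (simp add: abs_square_le_1)

lemma cmod_H: "0 <= t ==> w \<in> space M ==> cmod (H t w) = (1 - (cmod (V t w))^2) / 2"
 unfolding H_def norm_of_real using cmod_sq_le_1[of t w] by simp

lemma H_bound_half: "0 <= t ==> w \<in> space M ==> cmod (H t w) <= 1 / 2"
 by (simp add: cmod_H)

sublocale ito_integrand M F X Xi m H J "1 / 2"
proof
 show "has_ito_integral M F H X J" using V_ito unfolding H_def[abs_def] .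
 show "cmod (H t w) <= 1 / 2" if "0 <= t" "w \<in> space M" for t w by (rule H_bound_half[OF that])
 show "AE w in M. continuous_on {0..} (%t. H t w)"
  using V_cont by eventually_elim (auto simp: H_def intro!: continuous_intros)
qed

lemma H_bdd: "0 <= t ==> bdd_meas t (H t)"
 using H_adapted[of t] H_bound_half[of t] unfolding bdd_meas_def by blast

lemma V_bdd: "0 <= t ==> bdd_meas t (V t)"
 using V_adapted[of t] V_disk[of t] less_imp_le unfolding bdd_meas_def by blast

lemma H_lipschitz:
 assumes "0 <= s" "0 <= t" "w \<in> space M"
 shows "cmod (H t w - H s w) <= cmod (V t w - V s w)"
proof -
 let ?a = "cmod (V t w)" and ?b = "cmod (V s w)"
 have "cmod (H t w - H s w) = \<bar>(?b^2 - ?a^2) / 2\<bar>"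
  unfolding H_def of_real_diff[symmetric] norm_of_real by (simp add: diff_divide_distrib)
 also have "... = \<bar>?a - ?b\<bar> * (?a + ?b) / 2"
  by (simp add: power2_eq_square square_diff_square_factored abs_mult abs_minus_commute mult.commute)
 also have "... <= \<bar>?a - ?b\<bar> * 2 / 2"
  using V_disk[OF assms(1,3)] V_disk[OF assms(2,3)] by (intro divide_right_mono mult_left_mono) auto
 also have "... <= cmod (V t w - V s w)" using norm_triangle_ineq3 by simp
 finally show ?thesis .
qed

definition dV :: "real => real => 'w => complex" where "dV s t w = V t w - V s w"

text \<open>The error of the Euler step of \<open>V\<close>.\<close>

definition R :: "real => real => 'w => complex" where "R s t w = dV s t w - H s w * dX s t w"

context
 fixes s t :: real
 assumes st: "0 <= s" "s <= t"
begin

lemma t0: "0 <= t" using st by simp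

lemma dV_meas [measurable]: "dV s t \<in> borel_measurable M"
 unfolding dV_def using st t0 by measurable

lemma R_meas [measurable]: "R s t \<in> borel_measurable M"
 unfolding R_def using st t0 by measurable

lemma dV_J: "AE w in M. dV s t w = J t w - J s w"
 using V_J[OF st(1)] V_J[OF t0] by eventually_elim (simp add: dV_def)

lemma dV_bound: "w \<in> space M ==> cmod (dV s t w) <= 2"
 using V_disk[OF st(1), of w] V_disk[OF t0, of w] norm_triangle_ineq4[of "V t w" "V s w"] by (simp add: dV_def)

lemma dV_integrable: "integrable M (dV s t)"
 using dV_bound by (intro integrable_const_bound[where B=2]) auto

lemma dV_power_integrable: "integrable M (%w. (cmod (dV s t w)) ^ k)"
proof (rule integrable_const_bound[where B="2 ^ k"])
 show "AE w in M. norm (cmod (dV s t w) ^ k) <= 2 ^ k"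
  using dV_bound by (intro AE_I2) (auto intro!: power_mono)
qed measurable

lemma dV_sq: "mean (%w. (cmod (dV s t w))^2) <= t - s"
proof -
 have "mean (%w. (cmod (dV s t w))^2) = mean (%w. (cmod (J t w - J s w))^2)"
  using dV_J J_meas[OF st(1)] J_meas[OF t0] by (intro integral_cong_AE) auto
 also have "... <= t - s" using ito_sq(2)[OF st] by (simp add: power2_eq_square)
 finally show ?thesis .
qed

lemma dV_mean:
 assumes g: "bdd_meas s g"
 shows "integrable M (%w. g w * dV s t w)" "mean (%w. g w * dV s t w) = 0"
proof -
 show "integrable M (%w. g w * dV s t w)" by (rule bdd_meas_integrable_mult[OF g dV_integrable])
 have "mean (%w. g w * dV s t w) = mean (%w. g w * (J t w - J s w))"
  using dV_J J_meas[OF st(1)] J_meas[OF t0] bdd_meas_measM[OF g] by (intro integral_cong_AE) auto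
 thus "mean (%w. g w * dV s t w) = 0" using ito_mean(2)[OF st g] by simp
qed

lemma R_mean:
 assumes g: "bdd_meas s g"
 shows "integrable M (%w. g w * R s t w)" "mean (%w. g w * R s t w) = 0"
proof -
 note gH = bdd_meas_mult[OF g H_bdd[OF st(1)]]
 note inc = increment_moments(1,2)[OF st bdd_meas_measD[OF gH] bdd_meas_integrable[OF gH]]
 have e: "g w * R s t w = g w * dV s t w - g w * H s w * dX s t w" for w by (simp add: R_def algebra_simps)
 show "integrable M (%w. g w * R s t w)" "mean (%w. g w * R s t w) = 0"
  unfolding e using inc dV_mean[OF g] by simp_all
qed

end

text \<open>\<open>H\<close> is Lipschitz in \<open>V\<close>, so within a time \<open>u\<close> it moves by at most \<open>u\<close> in mean square; \<open>ito_estimate\<close> then gives the square of the time step.\<close>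

lemma R_sq:
 assumes st: "0 <= s" "s <= t"
 shows "integrable M (%w. (cmod (R s t w))^2)" "mean (%w. (cmod (R s t w))^2) <= 4 * (t - s)^2"
proof -
 have c: "mean (%w. (cmod (H r w - H s w))^2) <= t - s" if r: "s <= r" "r <= t" for r
 proof -
  have r0: "0 <= r" using st r by simp
  have "mean (%w. (cmod (H r w - H s w))^2) <= mean (%w. (cmod (dV s r w))^2)"
   using H_lipschitz[OF st(1) r0] dV_power_integrable[OF st(1) r(1), of 2]
   by (intro integral_mono') (auto simp: dV_def intro!: power_mono)
  also have "... <= r - s" by (rule dV_sq[OF st(1) r(1)])
  finally show ?thesis using r by simp
 qed
 have ts: "0 <= t - s" using st by simp
 note est = ito_estimate_expectation[OF st H_bdd[OF st(1)] ts c]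
 have ae: "AE w in M. (cmod (R s t w))^2 = (cmod (J t w - J s w - H s w * dX s t w))^2"
  using dV_J[OF st] by eventually_elim (simp add: R_def)
 have t0: "0 <= t" using st by simp
 note [measurable] = R_meas[OF st] J_meas[OF st(1)] J_meas[OF t0] H_meas[OF st(1)] X_meas[OF st(1)] X_meas[OF t0]
 show "integrable M (%w. (cmod (R s t w))^2)"
  by (rule integrable_cong_AE_imp[OF est(1)]) (use ae in auto)
 have "mean (%w. (cmod (R s t w))^2) = mean (%w. (cmod (J t w - J s w - H s w * dX s t w))^2)"
  by (rule integral_cong_AE) (use ae in auto)
 thus "mean (%w. (cmod (R s t w))^2) <= 4 * (t - s)^2" using est(2) by (simp only: power2_eq_square mult.assoc)
qed

text \<open>Either \<open>dV\<close> is at most the Gaussian increment, or at most twice \<open>R\<close>; in the second case two factors are bounded by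
 the diameter of the disk.\<close>

lemma dV_fourth:
 assumes st: "0 <= s" "s <= t"
 shows "mean (%w. (cmod (dV s t w)) ^ 4) <= 67 * (t - s)^2"
proof -
 have "mean (%w. (cmod (dV s t w)) ^ 4) <= mean (%w. (cmod (dX s t w)) ^ 4 + 16 * (cmod (R s t w))^2)"
 proof (rule integral_mono)
  show "integrable M (%w. (cmod (dV s t w)) ^ 4)" by (rule dV_power_integrable[OF st])
  show "integrable M (%w. (cmod (dX s t w)) ^ 4 + 16 * (cmod (R s t w))^2)"
   using increment_fourth(1)[OF st] R_sq(1)[OF st] by simp
  fix w assume w: "w \<in> space M"
  let ?d = "cmod (dV s t w)" and ?x = "cmod (dX s t w)" and ?r = "cmod (R s t w)"
  have "?d <= cmod (H s w) * ?x + ?r"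
   using norm_triangle_ineq[of "H s w * dX s t w" "R s t w"] by (simp add: R_def norm_mult)
  also have "... <= 1 / 2 * ?x + ?r" by (intro add_mono mult_right_mono H_bound_half[OF st(1) w]) auto
  finally have d: "?d <= ?x / 2 + ?r" by simp
  show "?d ^ 4 <= ?x ^ 4 + 16 * ?r^2"
  proof (cases "?d <= ?x")
   case True
   hence "?d ^ 4 <= ?x ^ 4" by (intro power_mono) auto
   thus ?thesis by (simp add: add_increasing2)
  next
   case False
   hence "?d <= 2 * ?r" using d by linarith
   hence "?d^2 <= 4 * ?r^2" using power_mono[of ?d "2 * ?r" 2] by (simp add: power_mult_distrib)
   moreover have "?d^2 <= 4" using power_mono[OF dV_bound[OF st w], of 2] by simp
   ultimately have "?d^2 * ?d^2 <= 4 * (4 * ?r^2)" by (intro mult_mono) auto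
   moreover have "?d ^ 4 = ?d^2 * ?d^2" by (simp add: power2_eq_square power4_eq_xxxx)
   moreover have "0 <= ?x ^ 4" by simp
   ultimately show ?thesis by linarith
  qed
 qed
 also have "... = mean (%w. (cmod (dX s t w)) ^ 4) + 16 * mean (%w. (cmod (R s t w))^2)"
  using increment_fourth(1)[OF st] R_sq(1)[OF st] by simp
 also have "... <= 67 * (t - s)^2" using increment_fourth(2)[OF st] R_sq(2)[OF st] by simp
 finally show ?thesis .
qed

lemma dV_cube:
 assumes st: "0 <= s" "s < t"
 shows "mean (%w. (cmod (dV s t w)) ^ 3) <= 34 * (t - s) * sqrt (t - s)"
proof -
 have le: "s <= t" using st by simp
 define h where "h = t - s"
 define k where "k = sqrt h"
 have k: "k > 0" "k^2 = h" using st by (auto simp: k_def h_def)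
 have "mean (%w. (cmod (dV s t w)) ^ 3) <= mean (%w. k / 2 * (cmod (dV s t w))^2 + 1 / (2 * k) * (cmod (dV s t w)) ^ 4)"
 proof (rule integral_mono)
  show "integrable M (%w. (cmod (dV s t w)) ^ 3)" by (rule dV_power_integrable[OF st(1) le])
  show "integrable M (%w. k / 2 * (cmod (dV s t w))^2 + 1 / (2 * k) * (cmod (dV s t w)) ^ 4)"
   using dV_power_integrable[OF st(1) le] by simp
  fix w
  let ?d = "cmod (dV s t w)"
  have "2 * k * ?d <= k^2 + ?d^2" using sum_squares_bound[of k ?d] by simp
  hence "?d <= k / 2 + ?d^2 / (2 * k)" using k(1) by (simp add: field_simps power2_eq_square)
  hence "?d^2 * ?d <= ?d^2 * (k / 2 + ?d^2 / (2 * k))" by (intro mult_left_mono) auto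
  thus "?d ^ 3 <= k / 2 * ?d^2 + 1 / (2 * k) * ?d ^ 4"
   by (simp add: power2_eq_square power3_eq_cube power4_eq_xxxx algebra_simps)
 qed
 also have "... = k / 2 * mean (%w. (cmod (dV s t w))^2) + 1 / (2 * k) * mean (%w. (cmod (dV s t w)) ^ 4)"
  using dV_power_integrable[OF st(1) le] by simp
 also have "... <= k / 2 * h + 1 / (2 * k) * (67 * h^2)"
  using dV_sq[OF st(1) le] dV_fourth[OF st(1) le] k(1) unfolding h_def by (intro add_mono mult_left_mono) auto
 also have "... = 34 * h * k" unfolding k(2)[symmetric] using k(1) by (simp add: power2_eq_square)
 finally show ?thesis by (simp add: h_def k_def)
qed

text \<open>There is no Ito correction: in \<open>dV\<^sup>2 = (H dX)\<^sup>2 + R (dV + H dX)\<close> the first term is centred and the second is of higher order.\<close>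

lemma dV_square_mean:
 assumes st: "0 <= s" "s < t" and g: "bdd_meas s g" "!!w. w \<in> space M ==> cmod (g w) <= K"
 shows "cmod (mean (%w. g w * (dV s t w)^2)) <= K * (6 * (t - s) * sqrt (t - s))"
proof -
 have le: "s <= t" and t0: "0 <= t" using st by auto
 define h where "h = t - s"
 \<comment> \<open>the weight that balances the mean squares of \<open>R\<close> and of the increments\<close>
 define k where "k = sqrt h"
 have k: "k > 0" "k^2 = h" using st by (auto simp: k_def h_def)
 note [measurable] = bdd_meas_measM[OF g(1)] R_meas[OF st(1) le] dV_meas[OF st(1) le] H_meas[OF st(1)] X_meas[OF st(1)] X_meas[OF t0]
 have gH: "bdd_meas s (%w. g w * (H s w)^2)"
  using bdd_meas_mult[OF g(1) bdd_meas_mult[OF H_bdd[OF st(1)] H_bdd[OF st(1)]]] by (simp add: power2_eq_square)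
 note inc = increment_moments(5,6)[OF st(1) le bdd_meas_measD[OF gH] bdd_meas_integrable[OF gH]]
 let ?Q = "%w. R s t w * (dV s t w + H s w * dX s t w)"
 let ?B = "%w. 1 / k * (cmod (R s t w))^2 + k * ((cmod (dV s t w))^2 + (cmod (dX s t w))^2)"
 have Bi: "integrable M ?B"
  using R_sq(1)[OF st(1) le] dV_power_integrable[OF st(1) le, of 2] increment_sq(1)[OF st(1) le] by simp
 have QB: "cmod (?Q w) <= ?B w" if w: "w \<in> space M" for w
 proof -
  let ?r = "cmod (R s t w)" and ?d = "cmod (dV s t w)" and ?x = "cmod (dX s t w)"
  have "cmod (H s w * dX s t w) <= 1 * ?x" unfolding norm_mult using H_bound_half[OF st(1) w] by (intro mult_right_mono) auto
  hence "cmod (dV s t w + H s w * dX s t w) <= ?d + ?x"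
   using norm_triangle_ineq[of "dV s t w" "H s w * dX s t w"] by linarith
  hence "cmod (?Q w) <= ?r * (?d + ?x)" unfolding norm_mult[of "R s t w"] by (intro mult_left_mono) auto
  also have "... <= 1 / k * ?r^2 + k * (?d^2 + ?x^2)"
  proof -
   have "2 * (?r / k) * ?d <= (?r / k)^2 + ?d^2" "2 * (?r / k) * ?x <= (?r / k)^2 + ?x^2"
    using sum_squares_bound[of "?r / k" ?d] sum_squares_bound[of "?r / k" ?x] by auto
   hence "(?r / k) * (?d + ?x) <= (?r / k)^2 + (?d^2 + ?x^2)"
    unfolding distrib_left using zero_le_power2[of ?d] zero_le_power2[of ?x] by linarith
   hence "k * ((?r / k) * (?d + ?x)) <= k * ((?r / k)^2 + (?d^2 + ?x^2))" using k(1) by (intro mult_left_mono) auto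
   thus ?thesis using k(1) by (simp add: power2_eq_square distrib_left)
  qed
  finally show ?thesis .
 qed
 have Qi: "integrable M ?Q"
 proof (rule integrable_bound[OF Bi])
  show "AE w in M. norm (?Q w) <= norm (?B w)"
   using order_trans[OF QB abs_ge_self] by (intro AE_I2) (simp only: real_norm_def)
 qed measurable
 have gQ: "integrable M (%w. g w * ?Q w)" by (rule bdd_meas_integrable_mult[OF g(1) Qi])
 have K0: "0 <= K" by (rule norm_bound_nonneg[OF g(2)])
 have "g w * (dV s t w)^2 = g w * (H s w)^2 * (dX s t w)^2 + g w * ?Q w" for w
  by (simp add: R_def power2_eq_square algebra_simps)
 hence "mean (%w. g w * (dV s t w)^2) = mean (%w. g w * ?Q w)"
  using inc gQ by simp
 hence "cmod (mean (%w. g w * (dV s t w)^2)) <= mean (%w. cmod (g w * ?Q w))"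
  by (simp only:) (rule integral_norm_bound)
 also have "... <= mean (%w. K * ?B w)"
 proof (rule integral_mono)
  show "integrable M (%w. cmod (g w * ?Q w))" using gQ by simp
  show "integrable M (%w. K * ?B w)" using Bi by simp
  show "cmod (g w * ?Q w) <= K * ?B w" if "w \<in> space M" for w
   unfolding norm_mult[of "g w"] by (rule mult_mono'[OF g(2)[OF that] QB[OF that]]) auto
 qed
 also have "... = K * (1 / k * mean (%w. (cmod (R s t w))^2) + k * (mean (%w. (cmod (dV s t w))^2) + mean (%w. (cmod (dX s t w))^2)))"
  using R_sq(1)[OF st(1) le] dV_power_integrable[OF st(1) le, of 2] increment_sq(1)[OF st(1) le] by simp
 also have "... <= K * (1 / k * (4 * h^2) + k * (h + h))"
  using R_sq(2)[OF st(1) le] dV_sq[OF st(1) le] increment_sq(2)[OF st(1) le] K0 k(1) unfolding h_def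
  by (intro mult_left_mono add_mono) auto
 also have "... = K * (6 * h * k)" unfolding k(2)[symmetric] using k(1) by (simp add: power2_eq_square algebra_simps)
 finally show ?thesis by (simp add: h_def k_def)
qed

end

section \<open>Localization\<close>

text \<open>An enumeration of the nonnegative rationals.\<close>

definition frac_time :: "nat \<times> nat => real" where
 "frac_time p = real (fst p) / real (Suc (snd p))"

lemma frac_time_nonneg [simp]: "0 <= frac_time p"
 by (simp add: frac_time_def)

lemma frac_time_below:
 assumes s: "0 <= s"
 obtains p where "!!n :: nat. frac_time (p n) <= s" "(%n. frac_time (p n)) ----> s"
proof
 define p where "p n = (nat \<lfloor>real (Suc n) * s\<rfloor>, n)" for n
 have "frac_time (p n) = of_int \<lfloor>real (Suc n) * s\<rfloor> / real (Suc n)" for n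
  using s by (simp only: frac_time_def p_def fst_conv snd_conv) simp
 thus "frac_time (p n) <= s" "(%n. frac_time (p n)) ----> s" for n
  using floor_grid_tendsto[OF filterlim_real_Suc] by (simp_all only: of_nat_0_less_iff zero_less_Suc)
qed

lemma (in prob_space) exists_likely:
 assumes "!!j::nat. B j \<in> events" "incseq B" "AE w in M. EX j. w \<in> B j" "e > 0"
 shows "EX j. prob (B j) > 1 - e"
proof -
 have "(%j. prob (B j)) ----> prob (\<Union>j. B j)"
  using assms by (intro finite_Lim_measure_incseq) auto
 moreover have "prob (\<Union>j. B j) = 1"
  using assms(1,3) by (subst prob_eq_1) (auto intro: sets.countable_UN)
 ultimately have "\<forall>\<^sub>F j in sequentially. 1 - e < prob (B j)"
  using assms(4) by (intro order_tendstoD(1)) auto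
 thus ?thesis by (auto simp: eventually_sequentially)
qed

context disk_bm
begin

text \<open>Only countably many times enter, all of them in the past of \<open>t\<close>; so the event is adapted. By continuity it controls the
 whole path up to time \<open>t\<close>.\<close>

definition good :: "real => real => real => real => 'w set" where
 "good r eps d t = {w\<in>space M. \<forall>p\<in>{p. frac_time p <= t}. cmod (V (frac_time p) w) <= r &
  (\<forall>q\<in>{q. frac_time q <= t}. \<bar>frac_time p - frac_time q\<bar> <= d --> cmod (V (frac_time p) w - V (frac_time q) w) <= eps)}"

lemma goodD:
 assumes "w \<in> good r eps d t" "frac_time p <= t"
 shows "cmod (V (frac_time p) w) <= r"
  "frac_time q <= t ==> \<bar>frac_time p - frac_time q\<bar> <= d ==> cmod (V (frac_time p) w - V (frac_time q) w) <= eps"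
 using assms unfolding good_def by blast+

lemma good_sets:
 assumes "0 <= t" shows "good r eps d t \<in> sets (F t)"
proof -
 have m: "V (frac_time p) \<in> borel_measurable (F t)" if "frac_time p <= t" for p
  by (rule measurable_F_mono[OF V_adapted that]) simp
 have "Measurable.pred (F t) (%w. \<forall>p\<in>{p. frac_time p <= t}. cmod (V (frac_time p) w) <= r &
  (\<forall>q\<in>{q. frac_time q <= t}. \<bar>frac_time p - frac_time q\<bar> <= d --> cmod (V (frac_time p) w - V (frac_time q) w) <= eps))"
 proof (intro pred_intros_countable_bounded pred_intros_logic)
  fix p assume "p \<in> {p. frac_time p <= t}"
  hence [measurable]: "V (frac_time p) \<in> borel_measurable (F t)" using m by simp
  show "Measurable.pred (F t) (%w. cmod (V (frac_time p) w) <= r)" by measurable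
  fix q assume "q \<in> {p. frac_time p <= t}"
  hence [measurable]: "V (frac_time q) \<in> borel_measurable (F t)" using m by simp
  show "Measurable.pred (F t) (%w. cmod (V (frac_time p) w - V (frac_time q) w) <= eps)" by measurable
  show "Measurable.pred (F t) (%w. \<bar>frac_time p - frac_time q\<bar> <= d)" by measurable
 qed
 thus ?thesis unfolding good_def pred_def space_F .
qed

lemma good_mono: "s <= t ==> good r eps d t \<subseteq> good r eps d s"
 unfolding good_def by (auto intro: order_trans)

lemma good_radius:
 assumes c: "continuous_on {0..} (%t. V t w)" and g: "w \<in> good r eps d t" and s: "0 <= s" "s <= t"
 shows "cmod (V s w) <= r"
proof -
 obtain p where p: "!!n :: nat. frac_time (p n) <= s" "(%n. frac_time (p n)) ----> s" using frac_time_below[OF s(1)] by blast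
 have "(%n. V (frac_time (p n)) w) ----> V s w"
  by (rule continuous_on_tendsto_compose[OF c p(2)]) (use s in auto)
 hence "(%n. cmod (V (frac_time (p n)) w)) ----> cmod (V s w)" by (rule tendsto_norm)
 thus ?thesis
 proof (rule LIMSEQ_le_const2)
  have "frac_time (p n) <= t" for n using p(1)[of n] s by linarith
  thus "EX N. \<forall>n\<ge>N. cmod (V (frac_time (p n)) w) <= r" using goodD(1)[OF g] by blast
 qed
qed

lemma good_modulus:
 assumes c: "continuous_on {0..} (%t. V t w)" and g: "w \<in> good r eps d t" and s: "0 <= s" "s <= t"
  and s': "0 <= s'" "s' <= t" "\<bar>s - s'\<bar> < d"
 shows "cmod (V s w - V s' w) <= eps"
proof -
 obtain p where p: "!!n :: nat. frac_time (p n) <= s" "(%n. frac_time (p n)) ----> s" using frac_time_below[OF s(1)] by blast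
 obtain q where q: "!!n :: nat. frac_time (q n) <= s'" "(%n. frac_time (q n)) ----> s'" using frac_time_below[OF s'(1)] by blast
 have "(%n. V (frac_time (p n)) w) ----> V s w" "(%n. V (frac_time (q n)) w) ----> V s' w"
  by (rule continuous_on_tendsto_compose[OF c p(2)] continuous_on_tendsto_compose[OF c q(2)]; use s s' in auto)+
 hence "(%n. cmod (V (frac_time (p n)) w - V (frac_time (q n)) w)) ----> cmod (V s w - V s' w)" by (intro tendsto_intros)
 thus ?thesis
 proof (rule LIMSEQ_le_const2)
  have "(%n. \<bar>frac_time (p n) - frac_time (q n)\<bar>) ----> \<bar>s - s'\<bar>" using p q by (intro tendsto_intros)
  hence "\<forall>\<^sub>F n in sequentially. \<bar>frac_time (p n) - frac_time (q n)\<bar> < d" using s'(3) by (rule order_tendstoD(2))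
  then obtain N where N: "!!n. n \<ge> N ==> \<bar>frac_time (p n) - frac_time (q n)\<bar> < d" by (auto simp: eventually_sequentially)
  have "frac_time (p n) <= t" "frac_time (q n) <= t" for n using p(1)[of n] q(1)[of n] s s' by linarith+
  thus "EX N. \<forall>n\<ge>N. cmod (V (frac_time (p n)) w - V (frac_time (q n)) w) <= eps"
   using goodD(2)[OF g] N less_imp_le by blast
 qed
qed

text \<open>A continuous path stays in a compact part of the open disk up to time \<open>T\<close> and is uniformly continuous there. The radius
 is chosen first, as the modulus of continuity has to be small relative to it.\<close>

lemma good_likely:
 assumes T: "0 <= T" and e: "e > 0"
 obtains r where "0 < r" "r < 1" "!!eps. eps > 0 ==> \<exists>d>0. prob (good r eps d T) \<ge> 1 - e"
proof -
 define B where "B j = {w\<in>space M. \<forall>p\<in>{p. frac_time p <= T}. cmod (V (frac_time p) w) <= 1 - 1 / real (Suc (Suc j))}" for j :: nat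
 define C where "C eps i = {w\<in>space M. \<forall>p\<in>{p. frac_time p <= T}. \<forall>q\<in>{q. frac_time q <= T}.
   \<bar>frac_time p - frac_time q\<bar> <= 1 / real (Suc i) --> cmod (V (frac_time p) w - V (frac_time q) w) <= eps}" for eps and i :: nat
 have Bm: "B j \<in> events" and Cm: "C eps i \<in> events" for j eps i
  unfolding B_def C_def by measurable
 have dec: "1 / real (Suc j) <= 1 / real (Suc i)" if "i <= j" for i j using that by (simp add: frac_le)
 have "EX j. prob (B j) > 1 - e / 2"
 proof (rule exists_likely[OF Bm])
  show "incseq B"
  proof (rule monoI, rule subsetI)
   fix i j :: nat and w assume "i <= j" "w \<in> B i"
   thus "w \<in> B j" unfolding B_def using dec[of "Suc i" "Suc j"] by (fastforce)
  qed
  show "AE w in M. EX j. w \<in> B j"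
   using V_cont AE_space
  proof eventually_elim
   case (elim w)
   have "continuous_on {0..T} (%t. cmod (V t w))"
    by (intro continuous_on_norm continuous_on_subset[OF elim(1)]) auto
   then obtain s where s: "s \<in> {0..T}" "!!t. t \<in> {0..T} ==> cmod (V t w) <= cmod (V s w)"
    using continuous_attains_sup[of "{0..T}" "%t. cmod (V t w)"] T by auto
   have "1 - cmod (V s w) > 0" using V_disk[of s w] s elim by simp
   then obtain j where j: "1 / real (Suc j) < 1 - cmod (V s w)" using reals_Archimedean[of "1 - cmod (V s w)"] by (auto simp: inverse_eq_divide)
   have "1 / real (Suc (Suc j)) <= 1 / real (Suc j)" by (rule dec) simp
   hence k: "cmod (V s w) <= 1 - 1 / real (Suc (Suc j))" using j by linarith
   have "w \<in> B j" unfolding B_def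
   proof (intro CollectI conjI ballI)
    show "w \<in> space M" by (rule elim)
    fix p assume "p \<in> {p. frac_time p <= T}"
    hence "frac_time p \<in> {0..T}" by simp
    from order_trans[OF s(2)[OF this] k] show "cmod (V (frac_time p) w) <= 1 - 1 / real (Suc (Suc j))" .
   qed
   thus ?case by blast
  qed
 qed (use e in simp)
 then obtain j where j: "prob (B j) > 1 - e / 2" by blast
 define r where "r = 1 - 1 / real (Suc (Suc j))"
 have "\<exists>d>0. prob (good r eps d T) \<ge> 1 - e" if eps: "eps > 0" for eps
 proof -
  have "EX i. prob (C eps i) > 1 - e / 2"
  proof (rule exists_likely[OF Cm])
   show "incseq (C eps)"
   proof (rule monoI, rule subsetI)
    fix i j :: nat and w assume "i <= j" "w \<in> C eps i"
    thus "w \<in> C eps j" unfolding C_def using dec[of i j] by fastforce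
   qed
   show "AE w in M. EX i. w \<in> C eps i"
    using V_cont AE_space
   proof eventually_elim
    case (elim w)
    have "uniformly_continuous_on {0..T} (%t. V t w)"
     by (intro compact_uniformly_continuous continuous_on_subset[OF elim(1)]) auto
    then obtain d where d: "d > 0" "!!x y. x \<in> {0..T} ==> y \<in> {0..T} ==> dist y x < d ==> dist (V y w) (V x w) < eps"
     using eps unfolding uniformly_continuous_on_def by meson
    obtain i where i: "1 / real (Suc i) < d" using reals_Archimedean[OF d(1)] by (auto simp: inverse_eq_divide)
    have "w \<in> C eps i" unfolding C_def
    proof (intro CollectI conjI ballI impI)
     show "w \<in> space M" by (rule elim)
     fix p q assume "p \<in> {p. frac_time p <= T}" "q \<in> {p. frac_time p <= T}" "\<bar>frac_time p - frac_time q\<bar> <= 1 / real (Suc i)"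
     hence "dist (V (frac_time p) w) (V (frac_time q) w) < eps"
      using i by (intro d(2)) (auto simp: dist_real_def)
     thus "cmod (V (frac_time p) w - V (frac_time q) w) <= eps" by (simp add: dist_norm)
    qed
    thus ?case by blast
   qed
  qed (use e in simp)
  then obtain i where i: "prob (C eps i) > 1 - e / 2" by blast
  have eq: "good r eps (1 / real (Suc i)) T = B j Int C eps i"
   unfolding good_def B_def C_def r_def by blast
  have "prob (B j) + prob (C eps i) - prob (B j Int C eps i) = prob (B j \<union> C eps i)"
   by (subst finite_measure_Union') (auto simp: Bm Cm finite_measure_Diff' Int_commute)
  also have "... <= 1" by (rule prob_le_1)
  finally have "prob (B j Int C eps i) \<ge> 1 - e" using i j by linarith
  thus ?thesis unfolding eq[symmetric] by (intro exI[of _ "1 / real (Suc i)"]) auto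
 qed
 thus ?thesis by (intro that[of r]) (auto simp: r_def)
qed

end

text \<open>This form makes the angle measurable.\<close>

lemma angle_arctan:
 assumes "cmod v < 1"
 shows "angle v g = g + 2 * arctan (Im (1 - v * cis (- g)) / Re (1 - v * cis (- g)))"
proof -
 have n: "cmod (v * cis (- g)) < 1" using assms by (simp add: norm_mult)
 have "Arg (1 - v * cis (- g)) = Im (Ln (1 - v * cis (- g)))"
  using one_minus_nz[OF n] by (rule Arg_eq_Im_Ln)
 thus ?thesis using arg_conv_arctan[OF Re_one_minus_pos[OF n]] by (simp add: angle_def)
qed

lemma borel_measurable_angle:
 assumes [measurable]: "v \<in> borel_measurable M" "g \<in> borel_measurable M" and "!!w. w \<in> space M ==> cmod (v w) < 1"
 shows "(%w. angle (v w) (g w)) \<in> borel_measurable M"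
proof -
 have [measurable]: "cis \<in> borel_measurable borel" by (intro borel_measurable_continuous_onI continuous_intros)
 have "(%w. g w + 2 * arctan (Im (1 - v w * cis (- g w)) / Re (1 - v w * cis (- g w)))) \<in> borel_measurable M" by measurable
 thus ?thesis using assms(3) by (subst measurable_cong[OF angle_arctan]) auto
qed

section \<open>The carousel angles solve the stochastic equation\<close>

text \<open>Seen from a fixed \<open>v'\<close> close to the moving center, the point turns at the speed \<open>l\<close> up to the ratio of two Poisson kernels.\<close>

lemma angle_flow:
 assumes h: "0 <= h" and r: "r < 1" "cmod v' <= r"
  and v: "!!s. s \<in> {t..t+h} ==> cmod (v s) <= r" "!!s. s \<in> {t..t+h} ==> cmod (v' - v s) <= eps"
  and d: "!!s. s \<in> {t..t+h} ==> (g has_real_derivative l / poisson (v s) (g s)) (at s within {t..t+h})"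
 shows "\<bar>angle v' (g (t + h)) - angle v' (g t) - l * h\<bar> <= 12 * \<bar>l\<bar> * eps * h / (1 - r) ^ 3"
proof -
 let ?f = "%s. angle v' (g s) - l * s"
 let ?f' = "%s. poisson v' (g s) * (l / poisson (v s) (g s)) - l"
 let ?B = "12 * \<bar>l\<bar> * eps / (1 - r) ^ 3"
 have v'1: "cmod v' < 1" using r by simp
 have "norm (?f (t + h) - ?f t) <= ?B * norm (t + h - t)"
 proof (rule field_differentiable_bound[of "{t..t+h}" ?f ?f'])
  fix s assume s: "s \<in> {t..t+h}"
  show "(?f has_field_derivative ?f' s) (at s within {t..t+h})"
   by (intro DERIV_diff DERIV_chain2[OF angle_deriv[OF v'1] d[OF s]] DERIV_cmult_Id)
  have "?f' s = l * (poisson v' (g s) / poisson (v s) (g s) - 1)" by (simp add: algebra_simps)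
  hence "\<bar>?f' s\<bar> = \<bar>l\<bar> * \<bar>poisson v' (g s) / poisson (v s) (g s) - 1\<bar>" by (simp only: abs_mult)
  also have "... <= \<bar>l\<bar> * (12 * cmod (v' - v s) / (1 - r) ^ 3)"
   by (intro mult_left_mono poisson_ratio v s r) auto
  also have "... <= \<bar>l\<bar> * (12 * eps / (1 - r) ^ 3)"
   using v(2)[OF s] r by (intro mult_left_mono divide_right_mono) auto
  finally show "norm (?f' s) <= ?B" by (simp add: mult_ac)
 qed (use h in auto)
 thus ?thesis using h by (simp add: algebra_simps)
qed

lemma second_order_difference:
 fixes a b d :: complex
 shows "2 * (- b * d - b\<^sup>2 * d\<^sup>2 / 2) - 2 * (- a * d - a\<^sup>2 * d\<^sup>2 / 2) = 2 * (a - b) * d + (a\<^sup>2 - b\<^sup>2) * d\<^sup>2"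
 by (simp add: field_simps)

lemma Im_double_diff: "2 * Im x - 2 * Im y = Im (2 * x - 2 * y)"
 by simp

lemma Im_eq_Re: "q = \<i> * (a * x) ==> Im (- a * x) = Re q"
 by simp

lemma abs_Im_sum_le: "\<bar>Im (a * x + b * y^2)\<bar> <= cmod a * cmod x + cmod b * (cmod y)^2"
proof -
 have "\<bar>Im (a * x + b * y^2)\<bar> <= cmod (a * x + b * y^2)" by (rule abs_Im_le_cmod)
 also have "... <= cmod (a * x) + cmod (b * y^2)" by (rule norm_triangle_ineq)
 finally show ?thesis by (simp only: norm_mult norm_power)
qed

lemma split_increment:
 fixes a b c x r :: complex
 shows "2 * (a - b) * (c * x + r) = - (2 * c * b - 2 * c * a) * x + 2 * (a - b) * r"
 by (simp add: algebra_simps)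

lemma cis_measurable [measurable]: "cis \<in> borel_measurable borel"
 by (intro borel_measurable_continuous_onI continuous_intros)

text \<open>The flow \<open>gamma\<close> is given by a differential equation and need not be adapted; \<open>\<Gamma>\<close> is an adapted version.\<close>

locale carousel_path = disk_bm M F X Xi m V J
 for M :: "'w measure" and F X Xi m V J +
 fixes l :: real and gamma \<Gamma> :: "real => 'w => real"
 assumes \<Gamma>_adapted: "!!t. 0 <= t ==> \<Gamma> t \<in> borel_measurable (F t)"
  and \<Gamma>_eq: "!!t. 0 <= t ==> AE w in M. \<Gamma> t w = gamma t w"
  and gamma_0: "AE w in M. gamma 0 w = 0"
  and gamma_ode: "AE w in M. \<forall>t\<ge>0. ((%s. gamma s w) has_real_derivative l / poisson (V t w) (gamma t w)) (at t within {0..})"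
begin

definition Y :: "real => 'w => real" where
 "Y t w = angle (V t w) (\<Gamma> t w) - angle (V t w) 0"

text \<open>The noise as seen in the frame in which the boundary point \<open>1\<close> has angle \<open>0\<close>.\<close>

definition rho :: "real => 'w => complex" where
 "rho t w = \<i> * cis (- angle (V t w) 0)"

definition b :: "real => 'w => complex" where
 "b t w = cis (- \<Gamma> t w) / (1 - V t w * cis (- \<Gamma> t w))"

definition b0 :: "real => 'w => complex" where
 "b0 t w = cis (- 0) / (1 - V t w * cis (- 0))"

text \<open>The second order part of the increment of \<open>Y\<close>: the error of the Euler step of \<open>V\<close> and the square of \<open>dV\<close>, both with
 coefficients of the past.\<close>

definition S :: "real => real => 'w => real" where
 "S h t w = Im (2 * (b0 t w - b t w) * R t (t + h) w + ((b0 t w)^2 - (b t w)^2) * (dV t (t + h) w)^2)"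

definition rem :: "real => real => 'w => real" where
 "rem h t w = Y (t + h) w - Y t w - l * h - Re ((cis (- Y t w) - 1) * (rho t w * dX t (t + h) w)) - S h t w"

lemma Y_adapted: "0 <= t ==> Y t \<in> borel_measurable (F t)"
 unfolding Y_def using V_adapted[of t] \<Gamma>_adapted[of t] V_disk[of t]
 by (intro borel_measurable_diff borel_measurable_angle) auto

lemma rho_adapted: "0 <= t ==> rho t \<in> borel_measurable (F t)"
proof -
 assume "0 <= t"
 hence [measurable]: "(%w. angle (V t w) 0) \<in> borel_measurable (F t)"
  using V_adapted[of t] V_disk[of t] by (intro borel_measurable_angle) auto
 show ?thesis unfolding rho_def by measurable
qed

lemma cmod_rho: "cmod (rho t w) = 1"
 by (simp add: rho_def norm_mult)

lemma b_adapted: "0 <= t ==> b t \<in> borel_measurable (F t)" "0 <= t ==> b0 t \<in> borel_measurable (F t)"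
proof -
 assume "0 <= t"
 note [measurable] = V_adapted[OF this] \<Gamma>_adapted[OF this]
 show "b t \<in> borel_measurable (F t)" "b0 t \<in> borel_measurable (F t)" unfolding b_def b0_def by measurable
qed

lemma Y_0: "AE w in M. Y 0 w = 0"
 using gamma_0 \<Gamma>_eq[OF order.refl] by eventually_elim (simp add: Y_def)

text \<open>The increment of \<open>Y\<close> splits into the motion of the boundary point with the center fixed (\<open>angle_flow\<close>) and the motion of the
 center with the point fixed, for this point and for \<open>1\<close> (\<open>angle_expansion\<close>).\<close>

lemma rem_bound:
 assumes r: "0 < r" "r < 1" and eps: "0 < eps" and h: "0 < h" "h < d" and t: "0 <= t"
 shows "AE w in M. w \<in> good r eps d (t + h) -->
  \<bar>rem h t w\<bar> <= (12 * \<bar>l\<bar> * eps * h + 4 * eps * (cmod (dV t (t + h) w))^2) / (1 - r) ^ 3 & cmod (dV t (t + h) w) <= eps"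
proof -
 have th: "0 <= t + h" using t h by simp
 show ?thesis
  using V_cont \<Gamma>_eq[OF t] \<Gamma>_eq[OF th] gamma_ode AE_space
 proof eventually_elim
  case (elim w)
  show ?case
  proof
   assume g: "w \<in> good r eps d (t + h)"
   let ?v = "V t w" and ?v' = "V (t + h) w" and ?g = "gamma t w" and ?D = "dV t (t + h) w" and ?B = "(1 - r) ^ 3"
   have rad: "cmod (V s w) <= r" if "0 <= s" "s <= t + h" for s by (rule good_radius[OF elim(1) g that])
   have v: "cmod ?v <= r" "cmod ?v' <= r" using rad t h by auto
   have v1: "cmod ?v < 1" using V_disk[OF t elim(5)] .
   have D: "cmod ?D <= eps" unfolding dV_def using t h by (intro good_modulus[OF elim(1) g]) auto
   have flow: "\<bar>angle ?v' (gamma (t + h) w) - angle ?v' ?g - l * h\<bar> <= 12 * \<bar>l\<bar> * eps * h / ?B"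
   proof (rule angle_flow[where v="%s. V s w"])
    fix s assume s: "s \<in> {t..t+h}"
    show "cmod (V s w) <= r" using rad s t by auto
    show "cmod (?v' - V s w) <= eps" using s t h by (intro good_modulus[OF elim(1) g]) auto
    show "((%s. gamma s w) has_real_derivative l / poisson (V s w) (gamma s w)) (at s within {t..t+h})"
    proof -
     have s0: "0 <= s" using s t by auto
     show ?thesis by (rule DERIV_subset[OF elim(4)[rule_format, OF s0]]) (use t in auto)
    qed
   qed (use h r v in auto)
   let ?q = "%B. - B * ?D - B\<^sup>2 * ?D\<^sup>2 / 2"
   define B1 where "B1 = cis (- ?g) / (1 - ?v * cis (- ?g))"
   define B0 where "B0 = cis (- 0) / (1 - ?v * cis (- 0))"
   have bb: "b t w = B1" "b0 t w = B0" using elim(2) by (simp_all add: b_def b0_def B1_def B0_def)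
   have e1: "\<bar>angle ?v' ?g - angle ?v ?g - 2 * Im (?q B1)\<bar> <= 2 * (cmod ?D) ^ 3 / ?B"
    unfolding B1_def dV_def by (rule angle_expansion[OF v r(2)])
   have e0: "\<bar>angle ?v' 0 - angle ?v 0 - 2 * Im (?q B0)\<bar> <= 2 * (cmod ?D) ^ 3 / ?B"
    unfolding B0_def dV_def by (rule angle_expansion[OF v r(2)])
   let ?H = "H t w" and ?R = "R t (t + h) w" and ?X = "dX t (t + h) w"
   have c1: "2 * ?H * B1 = cis (- angle ?v ?g) + cnj ?v" "2 * ?H * B0 = cis (- angle ?v 0) + cnj ?v"
   proof -
    have H2: "2 * ?H = Cx (1 - (cmod ?v)^2)" by (simp add: H_def)
    show "2 * ?H * B1 = cis (- angle ?v ?g) + cnj ?v" "2 * ?H * B0 = cis (- angle ?v 0) + cnj ?v"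
     unfolding H2 cis_minus_angle[OF v1] B1_def B0_def by (simp_all only: times_divide_eq_right mult.commute)
   qed
   have DR: "?D = ?H * ?X + ?R" by (simp add: R_def)
   have "2 * Im (?q B1) - 2 * Im (?q B0)
    = Im (- (2 * ?H * B1 - 2 * ?H * B0) * ?X) + S h t w"
   proof -
    have "2 * Im (?q B1) - 2 * Im (?q B0)
     = Im (2 * (?q B1) - 2 * (?q B0))" by (rule Im_double_diff)
    also have "2 * (?q B1) - 2 * (?q B0)
     = 2 * (B0 - B1) * ?D + (B0^2 - B1^2) * ?D^2" by (rule second_order_difference)
    also have "2 * (B0 - B1) * ?D = - (2 * ?H * B1 - 2 * ?H * B0) * ?X + 2 * (B0 - B1) * ?R"
     by (subst DR) (rule split_increment)
    finally show ?thesis by (simp only: S_def bb plus_complex.sel add.assoc)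
   qed
   also have "2 * ?H * B1 - 2 * ?H * B0 = cis (- angle ?v ?g) - cis (- angle ?v 0)" unfolding c1 by simp
   also have "Im (- (cis (- angle ?v ?g) - cis (- angle ?v 0)) * ?X) = Re ((cis (- Y t w) - 1) * (rho t w * ?X))"
   proof -
    have "cis (- Y t w) * cis (- angle ?v 0) = cis (- angle ?v ?g)"
     unfolding cis_mult using elim(2) by (simp add: Y_def)
    hence "(cis (- Y t w) - 1) * (rho t w * ?X) = \<i> * ((cis (- angle ?v ?g) - cis (- angle ?v 0)) * ?X)"
     by (simp add: rho_def algebra_simps)
    thus ?thesis by (rule Im_eq_Re)
   qed
   finally have main: "2 * Im (?q B1) - 2 * Im (?q B0)
    = Re ((cis (- Y t w) - 1) * (rho t w * ?X)) + S h t w" .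
   have "rem h t w = (angle ?v' (gamma (t + h) w) - angle ?v' ?g - l * h)
     + (angle ?v' ?g - angle ?v ?g - 2 * Im (?q B1))
     - (angle ?v' 0 - angle ?v 0 - 2 * Im (?q B0))"
    using main elim(2,3) unfolding rem_def by (simp add: Y_def)
   hence "\<bar>rem h t w\<bar> <= 12 * \<bar>l\<bar> * eps * h / ?B + 2 * (cmod ?D) ^ 3 / ?B + 2 * (cmod ?D) ^ 3 / ?B"
    using flow e1 e0 by linarith
   also have "... = (12 * \<bar>l\<bar> * eps * h + 4 * (cmod ?D) ^ 3) / ?B" by (simp add: add_divide_distrib)
   also have "... <= (12 * \<bar>l\<bar> * eps * h + 4 * eps * (cmod ?D)^2) / ?B"
   proof (rule divide_right_mono)
    have "(cmod ?D) ^ 3 <= eps * (cmod ?D)^2"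
     using mult_right_mono[OF D, of "(cmod ?D)^2"] by (simp add: power3_eq_cube power2_eq_square)
    thus "12 * \<bar>l\<bar> * eps * h + 4 * (cmod ?D) ^ 3 <= 12 * \<bar>l\<bar> * eps * h + 4 * eps * (cmod ?D)^2" by simp
   qed (use r in simp)
   finally show "\<bar>rem h t w\<bar> <= (12 * \<bar>l\<bar> * eps * h + 4 * eps * (cmod ?D)^2) / ?B & cmod ?D <= eps" using D by blast
  qed
 qed
qed

lemma b_bound:
 assumes "cmod (V t w) <= r" "r < 1"
 shows "cmod (b t w) <= 1 / (1 - r)" "cmod (b0 t w) <= 1 / (1 - r)"
proof -
 have "1 - r <= cmod (1 - V t w * cis x)" for x
  using norm_triangle_ineq2[of 1 "V t w * cis x"] assms by (simp add: norm_mult)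
 note le = this
 have "1 / cmod (1 - V t w * cis x) <= 1 / (1 - r)" for x
 proof (rule divide_left_mono[OF le])
  have "0 < cmod (1 - V t w * cis x)" using less_le_trans[OF _ le[of x], of 0] assms by simp
  thus "0 < cmod (1 - V t w * cis x) * (1 - r)" using assms by simp
 qed simp
 from this[of "- \<Gamma> t w"] this[of "- 0"] show "cmod (b t w) <= 1 / (1 - r)" "cmod (b0 t w) <= 1 / (1 - r)"
  by (simp_all add: b_def b0_def norm_divide)
qed

text \<open>On \<open>good\<close> the bound on \<open>V t\<close> at the time \<open>t\<close> itself holds only for continuous paths; here it holds everywhere.\<close>

definition core :: "real => real => real => real => 'w set" where
 "core r eps d t = good r eps d t Int {w\<in>space M. cmod (V t w) <= r}"

lemma core_sets: "0 <= t ==> core r eps d t \<in> sets (F t)"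
proof -
 assume t: "0 <= t"
 have "{w\<in>space (F t). cmod (V t w) <= r} \<in> sets (F t)"
  using V_adapted[OF t] by measurable
 thus ?thesis unfolding core_def space_F by (intro sets.Int good_sets[OF t])
qed

lemma core_AE: "0 <= t ==> AE w in M. indicator (good r eps d t) w = (indicator (core r eps d t) w :: real)"
 using V_cont AE_space
proof eventually_elim
 case (elim w)
 thus ?case using good_radius[OF elim(2), of r eps d t t] by (auto simp: core_def indicator_def)
qed

lemma S_bound:
 assumes r: "0 < r" "r < 1" and w: "w \<in> core r eps d t"
 shows "cmod (2 * (b0 t w - b t w)) <= 4 / (1 - r)^2" "cmod ((b0 t w)^2 - (b t w)^2) <= 2 / (1 - r)^2"
proof -
 have v: "cmod (V t w) <= r" using w by (simp add: core_def)
 note bb = b_bound[OF v r(2)]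
 have "(1 - r)^2 <= 1 - r" using r by (simp add: power2_eq_square)
 hence "1 / (1 - r) <= 1 / (1 - r)^2" using r by (intro divide_left_mono mult_pos_pos) auto
 moreover have "cmod (2 * (b0 t w - b t w)) <= 2 * (cmod (b0 t w) + cmod (b t w))"
  using norm_triangle_ineq4[of "b0 t w" "b t w"] unfolding norm_mult by simp
 ultimately show "cmod (2 * (b0 t w - b t w)) <= 4 / (1 - r)^2" using bb by simp
 have "(cmod (b0 t w))^2 <= (1 / (1 - r))^2" "(cmod (b t w))^2 <= (1 / (1 - r))^2"
  by (intro power_mono bb; simp)+
 moreover have "cmod ((b0 t w)^2 - (b t w)^2) <= (cmod (b0 t w))^2 + (cmod (b t w))^2"
  using norm_triangle_ineq4[of "(b0 t w)^2" "(b t w)^2"] by (simp add: norm_power)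
 ultimately show "cmod ((b0 t w)^2 - (b t w)^2) <= 2 / (1 - r)^2" by (simp add: power_divide)
qed

text \<open>Conditionally on the past \<open>R\<close> is centred and the square of \<open>dV\<close> is almost centred (\<open>dV_square_mean\<close>).\<close>

lemma S_estimates:
 assumes r: "0 < r" "r < 1" and t: "0 <= t" and h: "0 < h"
 shows "S h t \<in> borel_measurable M"
  "integrable M (%w. indicator (good r eps d t) w * (S h t w)^2)"
  "mean (%w. indicator (good r eps d t) w * (S h t w)^2) <= 664 * h^2 / (1 - r) ^ 4"
  "[|g \<in> borel_measurable (F t); !!w. w \<in> space M ==> \<bar>g w\<bar> <= 1|] ==>
   mean (%w. indicator (good r eps d t) w * g w * S h t w) <= 12 * h * sqrt h / (1 - r)^2"
proof -
 have th: "t <= t + h" "t < t + h" and th0: "0 <= t + h" using t h by auto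
 let ?A = "good r eps d t" and ?C = "core r eps d t" and ?R = "R t (t + h)" and ?D = "dV t (t + h)"
 define K where "K = 1 / (1 - r)^2"
 have K: "K > 0" using r by (simp add: K_def)
 note [measurable] = R_meas[OF t th(1)] dV_meas[OF t th(1)] measurable_F_M[OF b_adapted(1)[OF t]] measurable_F_M[OF b_adapted(2)[OF t]]
 have AM[measurable]: "?A \<in> sets M" "?C \<in> sets M" using sets_FM[OF good_sets[OF t]] sets_FM[OF core_sets[OF t]] by auto
 show SM[measurable]: "S h t \<in> borel_measurable M" unfolding S_def by measurable
 let ?B = "%w. K^2 * (32 * (cmod (?R w))^2 + 8 * (cmod (?D w)) ^ 4)"
 have Bi: "integrable M ?B" using R_sq(1)[OF t th(1)] dV_power_integrable[OF t th(1), of 4] by simp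
 have SB: "indicator ?C w * (S h t w)^2 <= ?B w" for w
 proof (cases "w \<in> ?C")
  case True
  let ?r = "cmod (?R w)" and ?d = "(cmod (?D w))^2"
  have "\<bar>S h t w\<bar> <= cmod (2 * (b0 t w - b t w)) * ?r + cmod ((b0 t w)^2 - (b t w)^2) * ?d"
   unfolding S_def
   by (rule abs_Im_sum_le)
  also have "... <= 4 * K * ?r + 2 * K * ?d"
   using S_bound[OF r True] by (intro add_mono mult_right_mono) (auto simp: K_def)
  finally have "\<bar>S h t w\<bar>^2 <= (4 * K * ?r + 2 * K * ?d)^2" by (intro power_mono) auto
  also have "... <= 2 * (4 * K * ?r)^2 + 2 * (2 * K * ?d)^2"
   using sum_squares_bound[of "4 * K * ?r" "2 * K * ?d"] by (simp add: power2_sum)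
  also have "... = ?B w" by (simp add: power_mult_distrib algebra_simps flip: power_mult)
  finally show ?thesis using True by simp
 next
  case False
  thus ?thesis by simp
 qed
 have Ci: "integrable M (%w. indicator ?C w * (S h t w)^2)"
  by (rule integrable_bound[OF Bi]) (use SB in \<open>auto intro!: AE_I2 order_trans[OF SB]\<close>)
 have ae: "AE w in M. indicator ?A w * (S h t w)^2 = indicator ?C w * (S h t w)^2"
  using core_AE[OF t, of r eps d] by eventually_elim simp
 show "integrable M (%w. indicator ?A w * (S h t w)^2)"
 proof (rule integrable_cong_AE_imp[OF Ci])
  show "AE w in M. indicator ?C w * (S h t w)^2 = indicator ?A w * (S h t w)^2"
   using ae by eventually_elim (rule sym)
 qed measurable
 have "mean (%w. indicator ?A w * (S h t w)^2) = mean (%w. indicator ?C w * (S h t w)^2)"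
  by (rule integral_cong_AE) (use ae in auto)
 also have "... <= mean ?B" by (rule integral_mono[OF Ci Bi SB])
 also have "... = K^2 * (32 * mean (%w. (cmod (?R w))^2) + 8 * mean (%w. (cmod (?D w)) ^ 4))"
  using R_sq(1)[OF t th(1)] dV_power_integrable[OF t th(1), of 4] by simp
 also have "... <= K^2 * (32 * (4 * h^2) + 8 * (67 * h^2))"
  using R_sq(2)[OF t th(1)] dV_fourth[OF t th(1)] by (intro mult_left_mono add_mono) auto
 also have "... = 664 * h^2 / (1 - r) ^ 4" by (simp add: K_def power_divide flip: power_mult)
 finally show "mean (%w. indicator ?A w * (S h t w)^2) <= 664 * h^2 / (1 - r) ^ 4" .
 assume g: "g \<in> borel_measurable (F t)" "!!w. w \<in> space M ==> \<bar>g w\<bar> <= 1"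
 let ?c1 = "%w. Cx (indicator ?C w * g w) * (2 * (b0 t w - b t w))"
 let ?c2 = "%w. Cx (indicator ?C w * g w) * ((b0 t w)^2 - (b t w)^2)"
 have CF[measurable]: "?C \<in> sets (F t)" by (rule core_sets[OF t])
 have cb: "cmod (?c1 w) <= 4 * K" "cmod (?c2 w) <= 2 * K" if w: "w \<in> space M" for w
 proof -
  have gw: "\<bar>g w\<bar> <= 1" by (rule g(2)[OF w])
  have "cmod (?c1 w) <= 4 * K & cmod (?c2 w) <= 2 * K"
  proof (cases "w \<in> ?C")
   case True
   have "\<bar>g w\<bar> * cmod (2 * (b0 t w - b t w)) <= 1 * (4 * K)" "\<bar>g w\<bar> * cmod ((b0 t w)^2 - (b t w)^2) <= 1 * (2 * K)"
    using S_bound[OF r True] by (intro mult_mono gw; simp add: K_def)+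
   thus ?thesis using True unfolding norm_mult[of "Cx _"] norm_of_real by simp
  qed (use K in simp)
  thus "cmod (?c1 w) <= 4 * K" "cmod (?c2 w) <= 2 * K" by auto
 qed
 have c1: "bdd_meas t ?c1" and c2: "bdd_meas t ?c2"
 proof -
  note [measurable] = b_adapted[OF t] g(1)
  have "?c1 \<in> borel_measurable (F t)" "?c2 \<in> borel_measurable (F t)" by measurable
  thus "bdd_meas t ?c1" "bdd_meas t ?c2" unfolding bdd_meas_def using cb by blast+
 qed
 have D2i: "integrable M (%w. (?D w)^2)"
  by (rule integrable_bound[OF dV_power_integrable[OF t th(1), of 2]]) (auto simp: norm_power)
 note i1 = R_mean[OF t th(1) c1]
 note i2 = bdd_meas_integrable_mult[OF c2 D2i]
 have e: "indicator ?C w * g w * S h t w = Im (?c1 w * ?R w + ?c2 w * (?D w)^2)" for w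
 proof -
  have "?c1 w * ?R w + ?c2 w * (?D w)^2 = Cx (indicator ?C w * g w) * (2 * (b0 t w - b t w) * ?R w + ((b0 t w)^2 - (b t w)^2) * (?D w)^2)"
   by (simp only: distrib_left mult.assoc)
  thus ?thesis unfolding S_def by (simp only: Im_complex_of_real Re_complex_of_real times_complex.simps)
 qed
 have gM[measurable]: "g \<in> borel_measurable M" by (rule measurable_F_M[OF g(1)])
 have ae': "AE w in M. indicator ?A w * g w * S h t w = indicator ?C w * g w * S h t w"
  using core_AE[OF t, of r eps d] by eventually_elim simp
 have "mean (%w. indicator ?A w * g w * S h t w) = mean (%w. indicator ?C w * g w * S h t w)"
  by (rule integral_cong_AE) (use ae' in auto)
 also have "... = Im (mean (%w. ?c1 w * ?R w + ?c2 w * (?D w)^2))"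
  unfolding e using i1(1) i2 by (intro integral_Im integrable_add)
 also have "... = Im (mean (%w. ?c2 w * (?D w)^2))"
  using i1 i2 by (subst integral_add) auto
 also have "... <= cmod (mean (%w. ?c2 w * (?D w)^2))" using abs_Im_le_cmod abs_le_D1 by blast
 also have "... <= 2 * K * (6 * (t + h - t) * sqrt (t + h - t))"
  by (rule dV_square_mean[OF t th(2) c2 cb(2)])
 also have "... = 12 * h * sqrt h / (1 - r)^2" by (simp add: K_def)
 finally show "mean (%w. indicator ?A w * g w * S h t w) <= 12 * h * sqrt h / (1 - r)^2" .
qed

end

text \<open>The diffusion coefficient of relative angles: it vanishes where the two angles agree.\<close>

definition \<sigma>\<^sub>0 :: "real => complex" where "\<sigma>\<^sub>0 x = cis (- x) - 1"

lemma \<sigma>\<^sub>0_measurable [measurable]: "\<sigma>\<^sub>0 \<in> borel_measurable borel"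
 unfolding \<sigma>\<^sub>0_def by (intro borel_measurable_continuous_onI continuous_intros)

text \<open>The left-hand side is at most \<open>4\<close> and at most the square of \<open>x - y\<close>.\<close>

lemma cmod_cis_diff_sq: "(cmod (cis x - cis y))^2 <= 5 * eta (x - y)"
proof -
 let ?e = "x - y"
 have sq: "(cmod (cis x - cis y))^2 = 2 - 2 * cos ?e"
 proof -
  have "(cmod (cis x - cis y))^2 = (cos x - cos y)^2 + (sin x - sin y)^2" by (simp add: cmod_power2)
  also have "... = ((cos x)^2 + (sin x)^2) + ((cos y)^2 + (sin y)^2) - 2 * (cos x * cos y + sin x * sin y)"
   by (simp add: power2_eq_square algebra_simps)
  finally show ?thesis by (simp add: cos_diff)
 qed
 have a: "2 - 2 * cos ?e <= 4" using cos_ge_minus_one[of ?e] by linarith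
 have b: "2 - 2 * cos ?e <= ?e^2"
 proof -
  have "2 - 2 * cos ?e = (2 * sin (?e / 2))^2"
  proof -
   have "2 * (?e / 2) = ?e" by simp
   hence "cos ?e = 1 - 2 * (sin (?e / 2))^2" using cos_double_sin[of "?e / 2"] by metis
   thus ?thesis by (simp only: power_mult_distrib) simp
  qed
  also have "... = \<bar>2 * sin (?e / 2)\<bar>^2" by simp
  also have "... <= \<bar>?e\<bar>^2" using abs_sin_x_le_abs_x[of "?e / 2"] by (intro power_mono) (auto simp: abs_mult)
  finally show ?thesis by simp
 qed
 have pos: "0 < 1 + ?e^2" using zero_le_power2[of ?e] by linarith
 have "(2 - 2 * cos ?e) * (1 + ?e^2) <= 5 * ?e^2"
 proof -
  have "(2 - 2 * cos ?e) * ?e^2 <= 4 * ?e^2" by (intro mult_right_mono a) simp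
  thus ?thesis using b by (simp add: algebra_simps)
 qed
 thus ?thesis unfolding sq eta_def using pos by (simp add: le_divide_eq)
qed

lemma \<sigma>\<^sub>0_lipschitz: "(cmod (\<sigma>\<^sub>0 x - \<sigma>\<^sub>0 y))^2 <= 5 * eta (x - y)"
proof -
 have "eta (- x - - y) = eta (x - y)" unfolding eta_def by (simp add: power2_commute)
 thus ?thesis using cmod_cis_diff_sq[of "- x" "- y"] by (simp add: \<sigma>\<^sub>0_def)
qed

context noise
begin

abbreviation expandable :: "real => real => (real => complex) => (real => 'w => complex) => (real => 'w => real) => real => bool" where
 "expandable T l \<sigma> rho Y eps \<equiv> \<exists>h0>0. ALL h. 0 < h & h < h0 --> (EX A S r. local_expansion T l \<sigma> rho Y eps h A S r)"

abbreviation euler_value :: "(real => complex) => real => (real => 'w => complex) => real => nat => 'w => real" where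
 "euler_value \<sigma> l rho T n w \<equiv> euler \<sigma> (l * (T / real (Suc n))) (%k. drive rho (T / real (Suc n)) k w) (Suc n)"

lemma scheme_converges:
 assumes T: "T > 0"
  and rho: "!!t. 0 <= t ==> rho t \<in> borel_measurable (F t)" "!!t w. 0 <= t ==> w \<in> space M ==> cmod (rho t w) = 1"
  and \<sigma>: "\<sigma> \<in> borel_measurable borel" "!!x y. (cmod (\<sigma> x - \<sigma> y))^2 <= L * eta (x - y)" "0 <= L"
  and Y: "!!t. 0 <= t ==> Y t \<in> borel_measurable (F t)" "AE w in M. Y 0 w = 0"
  and loc: "!!eps. 0 < eps ==> eps <= 1 ==> expandable T l \<sigma> rho Y eps"
 shows "(%n. mean (%w. eta (Y T w - euler_value \<sigma> l rho T n w))) ----> 0"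
proof (rule LIMSEQ_I)
 fix e :: real assume e: "0 < e"
 let ?E = "%n. mean (%w. eta (Y T w - euler_value \<sigma> l rho T n w))"
 define Q where "Q = 8 * T * exp (3 * L * T) + 1"
 have Q: "Q > 0" using T by (simp add: Q_def add_pos_pos)
 define eps where "eps = min 1 (e / (2 * Q))"
 have eps: "0 < eps" "eps <= 1" "eps * Q < e"
 proof -
  have "eps * Q <= e / (2 * Q) * Q" using Q by (intro mult_right_mono) (auto simp: eps_def)
  also have "... < e" using Q e by simp
  finally show "eps * Q < e" .
 qed (use e Q in \<open>auto simp: eps_def\<close>)
 obtain h0 where h0: "h0 > 0" "!!h. 0 < h ==> h < h0 ==> EX A S r. local_expansion T l \<sigma> rho Y eps h A S r"
  using loc[OF eps(1,2)] by blast
 obtain N where N: "T / h0 < real N" using reals_Archimedean2 by blast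
 show "EX N. \<forall>n\<ge>N. norm (?E n - 0) < e"
 proof (intro exI allI impI)
  fix n assume n: "N <= n"
  let ?h = "T / real (Suc n)"
  have h: "?h > 0" "real (Suc n) * ?h = T" using T by auto
  have "T / h0 < real (Suc n)" using N n by simp
  hence "?h < h0" using h0(1) T by (simp add: divide_less_eq mult.commute)
  then obtain A S r where "local_expansion T l \<sigma> rho Y eps ?h A S r" using h0(2)[OF h(1)] by blast
  note err = scheme_error[where rho=rho and \<sigma>=\<sigma> and Y=Y, OF h rho \<sigma> Y less_imp_le[OF eps(1)] this]
  have "0 <= ?E n" by (rule integral_nonneg) (rule eta_bounds)
  moreover have "?E n < e" using err eps(3) unfolding Q_def by linarith
  ultimately show "norm (?E n - 0) < e" by simp
 qed
qed

end

context carousel_path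
begin

text \<open>The localization radius \<open>r\<close> depends on the allowed error only; then the modulus of continuity and finally the step are
 chosen small relative to powers of \<open>1 - r\<close>.\<close>

lemma local_expansion_exists:
 assumes T: "0 <= T" and eps0: "0 < eps0" "eps0 <= 1"
 shows "expandable T l \<sigma>\<^sub>0 rho Y eps0"
proof -
 obtain r where r: "0 < r" "r < 1" and gl: "!!eps. eps > 0 ==> \<exists>d>0. prob (good r eps d T) \<ge> 1 - eps0"
  using good_likely[OF T eps0(1)] by blast
 define B where "B = (1 - r) ^ 3"
 have B: "0 < B" "B <= 1" using r by (auto simp: B_def intro!: power_le_one)
 \<comment> \<open>turns the bound of \<open>rem_bound\<close>, with \<open>h\<close> for the square of \<open>dV\<close>, into \<open>eps0 * h\<close>\<close>
 define eps where "eps = eps0 * B / (12 * \<bar>l\<bar> + 4)"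
 have eps: "0 < eps" "(12 * \<bar>l\<bar> + 4) * eps / B = eps0"
  using B eps0 by (auto simp: eps_def intro!: divide_pos_pos mult_pos_pos add_nonneg_pos)
 have eps1: "eps <= 1"
 proof -
  have "eps <= eps0 * B / 4" unfolding eps_def using B eps0 by (intro divide_left_mono) auto
  also have "eps0 * B <= 1" using B eps0 by (simp add: mult_le_one)
  finally show ?thesis by simp
 qed
 obtain d where d: "d > 0" "prob (good r eps d T) \<ge> 1 - eps0" using gl[OF eps(1)] by blast
 define h0 where "h0 = min (min 1 d) (min (eps0 * (1 - r) ^ 4 / 664) ((eps0 * (1 - r)^2 / 12)^2))"
 have h0: "h0 > 0" using r d eps0 by (simp add: h0_def)
 have "local_expansion T l \<sigma>\<^sub>0 rho Y eps0 h (good r eps d) (S h) (rem h)" if h: "0 < h" "h < h0" for h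
 proof -
  have hh: "h < d" "h <= 1" "664 * h <= eps0 * (1 - r) ^ 4" "h <= (eps0 * (1 - r)^2 / 12)^2"
   using h unfolding h0_def by auto
  have sq: "12 * sqrt h <= eps0 * (1 - r)^2"
  proof -
   have "sqrt h <= eps0 * (1 - r)^2 / 12" using hh(4) eps0 by (intro real_le_lsqrt) auto
   thus ?thesis by simp
  qed
  have "local_step l \<sigma>\<^sub>0 rho Y eps0 h t (good r eps d t) (good r eps d (t + h)) (S h t) (rem h t)" if t: "0 <= t" for t
  proof -
   have th: "0 <= t + h" "t <= t + h" using t h by auto
   note SE = S_estimates(1)[OF r t h(1)] S_estimates(2-4)[OF r t h(1), where eps=eps and d=d]
   note [measurable] = SE(1) measurable_F_M[OF Y_adapted[OF t]] measurable_F_M[OF Y_adapted[OF th(1)]] measurable_F_M[OF rho_adapted[OF t]]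
    X_meas[OF t] X_meas[OF th(1)] dV_meas[OF t th(2)] sets_FM[OF good_sets[OF th(1)]]
   have [measurable]: "rem h t \<in> borel_measurable M" unfolding rem_def by measurable
   let ?I = "indicat_real (good r eps d (t + h))" and ?b = "%x. (12 * \<bar>l\<bar> * eps * h + 4 * eps * x) / B"
   let ?D = "%w. (cmod (dV t (t + h) w))^2"
   have rb: "AE w in M. w \<in> good r eps d (t + h) --> \<bar>rem h t w\<bar> <= ?b (?D w) & \<bar>rem h t w\<bar> <= 1"
    using rem_bound[OF r eps(1) h(1) hh(1) t, folded B_def]
   proof eventually_elim
    case (elim w)
    show ?case
    proof
     assume "w \<in> good r eps d (t + h)"
     hence *: "\<bar>rem h t w\<bar> <= ?b (?D w)" "cmod (dV t (t + h) w) <= eps" using elim by auto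
     have "?b (?D w) <= (12 * \<bar>l\<bar> * eps * 1 + 4 * eps * 1) / B"
      using hh(2) eps(1) B *(2) eps1 by (intro divide_right_mono add_mono mult_left_mono) (auto simp: power_le_one)
     also have "... = eps0" unfolding eps(2)[symmetric] by (simp add: algebra_simps)
     finally show "\<bar>rem h t w\<bar> <= ?b (?D w) & \<bar>rem h t w\<bar> <= 1" using * eps0 by simp
    qed
   qed
   have small: "small_on (good r eps d (t + h)) (%w. \<bar>rem h t w\<bar>) (eps0 * h)"
   proof -
    note Di = dV_power_integrable[OF t th(2), of 2]
    have b: "AE w in M. ?I w * \<bar>rem h t w\<bar> <= ?b (?D w)"
     using rb by eventually_elim (use eps h B in \<open>simp add: indicator_def\<close>)
    have i: "integrable M (%w. ?I w * \<bar>rem h t w\<bar>)"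
     using rb by (intro integrable_const_bound[where B=1]) (auto simp: indicator_def)
    have "mean (%w. ?I w * \<bar>rem h t w\<bar>) <= mean (%w. ?b (?D w))"
     using Di by (intro integral_mono_AE i b) auto
    also have "... = ?b (mean ?D)" using Di by (simp add: prob_space)
    also have "... <= ?b h" using dV_sq[OF t th(2)] eps(1) B by (intro divide_right_mono add_left_mono mult_left_mono) auto
    also have "?b h = eps0 * h" unfolding eps(2)[symmetric] by (simp add: algebra_simps)
    finally show ?thesis unfolding small_on_def using i by blast
   qed
   have s1: "mean (%w. indicator (good r eps d t) w * (S h t w)^2) <= eps0 * h"
   proof -
    have "664 * h^2 / (1 - r) ^ 4 = (664 * h) * h / (1 - r) ^ 4" by (simp add: power2_eq_square)
    also have "... <= (eps0 * (1 - r) ^ 4) * h / (1 - r) ^ 4" using hh(3) h r by (intro divide_right_mono mult_right_mono) auto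
    also have "... = eps0 * h" using r by simp
    finally show ?thesis using SE(3) by linarith
   qed
   have s2: "mean (%w. indicator (good r eps d t) w * g w * S h t w) <= eps0 * h"
    if "g \<in> borel_measurable (F t)" "\<forall>w\<in>space M. \<bar>g w\<bar> <= 1" for g
   proof -
    have "12 * h * sqrt h / (1 - r)^2 = (12 * sqrt h) * h / (1 - r)^2" by simp
    also have "... <= (eps0 * (1 - r)^2) * h / (1 - r)^2" using sq h r by (intro divide_right_mono mult_right_mono) auto
    also have "... = eps0 * h" using r by simp
    finally show ?thesis using SE(4)[OF that(1)] that(2) by fastforce
   qed
   have "AE w in M. w \<in> good r eps d (t + h) -->
    Y (t + h) w = Y t w + l * h + Re (\<sigma>\<^sub>0 (Y t w) * (rho t w * dX t (t + h) w)) + S h t w + rem h t w & \<bar>rem h t w\<bar> <= 1"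
    using rb by eventually_elim (simp add: rem_def \<sigma>\<^sub>0_def)
   thus ?thesis unfolding local_step_def using SE(1,2) small s1 s2 by (simp only: small_on_def) blast
  qed
  thus ?thesis unfolding local_expansion_def
  proof (intro conjI allI impI)
   show "good r eps d t \<in> sets (F t)" if "0 <= t & t <= T" for t using good_sets that by blast
   show "good r eps d t \<subseteq> good r eps d s" if "0 <= s & s <= t & t <= T" for s t using good_mono that by blast
   show "1 - eps0 <= prob (good r eps d T)" by (rule d(2))
  qed blast
 qed
 thus ?thesis using h0 by blast
qed

lemma carousel_scheme:
 assumes T: "0 < T"
 shows "(%n. mean (%w. eta (Y T w - euler_value \<sigma>\<^sub>0 l rho T n w))) ----> 0"
 by (rule scheme_converges[where L=5])
  (use T rho_adapted cmod_rho \<sigma>\<^sub>0_lipschitz Y_adapted Y_0 local_expansion_exists[of T] in auto)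

end

section \<open>The flow of the Schroedinger equation\<close>

lemma cmod_cis_diff_le: "cmod (cis x - cis y) <= \<bar>x - y\<bar>"
proof -
 have "cis x - cis y = cis y * (cis (x - y) - 1)" by (simp add: right_diff_distrib cis_mult)
 hence "cmod (cis x - cis y) = cmod (cis (x - y) - 1)" by (simp only: norm_mult norm_cis mult_1)
 also have "... = 2 * \<bar>sin ((x - y) / 2)\<bar>" unfolding cis_conv_exp by (rule dist_exp_i_1)
 also have "... <= \<bar>x - y\<bar>" using abs_sin_x_le_abs_x[of "(x - y) / 2"] by simp
 finally show ?thesis .
qed

text \<open>One path of the flow, for a fixed drift \<open>l\<close>.\<close>

locale phase_path = noise M F X Xi m
 for M :: "'w measure" and F X Xi m +
 fixes phi :: "real => 'w => real" and J :: "real => 'w => complex" and l :: real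
 assumes phi_adapted: "!!t. 0 <= t ==> phi t \<in> borel_measurable (F t)"
  and phi_cont: "AE w in M. continuous_on {0..} (%t. phi t w)"
  and phi_0: "AE w in M. phi 0 w = 0"
  and phi_ito: "has_ito_integral M F (%t w. exp (- \<i> * Cx (phi t w))) X J"
  and phi_eq: "!!t. 0 <= t ==> AE w in M. phi t w = l * t + Xi t w + Re (J t w)"
  and Xi_sq: "!!s t. [|0 <= s; s <= t|] ==> integrable M (%w. (Xi t w - Xi s w)^2)"
   "!!s t. [|0 <= s; s <= t|] ==> mean (%w. (Xi t w - Xi s w)^2) <= t - s"
begin

definition E :: "real => 'w => complex" where "E t w = cis (- phi t w)"

lemma phi_meas: "0 <= t ==> phi t \<in> borel_measurable M"
 by (rule measurable_F_M[OF phi_adapted])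

sublocale ito_integrand M F X Xi m E J 1
proof
 have "E = (%t w. exp (- \<i> * Cx (phi t w)))" by (simp add: E_def fun_eq_iff cis_conv_exp)
 thus "has_ito_integral M F E X J" using phi_ito by simp
 show "cmod (E t w) <= 1" for t w by (simp add: E_def)
 show "AE w in M. continuous_on {0..} (%t. E t w)"
  using phi_cont by eventually_elim (auto simp: E_def intro!: continuous_intros)
qed

lemma E_bdd: "0 <= t ==> bdd_meas t (E t)"
 using H_adapted[of t] H_bound[of t] unfolding bdd_meas_def by blast

text \<open>The error of the Euler step of the stochastic integral in \<open>phi\<close>.\<close>

definition Rm :: "real => real => 'w => complex" where
 "Rm s t w = J t w - J s w - E s w * dX s t w"

lemma Rm_meas: "0 <= s ==> s <= t ==> Rm s t \<in> borel_measurable M"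
proof -
 assume st: "0 <= s" "s <= t"
 hence t0: "0 <= t" by simp
 note [measurable] = J_meas[OF st(1)] J_meas[OF t0] H_meas[OF st(1)] X_meas[OF st(1)] X_meas[OF t0]
 show ?thesis unfolding Rm_def by measurable
qed

lemma Rm_mean:
 assumes st: "0 <= s" "s <= t" and g: "bdd_meas s g"
 shows "integrable M (%w. g w * Rm s t w)" "mean (%w. g w * Rm s t w) = 0"
proof -
 note gE = bdd_meas_mult[OF g E_bdd[OF st(1)]]
 note inc = increment_moments(1,2)[OF st bdd_meas_measD[OF gE] bdd_meas_integrable[OF gE]]
 have e: "g w * Rm s t w = g w * (J t w - J s w) - g w * E s w * dX s t w" for w by (simp add: Rm_def algebra_simps)
 show "integrable M (%w. g w * Rm s t w)" "mean (%w. g w * Rm s t w) = 0"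
  unfolding e using inc ito_mean[OF st g] by simp_all
qed

text \<open>As for \<open>R_sq\<close>, with \<open>E\<close> Lipschitz in \<open>phi\<close>; short steps make the drift comparable with the noise.\<close>

lemma Rm_sq:
 assumes st: "0 <= s" "s <= t" "t <= s + 1"
 shows "integrable M (%w. (cmod (Rm s t w))^2)" "mean (%w. (cmod (Rm s t w))^2) <= (12 * l^2 + 60) * (t - s)^2"
proof -
 let ?c = "(3 * l^2 + 15) * (t - s)"
 have c: "mean (%w. (cmod (E r w - E s w))^2) <= ?c" if r: "s <= r" "r <= t" for r
 proof -
  have r0: "0 <= r" using st r by simp
  let ?B = "%w. 3 * (l * (r - s))^2 + 3 * (Xi r w - Xi s w)^2 + 3 * (cmod (J r w - J s w))^2"
  have Bi: "integrable M ?B" using Xi_sq(1)[OF st(1) r(1)] ito_sq(1)[OF st(1) r(1)] by simp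
  have le: "AE w in M. (cmod (E r w - E s w))^2 <= ?B w"
   using phi_eq[OF st(1)] phi_eq[OF r0]
  proof eventually_elim
   case (elim w)
   have "cmod (E r w - E s w) <= \<bar>phi r w - phi s w\<bar>"
    unfolding E_def using cmod_cis_diff_le[of "- phi r w" "- phi s w"] by simp
   hence "(cmod (E r w - E s w))^2 <= \<bar>phi r w - phi s w\<bar>^2" by (intro power_mono) auto
   also have "phi r w - phi s w = l * (r - s) + (Xi r w - Xi s w) + Re (J r w - J s w)"
    using elim by (simp add: algebra_simps)
   also have "\<bar>...\<bar>^2 <= 3 * (l * (r - s))^2 + 3 * (Xi r w - Xi s w)^2 + 3 * (Re (J r w - J s w))^2"
    unfolding power2_abs by (rule sq3)
   also have "... <= ?B w"
    using abs_Re_le_cmod[of "J r w - J s w"] by (simp add: abs_le_square_iff[symmetric])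
   finally show ?case .
  qed
  have "mean (%w. (cmod (E r w - E s w))^2) <= mean ?B"
  proof (rule integral_mono_AE[OF _ Bi le])
   note [measurable] = H_meas[OF st(1)] H_meas[OF r0]
   show "integrable M (%w. (cmod (E r w - E s w))^2)"
   proof (rule integrable_bound[OF Bi])
    show "AE w in M. norm ((cmod (E r w - E s w))^2) <= norm (?B w)"
     using le by eventually_elim simp
   qed measurable
  qed
  also have "... = 3 * (l * (r - s))^2 + 3 * mean (%w. (Xi r w - Xi s w)^2) + 3 * mean (%w. (cmod (J r w - J s w))^2)"
   using Xi_sq(1)[OF st(1) r(1)] ito_sq(1)[OF st(1) r(1)] by (simp add: prob_space)
  also have "... <= 3 * (l^2 * (r - s)) + 3 * (r - s) + 3 * (4 * (r - s))"
  proof -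
   have "(r - s) * (r - s) <= 1 * (r - s)" using r st by (intro mult_right_mono) auto
   hence "l^2 * ((r - s) * (r - s)) <= l^2 * (1 * (r - s))" by (intro mult_left_mono) auto
   hence "(l * (r - s))^2 <= l^2 * (r - s)" by (simp add: power2_eq_square mult_ac)
   thus ?thesis using Xi_sq(2)[OF st(1) r(1)] ito_sq(2)[OF st(1) r(1)] by simp
  qed
  also have "... = (3 * l^2 + 15) * (r - s)" by (simp add: algebra_simps)
  also have "... <= ?c" using r by (intro mult_left_mono) auto
  finally show ?thesis .
 qed
 have ts: "0 <= ?c" using st by simp
 note est = ito_estimate_expectation[OF st(1,2) E_bdd[OF st(1)] ts c]
 show "integrable M (%w. (cmod (Rm s t w))^2)" "mean (%w. (cmod (Rm s t w))^2) <= (12 * l^2 + 60) * (t - s)^2"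
  using est unfolding Rm_def by (simp_all add: power2_eq_square algebra_simps)
qed

lemma increment_eq:
 assumes "0 <= s" "s <= t"
 shows "AE w in M. phi t w = phi s w + l * (t - s) + (Xi t w - Xi s w) + Re (E s w * dX s t w) + Re (Rm s t w)"
proof -
 have t0: "0 <= t" using assms by simp
 show ?thesis using phi_eq[OF assms(1)] phi_eq[OF t0]
 proof eventually_elim
  case (elim w)
  have "Re (E s w * dX s t w) + Re (Rm s t w) = Re (J t w) - Re (J s w)"
   unfolding plus_complex.sel[symmetric] Rm_def by simp
  thus ?case using elim by (simp add: algebra_simps)
 qed
qed

end

text \<open>A remainder that is conditionally centred and of second order in mean square gives a local expansion
 without any localization.\<close>

lemma (in noise) local_expansion_centred:
 assumes T: "0 <= T" and eps: "0 < eps" "eps <= 1" and K: "0 <= K"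
  and Q: "!!t h. [|0 <= t; 0 <= h|] ==> Q h t \<in> borel_measurable M"
   "!!t h. [|0 <= t; 0 <= h; h <= 1|] ==> integrable M (%w. (cmod (Q h t w))^2)"
   "!!t h. [|0 <= t; 0 <= h; h <= 1|] ==> mean (%w. (cmod (Q h t w))^2) <= K * h^2"
   "!!t h g. [|0 <= t; 0 <= h; bdd_meas t g|] ==> integrable M (%w. g w * Q h t w) & mean (%w. g w * Q h t w) = 0"
  and Y: "!!t h. [|0 <= t; 0 <= h|] ==> AE w in M. Y (t + h) w = Y t w + l * h + Re (\<sigma> (Y t w) * (rho t w * dX t (t + h) w)) + Re (Q h t w)"
 shows "expandable T l \<sigma> rho Y eps"
proof -
 define h0 where "h0 = min 1 (eps / (K + 1))"
 have "local_expansion T l \<sigma> rho Y eps h (%_. space M) (%t w. Re (Q h t w)) (%_ _. 0)" if h: "0 < h" "h < h0" for h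
 proof -
  have h1: "0 <= h" "h <= 1" and Kh: "K * h <= eps"
  proof -
   have "h <= eps / (K + 1)" using h by (simp add: h0_def)
   hence "(K + 1) * h <= eps" using K by (simp add: pos_le_divide_eq mult.commute)
   thus "K * h <= eps" using h by (simp add: algebra_simps)
  qed (use h in \<open>auto simp: h0_def\<close>)
  have "local_step l \<sigma> rho Y eps h t (space M) (space M) (%w. Re (Q h t w)) (%_. 0)" if t: "0 <= t" for t
  proof -
   note [measurable] = Q(1)[OF t h1(1)]
   have sq: "(Re (Q h t w))^2 <= (cmod (Q h t w))^2" for w
    using abs_Re_le_cmod[of "Q h t w"] by (simp flip: abs_le_square_iff)
   have i: "integrable M (%w. indicator (space M) w * (Re (Q h t w))^2)"
    by (rule integrable_bound[OF Q(2)[OF t h1]]) (measurable, intro AE_I2, use sq in \<open>simp add: abs_mult\<close>)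
   have "mean (%w. indicator (space M) w * (Re (Q h t w))^2) <= mean (%w. (cmod (Q h t w))^2)"
    by (rule integral_mono[OF i Q(2)[OF t h1]]) (use sq in simp)
   also have "... <= (K * h) * h" using Q(3)[OF t h1] by (simp add: power2_eq_square mult.assoc)
   also have "... <= eps * h" using Kh h by (intro mult_right_mono) auto
   finally have e: "small_on (space M) (%w. (Re (Q h t w))^2) (eps * h)" using i by (simp add: small_on_def)
   have m: "mean (%w. indicator (space M) w * g w * Re (Q h t w)) <= eps * h"
    if g: "g \<in> borel_measurable (F t)" "\<forall>w\<in>space M. \<bar>g w\<bar> <= 1" for g
   proof -
    have gb: "bdd_meas t (%w. Cx (g w))"
     unfolding bdd_meas_def norm_of_real using g by (auto intro!: measurable_compose[OF g(1)])
    note q = Q(4)[OF t h1(1) gb]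
    have "mean (%w. indicator (space M) w * g w * Re (Q h t w)) = mean (%w. Re (Cx (g w) * Q h t w))"
     by (intro integral_cong) auto
    also have "... <= eps * h" using integral_Re[of M "%w. Cx (g w) * Q h t w"] q eps h by simp
    finally show ?thesis .
   qed
   have "small_on (space M) (%w. \<bar>0\<bar>) (eps * h)" using eps h by (simp add: small_on_def)
   thus ?thesis using Y[OF t h1(1)] e m unfolding local_step_def by auto
  qed
  thus ?thesis unfolding local_expansion_def using sets.top[of "F _"] eps by (simp add: prob_space)
 qed
 moreover have "h0 > 0" using eps K by (simp add: h0_def)
 ultimately show ?thesis by blast
qed

locale phase_pair = P: phase_path M F X Xi m phi J l + P0: phase_path M F X Xi m phi0 J0 l0
 for M :: "'w measure" and F X Xi m phi J l phi0 J0 l0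
begin

text \<open>The real noise cancels in the difference of two paths, and \<open>cis (- phi) = cis (- (phi - phi0)) * P0.E\<close> brings the equation
 into the form of the relative angle of the carousel.\<close>

lemma difference_scheme:
 assumes T: "0 < T"
 shows "(%n. P.mean (%w. eta ((phi T w - phi0 T w) - P.euler_value \<sigma>\<^sub>0 (l - l0) P0.E T n w))) ----> 0"
proof (rule P.scheme_converges[where L=5 and Y="%t w. phi t w - phi0 t w"])
 show "P0.E t \<in> borel_measurable (F t)" if "0 <= t" for t by (rule P0.H_adapted[OF that])
 show "cmod (P0.E t w) = 1" for t w by (simp add: P0.E_def)
 show "(%w. phi t w - phi0 t w) \<in> borel_measurable (F t)" if "0 <= t" for t
  using P.phi_adapted[OF that] P0.phi_adapted[OF that] by simp
 show "AE w in M. phi 0 w - phi0 0 w = 0" using P.phi_0 P0.phi_0 by eventually_elim simp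
 fix eps :: real assume eps: "0 < eps" "eps <= 1"
 let ?K = "2 * (12 * l^2 + 60) + 2 * (12 * l0^2 + 60)"
 let ?Q = "%h t w. P.Rm t (t + h) w - P0.Rm t (t + h) w"
 show "P.expandable T (l - l0) \<sigma>\<^sub>0 P0.E (%t w. phi t w - phi0 t w) eps"
 proof (rule P.local_expansion_centred[where K="?K" and Q="?Q"])
  fix t h :: real assume th: "0 <= t" "0 <= h"
  hence le: "t <= t + h" by simp
  note m[measurable] = P.Rm_meas[OF th(1) le] P0.Rm_meas[OF th(1) le]
  show "?Q h t \<in> borel_measurable M" by measurable
  show "integrable M (%w. g w * ?Q h t w) & P.mean (%w. g w * ?Q h t w) = 0" if "P.bdd_meas t g" for g
   unfolding right_diff_distrib using P.Rm_mean[OF th(1) le that] P0.Rm_mean[OF th(1) le that] by simp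
  show "AE w in M. phi (t + h) w - phi0 (t + h) w = phi t w - phi0 t w + (l - l0) * h + Re (\<sigma>\<^sub>0 (phi t w - phi0 t w) * (P0.E t w * P.dX t (t + h) w)) + Re (?Q h t w)"
   using P.increment_eq[OF th(1) le] P0.increment_eq[OF th(1) le]
  proof eventually_elim
   case (elim w)
   have "cis (- (phi t w - phi0 t w)) * P0.E t w = P.E t w" by (simp add: P.E_def P0.E_def cis_mult)
   hence "\<sigma>\<^sub>0 (phi t w - phi0 t w) * (P0.E t w * P.dX t (t + h) w) = P.E t w * P.dX t (t + h) w - P0.E t w * P.dX t (t + h) w"
    unfolding \<sigma>\<^sub>0_def by (simp only: left_diff_distrib mult_1 mult.assoc[symmetric])
   hence "Re (\<sigma>\<^sub>0 (phi t w - phi0 t w) * (P0.E t w * P.dX t (t + h) w)) = Re (P.E t w * P.dX t (t + h) w) - Re (P0.E t w * P.dX t (t + h) w)"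
    by (simp only: minus_complex.sel)
   moreover have "t + h - t = h" by simp
   ultimately show ?case using elim unfolding minus_complex.sel[of "P.Rm t (t + h) w"] left_diff_distrib by simp
  qed
  assume h1: "h <= 1"
  have le1: "t + h <= t + 1" using h1 by simp
  note s = P.Rm_sq[OF th(1) le le1] P0.Rm_sq[OF th(1) le le1]
  have b: "(cmod (?Q h t w))^2 <= 2 * (cmod (P.Rm t (t + h) w))^2 + 2 * (cmod (P0.Rm t (t + h) w))^2" for w
   using cmod_add_sq[of "P.Rm t (t + h) w" "- P0.Rm t (t + h) w"] by simp
  have bi: "integrable M (%w. 2 * (cmod (P.Rm t (t + h) w))^2 + 2 * (cmod (P0.Rm t (t + h) w))^2)" using s by simp
  show i: "integrable M (%w. (cmod (?Q h t w))^2)"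
   by (rule integrable_bound[OF bi]) (measurable, intro AE_I2, use b in simp)
  have "P.mean (%w. (cmod (?Q h t w))^2) <= P.mean (%w. 2 * (cmod (P.Rm t (t + h) w))^2 + 2 * (cmod (P0.Rm t (t + h) w))^2)"
   by (rule integral_mono[OF i bi b])
  also have "... = 2 * P.mean (%w. (cmod (P.Rm t (t + h) w))^2) + 2 * P.mean (%w. (cmod (P0.Rm t (t + h) w))^2)"
   using s by simp
  also have "... <= ?K * h^2" using s by (simp add: algebra_simps)
  finally show "P.mean (%w. (cmod (?Q h t w))^2) <= ?K * h^2" .
 qed (use T eps in auto)
qed (use T \<sigma>\<^sub>0_lipschitz in auto)

end

context phase_path
begin

text \<open>The rest of a single path is, in the limit, the sum of the real parts of the rotated increments. Together with
 \<open>difference_scheme\<close> this writes a whole path through the noise as rotated by the reference path.\<close>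

lemma total_scheme:
 assumes T: "0 < T"
 shows "(%n. mean (%w. eta (phi T w - l * T - (Xi T w - Xi 0 w) - euler_value (%_. 1) 0 E T n w))) ----> 0"
proof -
 let ?Y = "%t w. phi t w - l * t - (Xi t w - Xi 0 w)"
 show ?thesis
 proof (rule scheme_converges[where L=0])
  show "E t \<in> borel_measurable (F t)" if "0 <= t" for t by (rule H_adapted[OF that])
  show "cmod (E t w) = 1" for t w by (simp add: E_def)
  show "(%w. ?Y t w) \<in> borel_measurable (F t)" if "0 <= t" for t
   using phi_adapted[OF that] Xi_adapted[OF that] measurable_F_mono[OF Xi_adapted[OF order.refl] that] by measurable
  show "AE w in M. phi 0 w - l * 0 - (Xi 0 w - Xi 0 w) = 0" using phi_0 by eventually_elim simp
  fix eps :: real assume eps: "0 < eps" "eps <= 1"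
  show "expandable T 0 (%_. 1) E ?Y eps"
  proof (rule local_expansion_centred[where K="12 * l^2 + 60" and Q="%h t. Rm t (t + h)"])
   fix t h :: real assume th: "0 <= t" "0 <= h"
   hence le: "t <= t + h" by simp
   show "Rm t (t + h) \<in> borel_measurable M" by (rule Rm_meas[OF th(1) le])
   show "integrable M (%w. g w * Rm t (t + h) w) & mean (%w. g w * Rm t (t + h) w) = 0" if "bdd_meas t g" for g
    using Rm_mean[OF th(1) le that] by blast
   show "AE w in M. ?Y (t + h) w = ?Y t w + 0 * h + Re (1 * (E t w * dX t (t + h) w)) + Re (Rm t (t + h) w)"
    using increment_eq[OF th(1) le]
   proof eventually_elim
    case (elim w)
    have "l * (t + h - t) = l * (t + h) - l * t" by (simp add: algebra_simps)
    thus ?case using elim unfolding mult_1 mult_zero_left by linarith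
   qed
   assume h1: "h <= 1"
   have le1: "t + h <= t + 1" using h1 by simp
   show "integrable M (%w. (cmod (Rm t (t + h) w))^2)" by (rule Rm_sq(1)[OF th(1) le le1])
   show "mean (%w. (cmod (Rm t (t + h) w))^2) <= (12 * l^2 + 60) * h^2"
    using Rm_sq(2)[OF th(1) le le1] by simp
  qed (use T eps in auto)
 qed (use T in auto)
qed

end

section \<open>Equality of laws through the Euler scheme\<close>

abbreviation real_paths :: "'i set => ('i => real) measure" where
 "real_paths I \<equiv> \<Pi>\<^sub>M i\<in>I. borel"

definition box :: "'i set => 'i set => ('i => real) => ('i => real) set" where
 "box I J a = {x \<in> \<Pi>\<^sub>E i\<in>I. UNIV. \<forall>j\<in>J. x j <= a j}"

lemma box_sets:
 assumes "finite J" "J \<subseteq> I"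
 shows "box I J a \<in> sets (real_paths I)"
proof -
 have "box I J a = {x \<in> space (real_paths I). \<forall>j\<in>J. x j <= a j}"
  by (simp add: box_def space_PiM)
 also have "... \<in> sets (real_paths I)"
 proof (rule sets.sets_Collect_finite_All[OF _ assms(1)])
  fix j assume "j \<in> J"
  hence [measurable]: "(%x. x j) \<in> borel_measurable (real_paths I)"
   using assms by (intro measurable_component_singleton) auto
  show "{x \<in> space (real_paths I). x j <= a j} \<in> sets (real_paths I)" by measurable
 qed
 finally show ?thesis .
qed

lemma sets_PiM_boxes:
 assumes "I ~= {}"
 shows "sets (real_paths I) = sigma_sets (\<Pi>\<^sub>E i\<in>I. UNIV) {box I J a | J a. finite J & J \<subseteq> I}"
  (is "_ = sigma_sets ?\<Omega> ?G")
proof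
 have "?\<Omega> = space (real_paths I)" by (simp add: space_PiM)
 moreover have "?G \<subseteq> sets (real_paths I)" using box_sets by auto
 ultimately show "sigma_sets ?\<Omega> ?G \<subseteq> sets (real_paths I)" by (simp add: sets.sigma_sets_subset)
 show "sets (real_paths I) \<subseteq> sigma_sets ?\<Omega> ?G"
  unfolding sets_PiM_single space_borel
 proof (rule sigma_sets_mono, rule subsetI)
  fix S assume "S \<in> {{f \<in> ?\<Omega>. f i \<in> A} | i A. i \<in> I & A \<in> sets (borel :: real measure)}"
  then obtain i A where i: "i \<in> I" "S = {f \<in> ?\<Omega>. f i \<in> A}" "A \<in> sets borel" by auto
  have G: "?G \<subseteq> Pow ?\<Omega>" by (auto simp: box_def)
  have "(%f. f i) \<in> borel_measurable (sigma ?\<Omega> ?G)"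
  proof (rule borel_measurableI_le)
   fix a
   have "{f \<in> space (sigma ?\<Omega> ?G). f i <= a} = box I {i} (%_. a)" using G by (simp add: box_def space_measure_of)
   also have "... \<in> sets (sigma ?\<Omega> ?G)" using G i(1) by (auto simp: sets_measure_of intro!: sigma_sets.Basic)
   finally show "{f \<in> space (sigma ?\<Omega> ?G). f i <= a} \<in> sets (sigma ?\<Omega> ?G)" .
  qed
  from measurable_sets[OF this i(3)] show "S \<in> sigma_sets ?\<Omega> ?G"
   using G unfolding i(2) by (simp add: sets_measure_of space_measure_of vimage_def Int_def conj_commute)
 qed
qed

lemma measure_eqI_boxes:
 assumes I: "I ~= {}" and sets: "sets mu = sets (real_paths I)" "sets nu = sets (real_paths I)"
  and fin: "finite_measure mu"
  and eq: "!!J a. finite J ==> J \<subseteq> I ==> emeasure mu (box I J a) = emeasure nu (box I J a)"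
 shows "mu = nu"
proof (rule measure_eqI_generator_eq[where \<Omega>="\<Pi>\<^sub>E i\<in>I. UNIV" and A="%_. box I {} (%_. 0)"])
 let ?G = "{box I J a | J a. finite J & J \<subseteq> I}"
 show "Int_stable ?G"
 proof (rule Int_stableI)
  fix A B assume "A \<in> ?G" "B \<in> ?G"
  then obtain J a K b where *: "A = box I J a" "B = box I K b" "finite J" "finite K" "J \<subseteq> I" "K \<subseteq> I" by auto
  have "A Int B = box I (J \<union> K) (%i. if i \<in> J & i \<in> K then min (a i) (b i) else if i \<in> J then a i else b i)"
   unfolding * box_def by (auto split: if_splits)
  thus "A Int B \<in> ?G" using * by blast
 qed
 show "?G \<subseteq> Pow (\<Pi>\<^sub>E i\<in>I. UNIV)" by (auto simp: box_def)
 show "emeasure mu X = emeasure nu X" if "X \<in> ?G" for X using that eq by auto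
 show "sets mu = sigma_sets (\<Pi>\<^sub>E i\<in>I. UNIV) ?G" "sets nu = sigma_sets (\<Pi>\<^sub>E i\<in>I. UNIV) ?G"
  using sets sets_PiM_boxes[OF I] by auto
 show "range (%_::nat. box I {} (%_. 0)) \<subseteq> ?G" by auto
 show "(\<Union>i::nat. box I {} (%_. 0)) = (\<Pi>\<^sub>E i\<in>I. UNIV)" by (auto simp: box_def)
 show "emeasure mu (box I {} (%_. 0)) ~= \<infinity>" using finite_measure.emeasure_finite[OF fin] by simp
qed

text \<open>A Lipschitz approximation from above of the indicator of \<open>{..a}\<close>.\<close>

definition ramp :: "real => nat => real => real" where
 "ramp a k x = max 0 (min 1 (1 - real k * (x - a)))"

lemma ramp_bounds: "0 <= ramp a k x" "ramp a k x <= 1"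
 by (auto simp: ramp_def)

lemma ramp_measurable [measurable]: "ramp a k \<in> borel_measurable borel"
 unfolding ramp_def by measurable

lemma ramp_lipschitz: "\<bar>ramp a k x - ramp a k y\<bar> <= real k * \<bar>x - y\<bar>"
proof -
 have "\<bar>max 0 (min 1 u) - max 0 (min 1 v)\<bar> <= \<bar>u - v\<bar>" for u v :: real by (auto simp: max_def min_def)
 from this[of "1 - real k * (x - a)" "1 - real k * (y - a)"]
 have "\<bar>ramp a k x - ramp a k y\<bar> <= \<bar>real k * (y - x)\<bar>" unfolding ramp_def by (simp add: algebra_simps)
 thus ?thesis by (simp add: abs_mult abs_minus_commute)
qed

lemma ramp_limit: "(%k. ramp a k x) ----> (if x <= a then 1 else 0)"
proof (cases "x <= a")
 case True
 hence "real k * (x - a) <= 0" for k by (intro mult_nonneg_nonpos) auto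
 hence "ramp a k x = 1" for k unfolding ramp_def by (smt (verit, best))
 thus ?thesis using True by simp
next
 case False
 then obtain N where N: "1 / (x - a) < real N" using reals_Archimedean2 by blast
 have "\<forall>\<^sub>F k in sequentially. ramp a k x = 0"
 proof (rule eventually_sequentiallyI)
  fix k assume "N <= k"
  hence "1 / (x - a) < real k" using N by linarith
  hence "1 < real k * (x - a)" using False by (simp add: divide_less_eq)
  thus "ramp a k x = 0" by (simp add: ramp_def)
 qed
 thus ?thesis using False by (simp add: tendsto_eventually)
qed

text \<open>A bounded Lipschitz function turns convergence in the sense of \<open>eta\<close> into convergence in mean square.\<close>

lemma ramp_eta: "(ramp a k x - ramp a k y)^2 <= 2 * (real k + 1)^2 * eta (x - y)"
proof -
 let ?e = "x - y"
 have m: "(min 1 \<bar>?e\<bar>)^2 <= 2 * eta ?e"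
 proof (cases "\<bar>?e\<bar> <= 1")
  case True
  hence "?e^2 * (1 + ?e^2) <= ?e^2 * 2" by (intro mult_left_mono) (simp_all add: abs_square_le_1)
  moreover have "0 < 1 + ?e^2" by (intro add_pos_nonneg) auto
  ultimately have "?e^2 <= 2 * eta ?e" by (simp add: eta_def pos_le_divide_eq mult.commute)
  with True show ?thesis by (simp add: min_def)
 next
  case False
  hence "1 <= ?e^2" using abs_le_square_iff[of 1 ?e] by simp
  hence "1 <= 2 * eta ?e" unfolding eta_def by (simp add: pos_le_divide_eq)
  with False show ?thesis by (simp add: min_def)
 qed
 have "\<bar>ramp a k x - ramp a k y\<bar> <= (real k + 1) * min 1 \<bar>?e\<bar>"
  using ramp_lipschitz[of a k x y] ramp_bounds[of a k x] ramp_bounds[of a k y] by (auto simp: min_def algebra_simps)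
 hence "(ramp a k x - ramp a k y)^2 <= ((real k + 1) * min 1 \<bar>?e\<bar>)^2" by (rule power2_le_iff_abs_le[THEN iffD2, rotated]) simp
 also have "... <= (real k + 1)^2 * (2 * eta ?e)" unfolding power_mult_distrib by (intro mult_left_mono m) simp
 finally show ?thesis by (simp add: mult_ac)
qed

lemma (in prob_space) ramp_convergence:
 assumes J: "finite J" and X: "!!j. j \<in> J ==> X j \<in> borel_measurable M" and Xn: "!!j n. j \<in> J ==> Xn n j \<in> borel_measurable M"
  and conv: "!!j. j \<in> J ==> (%n. mean (%w. eta (X j w - Xn n j w))) ----> 0"
 shows "(%n. mean (%w. \<Prod>j\<in>J. ramp (a j) k (Xn n j w))) ----> mean (%w. \<Prod>j\<in>J. ramp (a j) k (X j w))"
proof -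
 let ?p = "%Z w. \<Prod>j\<in>J. ramp (a j) k (Z j w)" and ?d = "%n j w. \<bar>ramp (a j) k (Xn n j w) - ramp (a j) k (X j w)\<bar>"
 let ?b = "%n. \<Sum>j\<in>J. sqrt (2 * (real k + 1)^2 * mean (%w. eta (X j w - Xn n j w)))"
 have pi: "integrable M (?p Z)" if "!!j. j \<in> J ==> Z j \<in> borel_measurable M" for Z
  using that ramp_bounds by (intro integrable_const_bound[where B=1]) (auto simp: abs_prod intro!: prod_le_1)
 note i = pi[of "Xn _", OF Xn] pi[OF X]
 have d1: "?d n j w <= 1" for n j w using ramp_bounds[of "a j" k "Xn n j w"] ramp_bounds[of "a j" k "X j w"] by linarith
 have di: "integrable M (?d n j)" "integrable M (%w. (?d n j w)^2)" if "j \<in> J" for n j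
  using X[OF that] Xn[OF that] d1 by (intro integrable_const_bound[where B=1]; auto simp: abs_square_le_1)+
 have root: "mean (?d n j) <= sqrt (2 * (real k + 1)^2 * mean (%w. eta (X j w - Xn n j w)))" if j: "j \<in> J" for n j
 proof -
  have etai: "integrable M (%w. eta (X j w - Xn n j w))"
   using X[OF j] Xn[OF j] eta_bounds by (intro integrable_const_bound[where B=1]) auto
  have "(mean (?d n j))^2 <= mean (%w. (?d n j w)^2)"
   using variance_eq[OF di(1)[OF j, of n] di(2)[OF j, of n]] variance_positive[of "?d n j"] by linarith
  also have "... <= mean (%w. 2 * (real k + 1)^2 * eta (X j w - Xn n j w))"
   by (rule integral_mono[OF di(2)[OF j]]) (use etai ramp_eta power2_commute in \<open>auto simp: power2_commute[of "ramp _ _ (Xn _ _ _)"]\<close>)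
  finally show ?thesis by (intro real_le_rsqrt) simp
 qed
 have bound: "norm (mean (?p (Xn n)) - mean (?p X)) <= ?b n" for n
 proof -
  have "\<bar>mean (?p (Xn n)) - mean (?p X)\<bar> = \<bar>mean (%w. ?p (Xn n) w - ?p X w)\<bar>" using i by simp
  also have "... <= mean (%w. \<Sum>j\<in>J. ?d n j w)"
  proof (rule order_trans[OF integral_abs_bound integral_mono])
   show "\<bar>?p (Xn n) w - ?p X w\<bar> <= (\<Sum>j\<in>J. ?d n j w)" for w
    using norm_prod_diff[of J "%j. ramp (a j) k (Xn n j w)" "%j. ramp (a j) k (X j w)"] ramp_bounds by simp
  qed (use i di in auto)
  also have "... = (\<Sum>j\<in>J. mean (?d n j))" using di by simp
  also have "... <= ?b n" by (intro sum_mono root)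
  finally show ?thesis by simp
 qed
 have "?b ----> (\<Sum>j\<in>J. sqrt (2 * (real k + 1)^2 * 0))" by (intro tendsto_intros conv)
 hence "?b ----> 0" by simp
 hence "(%n. mean (?p (Xn n)) - mean (?p X)) ----> 0"
  by (rule Lim_null_comparison[rotated]) (intro always_eventually allI bound)
 thus ?thesis by (rule LIM_zero_cancel)
qed

lemma (in prob_space) ramp_to_box:
 assumes J: "finite J" "J \<subseteq> I" and X: "!!i. i \<in> I ==> X i \<in> borel_measurable M"
 shows "(%k. mean (%w. \<Prod>j\<in>J. ramp (a j) k (X j w))) ----> measure (distr M (real_paths I) (%w. \<lambda>i\<in>I. X i w)) (box I J a)"
proof -
 let ?B = "{w\<in>space M. \<forall>j\<in>J. X j w <= a j}"
 have XJ: "X j \<in> borel_measurable M" if "j \<in> J" for j using X J that by auto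
 have B: "?B \<in> sets M" using J(1) XJ by (intro sets.sets_Collect_finite_All) auto
 have "(%k. mean (%w. \<Prod>j\<in>J. ramp (a j) k (X j w))) ----> mean (indicator ?B)"
 proof (rule integral_dominated_convergence[where w="%_. 1"])
  show "AE w in M. (%k. \<Prod>j\<in>J. ramp (a j) k (X j w)) ----> indicator ?B w"
  proof (rule AE_I2)
   fix w assume "w \<in> space M"
   have "(%k. \<Prod>j\<in>J. ramp (a j) k (X j w)) ----> (\<Prod>j\<in>J. if X j w <= a j then 1 else 0)"
    by (intro tendsto_prod ramp_limit)
   also have "(\<Prod>j\<in>J. if X j w <= a j then 1 else 0) = (indicator ?B w :: real)"
    using J(1) `w \<in> space M` by (auto simp: indicator_def prod_zero_iff)
   finally show "(%k. \<Prod>j\<in>J. ramp (a j) k (X j w)) ----> indicator ?B w" .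
  qed
  show "AE w in M. norm (\<Prod>j\<in>J. ramp (a j) k (X j w)) <= 1" for k
   using ramp_bounds by (intro AE_I2) (auto simp: abs_prod intro!: prod_le_1)
 qed (use B XJ in auto)
 moreover have "mean (indicator ?B) = measure (distr M (real_paths I) (%w. \<lambda>i\<in>I. X i w)) (box I J a)"
 proof -
  have m: "(%w. \<lambda>i\<in>I. X i w) \<in> measurable M (real_paths I)" using X by (intro measurable_restrict)
  have "(%w. \<lambda>i\<in>I. X i w) -` box I J a Int space M = ?B" using J(2) by (auto simp: box_def)
  thus ?thesis using B by (subst measure_distr[OF m box_sets[OF J]]) auto
 qed
 ultimately show ?thesis by simp
qed

text \<open>The finite-dimensional laws determine the law, products of ramps determine these, and expectations of products of ramps pass
 to the limit along both approximations.\<close>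

lemma law_eqI:
 fixes X Xn Y Yn
 assumes M: "prob_space M" and N: "prob_space N" and I: "I ~= {}"
  and X: "!!i. i \<in> I ==> X i \<in> borel_measurable M" "!!i n. i \<in> I ==> Xn n i \<in> borel_measurable M"
   "!!i. i \<in> I ==> (%n. integral\<^sup>L M (%w. eta (X i w - Xn n i w))) ----> 0"
  and Y: "!!i. i \<in> I ==> Y i \<in> borel_measurable N" "!!i n. i \<in> I ==> Yn n i \<in> borel_measurable N"
   "!!i. i \<in> I ==> (%n. integral\<^sup>L N (%w. eta (Y i w - Yn n i w))) ----> 0"
  and eq: "!!n J a k. finite J ==> J \<subseteq> I ==> integral\<^sup>L M (%w. \<Prod>j\<in>J. ramp (a j) k (Xn n j w)) = integral\<^sup>L N (%w. \<Prod>j\<in>J. ramp (a j) k (Yn n j w))"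
 shows "distr M (real_paths I) (%w. \<lambda>i\<in>I. X i w) = distr N (real_paths I) (%w. \<lambda>i\<in>I. Y i w)" (is "?mu = ?nu")
proof -
 interpret M: prob_space M by fact
 interpret N: prob_space N by fact
 have mX: "(%w. \<lambda>i\<in>I. X i w) \<in> measurable M (real_paths I)" using X by (intro measurable_restrict)
 have mY: "(%w. \<lambda>i\<in>I. Y i w) \<in> measurable N (real_paths I)" using Y by (intro measurable_restrict)
 interpret mu: prob_space ?mu by (rule M.prob_space_distr[OF mX])
 interpret nu: prob_space ?nu by (rule N.prob_space_distr[OF mY])
 show ?thesis
 proof (rule measure_eqI_boxes[OF I])
  fix J a assume J: "finite J" "J \<subseteq> I"
  have XY: "integral\<^sup>L M (%w. \<Prod>j\<in>J. ramp (a j) k (X j w)) = integral\<^sup>L N (%w. \<Prod>j\<in>J. ramp (a j) k (Y j w))" for k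
  proof (rule LIMSEQ_unique)
   show "(%n. integral\<^sup>L M (%w. \<Prod>j\<in>J. ramp (a j) k (Xn n j w))) ----> integral\<^sup>L M (%w. \<Prod>j\<in>J. ramp (a j) k (X j w))"
    using J X by (intro M.ramp_convergence) auto
   show "(%n. integral\<^sup>L M (%w. \<Prod>j\<in>J. ramp (a j) k (Xn n j w))) ----> integral\<^sup>L N (%w. \<Prod>j\<in>J. ramp (a j) k (Y j w))"
    unfolding eq[OF J] using J Y by (intro N.ramp_convergence) auto
  qed
  have "measure ?mu (box I J a) = measure ?nu (box I J a)"
   using LIMSEQ_unique[OF M.ramp_to_box[where X=X and a=a, OF J X(1), unfolded XY] N.ramp_to_box[where X=Y and a=a, OF J Y(1)]] .
  thus "emeasure ?mu (box I J a) = emeasure ?nu (box I J a)" by (simp add: mu.emeasure_eq_measure nu.emeasure_eq_measure)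
 qed (auto intro: mu.finite_measure_axioms)
qed

section \<open>The carousel differential equation\<close>

text \<open>At a first zero after time \<open>0\<close> the function would have come from positive values, against its positive derivative there.\<close>

lemma crosses_upwards:
 fixes d D :: "real => real"
 assumes d0: "d 0 = 0" and D: "!!t. 0 <= t ==> (d has_real_derivative D t) (at t within {0..})"
  and up: "!!t. 0 <= t ==> d t = 0 ==> 0 < D t" and t1: "0 < t1"
 shows "0 < d t1"
proof (rule ccontr)
 assume neg: "~ 0 < d t1"
 obtain e where e: "e > 0" "!!h. 0 < h ==> h < e ==> 0 < d h"
  using has_real_derivative_pos_inc_right[OF D[of 0] up[of 0]] d0 by auto
 define s where "s = min t1 e / 2"
 have s: "0 < s" "s < t1" "0 < d s" using t1 e by (auto simp: s_def)
 have cont: "continuous_on {s..t1} d"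
  by (rule continuous_on_subset[of "{0..}"]) (use D s in \<open>auto intro: DERIV_continuous_on\<close>)
 define S where "S = {s..t1} Int d -` {..0}"
 have "closed S" unfolding S_def by (rule continuous_closed_preimage[OF cont]) auto
 have "t1 \<in> S" using neg s by (simp add: S_def)
 hence S: "S ~= {}" "bdd_below S" by (auto simp: S_def)
 define t0 where "t0 = Inf S"
 have t0: "t0 \<in> S" unfolding t0_def by (rule closed_contains_Inf[OF S `closed S`])
 have before: "0 < d u" if "s <= u" "u < t0" for u
 proof -
  have "u \<notin> S" using that cInf_lower[OF _ S(2), of u] by (auto simp: t0_def)
  thus ?thesis using that t0 by (auto simp: S_def)
 qed
 have st0: "s < t0" "t0 <= t1" "d t0 <= 0" using t0 s by (auto simp: S_def order_le_less)
 have "d t0 = 0"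
 proof (rule ccontr)
  assume "d t0 ~= 0"
  hence "d t0 < 0" using st0 by simp
  then obtain u where "s <= u" "u <= t0" "d u = 0"
   using IVT2'[of d t0 0 s] st0 s(3) continuous_on_subset[OF cont, of "{s..t0}"] by auto
  thus False using before[of u] `d t0 < 0` by (cases "u = t0") auto
 qed
 moreover have "0 <= t0" using st0 s by simp
 ultimately obtain e' where e': "e' > 0" "!!h. 0 < h ==> t0 - h \<in> {0..} ==> h < e' ==> d (t0 - h) < 0"
  using has_real_derivative_pos_inc_left[OF D[of t0] up[of t0]] by auto
 define h where "h = min (t0 - s) e' / 2"
 have h: "0 < h" "h < e'" "h <= t0 - s" using e' st0 by (auto simp: h_def)
 hence "d (t0 - h) < 0" using st0 s by (intro e'(2)) auto
 moreover have "0 < d (t0 - h)" using h by (intro before) auto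
 ultimately show False by simp
qed

lemma speed_lipschitz:
 assumes r: "cmod v <= r" "r < 1"
 shows "\<bar>1 / poisson v x - 1 / poisson v y\<bar> <= 4 / (1 - r) * \<bar>x - y\<bar>"
proof -
 have v: "cmod v < 1" using r by simp
 have a: "1 - r <= 1 - (cmod v)^2"
 proof -
  have "(cmod v)^2 <= cmod v" using v by (simp add: power2_eq_square mult_left_le_one_le)
  thus ?thesis using r by simp
 qed
 let ?p = "cmod (cis x - v)" and ?q = "cmod (cis y - v)"
 have pq: "?p <= 2" "?q <= 2" using norm_triangle_ineq4[of "cis x" v] norm_triangle_ineq4[of "cis y" v] v by auto
 have "\<bar>?p^2 - ?q^2\<bar> = \<bar>?p - ?q\<bar> * (?p + ?q)"
  by (simp add: power2_eq_square square_diff_square_factored abs_mult mult.commute)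
 also have "... <= \<bar>x - y\<bar> * 4"
  using norm_triangle_ineq3[of "cis x - v" "cis y - v"] cmod_cis_diff_le[of x y] pq by (intro mult_mono) auto
 finally have n: "\<bar>?p^2 - ?q^2\<bar> <= \<bar>x - y\<bar> * 4" .
 have "1 / poisson v x - 1 / poisson v y = (?p^2 - ?q^2) / (1 - (cmod v)^2)"
  unfolding poisson_def divide_divide_eq_right mult_1 by (rule diff_divide_distrib[symmetric])
 hence "\<bar>1 / poisson v x - 1 / poisson v y\<bar> = \<bar>?p^2 - ?q^2\<bar> / (1 - (cmod v)^2)"
  using a r by simp
 also have "... <= (\<bar>x - y\<bar> * 4) / (1 - r)" using n a r by (intro frac_le) auto
 finally show ?thesis by (simp add: mult.commute)
qed

lemma speed_lower:
 assumes r: "0 <= r" "cmod v <= r" "r < 1" shows "(1 - r)^2 <= 1 / poisson v x"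
proof -
 have "1 - r <= cmod (cis x - v)" using norm_triangle_ineq2[of "cis x" v] r by simp
 hence *: "(1 - r)^2 <= (cmod (cis x - v))^2" using r by (intro power_mono) auto
 have b: "0 < 1 - (cmod v)^2" "1 - (cmod v)^2 <= 1" using r by (auto simp: abs_square_less_1)
 have "(cmod (cis x - v))^2 * 1 <= (cmod (cis x - v))^2 / (1 - (cmod v)^2)"
  using b by (simp add: le_divide_eq mult_left_le)
 thus ?thesis using * by (simp add: poisson_def)
qed

lemma abs_sum_bound:
 fixes a x y z h :: real
 assumes "a = x + y + h * z" "\<bar>x\<bar> <= b" "0 <= h" "\<bar>z\<bar> <= c" shows "\<bar>a\<bar> <= b + \<bar>y\<bar> + h * c"
proof -
 have "\<bar>h * z\<bar> <= h * c" using assms by (simp add: abs_mult mult_left_mono)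
 thus ?thesis using assms by linarith
qed

text \<open>The explicit Euler scheme of the carousel equation. It shows that the solution at time \<open>T\<close> is a limit of functions of finitely
 many values of \<open>v\<close> before \<open>T\<close>, hence adapted.\<close>

primrec polygon :: "(real => complex) => real => real => nat => real" where
 "polygon v l h 0 = 0"
| "polygon v l h (Suc k) = polygon v l h k + h * (l / poisson (v (real k * h)) (polygon v l h k))"

text \<open>A single realization of the carousel; everything in this context is deterministic.\<close>

locale carousel_flow =
 fixes v :: "real => complex" and gamma :: "real => real => real"
 assumes v_cont: "continuous_on {0..} v" and v_disk: "!!t. 0 <= t ==> cmod (v t) < 1"
  and start: "!!l. gamma l 0 = 0"
  and ode: "!!l t. 0 <= t ==> (gamma l has_real_derivative l / poisson (v t) (gamma l t)) (at t within {0..})"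
begin

lemma radius:
 assumes "0 <= T"
 obtains r where "0 <= r" "r < 1" "!!t. 0 <= t ==> t <= T ==> cmod (v t) <= r"
proof -
 have "continuous_on {0..T} (%t. cmod (v t))"
  by (intro continuous_on_norm continuous_on_subset[OF v_cont]) auto
 then obtain s where s: "s \<in> {0..T}" "!!t. t \<in> {0..T} ==> cmod (v t) <= cmod (v s)"
  using continuous_attains_sup[of "{0..T}" "%t. cmod (v t)"] assms by auto
 thus ?thesis using v_disk[of s] by (intro that[of "cmod (v s)"]) auto
qed

text \<open>Where two solutions meet, the one with the larger \<open>l\<close> is faster.\<close>

lemma gamma_mono:
 assumes "l < l'" "0 < t" shows "gamma l t < gamma l' t"
proof -
 have "0 < gamma l' t - gamma l t"
 proof (rule crosses_upwards[where d="%t. gamma l' t - gamma l t" and D="%t. l' / poisson (v t) (gamma l' t) - l / poisson (v t) (gamma l t)"])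
  fix s :: real assume s: "0 <= s"
  show "((%t. gamma l' t - gamma l t) has_real_derivative l' / poisson (v s) (gamma l' s) - l / poisson (v s) (gamma l s)) (at s within {0..})"
   by (intro DERIV_diff ode s)
  assume "gamma l' s - gamma l s = 0"
  thus "0 < l' / poisson (v s) (gamma l' s) - l / poisson (v s) (gamma l s)"
   using poisson_pos[OF v_disk[OF s], of "gamma l s"] assms by (simp add: divide_strict_right_mono)
 qed (use assms start in auto)
 thus ?thesis by simp
qed

lemma mean_value:
 assumes "0 < T" "!!t. 0 <= t ==> (u has_real_derivative u' t) (at t within {0..})"
 obtains t where "0 < t" "t < T" "u T - u 0 = u' t * T"
proof -
 have "(u has_derivative (*) (u' t)) (at t within {0..T})" if "0 <= t" for t
  using DERIV_subset[OF assms(2)[OF that], of "{0..T}"] by (auto simp: has_field_derivative_def)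
 thus ?thesis using mvt_simple[of 0 T u "%t. (*) (u' t)"] assms(1) that by auto
qed

text \<open>A Gronwall argument: the derivative of the difference, damped by \<open>exp (- L * t)\<close>, is at most \<open>(l' - l) * K\<close>.\<close>

lemma gamma_lipschitz:
 assumes T: "0 < T"
 shows "EX C. ALL l l'. \<bar>l\<bar> <= B & l <= l' --> gamma l' T - gamma l T <= C * (l' - l)"
proof -
 obtain r where r: "0 <= r" "r < 1" "!!t. 0 <= t ==> t <= T ==> cmod (v t) <= r" using radius[of T] T by auto
 define K where "K = 4 / (1 - r)"
 \<comment> \<open>a Lipschitz constant of the speed in the angle, for all \<open>l\<close> in question\<close>
 define L where "L = B * K"
 have K: "K > 0" using r by (simp add: K_def)
 have "gamma l' T - gamma l T <= exp (L * T) * K * T * (l' - l)" if l: "\<bar>l\<bar> <= B" "l <= l'" for l l'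
 proof (cases "l = l'")
  case False
  hence ll: "l < l'" using l by simp
  let ?d = "%t. gamma l' t - gamma l t"
  let ?D = "%t. l' / poisson (v t) (gamma l' t) - l / poisson (v t) (gamma l t)"
  let ?u = "%t. ?d t * exp (- L * t) - (l' - l) * K * t"
  let ?u' = "%t. ?d t * (exp (- L * t) * (- L)) + ?D t * exp (- L * t) - (l' - l) * K"
  have der: "(?u has_real_derivative ?u' t) (at t within {0..})" if "0 <= t" for t
   by (rule derivative_eq_intros ode[OF that] refl | simp)+
  obtain t where t: "0 < t" "t < T" "?u T - ?u 0 = ?u' t * T"
   by (rule mean_value[of T ?u ?u', OF T der])
  have L0: "0 <= L" using l K by (simp add: L_def)
  have D: "?D t <= (l' - l) * K + L * ?d t"
  proof -
   have vt: "cmod (v t) <= r" using r t by auto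
   have "?D t = (l' - l) * (1 / poisson (v t) (gamma l' t)) + l * (1 / poisson (v t) (gamma l' t) - 1 / poisson (v t) (gamma l t))"
    by (simp add: right_diff_distrib left_diff_distrib diff_divide_distrib)
   also have "... <= (l' - l) * K + \<bar>l\<bar> * \<bar>1 / poisson (v t) (gamma l' t) - 1 / poisson (v t) (gamma l t)\<bar>"
    using poisson_lower(2)[OF vt r(2)] ll unfolding K_def abs_mult[symmetric]
    by (intro add_mono mult_left_mono) auto
   also have "... <= (l' - l) * K + B * (K * \<bar>?d t\<bar>)"
    using speed_lipschitz[OF vt r(2)] l r(2) unfolding K_def by (intro add_mono mult_mono) auto
   also have "... = (l' - l) * K + L * ?d t" using gamma_mono[OF ll t(1)] by (simp add: L_def)
   finally show ?thesis .
  qed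
  have "?u' t = (?D t - L * ?d t) * exp (- L * t) - (l' - l) * K" by (simp add: algebra_simps)
  also have "... <= ((l' - l) * K) * exp (- L * t) - (l' - l) * K"
   using D by (intro diff_right_mono mult_right_mono) auto
  also have "... <= ((l' - l) * K) * 1 - (l' - l) * K"
   using L0 t ll K by (intro diff_right_mono mult_left_mono) auto
  finally have "?u' t * T <= 0" using T by (simp add: mult_nonpos_nonneg)
  hence "?d T * exp (- L * T) <= (l' - l) * K * T" using t(3) start by simp
  hence i: "exp (L * T) * (?d T * exp (- L * T)) <= exp (L * T) * ((l' - l) * K * T)" by (intro mult_left_mono) auto
  have "exp (L * T) * (?d T * exp (- L * T)) = ?d T * (exp (L * T) * exp (- L * T))" by (rule mult.left_commute)
  also have "exp (L * T) * exp (- L * T) = 1" by (simp flip: exp_add)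
  finally have e: "exp (L * T) * (?d T * exp (- L * T)) = ?d T * 1" .
  have "?d T <= exp (L * T) * ((l' - l) * K * T)" using i unfolding e mult_1_right .
  thus ?thesis by (simp only: mult.assoc mult.left_commute mult.commute)
 qed simp
 thus ?thesis by blast
qed

lemma gamma_continuous:
 assumes T: "0 < T" shows "continuous_on UNIV (%l. gamma l T)"
proof (rule continuous_at_imp_continuous_on, rule ballI)
 fix l0 :: real
 obtain C where C: "!!l l'. \<bar>l\<bar> <= \<bar>l0\<bar> + 1 ==> l <= l' ==> gamma l' T - gamma l T <= C * (l' - l)"
  using gamma_lipschitz[OF T, of "\<bar>l0\<bar> + 1"] by blast
 have le: "gamma l T <= gamma l' T" if "l <= l'" for l l' using gamma_mono[OF _ T, of l l'] that by (cases "l = l'") auto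
 have b: "\<bar>gamma l T - gamma l0 T\<bar> <= \<bar>C\<bar> * \<bar>l - l0\<bar>" if "\<bar>l - l0\<bar> <= 1" for l
 proof (cases "l0 <= l")
  case True
  thus ?thesis using C[of l0 l] le[of l0 l] abs_ge_self[of C] mult_right_mono[of C "\<bar>C\<bar>" "l - l0"] by auto
 next
  case False
  hence "gamma l0 T - gamma l T <= C * (l0 - l)" using that by (intro C) auto
  also have "... <= \<bar>C\<bar> * (l0 - l)" using False by (intro mult_right_mono) auto
  finally show ?thesis using le[of l l0] False by simp
 qed
 have "((%l. gamma l T - gamma l0 T) \<longlongrightarrow> 0) (at l0)"
 proof (rule Lim_null_comparison)
  show "\<forall>\<^sub>F l in at l0. norm (gamma l T - gamma l0 T) <= \<bar>C\<bar> * \<bar>l - l0\<bar>"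
   using eventually_at_ball[OF zero_less_one, of l0 UNIV] by eventually_elim (use b in \<open>auto simp: dist_real_def abs_minus_commute\<close>)
  show "((%l. \<bar>C\<bar> * \<bar>l - l0\<bar>) \<longlongrightarrow> 0) (at l0)" by (auto intro!: tendsto_eq_intros)
 qed
 thus "isCont (%l. gamma l T) l0" unfolding isCont_def by (rule LIM_zero_cancel)
qed

lemma gamma_unbounded:
 assumes T: "0 < T" shows "EX l. c <= gamma l T" "EX l. gamma l T <= c"
proof -
 obtain r where r: "0 <= r" "r < 1" "!!t. 0 <= t ==> t <= T ==> cmod (v t) <= r" using radius[of T] T by auto
 define k where "k = (1 - r)^2 * T"
 have k: "k > 0" using r T by (simp add: k_def)
 have mv: "\<exists>s\<ge>(1 - r)^2. gamma l T = l * s * T" for l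
 proof -
  obtain t where t: "0 < t" "t < T" "gamma l T - gamma l 0 = l / poisson (v t) (gamma l t) * T"
   by (rule mean_value[OF T ode])
  have "(1 - r)^2 <= 1 / poisson (v t) (gamma l t)" using t r by (intro speed_lower) auto
  thus ?thesis using t(3) start by (intro exI[of _ "1 / poisson (v t) (gamma l t)"]) simp
 qed
 obtain s where s: "s \<ge> (1 - r)^2" "gamma (\<bar>c\<bar> / k) T = \<bar>c\<bar> / k * s * T" using mv by blast
 have "\<bar>c\<bar> / k * k <= \<bar>c\<bar> / k * (s * T)" using s k T unfolding k_def by (intro mult_left_mono mult_right_mono) auto
 hence "c <= gamma (\<bar>c\<bar> / k) T" using s(2) k by (simp add: mult.assoc)
 thus "EX l. c <= gamma l T" by blast
 obtain s where s: "s \<ge> (1 - r)\<^sup>2" "gamma (- \<bar>c\<bar> / k) T = - \<bar>c\<bar> / k * s * T" using mv by blast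
 have "\<bar>c\<bar> / k * k <= \<bar>c\<bar> / k * (s * T)" using s k T unfolding k_def by (intro mult_left_mono mult_right_mono) auto
 hence "gamma (- \<bar>c\<bar> / k) T <= c" using s(2) k by (simp add: mult.assoc)
 thus "EX l. gamma l T <= c" by blast
qed

text \<open>The speed is uniformly continuous along the solution and Lipschitz in the angle; the errors add up by \<open>discrete_gronwall\<close>.\<close>

lemma polygon_converges:
 assumes T: "0 <= T"
 shows "(%n. polygon v l (T / real (Suc n)) (Suc n)) ----> gamma l T"
proof (rule LIMSEQ_I)
 fix e :: real assume e: "0 < e"
 obtain r where r: "0 <= r" "r < 1" "!!t. 0 <= t ==> t <= T ==> cmod (v t) <= r" using radius[OF T] by auto
 define L where "L = \<bar>l\<bar> * (4 / (1 - r))"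
 have L: "0 <= L" using r by (simp add: L_def)
 let ?f = "%t. l / poisson (v t) (gamma l t)"
 \<comment> \<open>the factor \<open>T + 1\<close> admits \<open>T = 0\<close>\<close>
 define delta where "delta = e / (2 * ((T + 1) * exp (T * L)))"
 have delta: "delta > 0" "T * delta * exp (T * L) < e"
 proof -
  have "T * delta * exp (T * L) <= (T + 1) * delta * exp (T * L)" using T e by (intro mult_right_mono) (auto simp: delta_def)
  also have "... = e / 2" using T by (simp add: delta_def)
  finally show "T * delta * exp (T * L) < e" using e by simp
 qed (use e T in \<open>simp add: delta_def\<close>)
 have gc: "continuous_on {0..T} (gamma l)"
  by (rule continuous_on_subset[OF DERIV_continuous_on[OF ode]]) auto
 have ne: "cis (gamma l t) - v t ~= 0" "1 - (cmod (v t))^2 ~= 0" if "0 <= t" for t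
  using v_disk[OF that] by (auto simp: abs_square_eq_1) (metis norm_cis less_irrefl)
 have "continuous_on {0..T} ?f"
  unfolding poisson_def by (intro continuous_intros gc continuous_on_subset[OF v_cont]) (use ne in auto)
 hence "uniformly_continuous_on {0..T} ?f" by (rule compact_uniformly_continuous) simp
 then obtain d where d: "d > 0" "!!s t. s \<in> {0..T} ==> t \<in> {0..T} ==> dist s t < d ==> dist (?f s) (?f t) < delta"
  using delta unfolding uniformly_continuous_on_def by metis
 obtain N where N: "T / d < real N" using reals_Archimedean2 by blast
 show "EX N. \<forall>n\<ge>N. norm (polygon v l (T / real (Suc n)) (Suc n) - gamma l T) < e"
 proof (intro exI allI impI)
  fix n assume n: "N <= n"
  define h where "h = T / real (Suc n)"
  have h: "0 <= h" "real (Suc n) * h = T" using T by (auto simp: h_def)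
  have "T / d < real (Suc n)" using N n by simp
  hence hd: "h < d" using d(1) by (simp add: h_def divide_less_eq mult.commute)
  let ?t = "%k. real k * h"
  let ?p = "polygon v l h"
  let ?g = "%k. l / poisson (v (?t k)) (?p k)"
  let ?q = "%k. \<bar>gamma l (?t k) - ?p k\<bar>"
  have "?q (Suc n) <= real (Suc n) * (h * delta) * exp (real (Suc n) * (h * L))"
  proof (rule discrete_gronwall)
   show "?q 0 <= 0" by (simp add: start)
   fix k assume k: "k < Suc n"
   have tk: "0 <= ?t k" "?t k <= ?t (Suc k)" using h(1) by (auto intro: mult_right_mono)
   have tS: "?t (Suc k) <= T" unfolding h(2)[symmetric] using k h by (intro mult_right_mono) auto
   have tSk: "?t (Suc k) - ?t k = h" by (simp add: algebra_simps)
   have "norm ((gamma l (?t (Suc k)) - ?f (?t k) * ?t (Suc k)) - (gamma l (?t k) - ?f (?t k) * ?t k)) <= delta * norm (?t (Suc k) - ?t k)"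
   proof (rule field_differentiable_bound[of "{?t k..?t (Suc k)}" "%s. gamma l s - ?f (?t k) * s" "%s. ?f s - ?f (?t k)"])
    fix s assume s: "s \<in> {?t k..?t (Suc k)}"
    hence s0: "0 <= s" using tk by auto
    show "((%s. gamma l s - ?f (?t k) * s) has_field_derivative ?f s - ?f (?t k)) (at s within {?t k..?t (Suc k)})"
     by (intro DERIV_diff DERIV_cmult_Id DERIV_subset[OF ode[OF s0]]) (use tk in auto)
    have "s \<in> {0..T}" "?t k \<in> {0..T}" using s s0 tk tS by (simp_all del: of_nat_Suc)
    moreover have "dist s (?t k) < d" using s hd tSk unfolding dist_real_def atLeastAtMost_iff by linarith
    ultimately have "dist (?f s) (?f (?t k)) < delta" by (rule d(2))
    thus "norm (?f s - ?f (?t k)) <= delta" by (simp add: dist_real_def)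
   qed (use tk in auto)
   hence m: "\<bar>gamma l (?t (Suc k)) - gamma l (?t k) - ?f (?t k) * h\<bar> <= delta * h"
   proof -
    have e: "(a - f * b) - (c - f * e) = a - c - f * (b - e)" for a b c e f :: real by (simp add: algebra_simps)
    show ?thesis using `norm _ <= _` unfolding e tSk real_norm_def abs_of_nonneg[OF h(1)] .
   qed
   have vk: "cmod (v (?t k)) <= r" using tk tS by (intro r) auto
   have "\<bar>?f (?t k) - ?g k\<bar> = \<bar>l\<bar> * \<bar>1 / poisson (v (?t k)) (gamma l (?t k)) - 1 / poisson (v (?t k)) (?p k)\<bar>"
    unfolding abs_mult[symmetric] by (simp add: right_diff_distrib)
   also have "... <= \<bar>l\<bar> * (4 / (1 - r) * ?q k)" by (intro mult_left_mono speed_lipschitz vk r) auto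
   finally have s: "\<bar>?f (?t k) - ?g k\<bar> <= L * ?q k" by (simp add: L_def)
   have "gamma l (?t (Suc k)) - ?p (Suc k) = (gamma l (?t (Suc k)) - gamma l (?t k) - ?f (?t k) * h)
     + (gamma l (?t k) - ?p k) + h * (?f (?t k) - ?g k)"
    by (simp add: algebra_simps)
   hence "?q (Suc k) <= delta * h + ?q k + h * (L * ?q k)"
    by (rule abs_sum_bound[OF _ m h(1) s])
   also have "... = (1 + h * L) * ?q k + h * delta" by (simp add: algebra_simps)
   finally show "?q (Suc k) <= (1 + h * L) * ?q k + h * delta" .
  qed (use h L delta in auto)
  also have "... = (real (Suc n) * h) * delta * exp ((real (Suc n) * h) * L)" by (simp only: mult.assoc)
  also have "... < e" unfolding h(2) by (rule delta(2))
  finally show "norm (polygon v l (T / real (Suc n)) (Suc n) - gamma l T) < e"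
   unfolding h(2) by (simp add: h_def abs_minus_commute)
 qed
qed

end

section \<open>The limit point on the boundary\<close>

lemma power_expansion:
 fixes v v' :: complex
 assumes "cmod v <= 1" "cmod v' <= 1"
 shows "cmod (v' ^ m - v ^ m - of_nat m * v ^ (m - 1) * (v' - v) - of_nat (m * (m - 1)) * v ^ (m - 2) * (v' - v)^2 / 2)
  <= real m ^ 3 * (cmod (v' - v)) ^ 3"
proof -
 define f where "f = (%i::nat. %x::complex. if i = 0 then x ^ m else if i = 1 then of_nat m * x ^ (m - 1)
  else if i = 2 then of_nat (m * (m - 1)) * x ^ (m - 2) else of_nat (m * (m - 1) * (m - 2)) * x ^ (m - 3))"
 have "cmod (f 0 v' - (\<Sum>i\<le>2. f i v * (v' - v) ^ i / fact i)) <= (real m ^ 3) * cmod (v' - v) ^ Suc 2 / fact 2"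
 proof (rule complex_Taylor[of "cball 0 1"])
  fix i :: nat and x :: complex assume i: "i <= 2"
  have d: "((%x. x ^ k) has_field_derivative of_nat k * x ^ (k - 1)) (at x within cball 0 1)" for k
   by (auto intro!: derivative_eq_intros)
  consider "i = 0" | "i = 1" | "i = 2" using i by linarith
  thus "(f i has_field_derivative f (Suc i) x) (at x within cball 0 1)"
  proof cases
   case 1 thus ?thesis using d[of m] by (simp add: f_def)
  next
   case 2 thus ?thesis using DERIV_cmult[OF d[of "m - 1"], of "of_nat m"] by (simp add: f_def numeral_2_eq_2 mult.assoc)
  next
   case 3 thus ?thesis using DERIV_cmult[OF d[of "m - 2"], of "of_nat (m * (m - 1))"] by (simp add: f_def numeral_3_eq_3 numeral_2_eq_2 mult.assoc)
  qed
 next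
  fix x :: complex assume "x \<in> cball 0 1"
  hence x: "cmod x <= 1" by simp
  have "cmod (f (Suc 2) x) = real (m * (m - 1) * (m - 2)) * cmod x ^ (m - 3)"
   unfolding f_def by (simp add: norm_mult norm_power)
  also have "... <= real (m * m * m) * 1"
   using x by (intro mult_mono power_le_one) (auto intro!: mult_mono)
  finally show "cmod (f (Suc 2) x) <= real m ^ 3" by (simp add: power3_eq_cube)
 qed (use assms in \<open>auto intro: convex_cball\<close>)
 moreover have "f 0 v' - (\<Sum>i\<le>2. f i v * (v' - v) ^ i / fact i)
  = v' ^ m - v ^ m - of_nat m * v ^ (m - 1) * (v' - v) - of_nat (m * (m - 1)) * v ^ (m - 2) * (v' - v)^2 / 2"
  by (simp add: f_def numeral_2_eq_2)
 ultimately have "cmod (v' ^ m - v ^ m - of_nat m * v ^ (m - 1) * (v' - v) - of_nat (m * (m - 1)) * v ^ (m - 2) * (v' - v)^2 / 2)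
  <= real m ^ 3 * cmod (v' - v) ^ Suc 2 / fact 2" by simp
 also have "... <= real m ^ 3 * cmod (v' - v) ^ 3" by (simp add: fact_numeral numeral_3_eq_3)
 finally show ?thesis .
qed

context disk_bm
begin

lemma V_power_bdd: "0 <= t ==> bdd_meas t (%w. V t w ^ k)"
proof (induction k)
 case (Suc k) thus ?case using bdd_meas_mult[OF V_bdd Suc.IH] by simp
qed simp

text \<open>Expanding the power to second order, the linear term is centred, the quadratic one almost centred, and the rest is cubic;
 all errors are of order \<open>3 / 2\<close> in the time step.\<close>

lemma power_step:
 assumes st: "0 <= s" "s < t" and g: "bdd_meas s g" "!!w. w \<in> space M ==> cmod (g w) <= K"
 shows "cmod (mean (%w. g w * V t w ^ d) - mean (%w. g w * V s w ^ d)) <= 37 * K * real d ^ 3 * ((t - s) * sqrt (t - s))" 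
proof -
 have le: "s <= t" and t0: "0 <= t" using st by auto
 let ?v = "V s" and ?D = "dV s t"
 let ?c1 = "%w. g w * (of_nat d * ?v w ^ (d - 1))" and ?c2 = "%w. g w * (of_nat (d * (d - 1)) / 2 * ?v w ^ (d - 2))"
 let ?E = "%w. g w * (V t w ^ d - ?v w ^ d) - ?c1 w * ?D w - ?c2 w * (?D w)^2"
 have c1: "bdd_meas s ?c1" and c2: "bdd_meas s ?c2"
  by (intro bdd_meas_mult g(1) bdd_meas_const V_power_bdd st)+
 have K0: "0 <= K" by (rule norm_bound_nonneg[OF g(2)])
 have c2b: "cmod (?c2 w) <= K * (real d)^2 / 2" if w: "w \<in> space M" for w
 proof -
  have p: "cmod (?v w) ^ (d - 2) <= 1" using V_disk[OF st(1) w] by (intro power_le_one) auto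
  have "d * (d - 1) <= d^2" by (simp add: power2_eq_square)
  hence "real (d * (d - 1)) / 2 <= (real d)^2 / 2" by (metis of_nat_mono of_nat_power divide_right_mono zero_le_numeral)
  from mult_mono[OF this p] have "real (d * (d - 1)) / 2 * cmod (?v w) ^ (d - 2) <= (real d)^2 / 2 * 1" by simp
  from mult_mono[OF g(2)[OF w] this] have "cmod (g w) * (real (d * (d - 1)) / 2 * cmod (?v w) ^ (d - 2)) <= K * ((real d)^2 / 2 * 1)"
   using K0 by simp
  moreover have "cmod (?c2 w) = cmod (g w) * (real (d * (d - 1)) / 2 * cmod (?v w) ^ (d - 2))"
   by (simp only: norm_mult norm_power norm_divide norm_of_nat norm_numeral)
  ultimately show ?thesis by simp
 qed
 have gV: "integrable M (%w. g w * V t w ^ d)" "integrable M (%w. g w * ?v w ^ d)"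
  using bdd_meas_integrable[OF bdd_meas_mult[OF bdd_meas_mono[OF g(1) le] V_power_bdd[OF t0]]]
   bdd_meas_integrable[OF bdd_meas_mult[OF g(1) V_power_bdd[OF st(1)]]] by (simp_all only:)
 have D2i: "integrable M (%w. (?D w)^2)"
  by (rule integrable_bound[OF dV_power_integrable[OF st(1) le, of 2]]) (use dV_meas[OF st(1) le] in \<open>auto simp: norm_power\<close>)
 note i1 = dV_mean[OF st(1) le c1]
 note i2 = bdd_meas_integrable_mult[OF c2 D2i]
 have Ei: "integrable M ?E" unfolding right_diff_distrib using gV i1(1) i2 by simp
 have "mean (%w. g w * V t w ^ d) - mean (%w. g w * ?v w ^ d) = mean ?E + mean (%w. ?c2 w * (?D w)^2)"
  unfolding right_diff_distrib using gV i1 i2 by simp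
 hence "cmod (mean (%w. g w * V t w ^ d) - mean (%w. g w * ?v w ^ d)) <= cmod (mean ?E) + cmod (mean (%w. ?c2 w * (?D w)^2))"
  by (simp only: norm_triangle_ineq)
 also have "cmod (mean (%w. ?c2 w * (?D w)^2)) <= K * (real d)^2 / 2 * (6 * (t - s) * sqrt (t - s))"
  by (rule dV_square_mean[OF st c2 c2b])
 also have "cmod (mean ?E) <= K * real d ^ 3 * (34 * (t - s) * sqrt (t - s))"
 proof -
  have "cmod (mean ?E) <= mean (%w. cmod (?E w))" by (rule integral_norm_bound)
  also have "... <= mean (%w. K * real d ^ 3 * (cmod (?D w)) ^ 3)"
  proof (rule integral_mono)
   show "integrable M (%w. cmod (?E w))" using Ei by simp
   show "integrable M (%w. K * real d ^ 3 * (cmod (?D w)) ^ 3)" using dV_power_integrable[OF st(1) le, of 3] by simp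
   fix w assume w: "w \<in> space M"
   let ?T = "V t w ^ d - ?v w ^ d - of_nat d * ?v w ^ (d - 1) * ?D w - of_nat (d * (d - 1)) * ?v w ^ (d - 2) * (?D w)^2 / 2"
   have T: "cmod ?T <= real d ^ 3 * (cmod (?D w)) ^ 3"
    unfolding dV_def using V_disk[OF st(1) w] V_disk[OF t0 w] by (intro power_expansion) auto
   have "?E w = g w * ?T" by (simp add: algebra_simps)
   hence "cmod (?E w) = cmod (g w) * cmod ?T" by (simp only: norm_mult)
   also have "... <= K * (real d ^ 3 * (cmod (?D w)) ^ 3)" using g(2)[OF w] T K0 by (intro mult_mono) auto
   finally show "cmod (?E w) <= K * real d ^ 3 * (cmod (?D w)) ^ 3" by (simp add: mult.assoc)
  qed
  also have "... <= K * real d ^ 3 * (34 * (t - s) * sqrt (t - s))"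
   using dV_cube[OF st] K0 by (simp add: mult_left_mono)
  finally show ?thesis .
 qed
 also have "K * real d ^ 3 * (34 * (t - s) * sqrt (t - s)) + K * (real d)^2 / 2 * (6 * (t - s) * sqrt (t - s)) <= 37 * K * real d ^ 3 * ((t - s) * sqrt (t - s))"
 proof -
  have "(real d)^2 <= real d ^ 3" by (cases "d = 0") (auto intro!: power_increasing)
  hence "3 * K * (real d)^2 * ((t - s) * sqrt (t - s)) <= 3 * K * real d ^ 3 * ((t - s) * sqrt (t - s))"
   using K0 st by (intro mult_right_mono mult_left_mono) auto
  thus ?thesis by (simp add: algebra_simps)
 qed
 finally show ?thesis by simp
qed

text \<open>Powers of \<open>V\<close> are martingales: over a fine partition the errors of \<open>power_step\<close> sum up to \<open>0\<close>.\<close>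

lemma power_mean:
 assumes st: "0 <= s" "s <= t" and g: "bdd_meas s g"
 shows "mean (%w. g w * V t w ^ d) = mean (%w. g w * V s w ^ d)"
proof (cases "s = t")
 case False
 hence lt: "s < t" using st by simp
 obtain K where K: "!!w. w \<in> space M ==> cmod (g w) <= K" using g by (auto simp: bdd_meas_def)
 let ?e = "%u. mean (%w. g w * V u w ^ d)"
 let ?C = "37 * K * real d ^ 3"
 have b: "cmod (?e t - ?e s) <= ?C * (t - s) * sqrt ((t - s) / real (Suc n))" for n
 proof -
  define h where "h = (t - s) / real (Suc n)"
  have h: "h > 0" "real (Suc n) * h = t - s" using lt by (auto simp: h_def)
  let ?u = "%k. s + real k * h"
  have "?e t - ?e s = (\<Sum>k<Suc n. ?e (?u (Suc k)) - ?e (?u k))"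
   by (subst sum_lessThan_telescope) (use h in simp)
  hence "cmod (?e t - ?e s) <= (\<Sum>k<Suc n. cmod (?e (?u (Suc k)) - ?e (?u k)))" by (simp only: norm_sum)
  also have "... <= (\<Sum>k<Suc n. ?C * (h * sqrt h))"
  proof (rule sum_mono)
   fix k
   have u: "0 <= ?u k" "?u k < ?u (Suc k)" "s <= ?u k" using st h by auto
   have "?u (Suc k) - ?u k = h" by (simp add: algebra_simps)
   thus "cmod (?e (?u (Suc k)) - ?e (?u k)) <= ?C * (h * sqrt h)"
    using power_step[OF u(1,2) bdd_meas_mono[OF g u(3)] K, of d] by simp
  qed
  also have "... = ?C * (real (Suc n) * h) * sqrt h" by simp
  finally show ?thesis unfolding h(2) by (simp add: h_def)
 qed
 have "(%n. (t - s) / real (Suc n)) ----> 0"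
  using tendsto_mult[OF tendsto_const[of "t - s"] LIMSEQ_inverse_real_of_nat] by (simp add: divide_inverse)
 hence "(%n. ?C * (t - s) * sqrt ((t - s) / real (Suc n))) ----> ?C * (t - s) * sqrt 0" by (intro tendsto_intros)
 hence "cmod (?e t - ?e s) <= ?C * (t - s) * sqrt 0" by (rule LIMSEQ_le_const) (use b in blast)
 thus ?thesis by simp
qed simp

text \<open>The mean distance of \<open>V\<close> from the boundary, in a form adapted to the martingale property.\<close>

definition defect :: "real => real" where "defect t = mean (%w. 1 - (cmod (V t w))^2)"

lemma V_sq_integrable: "0 <= t ==> integrable M (%w. (cmod (V t w))^2)"
 using cmod_sq_le_1 V_meas by (intro integrable_const_bound[where B=1]) auto

lemma defect_nonneg: "0 <= t ==> 0 <= defect t"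
 unfolding defect_def using cmod_sq_le_1 by (intro integral_nonneg_AE AE_I2) simp

lemma defect_diff:
 assumes st: "0 <= s" "s <= t"
 shows "defect s - defect t = mean (%w. (cmod (dV s t w))^2)"
proof -
 have t0: "0 <= t" using st by simp
 note m = dV_mean[OF st bdd_meas_cnj[OF V_bdd[OF st(1)]]]
 have e: "(cmod (V t w))^2 = (cmod (V s w))^2 + (cmod (dV s t w))^2 + 2 * Re (cnj (V s w) * dV s t w)" for w
  unfolding dV_def cmod_power2 by (simp add: power2_eq_square algebra_simps)
 have "mean (%w. (cmod (V t w))^2) = mean (%w. (cmod (V s w))^2) + mean (%w. (cmod (dV s t w))^2)"
 proof -
  have i: "integrable M (%w. 2 * Re (cnj (V s w) * dV s t w))"
   by (intro integrable_mult_right integrable_Re m)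
  have "mean (%w. 2 * Re (cnj (V s w) * dV s t w)) = 2 * Re (mean (%w. cnj (V s w) * dV s t w))"
   by (simp only: integral_mult_right_zero integral_Re[OF m(1)])
  also have "... = 0" unfolding m(2) by simp
  finally have z: "mean (%w. 2 * Re (cnj (V s w) * dV s t w)) = 0" .
  note j = V_sq_integrable[OF st(1)] dV_power_integrable[OF st, of 2]
  show ?thesis unfolding e integral_add[OF integrable_add[OF j] i] z
   integral_add[OF j] by simp
 qed
 thus ?thesis unfolding defect_def using V_sq_integrable[OF st(1)] V_sq_integrable[OF t0] by (simp add: prob_space)
qed

text \<open>The defect is lost at the rate of the expected square of \<open>H\<close>, which Jensen's inequality bounds from below by its own square.\<close>

lemma defect_decreases:
 assumes s: "0 <= s" and h: "0 <= h"
 shows "h * (defect s)^2 / 8 - 4 * h^2 <= defect s - defect (s + h)"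
proof -
 have st: "0 <= s" "s <= s + h" using s h by auto
 let ?H = "%w. (cmod (H s w))^2" and ?x = "%w. 1 - (cmod (V s w))^2"
 have Hi: "integrable M ?H"
 proof (intro integrable_const_bound[where B="1"] AE_I2)
  fix w assume "w \<in> space M"
  from H_bound_half[OF s this] have "cmod (H s w) <= 1" by simp
  thus "norm (?H w) <= 1" by (simp add: power_le_one)
 qed (use H_meas[OF s] in simp)
 have gH: "bdd_meas s (%w. H s w * cnj (H s w))" by (intro bdd_meas_mult bdd_meas_cnj H_bdd s)
 have gr: "H s w * cnj (H s w) = Cx (?H w)" for w by (simp only: complex_norm_square)
 note inc = increment_moments(7,8)[OF st bdd_meas_measD[OF gH] bdd_meas_integrable[OF gH], unfolded gr of_real_mult[symmetric]]
 have i: "integrable M (%w. ?H w * (cmod (dX s (s + h) w))^2)" using inc(1) unfolding complex_of_real_integrable_eq .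
 have "Cx (mean (%w. ?H w * (cmod (dX s (s + h) w))^2)) = Cx (mean ?H * (s + h - s))"
  using inc(2) by (simp only: integral_complex_of_real of_real_mult[symmetric])
 hence e: "mean (%w. ?H w * (cmod (dX s (s + h) w))^2) = mean ?H * h" by (simp only: of_real_eq_iff) simp
 have xi: "integrable M ?x" using V_sq_integrable[OF s] by simp
 have x2i: "integrable M (%w. (?x w)^2)"
  using cmod_sq_le_1[OF s] V_meas[OF s] by (intro integrable_const_bound[where B="1"]) (auto simp: power_le_one)
 have "(defect s)^2 <= mean (%w. (?x w)^2)"
  unfolding defect_def using variance_eq[OF xi x2i] integral_nonneg[of M "%w. (?x w - mean ?x)^2"] by simp
 also have "... = 4 * mean ?H"
 proof -
  have "mean ?H = mean (%w. (?x w)^2 / 4)"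
  proof (rule integral_cong[OF refl])
   fix w assume "w \<in> space M"
   from cmod_H[OF s this] have "cmod (H s w) = ?x w / 2" by simp
   thus "?H w = (?x w)^2 / 4" by (simp only: power_divide) simp
  qed
  thus ?thesis by simp
 qed
 finally have EH: "(defect s)^2 / 4 <= mean ?H" by simp
 have "mean (%w. ?H w * (cmod (dX s (s + h) w))^2) <= mean (%w. 2 * (cmod (dV s (s + h) w))^2 + 2 * (cmod (R s (s + h) w))^2)"
 proof (rule integral_mono[OF i])
  show "integrable M (%w. 2 * (cmod (dV s (s + h) w))^2 + 2 * (cmod (R s (s + h) w))^2)"
   using dV_power_integrable[OF st, of 2] R_sq(1)[OF st] by simp
  fix w
  show "?H w * (cmod (dX s (s + h) w))^2 <= 2 * (cmod (dV s (s + h) w))^2 + 2 * (cmod (R s (s + h) w))^2"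
   using cmod_add_sq[of "dV s (s + h) w" "- R s (s + h) w"] by (simp add: R_def norm_mult power_mult_distrib norm_minus_commute)
 qed
 also have "... = 2 * mean (%w. (cmod (dV s (s + h) w))^2) + 2 * mean (%w. (cmod (R s (s + h) w))^2)"
  using dV_power_integrable[OF st, of 2] R_sq(1)[OF st] by simp
 also have "... <= 2 * (defect s - defect (s + h)) + 2 * (4 * h^2)"
  using R_sq(2)[OF st] defect_diff[OF st] by simp
 finally have "mean ?H * h <= 2 * (defect s - defect (s + h)) + 8 * h^2" unfolding e by simp
 moreover have "(defect s)^2 / 4 * h <= mean ?H * h" using EH h by (rule mult_right_mono)
 ultimately show ?thesis by (simp add: mult.commute)
qed

text \<open>Otherwise \<open>defect_decreases\<close>, with a suitable fixed step, would lower the defect below \<open>0\<close>.\<close>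

lemma defect_vanishes:
 assumes delta: "0 < delta"
 obtains s where "0 <= s" "!!t. s <= t ==> defect t < delta"
proof -
 have anti: "defect t <= defect s" if "0 <= s" "s <= t" for s t
 proof -
  have "0 <= mean (%w. (cmod (dV s t w))^2)" by (rule integral_nonneg) simp
  thus ?thesis using defect_diff[OF that] by linarith
 qed
 have "\<exists>s\<ge>0. defect s < delta"
 proof (rule ccontr)
  assume "~ ?thesis"
  hence ge: "delta <= defect s" if "0 <= s" for s using that by force
  \<comment> \<open>maximizes the gain \<open>h * delta\<^sup>2 / 8 - 4 * h\<^sup>2\<close> of a step\<close>
  define h where "h = delta^2 / 64"
  define kappa where "kappa = h * (delta^2 / 16)"
  have h: "0 < h" and kappa: "0 < kappa" using delta by (simp_all add: h_def kappa_def)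
  have step: "defect (s + h) <= defect s - kappa" if "0 <= s" for s
  proof -
   have "delta^2 <= (defect s)^2" using ge[OF that] delta by (intro power_mono) auto
   hence "h * delta^2 <= h * (defect s)^2" using h by (intro mult_left_mono) auto
   moreover have "h * delta^2 / 8 - 4 * h^2 = kappa" by (simp add: kappa_def h_def power2_eq_square)
   ultimately show ?thesis using defect_decreases[OF that, of h] h by linarith
  qed
  have "defect (real n * h) <= defect 0 - real n * kappa" for n
  proof (induction n)
   case (Suc n)
   have "real (Suc n) * h = real n * h + h" by (simp add: algebra_simps)
   thus ?case using step[of "real n * h"] Suc h by (simp add: algebra_simps)
  qed simp
  moreover obtain n where "defect 0 / kappa < real n" using reals_Archimedean2 by blast
  ultimately have "defect (real n * h) < 0" using kappa by (simp add: divide_less_eq) (smt (verit))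
  thus False using defect_nonneg[of "real n * h"] h by simp
 qed
 then obtain s where "0 <= s" "defect s < delta" by blast
 thus ?thesis using that anti by (meson le_less_trans)
qed

text \<open>Doob's maximal inequality, first for the times \<open>u 0 \<le> \<dots> \<le> u n\<close>.\<close>

lemma maximal_finite:
 assumes u: "0 <= u 0" "!!k. k < n ==> u k <= u (Suc k)" and delta: "0 < delta"
 shows "prob {w\<in>space M. \<exists>k\<le>n. delta <= cmod (V (u k) w - V (u 0) w)} <= defect (u 0) / delta^2"
proof -
 have mono: "u i <= u j" if "i <= j" "j <= n" for i j
  using that by (induction j) (auto simp: le_Suc_eq intro: order_trans[OF _ u(2)])
 have u0: "0 <= u k" if "k <= n" for k using mono[of 0 k] that u(1) by simp
 let ?D = "%k. dV (u 0) (u k)"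
 \<comment> \<open>\<open>k\<close> is the first time at which the path has moved by \<open>delta\<close>\<close>
 define A where "A k = {w\<in>space M. delta <= cmod (?D k w) & (\<forall>j<k. ~ delta <= cmod (?D j w))}" for k
 have VF: "V (u j) \<in> borel_measurable (F (u k))" if "j <= k" "k <= n" for j k
  using measurable_F_mono[OF V_adapted[OF u0[of j]] mono[OF that]] that by simp
 have AF: "A k \<in> sets (F (u k))" if k: "k <= n" for k
 proof -
  have D: "?D j \<in> borel_measurable (F (u k))" if "j <= k" for j
   unfolding dV_def using VF[OF that k] VF[of 0 k] k by simp
  have "{w\<in>space (F (u k)). delta <= cmod (?D k w) & (\<forall>j\<in>{..<k}. ~ delta <= cmod (?D j w))} \<in> sets (F (u k))"
  proof (intro sets.sets_Collect_conj sets.sets_Collect_finite_All)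
   note [measurable] = D[OF order.refl]
   show "{w\<in>space (F (u k)). delta <= cmod (?D k w)} \<in> sets (F (u k))" by measurable
   fix j assume "j \<in> {..<k}"
   hence [measurable]: "?D j \<in> borel_measurable (F (u k))" by (intro D) simp
   show "{w\<in>space (F (u k)). ~ delta <= cmod (?D j w)} \<in> sets (F (u k))" by measurable
  qed simp
  thus ?thesis by (simp add: A_def Ball_def)
 qed
 have AM: "A k \<in> events" if "k <= n" for k by (rule sets_FM[OF AF[OF that]])
 have disj: "disjoint_family_on A {..n}"
  by (auto simp: disjoint_family_on_def A_def) (metis linorder_neqE_nat)
 have eq: "{w\<in>space M. \<exists>k\<le>n. delta <= cmod (V (u k) w - V (u 0) w)} = (\<Union>k\<le>n. A k)"
 proof (rule set_eqI, rule iffI)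
  fix w assume "w \<in> {w\<in>space M. \<exists>k\<le>n. delta <= cmod (V (u k) w - V (u 0) w)}"
  then obtain k where k: "w \<in> space M" "k <= n" "delta <= cmod (?D k w)" by (auto simp: dV_def)
  then obtain i where i: "delta <= cmod (?D i w)" "\<forall>j<i. ~ delta <= cmod (?D j w)"
   using exists_least_iff[of "%k. delta <= cmod (?D k w)"] by blast
  hence "i <= n" using k(2,3) by (meson linorder_not_less order_trans order.strict_implies_order)
  thus "w \<in> (\<Union>k\<le>n. A k)" using i k(1) unfolding A_def by (intro UN_I[of i]) simp_all
 qed (auto simp: A_def dV_def)
 have Dn: "integrable M (%w. (cmod (?D n w))^2)" by (rule dV_power_integrable[OF u(1) mono]) auto
 have key: "delta^2 * prob (A k) <= mean (%w. indicator (A k) w * (cmod (?D n w))^2)" if k: "k <= n" for k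
 proof -
  have kn: "0 <= u k" "u k <= u n" "u 0 <= u k" using u0[OF k] mono[OF k] mono[of 0 k] k by auto
  let ?g = "%w. Cx (indicator (A k) w) * cnj (?D k w)"
  have "bdd_meas (u k) (?D k)" unfolding dV_def using bdd_meas_mono[OF V_bdd[OF u(1)] kn(3)] V_bdd[OF kn(1)] by auto
  moreover have "bdd_meas (u k) (%w. Cx (indicator (A k) w))"
   unfolding bdd_meas_def norm_of_real using AF[OF k] by (auto intro!: exI[of _ 1])
  ultimately have g: "bdd_meas (u k) ?g" by auto
  note m = dV_mean[OF kn(1,2) g]
  have e: "indicator (A k) w * (cmod (?D n w))^2 = indicator (A k) w * (cmod (?D k w))^2
   + indicator (A k) w * (cmod (dV (u k) (u n) w))^2 + 2 * Re (?g w * dV (u k) (u n) w)" for w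
   unfolding dV_def cmod_power2 by (cases "w \<in> A k") (simp_all add: power2_eq_square algebra_simps)
  have ii: "integrable M (%w. indicator (A k) w * f w)" if "integrable M f" for f :: "'w => real"
   using that AM[OF k] by (intro integrable_bounded_mult[where C=1]) auto
  note i = ii[OF dV_power_integrable[OF u(1) kn(3), of 2]] ii[OF dV_power_integrable[OF kn(1,2), of 2]]
  have "delta^2 * prob (A k) = mean (%w. delta^2 * indicator (A k) w)" using AM[OF k] by simp
  also have "... <= mean (%w. indicator (A k) w * (cmod (?D k w))^2)"
  proof (rule integral_mono)
   show "integrable M (%w. delta^2 * indicator (A k) w)" using AM[OF k] by (intro integrable_mult_right integrable_const_bound[where B=1]) auto
   show "delta^2 * indicator (A k) w <= indicator (A k) w * (cmod (?D k w))^2" for w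
    using delta by (cases "w \<in> A k") (auto simp: A_def intro!: power_mono)
  qed (rule i)
  also have "... <= mean (%w. indicator (A k) w * (cmod (?D n w))^2)"
  proof -
   have z: "mean (%w. 2 * Re (?g w * dV (u k) (u n) w)) = 0"
    by (simp only: integral_mult_right_zero integral_Re[OF m(1)] m(2)) simp
   have iz: "integrable M (%w. 2 * Re (?g w * dV (u k) (u n) w))" by (intro integrable_mult_right integrable_Re m)
   have "0 <= mean (%w. indicator (A k) w * (cmod (dV (u k) (u n) w))^2)"
    by (rule integral_nonneg) (simp add: indicator_def)
   thus ?thesis unfolding e integral_add[OF integrable_add[OF i] iz] z
    integral_add[OF i] by simp
  qed
  finally show ?thesis .
 qed
 have "delta^2 * prob (\<Union>k\<le>n. A k) = (\<Sum>k\<le>n. delta^2 * prob (A k))"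
  using AM by (subst finite_measure_finite_Union[OF _ _ disj]) (auto simp: sum_distrib_left)
 also have "... <= (\<Sum>k\<le>n. mean (%w. indicator (A k) w * (cmod (?D n w))^2))"
  by (intro sum_mono key) auto
 also have "... = mean (%w. (\<Sum>k\<le>n. indicator (A k) w) * (cmod (?D n w))^2)"
  unfolding sum_distrib_right
  by (rule integral_sum[symmetric]) (use AM Dn in \<open>auto intro!: integrable_bounded_mult[where C=1]\<close>)
 also have "... <= mean (%w. (cmod (?D n w))^2)"
 proof (rule integral_mono'[OF Dn])
  fix w
  have "(\<Sum>k\<le>n. indicator (A k) w) = (indicator (\<Union>k\<le>n. A k) w :: real)"
   by (subst indicator_UN_disjoint[OF _ disj]) simp_all
  thus "(\<Sum>k\<le>n. indicator (A k) w) * (cmod (?D n w))^2 <= (cmod (?D n w))^2" by (simp add: indicator_def)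
 qed simp
 also have "... <= defect (u 0)"
  using defect_diff[OF u(1) mono[of 0 n]] defect_nonneg[OF u0[of n]] by simp
 finally show ?thesis unfolding eq using delta by (simp add: pos_le_divide_eq mult.commute)
qed

end

lemma dyadic_below:
 assumes x: "0 <= (x::real)"
 shows "(%n. real (nat \<lfloor>x * 2 ^ n\<rfloor>) / 2 ^ n) ----> x" "nat \<lfloor>x * 2 ^ n\<rfloor> <= nat \<lceil>x\<rceil> * 2 ^ n"
proof -
 have e: "real (nat \<lfloor>x * 2 ^ n\<rfloor>) / 2 ^ n = of_int \<lfloor>2 ^ n * x\<rfloor> / 2 ^ n" for n using x by (simp add: mult.commute)
 show "(%n. real (nat \<lfloor>x * 2 ^ n\<rfloor>) / 2 ^ n) ----> x"
  unfolding e by (rule floor_grid_tendsto(1)[OF filterlim_at_top_mono[OF filterlim_real_sequentially]])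
   (simp_all add: less_imp_le of_nat_less_two_power)
 have "x <= real (nat \<lceil>x\<rceil>)" using x by linarith
 hence "x * 2 ^ n <= real (nat \<lceil>x\<rceil> * 2 ^ n)" by simp
 thus "nat \<lfloor>x * 2 ^ n\<rfloor> <= nat \<lceil>x\<rceil> * 2 ^ n" by linarith
qed

context disk_bm
begin

text \<open>Dyadic times after \<open>s\<close>, in finer and finer finite grids that reach farther and farther.\<close>

definition excursion :: "real => real => 'w set" where
 "excursion s delta = (\<Union>n. {w\<in>space M. \<exists>k\<le>n * 2 ^ n. delta <= cmod (V (s + real k / 2 ^ n) w - V s w)})"

lemma grid_excursion_events:
 assumes s: "0 <= s"
 shows "{w\<in>space M. \<exists>k\<le>N. delta <= cmod (V (s + real k / 2 ^ n) w - V s w)} \<in> events"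
proof -
 have "{w\<in>space M. \<exists>k\<in>{..N}. delta <= cmod (V (s + real k / 2 ^ n) w - V s w)} \<in> events"
 proof (rule sets.sets_Collect_finite_Ex)
  fix k
  have "(%w. cmod (V (s + real k / 2 ^ n) w - V s w)) \<in> borel_measurable M"
   using s by (intro borel_measurable_diff V_meas measurable_compose[OF _ borel_measurable_norm]) auto
  thus "{w\<in>space M. delta <= cmod (V (s + real k / 2 ^ n) w - V s w)} \<in> events"
   by (rule borel_measurable_le[OF borel_measurable_const])
 qed simp
 thus ?thesis by (simp only: Bex_def atMost_iff)
qed

lemma excursion_events: "0 <= s ==> excursion s delta \<in> events"
 unfolding excursion_def by (intro sets.countable_UN image_subsetI grid_excursion_events)

lemma prob_excursion:
 assumes s: "0 <= s" and delta: "0 < delta"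
 shows "prob (excursion s delta) <= defect s / delta^2"
proof -
 define A where "A n = {w\<in>space M. \<exists>k\<le>n * 2 ^ n. delta <= cmod (V (s + real k / 2 ^ n) w - V s w)}" for n :: nat
 have A: "A n \<in> events" for n unfolding A_def by (rule grid_excursion_events[OF s])
 have b: "prob (A n) <= defect s / delta^2" for n
  using maximal_finite[of "%k. s + real k / 2 ^ n" "n * 2 ^ n" delta] s delta unfolding A_def by (simp add: divide_right_mono)
 have "incseq A"
 proof (rule incseq_SucI, rule subsetI)
  fix n w assume "w \<in> A n"
  then obtain k where k: "w \<in> space M" "k <= n * 2 ^ n" "delta <= cmod (V (s + real k / 2 ^ n) w - V s w)" unfolding A_def by blast
  have "real k / 2 ^ n = real (2 * k) / 2 ^ Suc n" "2 * k <= Suc n * 2 ^ Suc n" using k(2) by auto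
  thus "w \<in> A (Suc n)" unfolding A_def using k by (intro CollectI conjI exI[of _ "2 * k"]) simp_all
 qed
 hence "(%n. prob (A n)) ----> prob (\<Union>n. A n)" using A by (intro finite_Lim_measure_incseq) auto
 thus ?thesis unfolding excursion_def A_def[symmetric] by (rule LIMSEQ_le_const2) (use b in blast)
qed

lemma no_excursion:
 assumes s: "0 <= s" and c: "continuous_on {0..} (%t. V t w)" and w: "w \<in> space M" "w \<notin> excursion s delta" and t: "s <= t"
 shows "cmod (V t w - V s w) <= delta"
proof -
 define k where "k n = nat \<lfloor>(t - s) * 2 ^ n\<rfloor>" for n :: nat
 have d: "0 <= t - s" using t by simp
 have k: "(%n. real (k n) / 2 ^ n) ----> t - s" unfolding k_def by (rule dyadic_below(1)[OF d])
 have "(%n. s + real (k n) / 2 ^ n) ----> s + (t - s)" by (intro tendsto_add tendsto_const k)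
 hence "(%n. V (s + real (k n) / 2 ^ n) w) ----> V t w"
  using continuous_on_tendsto_compose[OF c, of "%n. s + real (k n) / 2 ^ n" t] s t by simp
 hence l: "(%n. cmod (V (s + real (k n) / 2 ^ n) w - V s w)) ----> cmod (V t w - V s w)" by (intro tendsto_intros)
 have "cmod (V (s + real (k n) / 2 ^ n) w - V s w) <= delta" if n: "nat \<lceil>t - s\<rceil> <= n" for n
 proof -
  have "k n <= n * 2 ^ n" using order_trans[OF dyadic_below(2)[OF d] mult_right_mono[OF n]] unfolding k_def by simp
  moreover have "~ (\<exists>k\<le>n * 2 ^ n. delta <= cmod (V (s + real k / 2 ^ n) w - V s w))"
   using w unfolding excursion_def by blast
  ultimately show ?thesis by (meson not_le less_imp_le)
 qed
 thus ?thesis by (intro LIMSEQ_le_const2[OF l]) blast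
qed

text \<open>\<open>prob_excursion\<close> and \<open>defect_vanishes\<close> make the path a Cauchy path.\<close>

lemma V_converges: "AE w in M. EX z. ((%t. V t w) \<longlongrightarrow> z) at_top"
proof -
 have one: "AE w in M. \<exists>i::nat. w \<notin> excursion (real i) delta" if delta: "0 < delta" for delta
 proof (rule AE_I')
  let ?N = "\<Inter>i::nat. excursion (real i) delta"
  have N: "?N \<in> events" by (intro sets.countable_INT image_subsetI excursion_events) auto
  have "prob ?N <= e" if e: "0 < e" for e
  proof -
   have "0 < e * delta^2" using e delta by simp
   from defect_vanishes[OF this] obtain s where s: "0 <= s" "!!t. s <= t ==> defect t < e * delta^2" by blast
   obtain i :: nat where i: "s <= real i" using real_arch_simple by blast
   have "prob ?N <= prob (excursion (real i) delta)" by (intro finite_measure_mono excursion_events INT_lower) auto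
   also have "... <= defect (real i) / delta^2" by (rule prob_excursion) (use delta in auto)
   also have "... <= e" using s(2)[OF i] delta by (simp add: divide_le_eq)
   finally show ?thesis .
  qed
  hence "prob ?N <= 0" by (rule dense_ge)
  hence "prob ?N = 0" by (rule antisym) (rule measure_nonneg)
  hence "emeasure M ?N = 0" by (simp only: emeasure_eq_measure ennreal_0)
  thus "?N \<in> null_sets M" using N by (rule null_setsI)
 qed auto
 have "AE w in M. \<forall>j::nat. \<exists>i::nat. w \<notin> excursion (real i) (1 / real (Suc j))"
  unfolding AE_all_countable by (intro allI one) simp
 thus ?thesis using V_cont AE_space
 proof eventually_elim
  case (elim w)
  have near: "\<exists>i::nat. \<forall>t\<ge>real i. dist (V t w) (V (real i) w) <= 1 / real (Suc j)" for j
  proof -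
   obtain i :: nat where i: "w \<notin> excursion (real i) (1 / real (Suc j))" using elim(1) by blast
   have "dist (V t w) (V (real i) w) <= 1 / real (Suc j)" if "real i <= t" for t
    unfolding dist_norm by (rule no_excursion[OF _ elim(2,3) i that]) simp
   thus ?thesis by blast
  qed
  have near': "\<exists>i::nat. \<forall>t\<ge>real i. \<forall>t'\<ge>real i. dist (V t w) (V t' w) < e" if e: "0 < e" for e
  proof -
   have "0 < e / 2" using e by simp
   then obtain j where j: "1 / real (Suc j) < e / 2" using nat_approx_posE by blast
   obtain i where i: "\<forall>t\<ge>real i. dist (V t w) (V (real i) w) <= 1 / real (Suc j)" using near[of j] by blast
   have "dist (V t w) (V t' w) < e" if "real i <= t" "real i <= t'" for t t'
    using i[rule_format, OF that(1)] i[rule_format, OF that(2)] j dist_triangle2[of "V t w" "V t' w" "V (real i) w"] by linarith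
   thus ?thesis by blast
  qed
  have "Cauchy (%n. V (real n) w)"
   unfolding Cauchy_def
  proof (intro allI impI)
   fix e :: real assume "0 < e"
   from near'[OF this] obtain i :: nat where "\<forall>t\<ge>real i. \<forall>t'\<ge>real i. dist (V t w) (V t' w) < e" by blast
   thus "EX i. \<forall>n\<ge>i. \<forall>n'\<ge>i. dist (V (real n) w) (V (real n') w) < e" by (intro exI[of _ i]) simp
  qed
  then obtain z where z: "(%n. V (real n) w) ----> z" using Cauchy_convergent_iff convergent_def by blast
  have "((%t. V t w) \<longlongrightarrow> z) at_top"
  proof (rule tendstoI)
   fix e :: real assume e: "0 < e"
   hence e2: "0 < e / 2" by simp
   obtain i where i: "\<forall>t\<ge>real i. \<forall>t'\<ge>real i. dist (V t w) (V t' w) < e / 2" using near'[OF e2] by blast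
   obtain n where n: "dist (V (real n) w) z < e / 2" "i <= n"
    using tendstoD[OF z e2] unfolding eventually_sequentially by (meson nat_le_linear order_refl)
   have "dist (V t w) z < e" if "real i <= t" for t
   proof -
    have "dist (V t w) (V (real n) w) < e / 2" using i that n(2) by simp
    thus ?thesis using n(1) dist_triangle[of "V t w" z "V (real n) w"] by linarith
   qed
   thus "\<forall>\<^sub>F t in at_top. dist (V t w) z < e" unfolding eventually_at_top_linorder by blast
  qed
  thus ?case ..
 qed
qed

definition end_point :: "'w => complex" where "end_point w = lim (%n. V (real n) w)"

lemma end_point_meas [measurable]: "end_point \<in> borel_measurable M"
 unfolding end_point_def by (intro borel_measurable_lim_metric) simp

lemma V_end_point: "AE w in M. ((%t. V t w) \<longlongrightarrow> end_point w) at_top"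
 using V_converges
proof eventually_elim
 case (elim w)
 then obtain z where z: "((%t. V t w) \<longlongrightarrow> z) at_top" by blast
 have "(%n. V (real n) w) ----> z" by (rule filterlim_compose[OF z filterlim_real_sequentially])
 hence "end_point w = z" unfolding end_point_def by (rule limI)
 thus ?case using z by simp
qed

lemma V_end_point_sequence: "AE w in M. (%n. V (real n) w) ----> end_point w"
 using V_end_point by eventually_elim (rule filterlim_compose[OF _ filterlim_real_sequentially])

text \<open>The defect tends to \<open>0\<close>, and by bounded convergence its limit is the defect of the limit point.\<close>

lemma cmod_end_point: "AE w in M. cmod (end_point w) = 1"
proof -
 let ?f = "%w. 1 - (cmod (end_point w))^2"
 have le: "AE w in M. 0 <= ?f w"
  using V_end_point_sequence AE_space
 proof eventually_elim
  case (elim w)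
  have "(%n. 1 - (cmod (V (real n) w))^2) ----> ?f w" by (intro tendsto_intros elim)
  thus ?case using cmod_sq_le_1[OF _ elim(2)] by (intro LIMSEQ_le_const) auto
 qed
 have "(%n. mean (%w. 1 - (cmod (V (real n) w))^2)) ----> mean ?f"
 proof (rule integral_dominated_convergence[where w="%_. 1"])
  show "AE w in M. (%n. 1 - (cmod (V (real n) w))^2) ----> ?f w"
   using V_end_point_sequence by eventually_elim (intro tendsto_intros)
  show "AE w in M. norm (1 - (cmod (V (real n) w))^2) <= 1" for n
  proof (rule AE_I2)
   fix w assume "w \<in> space M"
   from cmod_sq_le_1[OF _ this, of "real n"] show "norm (1 - (cmod (V (real n) w))^2) <= 1" by simp
  qed
 qed simp_all
 moreover have "(%n. defect (real n)) ----> 0"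
 proof (rule tendstoI)
  fix e :: real assume "0 < e"
  from defect_vanishes[OF this] obtain s where s: "!!t. s <= t ==> defect t < e" by blast
  obtain i :: nat where "s <= real i" using real_arch_simple by blast
  hence "dist (defect (real n)) 0 < e" if "i <= n" for n using s[of "real n"] defect_nonneg[of "real n"] that by simp
  thus "\<forall>\<^sub>F n in sequentially. dist (defect (real n)) 0 < e" unfolding eventually_sequentially by blast
 qed
 ultimately have "mean ?f = 0" unfolding defect_def using LIMSEQ_unique by blast
 moreover have "integrable M ?f"
 proof (rule integrable_const_bound[where B=1])
  show "AE w in M. norm (?f w) <= 1" using le by eventually_elim auto
 qed simp
 ultimately have "AE w in M. ?f w = 0" using integral_nonneg_eq_0_iff_AE[OF _ le] by simp
 thus ?thesis
 proof eventually_elim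
  case (elim w)
  hence "(cmod (end_point w))^2 = 1" by simp
  thus ?case by (simp add: power2_eq_1_iff) (smt (verit) norm_ge_zero)
 qed
qed

lemma end_point_moment:
 assumes s: "0 <= s" and g: "bdd_meas s g"
 shows "integrable M (%w. g w * end_point w ^ k)" (is ?i)
  "mean (%w. g w * end_point w ^ k) = mean (%w. g w * V s w ^ k)"
proof -
 obtain K where K: "!!w. w \<in> space M ==> cmod (g w) <= K" using g by (auto simp: bdd_meas_def)
 have gm: "g \<in> borel_measurable M" by (rule bdd_meas_measM[OF g])
 have Vb: "cmod (g w * V (real n) w ^ k) <= K" if w: "w \<in> space M" for w n
 proof -
  have "cmod (V (real n) w) ^ k <= 1" using V_disk[OF _ w, of "real n"] by (intro power_le_one) auto
  from mult_mono[OF K[OF w] this] have "cmod (g w) * cmod (V (real n) w) ^ k <= K"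
   using K[OF w] norm_ge_zero[of "g w"] by simp
  thus ?thesis by (simp only: norm_mult norm_power)
 qed
 have lim: "AE w in M. (%n. g w * V (real n) w ^ k) ----> g w * end_point w ^ k"
  using V_end_point_sequence by eventually_elim (intro tendsto_intros)
 have bd: "AE w in M. cmod (g w * V (real n) w ^ k) <= K" for n using Vb by (rule AE_I2)
 show ?i by (rule integrable_dominated_convergence[OF _ _ _ lim bd]) (use gm in simp_all)
 have "(%n. mean (%w. g w * V (real n) w ^ k)) ----> mean (%w. g w * end_point w ^ k)"
  by (rule integral_dominated_convergence[OF _ _ _ lim bd]) (use gm in simp_all)
 moreover obtain i :: nat where i: "s <= real i" using real_arch_simple by blast
 have "\<forall>\<^sub>F n in sequentially. mean (%w. g w * V (real n) w ^ k) = mean (%w. g w * V s w ^ k)"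
  unfolding eventually_sequentially using i by (intro exI[of _ i] allI impI power_mean[OF s _ g]) simp
 hence "(%n. mean (%w. g w * V (real n) w ^ k)) ----> mean (%w. g w * V s w ^ k)"
  by (rule tendsto_eventually)
 ultimately show "mean (%w. g w * end_point w ^ k) = mean (%w. g w * V s w ^ k)" using LIMSEQ_unique by blast
qed

end

section \<open>Harmonic measure\<close>

definition uniform_angle :: "real measure" where "uniform_angle = uniform_measure lborel {0..2 * pi}"

definition circle :: "complex measure" where "circle = distr uniform_angle borel cis"

lemma sets_uniform_angle [simp, measurable_cong]: "sets uniform_angle = sets borel"
 by (simp add: uniform_angle_def)

lemma space_uniform_angle [simp]: "space uniform_angle = UNIV"
 by (simp add: uniform_angle_def)

lemma prob_space_uniform_angle: "prob_space uniform_angle"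
 unfolding uniform_angle_def by (rule prob_space_uniform_measure) auto

lemma sets_circle [simp, measurable_cong]: "sets circle = sets borel"
 by (simp add: circle_def)

lemma space_circle [simp]: "space circle = UNIV"
 by (simp add: circle_def)

lemma prob_space_circle: "prob_space circle"
 unfolding circle_def by (rule prob_space.prob_space_distr[OF prob_space_uniform_angle]) simp

lemma AE_circle: "AE z in circle. cmod z = 1"
 unfolding circle_def by (subst AE_distr_iff) auto

lemma circle_moment:
 assumes k: "1 <= k"
 shows "integral\<^sup>L circle (%z. z ^ k) = 0"
proof -
 have "integral\<^sup>L circle (%z. z ^ k) = integral\<^sup>L uniform_angle (%x. cis x ^ k)"
  unfolding circle_def by (rule integral_distr) simp_all
 also have "... = (\<integral>x. indicator {0..2*pi} x *\<^sub>R cis x ^ k \<partial>lborel) /\<^sub>R (2 * pi)"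
 proof -
  have d: "uniform_angle = density lborel (%x. ennreal (indicator {0..2*pi} x / (2 * pi)))"
   unfolding uniform_angle_def uniform_measure_def
   by (intro density_cong) (auto simp: indicator_def divide_ennreal[symmetric] ennreal_mult)
  have "integral\<^sup>L uniform_angle (%x. cis x ^ k) = (\<integral>x. (indicator {0..2*pi} x / (2 * pi)) *\<^sub>R cis x ^ k \<partial>lborel)"
   unfolding d by (rule integral_density) auto
  also have "... = (\<integral>x. (indicator {0..2*pi} x *\<^sub>R cis x ^ k) /\<^sub>R (2 * pi) \<partial>lborel)"
   by (intro integral_cong refl) (simp only: scaleR_scaleR divide_inverse mult.commute)
  also have "... = (\<integral>x. indicator {0..2*pi} x *\<^sub>R cis x ^ k \<partial>lborel) /\<^sub>R (2 * pi)"
   by (rule integral_scaleR_right)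
  finally show ?thesis .
 qed
 also have "(\<integral>x. indicator {0..2*pi} x *\<^sub>R cis x ^ k \<partial>lborel) = cis (real k * (2 * pi)) / (\<i> * of_nat k) - cis (real k * 0) / (\<i> * of_nat k)"
 proof (rule integral_FTC_Icc)
  fix x :: real
  have c: "cis (real k * y) = exp (\<i> * of_nat k * Cx y)" for y by (simp add: cis_conv_exp mult.assoc)
  have "((%z. exp (\<i> * of_nat k * z) / (\<i> * of_nat k)) has_field_derivative exp (\<i> * of_nat k * Cx x)) (at (Cx x))"
   using k by (auto intro!: derivative_eq_intros)
  from has_vector_derivative_real_field[OF this]
  show "((%x. cis (real k * x) / (\<i> * of_nat k)) has_vector_derivative cis x ^ k) (at x within {0..2*pi})"
   unfolding Complex.DeMoivre c .
 qed (auto intro!: continuous_intros)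
 also have "cis (real k * (2 * pi)) = 1" using cis_multiple_2pi[OF Ints_of_nat, of k] by (simp only: mult.commute[of "real k"])
 finally show ?thesis by simp
qed

text \<open>On the unit circle a real trigonometric polynomial is a polynomial divided by a power of \<open>z\<close>;
 in this form products are as easy as sums.\<close>

lemma trigonometric_approximation:
 fixes f :: "complex => real"
 assumes f: "continuous_on (sphere 0 1) f" and e: "0 < e"
 obtains g d p where "!!z. cmod z = 1 ==> \<bar>f z - g z\<bar> < e" "!!z. cmod z = 1 ==> Cx (g z) = cnj z ^ d * poly p z"
proof -
 let ?P = "%g :: complex => real. continuous_on (sphere 0 1) g & (EX d p. \<forall>z\<in>sphere 0 1. z ^ d * Cx (g z) = poly p z)"
 have "EX g. ?P g & (\<forall>z\<in>sphere 0 1. \<bar>f z - g z\<bar> < e)"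
 proof (rule Stone_Weierstrass_HOL[where P = ?P, OF _ _ _ _ _ _ f e])
  show "?P (%_. c)" for c
   by (auto intro!: exI[of _ 0] exI[of _ "[:Cx c:]"])
  fix g h :: "complex => real" assume "?P g & ?P h"
  then obtain d p d' p' where c: "continuous_on (sphere 0 1) g" "continuous_on (sphere 0 1) h"
   and p: "!!z. z\<in>sphere 0 1 ==> z ^ d * Cx (g z) = poly p z" "!!z. z\<in>sphere 0 1 ==> z ^ d' * Cx (h z) = poly p' z" by metis
  have "z ^ (d + d') * Cx (g z + h z) = poly (monom 1 d' * p + monom 1 d * p') z" if "z \<in> sphere 0 1" for z
   by (simp add: poly_monom p[OF that, symmetric] power_add algebra_simps)
  with c show "?P (%z. g z + h z)" by (blast intro: continuous_on_add)
  have "z ^ (d + d') * Cx (g z * h z) = poly (p * p') z" if "z \<in> sphere 0 1" for z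
   by (simp add: p[OF that, symmetric] power_add algebra_simps)
  with c show "?P (%z. g z * h z)" by (blast intro: continuous_on_mult)
 next
  have c: "z * cnj z = 1" if "z \<in> sphere 0 1" for z :: complex using that by (simp add: complex_norm_square[symmetric])
  have R: "z * Cx (Re z) = (z^2 + 1) / 2" "z * Cx (Im z) = (z^2 - 1) / (2 * \<i>)" if "z \<in> sphere 0 1" for z
  proof -
   have "Cx (Re z) = (z + cnj z) / 2" "Cx (Im z) = (z - cnj z) / (2 * \<i>)"
    by (simp_all add: complex_eq_iff)
   thus "z * Cx (Re z) = (z^2 + 1) / 2" "z * Cx (Im z) = (z^2 - 1) / (2 * \<i>)"
    using c[OF that] by (simp_all only: times_divide_eq_right distrib_left right_diff_distrib power2_eq_square)
  qed
  have PR: "?P Re"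
   by (rule conjI, intro continuous_intros, rule exI[of _ 1], rule exI[of _ "[:1/2, 0, 1/2:]"]) (use R(1) in \<open>auto simp: power2_eq_square add_divide_distrib algebra_simps\<close>)
  have PI: "?P Im"
   by (rule conjI, intro continuous_intros, rule exI[of _ 1], rule exI[of _ "[:- 1/(2 * \<i>), 0, 1/(2 * \<i>):]"]) (use R(2) in \<open>auto simp: power2_eq_square diff_divide_distrib algebra_simps\<close>)
  fix x y :: complex assume "x \<in> sphere 0 1 & y \<in> sphere 0 1 & x ~= y"
  thus "EX f. ?P f & f x ~= f y" using PR PI complex_eq_iff by blast
 qed auto
 then obtain g d p where g: "!!z. z \<in> sphere 0 1 ==> \<bar>f z - g z\<bar> < e" "!!z. z \<in> sphere 0 1 ==> z ^ d * Cx (g z) = poly p z"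
  by blast
 have "Cx (g z) = cnj z ^ d * poly p z" if "cmod z = 1" for z
 proof -
  have "cnj z * z = 1" using that by (simp add: complex_norm_square[symmetric] mult.commute)
  hence "(cnj z * z) ^ d = 1" by simp
  hence "Cx (g z) = cnj z ^ d * (z ^ d * Cx (g z))"
   by (simp only: power_mult_distrib mult.assoc[symmetric] mult_1)
  thus ?thesis using g(2)[of z] that by simp
 qed
 thus ?thesis using that[of g d p] g(1) by simp
qed


lemma circle_mixed_power:
 assumes "cmod z = 1"
 shows "cnj z ^ d * z ^ k = (if d <= k then z ^ (k - d) else cnj (z ^ (d - k)))"
proof -
 have "cnj z * z = 1" using assms by (simp add: complex_norm_square[symmetric] mult.commute)
 hence c: "(cnj z * z) ^ n = 1" for n by simp
 show ?thesis
 proof (cases "d <= k")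
  case True
  hence "z ^ k = z ^ d * z ^ (k - d)" by (simp add: power_add[symmetric])
  hence "cnj z ^ d * z ^ k = (cnj z * z) ^ d * z ^ (k - d)" by (simp only: power_mult_distrib mult.assoc)
  with True show ?thesis by (simp add: c)
 next
  case False
  hence "cnj z ^ d = cnj z ^ (d - k) * cnj z ^ k" by (simp add: power_add[symmetric])
  hence "cnj z ^ d * z ^ k = cnj z ^ (d - k) * (cnj z * z) ^ k" by (simp only: power_mult_distrib mult.assoc)
  with False show ?thesis by (simp add: c)
 qed
qed

locale circle_measure = finite_measure mu for mu :: "complex measure" +
 assumes sets [simp, measurable_cong]: "sets mu = sets borel" and circle: "AE z in mu. cmod z = 1"
begin

lemma continuous_integrable:
 fixes f :: "complex => 'b::{banach, second_countable_topology}"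
 assumes f: "continuous_on UNIV f"
 shows "integrable mu f"
proof -
 have "bounded (f ` sphere 0 1)" by (intro compact_imp_bounded compact_continuous_image continuous_on_subset[OF f]) auto
 then obtain K where K: "\<forall>z\<in>sphere 0 1. norm (f z) <= K" unfolding bounded_iff by auto
 show ?thesis
 proof (rule integrable_const_bound)
  show "AE z in mu. norm (f z) <= K" using circle by eventually_elim (use K in simp)
  show "f \<in> borel_measurable mu" using borel_measurable_continuous_onI[OF f] by simp
 qed
qed

lemma mixed_moment:
 "integral\<^sup>L mu (%z. cnj z ^ d * z ^ k) = (if d <= k then integral\<^sup>L mu (%z. z ^ (k - d)) else cnj (integral\<^sup>L mu (%z. z ^ (d - k))))"
proof -
 have "integral\<^sup>L mu (%z. cnj z ^ d * z ^ k) = integral\<^sup>L mu (%z. if d <= k then z ^ (k - d) else cnj (z ^ (d - k)))"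
  by (rule integral_cong_AE) (use circle in \<open>measurable, eventually_elim, simp add: circle_mixed_power\<close>)
 thus ?thesis by (cases "d <= k") (simp_all only: if_True if_False integral_cnj)
qed

lemma integral_approximation:
 fixes f g :: "complex => real"
 assumes f: "continuous_on UNIV f" and g: "continuous_on UNIV g" and e: "!!z. cmod z = 1 ==> \<bar>f z - g z\<bar> < e"
 shows "\<bar>integral\<^sup>L mu f - integral\<^sup>L mu g\<bar> <= e * measure mu (space mu)"
proof -
 note i = continuous_integrable[OF f] continuous_integrable[OF g]
 have "\<bar>integral\<^sup>L mu f - integral\<^sup>L mu g\<bar> = \<bar>\<integral>z. f z - g z \<partial>mu\<bar>" using i by simp
 also have "... <= (\<integral>z. \<bar>f z - g z\<bar> \<partial>mu)" by (rule integral_abs_bound)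
 also have "... <= (\<integral>z. e \<partial>mu)"
 proof (rule integral_mono_AE)
  show "AE z in mu. \<bar>f z - g z\<bar> <= e" using circle by eventually_elim (use e less_imp_le in blast)
 qed (use i in auto)
 finally show ?thesis by (simp add: mult.commute)
qed

end

text \<open>Equal moments give equal integrals of trigonometric polynomials, which are dense by the Stone-Weierstrass theorem.\<close>

lemma circle_integral_eq:
 fixes f :: "complex => real"
 assumes mu: "circle_measure mu" and nu: "circle_measure nu" and moments: "!!k. integral\<^sup>L mu (%z. z ^ k) = integral\<^sup>L nu (%z. z ^ k)"
  and f: "continuous_on UNIV f"
 shows "integral\<^sup>L mu f = integral\<^sup>L nu f"
proof -
 interpret mu: circle_measure mu by fact
 interpret nu: circle_measure nu by fact
 let ?m = "measure mu (space mu) + measure nu (space nu)"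
 have close: "\<bar>integral\<^sup>L mu f - integral\<^sup>L nu f\<bar> <= e * ?m" if e: "0 < e" for e
 proof -
  from trigonometric_approximation[OF continuous_on_subset[OF f subset_UNIV] e] obtain g0 d p where
   g0: "!!z. cmod z = 1 ==> \<bar>f z - g0 z\<bar> < e" "!!z. cmod z = 1 ==> Cx (g0 z) = cnj z ^ d * poly p z" by metis
  define P where "P z = (\<Sum>k\<le>degree p. coeff p k * (cnj z ^ d * z ^ k))" for z
  have P: "P z = cnj z ^ d * poly p z" for z unfolding P_def poly_altdef sum_distrib_left by (simp add: mult.left_commute)
  have c: "continuous_on UNIV P" "continuous_on UNIV (%z. Re (P z))" unfolding P_def by (intro continuous_intros)+
  have g: "\<bar>f z - Re (P z)\<bar> < e" if "cmod z = 1" for z using g0(1)[OF that] unfolding P g0(2)[OF that, symmetric] by simp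
  have int: "integral\<^sup>L rho (%z. Re (P z)) = Re (\<Sum>k\<le>degree p. coeff p k * integral\<^sup>L rho (%z. cnj z ^ d * z ^ k))" if "circle_measure rho" for rho
  proof -
   interpret rho: circle_measure rho by fact
   have "complex_integrable rho (%z. coeff p k * (cnj z ^ d * z ^ k))" for k by (intro rho.continuous_integrable continuous_intros)
   thus ?thesis unfolding integral_Re[OF rho.continuous_integrable[OF c(1)]] unfolding P_def
    by (subst integral_sum) simp_all
  qed
  have "integral\<^sup>L mu (%z. Re (P z)) = integral\<^sup>L nu (%z. Re (P z))"
   unfolding int[OF mu] int[OF nu] mu.mixed_moment nu.mixed_moment moments ..
  thus ?thesis
   using mu.integral_approximation[OF f c(2) g] nu.integral_approximation[OF f c(2) g] by (simp add: distrib_left)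
 qed
 have "\<bar>integral\<^sup>L mu f - integral\<^sup>L nu f\<bar> <= 0 + e" if e: "0 < e" for e
 proof -
  have m: "0 <= ?m" by (simp add: add_nonneg_nonneg)
  hence "e / (?m + 1) * ?m <= e" using e by (simp add: divide_le_eq mult_left_mono not_less add_nonneg_nonneg)
  thus ?thesis using close[of "e / (?m + 1)"] e m by simp
 qed
 hence "\<bar>integral\<^sup>L mu f - integral\<^sup>L nu f\<bar> <= 0" by (rule field_le_epsilon)
 thus ?thesis by simp
qed

lemma circle_measure_eqI:
 assumes mu: "circle_measure mu" and nu: "circle_measure nu" and moments: "!!k. integral\<^sup>L mu (%z. z ^ k) = integral\<^sup>L nu (%z. z ^ k)"
 shows "mu = nu"
proof (rule measure_eqI_generator_eq[where \<Omega>=UNIV and E="Collect closed" and A="%_. UNIV"])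
 interpret mu: circle_measure mu by fact
 interpret nu: circle_measure nu by fact
 show "Int_stable (Collect closed)" by (auto simp: Int_stable_def)
 show "sets mu = sigma_sets UNIV (Collect closed)" "sets nu = sigma_sets UNIV (Collect closed)" by (simp_all add: borel_eq_closed)
 fix D :: "complex set" assume "D \<in> Collect closed"
 hence D: "closed D" by simp
 show "emeasure mu D = emeasure nu D"
 proof (cases "D = {}")
  case False
  have D': "D \<in> sets borel" using D by (rule borel_closed)
  define f where "f n z = max 0 (1 - real n * infdist z D)" for n :: nat and z
  have f: "continuous_on UNIV (f n)" for n unfolding f_def by (intro continuous_intros)
  have fb: "0 <= f n z" "f n z <= 1" for n z using infdist_nonneg[of z D] unfolding f_def by auto
  have lim: "(%n. f n z) ----> indicator D z" for z
  proof (cases "z \<in> D")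
   case z: False
   hence d: "0 < infdist z D" using D False by (simp add: in_closed_iff_infdist_zero infdist_nonneg order.not_eq_order_implies_strict)
   obtain i where i: "1 / infdist z D < real i" using reals_Archimedean2 by blast
   have "f n z = 0" if "i <= n" for n
   proof -
    have "1 / infdist z D < real n" using i that by linarith
    hence "1 < real n * infdist z D" using d by (simp add: divide_less_eq)
    thus ?thesis by (simp add: f_def)
   qed
   hence "\<forall>\<^sub>F n in sequentially. f n z = 0" by (rule eventually_sequentiallyI)
   thus ?thesis using z by (simp add: tendsto_eventually)
  qed (simp add: f_def)
  have conv: "(%n. integral\<^sup>L rho (f n)) ----> measure rho D" if "circle_measure rho" for rho
  proof -
   interpret rho: circle_measure rho by fact
   have "(%n. integral\<^sup>L rho (f n)) ----> integral\<^sup>L rho (indicator D)"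
   proof (rule integral_dominated_convergence[where w="%_. 1"])
    show "AE z in rho. (%n. f n z) ----> indicator D z" by (intro AE_I2 lim)
    show "AE z in rho. norm (f n z) <= 1" for n using fb by (intro AE_I2) auto
    show "f n \<in> borel_measurable rho" for n using borel_measurable_continuous_onI[OF f] by simp
   qed (use D' in simp_all)
   thus ?thesis using D' by simp
  qed
  have "measure mu D = measure nu D"
   using conv[OF mu] conv[OF nu] unfolding circle_integral_eq[OF mu nu moments f] by (rule LIMSEQ_unique)
  thus ?thesis by (simp add: mu.emeasure_eq_measure nu.emeasure_eq_measure)
 qed simp
qed (use circle_measure.axioms(1)[OF mu, THEN finite_measure.emeasure_finite] in auto)

text \<open>With vanishing moments the law of \<open>Z\<close> on \<open>A\<close> is a multiple of the uniform law; as \<open>A\<close> is arbitrary, this contains the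
 independence.\<close>

lemma (in prob_space) circle_law:
 fixes Z :: "'a => complex"
 assumes Z [measurable]: "Z \<in> borel_measurable M" and Z1: "AE w in M. cmod (Z w) = 1" and A [measurable]: "A \<in> events"
  and moments: "!!k. 1 <= k ==> mean (%w. indicator A w * Z w ^ k) = 0"
  and D: "D \<in> sets borel"
 shows "emeasure M (A Int Z -` D) = emeasure M A * emeasure circle D"
proof -
 interpret C: prob_space circle by (rule prob_space_circle)
 let ?A = "density M (indicator A)" and ?nu = "density circle (%_. ennreal (prob A))"
 let ?mu = "distr ?A borel Z"
 have AM: "A \<subseteq> space M" using A by (rule sets.sets_into_space)
 have mu: "emeasure ?mu D = emeasure M (A Int Z -` D)" if D [measurable]: "D \<in> sets borel" for D
 proof -
  have "emeasure ?mu D = emeasure ?A (Z -` D Int space M)" by (simp add: emeasure_distr)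
  also have "... = emeasure M (A Int (Z -` D Int space M))" by (intro emeasure_restricted) measurable
  also have "A Int (Z -` D Int space M) = A Int Z -` D" using AM by auto
  finally show ?thesis .
 qed
 have "?mu = ?nu"
 proof (rule circle_measure_eqI)
  show "circle_measure ?mu"
  proof (intro circle_measure.intro circle_measure_axioms.intro finite_measureI)
   show "emeasure ?mu (space ?mu) ~= \<infinity>" using mu[of UNIV] by simp
   show "AE z in ?mu. cmod z = 1" by (subst AE_distr_iff) (use Z1 in \<open>auto simp: AE_density elim: eventually_mono\<close>)
  qed simp
  show "circle_measure ?nu"
  proof (intro circle_measure.intro circle_measure_axioms.intro finite_measureI)
   show "emeasure ?nu (space ?nu) ~= \<infinity>" by (simp add: emeasure_density ennreal_mult_eq_top_iff)
   show "AE z in ?nu. cmod z = 1" using AE_circle by (subst AE_density) (auto elim: eventually_mono)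
  qed simp
  fix k
  have "integral\<^sup>L ?mu (%z. z ^ k) = mean (%w. indicator A w * Z w ^ k)"
  proof -
   have "?A = density M (%w. ennreal (indicator A w))" by (intro density_cong) (auto simp: indicator_def)
   hence "integral\<^sup>L ?mu (%z. z ^ k) = integral\<^sup>L (density M (%w. ennreal (indicator A w))) (%w. Z w ^ k)"
    by (simp add: integral_distr)
   also have "... = mean (%w. indicator A w *\<^sub>R Z w ^ k)" by (rule integral_density) auto
   finally show ?thesis by (simp add: scaleR_conv_of_real of_real_indicator)
  qed
  also have "... = prob A *\<^sub>R integral\<^sup>L circle (%z. z ^ k)"
  proof (cases "k = 0")
   case True
   have "mean (%w. indicator A w :: complex) = Cx (mean (indicator A))"
    unfolding integral_complex_of_real[symmetric] by (intro integral_cong refl) (simp add: indicator_def)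
   thus ?thesis using True A C.prob_space by (simp add: scaleR_conv_of_real)
  qed (simp add: moments circle_moment)
  also have "... = integral\<^sup>L ?nu (%z. z ^ k)" by (subst integral_density) auto
  finally show "integral\<^sup>L ?mu (%z. z ^ k) = integral\<^sup>L ?nu (%z. z ^ k)" .
 qed
 hence "emeasure M (A Int Z -` D) = emeasure ?nu D" using mu[OF D] by simp
 also have "... = emeasure M A * emeasure circle D" using D by (simp add: emeasure_density nn_integral_cmult emeasure_eq_measure)
 finally show ?thesis .
qed

text \<open>Since the moments of the end point are known, the Moebius map is approximated by polynomials in \<open>w\<close>.\<close>

lemma geometric_moebius:
 fixes v w :: complex
 assumes v: "cmod v < 1" and w: "cmod w = 1"
 shows "(%n. (w - v) * (\<Sum>i<n. cnj v ^ i * w ^ i)) ----> moebius v w"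
  "cmod ((w - v) * (\<Sum>i<n. cnj v ^ i * w ^ i)) <= 4 / (1 - cmod v)"
proof -
 let ?q = "cnj v * w"
 have q: "cmod ?q = cmod v" using w by (simp add: norm_mult)
 hence "cmod ?q < 1" using v by simp
 from geometric_sums[OF this] have "(%n. \<Sum>i<n. ?q ^ i) ----> 1 / (1 - ?q)" by (simp add: sums_def)
 hence "(%n. (w - v) * (\<Sum>i<n. ?q ^ i)) ----> (w - v) * (1 / (1 - ?q))" by (intro tendsto_intros)
 thus "(%n. (w - v) * (\<Sum>i<n. cnj v ^ i * w ^ i)) ----> moebius v w" by (simp add: power_mult_distrib)
 have ne: "?q ~= 1" using q v by auto
 have "(\<Sum>i<n. ?q ^ i) = (1 - ?q ^ n) / (1 - ?q)" using ne by (simp add: sum_gp_strict)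
 moreover have "cmod (1 - ?q ^ n) <= 2"
 proof -
  have "cmod (?q ^ n) <= 1" unfolding norm_power q using v by (intro power_le_one) auto
  thus ?thesis using norm_triangle_ineq4[of 1 "?q ^ n"] by simp
 qed
 moreover have "1 - cmod v <= cmod (1 - ?q)" using norm_triangle_ineq2[of 1 ?q] q by simp
 moreover have "cmod (w - v) <= 2" using norm_triangle_ineq4[of w v] v w by simp
 ultimately have "cmod (w - v) * cmod (\<Sum>i<n. ?q ^ i) <= 2 * (2 / (1 - cmod v))"
  using v by (intro mult_mono) (auto simp: norm_divide intro!: frac_le)
 thus "cmod ((w - v) * (\<Sum>i<n. cnj v ^ i * w ^ i)) <= 4 / (1 - cmod v)"
  by (simp add: norm_mult power_mult_distrib)
qed

lemma cmod_moebius: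
 assumes v: "cmod v < 1" and w: "cmod w = 1"
 shows "cmod (moebius v w) = 1"
proof -
 have "cnj w * w = 1" using w by (simp add: complex_norm_square[symmetric] mult.commute)
 hence "1 - cnj v * w = w * cnj (w - v)" by (simp add: algebra_simps)
 hence "cmod (1 - cnj v * w) = cmod (w - v)" using w by (simp only: norm_mult complex_mod_cnj mult_1)
 moreover have "w ~= v" using v w by auto
 ultimately show ?thesis by (simp add: norm_divide)
qed

context disk_bm
begin

definition ess_bdd :: "('w => complex) => bool" where
 "ess_bdd f \<longleftrightarrow> f \<in> borel_measurable M & (EX C. AE w in M. cmod (f w) <= C)"

lemma ess_bdd_integrable: "ess_bdd f ==> complex_integrable M f"
 unfolding ess_bdd_def by (blast intro: integrable_const_bound)

lemma ess_bdd_const: "ess_bdd (%_. c)"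
 unfolding ess_bdd_def by auto

lemma ess_bdd_mult:
 assumes "ess_bdd f" "ess_bdd g" shows "ess_bdd (%w. f w * g w)"
proof -
 obtain C C' where "AE w in M. cmod (f w) <= C" "AE w in M. cmod (g w) <= C'" using assms unfolding ess_bdd_def by blast
 hence "AE w in M. cmod (f w * g w) <= C * C'"
 proof eventually_elim
  case (elim w)
  thus ?case unfolding norm_mult using norm_ge_zero[of "f w"] norm_ge_zero[of "g w"] by (intro mult_mono) linarith+
 qed
 thus ?thesis using assms unfolding ess_bdd_def by (blast intro: borel_measurable_times)
qed

lemma ess_bdd_add:
 assumes "ess_bdd f" "ess_bdd g" shows "ess_bdd (%w. f w + g w)"
proof -
 obtain C C' where "AE w in M. cmod (f w) <= C" "AE w in M. cmod (g w) <= C'" using assms unfolding ess_bdd_def by blast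
 hence "AE w in M. cmod (f w + g w) <= C + C'" by eventually_elim (rule norm_triangle_mono)
 thus ?thesis using assms unfolding ess_bdd_def by (blast intro: borel_measurable_add)
qed

lemma ess_bdd_sum: "finite I ==> (!!i. i \<in> I ==> ess_bdd (f i)) ==> ess_bdd (%w. \<Sum>i\<in>I. f i w)"
 by (induction I rule: finite_induct) (simp_all add: ess_bdd_const ess_bdd_add)

lemma ess_bdd_power: "ess_bdd f ==> ess_bdd (%w. f w ^ k)"
 by (induction k) (simp_all add: ess_bdd_const ess_bdd_mult)

lemma ess_bdd_of_bdd_meas: "bdd_meas t g ==> ess_bdd g"
 using bdd_meas_measM unfolding ess_bdd_def bdd_meas_def by (metis AE_I2)

lemma ess_bdd_end_point: "ess_bdd end_point"
 unfolding ess_bdd_def using cmod_end_point by (auto intro!: exI[of _ 1])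

lemma ess_bdd_displacement:
 assumes "0 <= t" shows "ess_bdd (%w. end_point w - V t w)"
proof -
 have "ess_bdd (%w. end_point w + (- 1) * V t w)"
  by (intro ess_bdd_add ess_bdd_mult ess_bdd_const ess_bdd_end_point ess_bdd_of_bdd_meas[OF V_bdd[OF assms]])
 thus ?thesis by simp
qed

lemma ess_bdd_geometric: "0 <= t ==> ess_bdd (%w. \<Sum>i<n. cnj (V t w) ^ i * end_point w ^ i)"
 by (intro ess_bdd_sum ess_bdd_mult ess_bdd_power ess_bdd_end_point ess_bdd_of_bdd_meas[OF bdd_meas_cnj[OF V_bdd]]) auto

text \<open>Given the past of \<open>t\<close>, the powers of the end point have the means \<open>V t ^ k\<close>, so a polynomial in the end point is evaluated at
 \<open>V t\<close>, where the first factor vanishes.\<close>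

lemma centred_moment:
 assumes t: "0 <= t"
 shows "bdd_meas t g ==> mean (%w. g w * (end_point w - V t w) ^ Suc j * end_point w ^ k) = 0"
proof (induction j arbitrary: g k)
 case 0
 have gV: "bdd_meas t (%w. g w * V t w)" by (intro bdd_meas_mult 0 V_bdd t)
 have "g w * (end_point w - V t w) ^ Suc 0 * end_point w ^ k = g w * end_point w ^ Suc k - (g w * V t w) * end_point w ^ k" for w
  by (simp add: algebra_simps)
 hence "mean (%w. g w * (end_point w - V t w) ^ Suc 0 * end_point w ^ k)
   = mean (%w. g w * V t w ^ Suc k) - mean (%w. g w * V t w * V t w ^ k)"
  by (simp only: integral_diff[OF end_point_moment(1)[OF t 0] end_point_moment(1)[OF t gV]]
    end_point_moment(2)[OF t 0] end_point_moment(2)[OF t gV])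
 thus ?case by (simp only: power_Suc mult.assoc diff_self)
next
 case (Suc j)
 let ?f = "%w. g w * (end_point w - V t w) ^ Suc j * end_point w ^ Suc k"
 let ?h = "%w. (g w * V t w) * (end_point w - V t w) ^ Suc j * end_point w ^ k"
 have gV: "bdd_meas t (%w. g w * V t w)" by (intro bdd_meas_mult Suc V_bdd t)
 have i: "complex_integrable M (%w. g' w * (end_point w - V t w) ^ Suc j * end_point w ^ k')" if g': "bdd_meas t g'" for g' k'
  by (intro ess_bdd_integrable ess_bdd_mult ess_bdd_power ess_bdd_displacement ess_bdd_end_point ess_bdd_of_bdd_meas[OF g'] t)
 have "g w * (end_point w - V t w) ^ Suc (Suc j) * end_point w ^ k = ?f w - ?h w" for w
  by (simp add: algebra_simps)
 hence "mean (%w. g w * (end_point w - V t w) ^ Suc (Suc j) * end_point w ^ k) = mean ?f - mean ?h"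
  by (simp only: integral_diff[OF i[OF Suc.prems] i[OF gV]])
 thus ?case by (simp only: Suc.IH[OF Suc.prems] Suc.IH[OF gV] diff_self)
qed

lemma geometric_moment:
 assumes t: "0 <= t"
 shows "bdd_meas t g ==> mean (%w. g w * (end_point w - V t w) ^ Suc j * end_point w ^ k
  * (\<Sum>i<n. cnj (V t w) ^ i * end_point w ^ i) ^ e) = 0"
proof (induction e arbitrary: g k)
 case 0
 thus ?case using centred_moment[OF t 0] by simp
next
 case (Suc e)
 let ?G = "%w. \<Sum>i<n. cnj (V t w) ^ i * end_point w ^ i"
 let ?f = "%i w. (g w * cnj (V t w) ^ i) * (end_point w - V t w) ^ Suc j * end_point w ^ (k + i) * ?G w ^ e"
 have g: "bdd_meas t (%w. g w * cnj (V t w) ^ i)" for i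
  using bdd_meas_mult[OF Suc.prems bdd_meas_cnj[OF V_power_bdd[OF t, of i]]] by simp
 have i: "complex_integrable M (?f i)" for i
  by (intro ess_bdd_integrable ess_bdd_mult ess_bdd_power[OF ess_bdd_displacement] ess_bdd_power[OF ess_bdd_end_point]
   ess_bdd_power[OF ess_bdd_geometric] ess_bdd_of_bdd_meas[OF g] t)
 have e: "g w * (end_point w - V t w) ^ Suc j * end_point w ^ k * ?G w ^ Suc e = (\<Sum>i<n. ?f i w)" for w
 proof -
  have "g w * (end_point w - V t w) ^ Suc j * end_point w ^ k * ?G w ^ Suc e
   = ?G w * (g w * (end_point w - V t w) ^ Suc j * end_point w ^ k * ?G w ^ e)" by (simp only: power_Suc mult_ac)
  also have "... = (\<Sum>i<n. ?f i w)" unfolding sum_distrib_right[of _ _ "g w * (end_point w - V t w) ^ Suc j * end_point w ^ k * ?G w ^ e"]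
   by (intro sum.cong refl) (simp only: power_add mult_ac)
  finally show ?thesis .
 qed
 have "mean (%w. \<Sum>i<n. ?f i w) = (\<Sum>i<n. mean (?f i))"
  by (rule integral_sum) (rule i)
 thus ?case unfolding e Suc.IH[OF g] by simp
qed

text \<open>A limit of \<open>geometric_moment\<close>. The bound of \<open>geometric_moebius\<close> is not integrable near the boundary, so first \<open>V t\<close> is
 confined to a smaller disk, and then the disk is enlarged.\<close>

lemma moebius_moment:
 assumes t: "0 <= t" and g: "bdd_meas t g"
 shows "mean (%w. g w * (moebius (V t w) (end_point w)) ^ Suc j) = 0"
proof -
 let ?Z = "%w. moebius (V t w) (end_point w)"
 let ?G = "%n w. (end_point w - V t w) * (\<Sum>i<n. cnj (V t w) ^ i * end_point w ^ i)"
 obtain K where K: "!!w. w \<in> space M ==> cmod (g w) <= K" using g by (auto simp: bdd_meas_def)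
 note [measurable] = V_meas[OF t] bdd_meas_measM[OF g]
 define r where "r i = 1 - 1 / real (Suc i)" for i
 have r1: "r i < 1" for i by (simp add: r_def)
 let ?A = "%i. {w\<in>space M. cmod (V t w) <= r i}"
 let ?g = "%i w. g w * indicator (?A i) w"
 have cut: "mean (%w. ?g i w * ?Z w ^ Suc j) = 0" for i
 proof -
  have AM [measurable]: "?A i \<in> events" by measurable
  have "?A i \<in> sets (F t)"
  proof -
   note [measurable] = V_adapted[OF t]
   have "{w\<in>space (F t). cmod (V t w) <= r i} \<in> sets (F t)" by measurable
   thus ?thesis by simp
  qed
  hence "bdd_meas t (%w. indicator (?A i) w)" unfolding bdd_meas_def by (auto intro!: exI[of _ 1] simp: indicator_def)
  hence g': "bdd_meas t (?g i)" by (rule bdd_meas_mult[OF g])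
  have "(%n. mean (%w. ?g i w * ?G n w ^ Suc j)) ----> mean (%w. ?g i w * ?Z w ^ Suc j)"
  proof (rule integral_dominated_convergence[where w="%_. \<bar>K\<bar> * (4 / (1 - r i)) ^ Suc j"])
   show "AE w in M. (%n. ?g i w * ?G n w ^ Suc j) ----> ?g i w * ?Z w ^ Suc j"
    using cmod_end_point AE_space
   proof eventually_elim
    case (elim w)
    show ?case by (intro tendsto_intros geometric_moebius(1) V_disk t elim)
   qed
   show "AE w in M. cmod (?g i w * ?G n w ^ Suc j) <= \<bar>K\<bar> * (4 / (1 - r i)) ^ Suc j" for n
    using cmod_end_point AE_space
   proof eventually_elim
    case (elim w)
    show ?case
    proof (cases "w \<in> (?A i)")
     case True
     have "cmod (?G n w) <= 4 / (1 - cmod (V t w))" by (intro geometric_moebius(2) V_disk t elim)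
     also have "... <= 4 / (1 - r i)" using True r1[of i] by (intro frac_le) auto
     finally have "cmod (?G n w) ^ Suc j <= (4 / (1 - r i)) ^ Suc j" by (intro power_mono) simp_all
     moreover have "cmod (?g i w) <= \<bar>K\<bar>" using K[OF elim(2)] by (auto simp: norm_mult indicator_def)
     ultimately show ?thesis unfolding norm_mult[of "?g i w"] norm_power by (intro mult_mono) auto
    next
     case False
     have "0 <= \<bar>K\<bar> * (4 / (1 - r i)) ^ Suc j" using r1[of i] by (intro mult_nonneg_nonneg zero_le_power) auto
     with False show ?thesis by simp
    qed
   qed
  qed measurable
  moreover have zero: "mean (%w. ?g i w * ?G n w ^ Suc j) = 0" for n
   using geometric_moment[OF t g', of j 0 n "Suc j"] by (simp only: power_mult_distrib power_0 mult_1_right mult.assoc)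
  ultimately have "(%n::nat. 0) ----> mean (%w. ?g i w * ?Z w ^ Suc j)" by (simp only: zero)
  thus ?thesis by (rule LIMSEQ_unique[OF _ tendsto_const])
 qed
 have Z: "AE w in M. cmod (?Z w) = 1"
  using cmod_end_point AE_space by eventually_elim (rule cmod_moebius[OF V_disk[OF t]])
 have "(%i. mean (%w. ?g i w * ?Z w ^ Suc j)) ----> mean (%w. g w * ?Z w ^ Suc j)"
 proof (rule integral_dominated_convergence[where w="%_. \<bar>K\<bar>"])
  show "AE w in M. (%i. ?g i w * ?Z w ^ Suc j) ----> g w * ?Z w ^ Suc j"
  proof (rule AE_I2)
   fix w assume w: "w \<in> space M"
   have "r ----> 1 - 0" unfolding r_def
    using tendsto_diff[OF tendsto_const LIMSEQ_inverse_real_of_nat, of 1] by (simp add: divide_inverse)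
   hence "\<forall>\<^sub>F i in sequentially. cmod (V t w) < r i" using V_disk[OF t w] by (intro order_tendstoD(1)) auto
   hence "\<forall>\<^sub>F i in sequentially. ?g i w * ?Z w ^ Suc j = g w * ?Z w ^ Suc j"
    by eventually_elim (use w in simp)
   thus "(%i. ?g i w * ?Z w ^ Suc j) ----> g w * ?Z w ^ Suc j"
    by (rule tendsto_eventually)
  qed
  show "AE w in M. cmod (?g i w * ?Z w ^ Suc j) <= \<bar>K\<bar>" for i
   using Z AE_space
  proof eventually_elim
   case (elim w)
   have "cmod (?g i w * ?Z w ^ Suc j) = cmod (g w) * cmod (indicator (?A i) w :: complex)"
    unfolding norm_mult[of _ "?Z w ^ Suc j"] norm_power elim(1) by (simp add: norm_mult)
   thus ?case using K[OF elim(2)] by (auto simp: indicator_def)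
  qed
 qed measurable
 hence "(%i::nat. 0) ----> mean (%w. g w * ?Z w ^ Suc j)" unfolding cut .
 thus ?thesis by (rule LIMSEQ_unique[OF _ tendsto_const])
qed

text \<open>The end point is mapped to the circle by the Moebius map that takes \<open>V t\<close> to \<open>0\<close>: the hitting law from the center is uniform.\<close>

lemma harmonic_measure:
 assumes t: "0 <= t" and kappa: "kappa \<in> borel_measurable (F t)" "!!w. cmod (kappa w) = 1" and A: "A \<in> sets (F t)" and D: "D \<in> sets borel"
 shows "emeasure M (A Int (%w. kappa w * (moebius (V t w) (end_point w))) -` D) = emeasure M A * emeasure circle D"
proof (rule circle_law[OF _ _ _ _ D])
 let ?Z = "%w. moebius (V t w) (end_point w)"
 note [measurable] = V_meas[OF t] measurable_F_M[OF kappa(1)]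
 show "(%w. kappa w * ?Z w) \<in> borel_measurable M" by measurable
 show "AE w in M. cmod (kappa w * ?Z w) = 1"
  using cmod_end_point AE_space
 proof eventually_elim
  case (elim w)
  show ?case unfolding norm_mult kappa(2) cmod_moebius[OF V_disk[OF t elim(2)] elim(1)] by simp
 qed
 show "A \<in> events" by (rule sets_FM[OF A])
 fix k :: nat assume "1 <= k"
 then obtain j where k: "k = Suc j" by (cases k) auto
 have kappab: "bdd_meas t kappa" unfolding bdd_meas_def using kappa by (auto intro!: exI[of _ 1])
 have "bdd_meas t (%w. kappa w ^ n)" for n by (induction n) (simp_all add: bdd_meas_mult[OF kappab])
 moreover have "bdd_meas t (%w. indicator A w)" unfolding bdd_meas_def using A by (auto intro!: exI[of _ 1] simp: indicator_def)
 ultimately have "bdd_meas t (%w. indicator A w * kappa w ^ k)" by (intro bdd_meas_mult)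
 from moebius_moment[OF t this, of j]
 show "mean (%w. indicator A w * (kappa w * ?Z w) ^ k) = 0" unfolding k power_mult_distrib mult.assoc .
qed

end

section \<open>The law of the Euler scheme\<close>

lemma euler_measurable:
 assumes [measurable]: "\<sigma> \<in> borel_measurable borel" and z: "!!k. k < n ==> (%x. z x k) \<in> borel_measurable A"
 shows "(%x. euler \<sigma> d (z x) n) \<in> borel_measurable A"
 using z
proof (induction n)
 case (Suc n)
 have [measurable]: "(%x. euler \<sigma> d (z x) n) \<in> borel_measurable A" using Suc by simp
 have [measurable]: "(%x. z x n) \<in> borel_measurable A" using Suc.prems by simp
 show ?case unfolding euler.simps by measurable
qed simp

lemma euler_cong: "(!!k. k < n ==> z k = z' k) ==> euler \<sigma> d z n = euler \<sigma> d z' n"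
 by (induction n) simp_all

text \<open>For \<open>b = 0\<close> the scheme of a relative angle, for \<open>b = 1\<close> that of a whole path of the flow: the reference path adds the real
 parts of the rotated increments and the real noise.\<close>

definition scheme_value :: "real => real => nat => (nat => complex \<times> real) => real" where
 "scheme_value b d n z = euler \<sigma>\<^sub>0 d (%k. fst (z k)) n + b * (euler (%_. 1) 0 (%k. fst (z k)) n + (\<Sum>k<n. snd (z k)))"

lemma scheme_value_measurable:
 "scheme_value b d n \<in> borel_measurable (\<Pi>\<^sub>M k\<in>{..<n}. borel \<Otimes>\<^sub>M borel)"
proof -
 have c: "(%z. z k) \<in> measurable (\<Pi>\<^sub>M k\<in>{..<n}. borel \<Otimes>\<^sub>M borel) (borel \<Otimes>\<^sub>M (borel :: real measure))" if "k < n" for k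
  using that by (intro measurable_component_singleton) simp
 have f: "(%z. fst (z k)) \<in> borel_measurable (\<Pi>\<^sub>M k\<in>{..<n}. borel \<Otimes>\<^sub>M (borel :: real measure))" if "k < n" for k
  by (rule measurable_compose[OF c[OF that] measurable_fst])
 have s: "(%z. snd (z k)) \<in> borel_measurable (\<Pi>\<^sub>M k\<in>{..<n}. borel \<Otimes>\<^sub>M (borel :: real measure))" if "k < n" for k
  by (rule measurable_compose[OF c[OF that] measurable_snd])
 show ?thesis unfolding scheme_value_def[abs_def]
  by (intro borel_measurable_add borel_measurable_times borel_measurable_const euler_measurable \<sigma>\<^sub>0_measurable f borel_measurable_sum s) auto
qed

lemma scheme_value_cong:
 assumes "!!k. k < n ==> z k = z' k"
 shows "scheme_value b d n z = scheme_value b d n z'"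
proof -
 have "euler \<sigma> d' (%k. fst (z k)) n = euler \<sigma> d' (%k. fst (z' k)) n" for \<sigma> d' using assms by (intro euler_cong) simp
 moreover have "(\<Sum>k<n. snd (z k)) = (\<Sum>k<n. snd (z' k))" using assms by (intro sum.cong) auto
 ultimately show ?thesis unfolding scheme_value_def by (simp only:)
qed

context noise
begin

definition unit_process :: "(real => 'w => complex) => bool" where
 "unit_process rho \<longleftrightarrow> (\<forall>t\<ge>0. rho t \<in> borel_measurable (F t) & (\<forall>w\<in>space M. cmod (rho t w) = 1))"

definition scheme :: "real => real => (real => 'w => complex) => real => nat => 'w => real" where
 "scheme b c rho T n w = scheme_value b (c * (T / real (Suc n))) (Suc n) (%k. noise_seq (T / real (Suc n)) (%k. rho (real k * (T / real (Suc n)))) k w)"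

lemma scheme_restrict:
 "scheme b c rho T n w = scheme_value b (c * (T / real (Suc n))) (Suc n) (\<lambda>k\<in>{..<Suc n}. noise_seq (T / real (Suc n)) (%k. rho (real k * (T / real (Suc n)))) k w)"
 unfolding scheme_def by (rule scheme_value_cong) simp

lemma unit_process_phase:
 assumes "unit_process rho" "0 < h" shows "phase h (%k. rho (real k * h))"
 using assms unfolding unit_process_def phase_def by simp

lemma noise_vector_measurable:
 assumes rho: "unit_process rho" and h: "0 < h"
 shows "(%w. \<lambda>k\<in>{..<n}. noise_seq h (%k. rho (real k * h)) k w) \<in> measurable M (\<Pi>\<^sub>M k\<in>{..<n}. borel \<Otimes>\<^sub>M borel)"
 by (intro measurable_restrict measurable_F_M[OF noise_seq_adapted[OF h unit_process_phase[OF rho h]]])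

lemma scheme_measurable:
 assumes rho: "unit_process rho" and T: "0 < T"
 shows "scheme b c rho T n \<in> borel_measurable M"
proof -
 have h: "0 < T / real (Suc n)" using T by simp
 show ?thesis unfolding scheme_restrict[abs_def] by (rule measurable_compose[OF noise_vector_measurable[OF rho h] scheme_value_measurable])
qed

lemma scheme_expectation:
 assumes rho: "unit_process rho" and T: "0 < T" and J: "finite J"
 shows "mean (%w. \<Prod>j\<in>J. ramp (a j) k (scheme b (c j) rho T n w))
  = integral\<^sup>L (\<Pi>\<^sub>M k\<in>{..<Suc n}. cgauss (T / real (Suc n)) \<Otimes>\<^sub>M m (T / real (Suc n)))
    (%z. \<Prod>j\<in>J. ramp (a j) k (scheme_value b (c j * (T / real (Suc n))) (Suc n) z))"
proof -
 have h: "0 < T / real (Suc n)" using T by simp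
 have "(%z. \<Prod>j\<in>J. ramp (a j) k (scheme_value b (c j * (T / real (Suc n))) (Suc n) z)) \<in> borel_measurable (\<Pi>\<^sub>M k\<in>{..<Suc n}. borel \<Otimes>\<^sub>M borel)"
  by (intro borel_measurable_prod measurable_compose[OF scheme_value_measurable ramp_measurable])
 from integral_distr[OF noise_vector_measurable[OF rho h] this]
 show ?thesis unfolding noise_seq_law[OF h unit_process_phase[OF rho h]] scheme_restrict ..
qed

end

text \<open>The scheme is the same function of noise sequences with the same law, simultaneously for all drifts \<open>c i\<close>, because the
 rotation \<open>rho\<close> does not depend on \<open>i\<close>.\<close>

lemma scheme_law_eq:
 assumes M: "noise M F X Xi m" and N: "noise N G X' Xi' m" and T: "0 < T" and I: "I ~= {}"
  and rho: "noise.unit_process M F rho" and rho': "noise.unit_process N G rho'"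
  and Y: "!!i. i \<in> I ==> Y i \<in> borel_measurable M"
   "!!i. i \<in> I ==> (%n. integral\<^sup>L M (%w. eta (Y i w - noise.scheme X Xi b (c i) rho T n w))) ----> 0"
  and Y': "!!i. i \<in> I ==> Y' i \<in> borel_measurable N"
   "!!i. i \<in> I ==> (%n. integral\<^sup>L N (%w. eta (Y' i w - noise.scheme X' Xi' b (c i) rho' T n w))) ----> 0"
 shows "distr M (real_paths I) (%w. \<lambda>i\<in>I. Y i w) = distr N (real_paths I) (%w. \<lambda>i\<in>I. Y' i w)"
proof -
 interpret M: noise M F X Xi m by fact
 interpret N: noise N G X' Xi' m by fact
 show ?thesis
 proof (rule law_eqI[where Xn="%n i. M.scheme b (c i) rho T n" and Yn="%n i. N.scheme b (c i) rho' T n"])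
  fix n J a k assume J: "finite J" "J \<subseteq> I"
  show "M.mean (%w. \<Prod>j\<in>J. ramp (a j) k (M.scheme b (c j) rho T n w)) = N.mean (%w. \<Prod>j\<in>J. ramp (a j) k (N.scheme b (c j) rho' T n w))"
   unfolding M.scheme_expectation[OF rho T J(1)] N.scheme_expectation[OF rho' T J(1)] ..
 qed (rule M.prob_space_axioms N.prob_space_axioms I Y Y' M.scheme_measurable[OF rho T] N.scheme_measurable[OF rho' T]; assumption)+
qed

lemma eta_add: "eta (x + y) <= 2 * eta x + 2 * eta y"
proof -
 let ?s = "2 * x^2 + 2 * y^2"
 have e: "eta z = 1 - 1 / (1 + z^2)" for z
  using zero_le_power2[of z] unfolding eta_def by (simp add: field_simps add_nonneg_eq_0_iff)
 have "(x + y)^2 <= ?s" using zero_le_power2[of "x - y"] by (simp add: power2_eq_square algebra_simps)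
 hence "1 / (1 + ?s) <= 1 / (1 + (x + y)^2)" by (intro divide_left_mono mult_pos_pos) (auto intro: add_pos_nonneg)
 moreover have "?s / (1 + ?s) = 1 - 1 / (1 + ?s)"
  using zero_le_power2[of x] zero_le_power2[of y] by (simp add: field_simps add_nonneg_eq_0_iff)
 ultimately have "eta (x + y) <= ?s / (1 + ?s)" using e[of "x + y"] by linarith
 also have "... = 2 * (x^2 / (1 + ?s)) + 2 * (y^2 / (1 + ?s))" by (simp add: add_divide_distrib)
 also have "... <= 2 * eta x + 2 * eta y" unfolding eta_def
  by (intro add_mono mult_left_mono divide_left_mono mult_pos_pos) (auto intro: add_pos_nonneg)
 finally show ?thesis .
qed

context noise
begin

lemma scheme_0: "scheme 0 c rho T n w = euler_value \<sigma>\<^sub>0 c rho T n w"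
 unfolding scheme_def scheme_value_def noise_seq_def drive_def by simp

lemma scheme_1: "scheme 1 c rho T n w = euler_value \<sigma>\<^sub>0 c rho T n w + (euler_value (%_. 1) 0 rho T n w + (Xi T w - Xi 0 w))"
proof -
 have "(\<Sum>k<Suc n. Xi (real (Suc k) * (T / real (Suc n))) w - Xi (real k * (T / real (Suc n))) w) = Xi T w - Xi 0 w"
  by (subst sum_lessThan_telescope[where f="%k. Xi (real k * (T / real (Suc n))) w"]) simp
 thus ?thesis unfolding scheme_def scheme_value_def noise_seq_def drive_def by (simp only: fst_conv snd_conv mult_1 mult_zero_left)
qed

end

context phase_pair
begin

lemma reference_unit_process: "P.unit_process P0.E"
 unfolding P.unit_process_def using P0.H_adapted by (simp add: P0.E_def)

lemma relative_scheme:
 assumes T: "0 < T"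
 shows "(%n. P.mean (%w. eta ((phi T w - phi0 T w) - P.scheme 0 (l - l0) P0.E T n w))) ----> 0"
 unfolding P.scheme_0 by (rule difference_scheme[OF T])

text \<open>A path is the sum of its difference from the reference path and of the reference path itself.\<close>

lemma full_scheme:
 assumes T: "0 < T"
 shows "(%n. P.mean (%w. eta ((phi T w - l0 * T) - P.scheme 1 (l - l0) P0.E T n w))) ----> 0"
proof -
 have T0: "0 <= T" using T by simp
 let ?d = "%n w. (phi T w - phi0 T w) - P.euler_value \<sigma>\<^sub>0 (l - l0) P0.E T n w"
 let ?t = "%n w. phi0 T w - l0 * T - (Xi T w - Xi 0 w) - P.euler_value (%_. 1) 0 P0.E T n w"
 have dm: "?d n \<in> borel_measurable M" for n
  using borel_measurable_diff[OF borel_measurable_diff[OF P.phi_meas[OF T0] P0.phi_meas[OF T0]] P.scheme_measurable[OF reference_unit_process T, of 0 "l - l0" n]]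
  unfolding P.scheme_0 .
 have sm: "(%w. (phi T w - l0 * T) - P.scheme 1 (l - l0) P0.E T n w) \<in> borel_measurable M" for n
  by (intro borel_measurable_diff borel_measurable_const P.phi_meas T0 P.scheme_measurable reference_unit_process T)
 have e: "(phi T w - l0 * T) - P.scheme 1 (l - l0) P0.E T n w = ?d n w + ?t n w" for n w
  unfolding P.scheme_1 by simp
 have tm: "?t n \<in> borel_measurable M" for n
 proof -
  have "?t n = (%w. ((phi T w - l0 * T) - P.scheme 1 (l - l0) P0.E T n w) - ?d n w)" unfolding e by (simp only: add_diff_cancel_left')
  thus ?thesis using borel_measurable_diff[OF sm dm] by (simp only:)
 qed
 have i: "integrable M (%w. eta (f w))" if "f \<in> borel_measurable M" for f :: "'w => real"
  using that eta_bounds by (intro P.integrable_const_bound[where B=1]) auto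
 have b: "P.mean (%w. eta ((phi T w - l0 * T) - P.scheme 1 (l - l0) P0.E T n w))
   <= 2 * P.mean (%w. eta (?d n w)) + 2 * P.mean (%w. eta (?t n w))" for n
 proof -
  note i1 = i[OF dm[of n]] and i2 = i[OF tm[of n]]
  have "P.mean (%w. eta ((phi T w - l0 * T) - P.scheme 1 (l - l0) P0.E T n w)) <= P.mean (%w. 2 * eta (?d n w) + 2 * eta (?t n w))"
  proof (rule integral_mono[OF i[OF sm]])
   show "integrable M (%w. 2 * eta (?d n w) + 2 * eta (?t n w))" using i1 i2 by simp
   show "eta ((phi T w - l0 * T) - P.scheme 1 (l - l0) P0.E T n w) <= 2 * eta (?d n w) + 2 * eta (?t n w)" for w
    unfolding e by (rule eta_add)
  qed
  thus ?thesis using i1 i2 by simp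
 qed
 have "(%n. 2 * P.mean (%w. eta (?d n w)) + 2 * P.mean (%w. eta (?t n w))) ----> 2 * 0 + 2 * 0"
  by (intro tendsto_intros difference_scheme[OF T] P0.total_scheme[OF T])
 hence "(%n. 2 * P.mean (%w. eta (?d n w)) + 2 * P.mean (%w. eta (?t n w))) ----> 0" by simp
 thus ?thesis
 proof (rule tendsto_sandwich[OF _ _ tendsto_const, rotated 2])
  show "\<forall>\<^sub>F n in sequentially. 0 <= P.mean (%w. eta ((phi T w - l0 * T) - P.scheme 1 (l - l0) P0.E T n w))"
   by (intro always_eventually allI integral_nonneg eta_bounds)
 qed (use b in \<open>intro always_eventually allI\<close>)
qed

end

context carousel_path
begin

lemma rotation_unit_process: "unit_process rho"
 unfolding unit_process_def using rho_adapted cmod_rho by simp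

lemma relative_carousel_scheme:
 "0 < T ==> (%n. mean (%w. eta (Y T w - scheme 0 l rho T n w))) ----> 0"
 unfolding scheme_0 by (rule carousel_scheme)

end

section \<open>Brownian increments\<close>

lemma normal_law: "distributed M lborel f (normal_density 0 (sqrt h)) ==> distr M borel f = gauss h"
 unfolding gauss_def distributed_def by (metis distr_cong sets_lborel)

lemma complex_BM_increment:
 "complex_BM f g t w - complex_BM f g s w = complex_point (f t w - f s w) (g t w - g s w)"
 by (simp add: complex_BM_def Complex_eq diff_divide_distrib[symmetric] algebra_simps)

context
 fixes M :: "'w measure" and I :: "'i set" and B :: "'i => real => 'w => real" and s t :: real
 assumes M: "prob_space M" and B: "independent_BMs M I B" and st: "0 <= s" "s < t"
begin

interpretation prob_space M by (rule M)

lemma increment_measurable: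
 assumes "i \<in> I" shows "(%w. B i t w - B i s w) \<in> borel_measurable M"
proof -
 have "0 <= t" using st by simp
 moreover have "\<forall>t\<ge>0. B i t \<in> borel_measurable M" using B assms unfolding independent_BMs_def standard_BM_def by blast
 ultimately show ?thesis using st(1) by (intro borel_measurable_diff) blast+
qed

lemma increment_normal:
 assumes "i \<in> I" shows "distr M borel (%w. B i t w - B i s w) = gauss (t - s)"
proof (rule normal_law)
 have "\<forall>s\<ge>0. \<forall>t>s. distributed M lborel (%w. B i t w - B i s w) (normal_density 0 (sqrt (t - s)))"
  using B assms unfolding independent_BMs_def standard_BM_def by blast
 thus "distributed M lborel (%w. B i t w - B i s w) (normal_density 0 (sqrt (t - s)))" using st by blast
qed

lemma increments_independent: "indep_vars (%_. borel) (%i w. B i t w - B i s w) I"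
proof -
 have "indep_vars (%_. \<Pi>\<^sub>M t\<in>{0..}. borel) (%i w. \<lambda>t\<in>{0..}. B i t w) I" using B unfolding independent_BMs_def by simp
 hence "indep_vars (%_. borel) (%i w. (%f. f t - f s) (\<lambda>t\<in>{0..}. B i t w)) I"
  by (rule indep_vars_compose2) (use st in \<open>intro borel_measurable_diff measurable_component_singleton, auto\<close>)
 thus ?thesis using st by simp
qed

lemma increments_pair: "i \<in> I ==> j \<in> I ==> i ~= j ==> indep_var borel (%w. B i t w - B i s w) borel (%w. B j t w - B j s w)"
proof -
 assume "i \<in> I" "j \<in> I" "i ~= j"
 hence "indep_var (\<Pi>\<^sub>M i\<in>{i}. borel) (%w. restrict (%i. B i t w - B i s w) {i}) (\<Pi>\<^sub>M i\<in>{j}. borel) (%w. restrict (%i. B i t w - B i s w) {j})"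
  by (intro indep_var_restrict[OF increments_independent]) auto
 from indep_var_compose[OF this, of "%f. f i" borel "%f. f j" borel]
 show ?thesis by (simp add: comp_def)
qed

lemma complex_increment_law:
 assumes ij: "i \<in> I" "j \<in> I" "i ~= j"
 shows "distr M borel (%w. complex_BM (B i) (B j) t w - complex_BM (B i) (B j) s w) = cgauss (t - s)"
proof -
 note [measurable] = increment_measurable[OF ij(1)] increment_measurable[OF ij(2)]
 have d: "distr M (borel \<Otimes>\<^sub>M borel) (%w. (B i t w - B i s w, B j t w - B j s w)) = gauss (t - s) \<Otimes>\<^sub>M gauss (t - s)"
  using increments_pair[OF ij] unfolding indep_var_distribution_eq increment_normal[OF ij(1)] increment_normal[OF ij(2)] by simp
 show ?thesis unfolding complex_BM_increment cgauss_def d[symmetric] by (subst distr_distr) (auto simp: comp_def)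
qed

lemma full_increment_law:
 assumes ij: "i \<in> I" "j \<in> I" "i ~= j" and k: "k \<in> I" "k ~= i" "k ~= j"
 shows "distr M (borel \<Otimes>\<^sub>M borel) (%w. (complex_BM (B i) (B j) t w - complex_BM (B i) (B j) s w, B k t w - B k s w)) = cgauss (t - s) \<Otimes>\<^sub>M gauss (t - s)"
proof -
 have r: "indep_var (\<Pi>\<^sub>M i\<in>{i, j}. borel) (%w. restrict (%i. B i t w - B i s w) {i, j}) (\<Pi>\<^sub>M i\<in>{k}. borel) (%w. restrict (%i. B i t w - B i s w) {k})"
  using ij k by (intro indep_var_restrict[OF increments_independent]) auto
 have mc: "(%f. complex_point (f i) (f j)) \<in> borel_measurable (\<Pi>\<^sub>M i\<in>{i, j}. borel)"
  by (intro borel_measurable_divide borel_measurable_const borel_measurable_Complex measurable_component_singleton) auto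
 have mk: "(%f. Cx (f k)) \<in> borel_measurable (\<Pi>\<^sub>M i\<in>{k}. (borel :: real measure))"
  by (rule measurable_compose[OF measurable_component_singleton]) simp_all
 let ?X = "%w. complex_BM (B i) (B j) t w - complex_BM (B i) (B j) s w" and ?b = "%w. B k t w - B k s w"
 have c: "indep_var borel ?X borel (%w. Cx (?b w))"
  using indep_var_compose[OF r mc mk] unfolding complex_BM_increment by (simp add: comp_def)
 note [measurable] = increment_measurable[OF k(1)] indep_var_rv1[OF c]
 have h: "0 < t - s" using st by simp
 interpret C: prob_space "cgauss (t - s)" by (rule prob_space_cgauss[OF h])
 interpret G: prob_space "gauss (t - s)" by (rule prob_space_gauss[OF h])
 show ?thesis
 proof (rule pair_measure_eqI[symmetric])
  show "sigma_finite_measure (cgauss (t - s))" "sigma_finite_measure (gauss (t - s))" ..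
  show "sets (cgauss (t - s) \<Otimes>\<^sub>M gauss (t - s)) = sets (distr M (borel \<Otimes>\<^sub>M borel) (%w. (?X w, ?b w)))"
   by (simp cong: sets_pair_measure_cong)
  fix A D assume "A \<in> sets (cgauss (t - s))" "D \<in> sets (gauss (t - s))"
  hence A: "A \<in> sets borel" and D: "D \<in> sets borel" by simp_all
  have "Re -` D Int space borel \<in> sets borel" by (rule measurable_sets[OF borel_measurable_Re D])
  from indep_varD[OF c A this]
  have "prob ((%w. (?X w, ?b w)) -` (A \<times> D) Int space M) = prob (?X -` A Int space M) * prob (?b -` D Int space M)"
   by (simp add: vimage_def)
  hence "emeasure M ((%w. (?X w, ?b w)) -` (A \<times> D) Int space M) = emeasure M (?X -` A Int space M) * emeasure M (?b -` D Int space M)"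
   by (simp add: emeasure_eq_measure ennreal_mult)
  thus "emeasure (cgauss (t - s)) A * emeasure (gauss (t - s)) D = emeasure (distr M (borel \<Otimes>\<^sub>M borel) (%w. (?X w, ?b w))) (A \<times> D)"
   unfolding complex_increment_law[OF ij, symmetric] increment_normal[OF k(1), symmetric]
   using A D by (simp add: emeasure_distr pair_measureI)
 qed
qed

lemma increments_independent_of_past:
 assumes F: "BM_filtration M F I B" and A: "A \<in> sets (F s)" and f: "f \<in> measurable (real_paths I) E" and D: "D \<in> sets E"
 shows "emeasure M (A Int {w\<in>space M. f (\<lambda>i\<in>I. B i t w - B i s w) \<in> D}) = emeasure M A * emeasure M {w\<in>space M. f (\<lambda>i\<in>I. B i t w - B i s w) \<in> D}"
proof -
 let ?P = "\<Pi>\<^sub>M j \<in> I \<times> {s..}. (borel :: real measure)"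
 let ?inc = "%w. \<lambda>(i, t) \<in> I \<times> {s..}. B i t w - B i s w"
 let ?r = "%g. \<lambda>i\<in>I. g (i, t)"
 let ?A' = "(%g. f (?r g)) -` D Int space ?P"
 have r: "?r \<in> measurable ?P (real_paths I)"
  using st by (intro measurable_restrict measurable_component_singleton) auto
 have A': "?A' \<in> sets ?P" by (rule measurable_sets[OF measurable_compose[OF r f] D])
 have "?r (?inc w) = (\<lambda>i\<in>I. B i t w - B i s w)" for w using st by (auto simp: fun_eq_iff restrict_def)
 moreover have "?inc w \<in> space ?P" for w by (simp add: space_PiM)
 ultimately have e: "{w\<in>space M. f (\<lambda>i\<in>I. B i t w - B i s w) \<in> D} = ?inc -` ?A' Int space M" by auto
 have "prob_space.indep_set M (sets (F s)) {?inc -` A Int space M | A. A \<in> sets ?P}" using F st unfolding BM_filtration_def by blast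
 from indep_setD[OF this A, of "?inc -` ?A' Int space M"] A'
 have "prob (A Int (?inc -` ?A' Int space M)) = prob A * prob (?inc -` ?A' Int space M)" by blast
 thus ?thesis unfolding e emeasure_eq_measure by (simp add: ennreal_mult)
qed

end

lemma BM_filtration_basic:
 assumes "BM_filtration M F I B"
 shows "subalgebra M (F t)" "s <= t ==> sets (F s) \<subseteq> sets (F t)" "i \<in> I ==> 0 <= t ==> B i t \<in> borel_measurable (F t)"
 using assms unfolding BM_filtration_def filtration_def by blast+

lemma complex_BM_measurable:
 assumes "f t \<in> borel_measurable A" "g t \<in> borel_measurable A" shows "complex_BM f g t \<in> borel_measurable A"
 using assms unfolding complex_BM_def[abs_def] by measurable

text \<open>\<open>noise\<close> asks for independence of single increments from the past only, while the admissibility of the filtration concerns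
 all later increments.\<close>

lemma Brownian_noise:
 assumes M: "prob_space M" and B: "independent_BMs M I B" and F: "BM_filtration M F I B"
  and XF: "!!t. 0 <= t ==> X t \<in> borel_measurable (F t)" and XiF: "!!t. 0 <= t ==> Xi t \<in> borel_measurable (F t)"
  and m: "!!h. 0 < h ==> prob_space (m h)" "!!h. sets (m h) = sets borel"
  and f: "f \<in> measurable (real_paths I) (borel \<Otimes>\<^sub>M borel)"
  and inc: "!!s t w. (X t w - X s w, Xi t w - Xi s w) = f (\<lambda>i\<in>I. B i t w - B i s w)"
  and law: "!!s t. 0 <= s ==> s < t ==> distr M (borel \<Otimes>\<^sub>M borel) (%w. (X t w - X s w, Xi t w - Xi s w)) = cgauss (t - s) \<Otimes>\<^sub>M m (t - s)"
 shows "noise M F X Xi m"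
proof (intro noise.intro noise_axioms.intro)
 fix s t :: real and A and D :: "(complex \<times> real) set"
 assume st: "0 <= s" "s < t" and A: "A \<in> sets (F s)" and D: "D \<in> sets (borel \<Otimes>\<^sub>M borel)"
 let ?Z = "%w. (X t w - X s w, Xi t w - Xi s w)"
 have Z: "?Z \<in> measurable M (borel \<Otimes>\<^sub>M borel)"
  unfolding inc by (rule measurable_compose[OF measurable_restrict f]) (rule increment_measurable[OF M B st])
 have "{w\<in>space M. ?Z w \<in> D} = ?Z -` D Int space M" by auto
 hence "emeasure M {w\<in>space M. ?Z w \<in> D} = emeasure (cgauss (t - s) \<Otimes>\<^sub>M m (t - s)) D"
  unfolding law[OF st, symmetric] using D Z by (simp add: emeasure_distr)
 thus "emeasure M (A Int {w\<in>space M. ?Z w \<in> D}) = emeasure M A * emeasure (cgauss (t - s) \<Otimes>\<^sub>M m (t - s)) D"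
  unfolding inc increments_independent_of_past[OF M B st F A f D] by simp
qed (rule M BM_filtration_basic[OF F] XF XiF m, (assumption | simp)?)+

lemma complex_noise:
 assumes M: "prob_space M" and B: "independent_BMs M I B" and F: "BM_filtration M F I B" and ij: "i \<in> I" "j \<in> I" "i ~= j"
 shows "noise M F (complex_BM (B i) (B j)) (%_ _. 0) (%_. return borel 0)"
proof (rule Brownian_noise[OF M B F, where f="%g. (complex_point (g i) (g j), 0)"])
 fix s t :: real assume st: "0 <= s" "s < t"
 let ?X = "%w. complex_BM (B i) (B j) t w - complex_BM (B i) (B j) s w"
 have h: "0 < t - s" using st by simp
 interpret C: prob_space "cgauss (t - s)" by (rule prob_space_cgauss[OF h])
 interpret r: prob_space "return borel (0::real)" by (rule prob_space_return) simp
 have X: "?X \<in> borel_measurable M"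
  using increment_measurable[OF M B st ij(1)] increment_measurable[OF M B st ij(2)] unfolding complex_BM_increment by simp
 show "distr M (borel \<Otimes>\<^sub>M borel) (%w. (?X w, 0 - (0::real))) = cgauss (t - s) \<Otimes>\<^sub>M return borel (0::real)"
 proof (rule pair_measure_eqI[symmetric])
  fix A and D :: "real set" assume "A \<in> sets (cgauss (t - s))" "D \<in> sets (return borel 0)"
  hence AD: "A \<in> sets borel" "D \<in> sets borel" by simp_all
  have "(%w. (?X w, 0 - (0::real))) -` (A \<times> D) Int space M = (if 0 \<in> D then ?X -` A Int space M else {})" by auto
  thus "emeasure (cgauss (t - s)) A * emeasure (return borel 0) D = emeasure (distr M (borel \<Otimes>\<^sub>M borel) (%w. (?X w, 0 - (0::real)))) (A \<times> D)"
   unfolding complex_increment_law[OF M B st ij, symmetric] using AD X by (simp add: emeasure_distr)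
 qed (simp_all add: C.sigma_finite_measure_axioms r.sigma_finite_measure_axioms cong: sets_pair_measure_cong)
next
 show "(%g. (complex_point (g i) (g j), 0::real)) \<in> measurable (real_paths I) (borel \<Otimes>\<^sub>M borel)"
  using ij by (intro measurable_Pair borel_measurable_divide borel_measurable_const borel_measurable_Complex measurable_component_singleton) auto
qed (use ij in \<open>auto simp: complex_BM_increment intro!: complex_BM_measurable BM_filtration_basic(3)[OF F] prob_space_return\<close>)

lemma full_noise:
 assumes M: "prob_space M" and B: "independent_BMs M I B" and F: "BM_filtration M F I B" and ij: "i \<in> I" "j \<in> I" "i ~= j"
  and k: "k \<in> I" "k ~= i" "k ~= j"
 shows "noise M F (complex_BM (B i) (B j)) (B k) gauss"
proof (rule Brownian_noise[OF M B F, where f="%g. (complex_point (g i) (g j), g k)"])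
 show "(%g. (complex_point (g i) (g j), g k)) \<in> measurable (real_paths I) (borel \<Otimes>\<^sub>M borel)"
  using ij k by (intro measurable_Pair borel_measurable_divide borel_measurable_const borel_measurable_Complex measurable_component_singleton) auto
 show "distr M (borel \<Otimes>\<^sub>M borel) (%w. (complex_BM (B i) (B j) t w - complex_BM (B i) (B j) s w, B k t w - B k s w))
  = cgauss (t - s) \<Otimes>\<^sub>M gauss (t - s)" if "0 <= s" "s < t" for s t by (rule full_increment_law[OF M B that ij k])
qed (use ij k in \<open>auto simp: complex_BM_increment intro!: complex_BM_measurable BM_filtration_basic(3)[OF F] prob_space_gauss\<close>)

section \<open>The two models\<close>

lemma has_ito_integral_cong:
 assumes H: "has_ito_integral M F H X J" and H': "!!t. 0 <= t ==> H' t \<in> borel_measurable (F t)"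
  and eq: "!!t. 0 <= t ==> AE w in M. H t w = H' t w"
 shows "has_ito_integral M F H' X J"
proof -
 have "(\<integral>\<^sup>+ s\<in>{0..t}. L2sq M (%w. f s w - H s w) \<partial>lborel) = (\<integral>\<^sup>+ s\<in>{0..t}. L2sq M (%w. f s w - H' s w) \<partial>lborel)" for f t
 proof (rule nn_integral_cong)
  fix s :: real
  show "L2sq M (%w. f s w - H s w) * indicator {0..t} s = L2sq M (%w. f s w - H' s w) * indicator {0..t} s"
  proof (cases "s \<in> {0..t}")
   case True
   hence "L2sq M (%w. f s w - H s w) = L2sq M (%w. f s w - H' s w)"
    by (intro nn_integral_cong_AE) (use eq[of s] in \<open>auto elim: eventually_mono\<close>)
   thus ?thesis by simp
  qed simp
 qed
 note same = this
 have a: "\<forall>t\<ge>0. H' t \<in> borel_measurable (F t)" using H' by blast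
 show ?thesis using H unfolding has_ito_integral_def same by (elim conjE) (intro conjI a)
qed

lemma poisson_measurable:
 assumes "f \<in> borel_measurable A" "g \<in> borel_measurable A"
 shows "(%w. poisson (f w) (g w)) \<in> borel_measurable A"
 using assms unfolding poisson_def by measurable

lemma polygon_measurable:
 assumes "!!k. k < n ==> (%w. v (real k * h) w) \<in> borel_measurable A"
 shows "(%w. polygon (%s. v s w) l h n) \<in> borel_measurable A"
 using assms
proof (induction n)
 case (Suc n)
 have 1: "(%w. polygon (%s. v s w) l h n) \<in> borel_measurable A" using Suc by simp
 have 2: "(%w. v (real n * h) w) \<in> borel_measurable A" using Suc.prems by simp
 show ?case unfolding polygon.simps
  by (intro borel_measurable_add borel_measurable_times borel_measurable_divide borel_measurable_const poisson_measurable 1 2)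
qed simp

locale carousel =
 fixes M :: "'w measure" and F :: "real => 'w measure" and B :: "nat => real => 'w => real"
  and V :: "real => 'w => complex" and gamma :: "real => real => 'w => real"
 assumes M: "prob_space M" and V: "hyperbolic_BM M F B V" and gamma: "carousel_angle M V gamma"
begin

lemma V_facts:
 "independent_BMs M {1, 2} B" "BM_filtration M F {1, 2} B" "0 <= t ==> V t \<in> borel_measurable (F t)"
 "AE w in M. continuous_on {0..} (%t. V t w)" "AE w in M. \<forall>t\<ge>0. cmod (V t w) < 1" "AE w in M. V 0 w = 0"
 using V unfolding hyperbolic_BM_def by blast+

definition J :: "real => 'w => complex" where
 "J = (SOME J. has_ito_integral M F (%t w. Cx ((1 - (cmod (V t w))^2) / 2)) (complex_BM (B 1) (B 2)) J &
     (\<forall>t\<ge>0. AE w in M. V t w = J t w))"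

lemma J: "has_ito_integral M F (%t w. Cx ((1 - (cmod (V t w))^2) / 2)) (complex_BM (B 1) (B 2)) J"
 "!!t. 0 <= t ==> AE w in M. V t w = J t w"
proof -
 have "EX J. has_ito_integral M F (%t w. Cx ((1 - (cmod (V t w))^2) / 2)) (complex_BM (B 1) (B 2)) J &
     (\<forall>t\<ge>0. AE w in M. V t w = J t w)"
  using V unfolding hyperbolic_BM_def by blast
 from someI_ex[OF this]
 show "has_ito_integral M F (%t w. Cx ((1 - (cmod (V t w))^2) / 2)) (complex_BM (B 1) (B 2)) J"
  "!!t. 0 <= t ==> AE w in M. V t w = J t w" unfolding J_def[symmetric] by blast+
qed

text \<open>Equal to \<open>V\<close> almost surely, and inside the disk everywhere.\<close>

definition W :: "real => 'w => complex" where "W t w = (if cmod (V t w) < 1 then V t w else 0)"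

lemma W_eq: "AE w in M. \<forall>t\<ge>0. W t w = V t w"
 using V_facts(5) by eventually_elim (simp add: W_def)

lemma W_adapted: "0 <= t ==> W t \<in> borel_measurable (F t)"
proof -
 assume "0 <= t"
 note [measurable] = V_facts(3)[OF this]
 show ?thesis unfolding W_def[abs_def] by measurable
qed

lemma W_disk: "cmod (W t w) < 1"
 by (simp add: W_def)

lemma W_cont: "AE w in M. continuous_on {0..} (%t. W t w)"
 using V_facts(4) W_eq
proof eventually_elim
 case (elim w)
 have "continuous_on {0..} (%t. W t w) \<longleftrightarrow> continuous_on {0..} (%t. V t w)"
  by (rule continuous_on_cong) (use elim in auto)
 thus ?case using elim by blast
qed

sublocale noise M F "complex_BM (B 1) (B 2)" "%_ _. 0" "%_. return borel 0"
 by (rule complex_noise[OF M V_facts(1,2)]) auto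

sublocale disk_bm M F "complex_BM (B 1) (B 2)" "%_ _. 0" "%_. return borel 0" W J
proof
 show "has_ito_integral M F (%t w. Cx ((1 - (cmod (W t w))^2) / 2)) (complex_BM (B 1) (B 2)) J"
 proof (rule has_ito_integral_cong[OF J(1)])
  fix t :: real assume t: "0 <= t"
  note [measurable] = W_adapted[OF t]
  show "(%w. Cx ((1 - (cmod (W t w))^2) / 2)) \<in> borel_measurable (F t)" by measurable
  show "AE w in M. Cx ((1 - (cmod (V t w))^2) / 2) = Cx ((1 - (cmod (W t w))^2) / 2)"
   using W_eq by eventually_elim (simp add: t)
 qed
 show "AE w in M. W t w = J t w" if "0 <= t" for t using W_eq J(2)[OF that] by eventually_elim (simp add: that)
 show "AE w in M. W 0 w = 0" using W_eq V_facts(6) by eventually_elim simp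
qed (use W_adapted W_disk W_cont in auto)

lemma flow: "AE w in M. carousel_flow (%t. W t w) (%l t. gamma l t w)"
 using W_cont W_eq gamma[unfolded carousel_angle_def]
proof eventually_elim
 case (elim w)
 show ?case
 proof
  fix l t :: real assume t: "0 <= t"
  have "l * ((cmod (carousel_point gamma l t w - V t w))^2 / (1 - (cmod (V t w))^2)) = l / poisson (W t w) (gamma l t w)"
   using elim(2) t unfolding poisson_def carousel_point_def cis_conv_exp by simp
  thus "((%t. gamma l t w) has_real_derivative l / poisson (W t w) (gamma l t w)) (at t within {0..})"
   using elim(3) t by metis
 next
  show "cmod (W t w) < 1" for t by (rule W_disk)
 qed (use elim in auto)
qed

definition \<Gamma> :: "real => real => 'w => real" where
 "\<Gamma> l t w = lim (%n. polygon (%s. W s w) l (t / real (Suc n)) (Suc n))"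

lemma \<Gamma>_gamma: "AE w in M. ALL l. \<forall>t\<ge>0. \<Gamma> l t w = gamma l t w"
 using flow
proof eventually_elim
 case (elim w)
 then interpret carousel_flow "%t. W t w" "%l t. gamma l t w" .
 show ?case unfolding \<Gamma>_def using polygon_converges by (blast intro: limI)
qed

lemma carousel_path: "carousel_path M F (complex_BM (B 1) (B 2)) (%_ _. 0) (%_. return borel 0) W J l (gamma l) (\<Gamma> l)"
proof unfold_locales
 fix t :: real assume t: "0 <= t"
 have Wm: "(%w. W (real k * (t / real (Suc n))) w) \<in> borel_measurable (F t)" if "k < Suc n" for k n
 proof -
  have "real k * (t / real (Suc n)) <= t"
   using that t mult_right_mono[of "real k" "real (Suc n)" t] by (simp add: divide_le_eq mult.commute)
  thus ?thesis using t by (intro measurable_F_mono[OF W_adapted]) auto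
 qed
 show "\<Gamma> l t \<in> borel_measurable (F t)" unfolding \<Gamma>_def[abs_def]
  by (intro borel_measurable_lim_metric polygon_measurable Wm)
 show "AE w in M. \<Gamma> l t w = gamma l t w" using \<Gamma>_gamma by eventually_elim (simp add: t)
next
 show "AE w in M. gamma l 0 w = 0" using flow by eventually_elim (rule carousel_flow.start)
 show "AE w in M. \<forall>t\<ge>0. ((%s. gamma l s w) has_real_derivative l / poisson (W t w) (gamma l t w)) (at t within {0..})"
  using flow by eventually_elim (use carousel_flow.ode in blast)
qed

end

locale schroedinger =
 fixes N :: "'w measure" and G :: "real => 'w measure" and B :: "nat => real => 'w => real"
  and phi :: "real => real => 'w => real"
 assumes N: "prob_space N" and phi: "sch_flow N G B phi"
begin

lemma phi_facts:
 "independent_BMs N {1, 2, 3} B" "BM_filtration N G {1, 2, 3} B" "0 <= t ==> phi l t \<in> borel_measurable (G t)"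
 "AE w in N. (ALL l. continuous_on {0..} (%t. phi l t w)) & (\<forall>t\<ge>0. continuous_on UNIV (%l. phi l t w))"
 "AE w in N. phi l 0 w = 0"
 using phi unfolding sch_flow_def by blast+

definition J :: "real => real => 'w => complex" where
 "J l = (SOME J. has_ito_integral N G (%t w. exp (- \<i> * Cx (phi l t w))) (complex_BM (B 2) (B 3)) J &
       (\<forall>t\<ge>0. AE w in N. phi l t w = l * t + B 1 t w + Re (J t w)))"

lemma J: "has_ito_integral N G (%t w. exp (- \<i> * Cx (phi l t w))) (complex_BM (B 2) (B 3)) (J l)"
 "!!t. 0 <= t ==> AE w in N. phi l t w = l * t + B 1 t w + Re (J l t w)"
proof -
 have "EX J. has_ito_integral N G (%t w. exp (- \<i> * Cx (phi l t w))) (complex_BM (B 2) (B 3)) J &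
       (\<forall>t\<ge>0. AE w in N. phi l t w = l * t + B 1 t w + Re (J t w))"
  using phi unfolding sch_flow_def by blast
 from someI_ex[OF this]
 show "has_ito_integral N G (%t w. exp (- \<i> * Cx (phi l t w))) (complex_BM (B 2) (B 3)) (J l)"
  "!!t. 0 <= t ==> AE w in N. phi l t w = l * t + B 1 t w + Re (J l t w)" unfolding J_def[symmetric] by blast+
qed

sublocale noise N G "complex_BM (B 2) (B 3)" "B 1" gauss
 by (rule full_noise[OF N phi_facts(1,2)]) auto

lemma B_square:
 assumes "0 <= s" "s <= t"
 shows "integrable N (%w. (B 1 t w - B 1 s w)^2)" "mean (%w. (B 1 t w - B 1 s w)^2) <= t - s"
proof (atomize (full), cases "s = t")
 case False
 hence st: "s < t" "0 < t - s" using assms by auto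
 note d = increment_normal[OF N phi_facts(1) assms(1) st(1), of 1] and m = increment_measurable[OF N phi_facts(1) assms(1) st(1), of 1]
 have "integrable (distr N borel (%w. B 1 t w - B 1 s w)) (%x. x^2)" using gauss_moments(1)[OF st(2)] d by simp
 moreover have "integral\<^sup>L (distr N borel (%w. B 1 t w - B 1 s w)) (%x. x^2) = t - s" using gauss_moments(2)[OF st(2)] d by simp
 ultimately show "integrable N (%w. (B 1 t w - B 1 s w)^2) & mean (%w. (B 1 t w - B 1 s w)^2) <= t - s"
  using m by (simp add: integrable_distr_eq integral_distr)
qed simp

lemma phase_path: "phase_path N G (complex_BM (B 2) (B 3)) (B 1) gauss (phi l) (J l) l"
proof unfold_locales
 show "AE w in N. continuous_on {0..} (%t. phi l t w)" using phi_facts(4) by eventually_elim blast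
qed (rule phi_facts J B_square; assumption)+

lemma phase_pair: "phase_pair N G (complex_BM (B 2) (B 3)) (B 1) gauss (phi l) (J l) l (phi l0) (J l0) l0"
 by (intro phase_pair.intro phase_path)

end

context carousel
begin

definition alpha :: "real => real => 'w => real" where
 "alpha t l w = angle (W t w) (\<Gamma> l t w) - angle (W t w) 0"

lemma alpha_adapted: "0 <= t ==> alpha t l \<in> borel_measurable (F t)"
 using carousel_path.Y_adapted[OF carousel_path, of t l] unfolding carousel_path.Y_def[OF carousel_path] alpha_def .

end

context schroedinger
begin

lemma phi_meas: "0 <= t ==> phi l t \<in> borel_measurable N"
 by (rule measurable_F_M[OF phi_facts(3)])

text \<open>Take \<open>phi (- u / t)\<close> as the reference path: the drift relative to it is \<open>q / t\<close> for every \<open>u\<close>, and \<open>full_scheme\<close> depends on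
 this drift only.\<close>

lemma translation_invariance:
 assumes t: "0 < t"
 shows "distr N (\<Pi>\<^sub>M q\<in>\<rat>. borel) (%w. \<lambda>q\<in>\<rat>. phi ((q - u) / t) t w + u) = distr N (\<Pi>\<^sub>M q\<in>\<rat>. borel) (%w. \<lambda>q\<in>\<rat>. phi (q / t) t w)"
proof (rule scheme_law_eq[where b=1 and T=t and c="%q. q / t" and rho="phase_path.E (phi (- u / t))" and rho'="phase_path.E (phi 0)"])
 show "noise N G (complex_BM (B 2) (B 3)) (B 1) gauss" "noise N G (complex_BM (B 2) (B 3)) (B 1) gauss" by (rule noise_axioms)+
 show "unit_process (phase_path.E (phi (- u / t)))" "unit_process (phase_path.E (phi 0))"
  by (rule phase_pair.reference_unit_process[OF phase_pair])+
 show "(%w. phi ((q - u) / t) t w + u) \<in> borel_measurable N" "phi (q / t) t \<in> borel_measurable N" for q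
  using t phi_meas by simp_all
 fix q
 show "(%n. mean (%w. eta (phi ((q - u) / t) t w + u - scheme 1 (q / t) (phase_path.E (phi (- u / t))) t n w))) ----> 0"
  using phase_pair.full_scheme[OF phase_pair t, of "(q - u) / t" "- u / t"] t by (simp add: diff_divide_distrib)
 show "(%n. mean (%w. eta (phi (q / t) t w - scheme 1 (q / t) (phase_path.E (phi 0)) t n w))) ----> 0"
  using phase_pair.full_scheme[OF phase_pair t, of "q / t" 0] by simp
qed (use t in \<open>auto intro: exI[of _ 0]\<close>)

end

text \<open>Both families are limits of the same scheme: the reference is the boundary point \<open>1\<close> on one side and \<open>phi 0\<close> on the other.\<close>

lemma relative_law:
 assumes c: "carousel M F B V gamma" and s: "schroedinger N G B' phi" and t: "0 < t"
 shows "distr M (\<Pi>\<^sub>M q\<in>\<rat>. borel) (%w. \<lambda>q\<in>\<rat>. carousel.alpha V t (q / t) w) = distr N (\<Pi>\<^sub>M q\<in>\<rat>. borel) (%w. \<lambda>q\<in>\<rat>. phi (q / t) t w - phi 0 t w)"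
proof -
 interpret c: carousel M F B V gamma by fact
 interpret s: schroedinger N G B' phi by fact
 interpret n: noise N G "complex_BM (B' 2) (B' 3)" "%_ _. 0" "%_. return borel 0" by (rule complex_noise[OF s.N s.phi_facts(1,2)]) auto
 show ?thesis
 proof (rule scheme_law_eq[where b=0 and T=t and c="%q. q / t" and rho="carousel_path.rho c.W" and rho'="phase_path.E (phi 0)", OF c.noise_axioms n.noise_axioms t])
  show "c.unit_process (carousel_path.rho c.W)" by (rule carousel_path.rotation_unit_process[OF c.carousel_path])
  show "s.unit_process (phase_path.E (phi 0))" by (rule phase_pair.reference_unit_process[OF s.phase_pair])
  fix q
  show "c.alpha t (q / t) \<in> borel_measurable M" using t by (intro c.measurable_F_M[OF c.alpha_adapted]) simp
  show "(%w. phi (q / t) t w - phi 0 t w) \<in> borel_measurable N" using t s.phi_meas by simp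
  show "(%n. c.mean (%w. eta (c.alpha t (q / t) w - c.scheme 0 (q / t) (carousel_path.rho c.W) t n w))) ----> 0"
   using carousel_path.relative_carousel_scheme[OF c.carousel_path t, of "q / t"] unfolding carousel_path.Y_def[OF c.carousel_path] c.alpha_def .
  show "(%n. s.mean (%w. eta (phi (q / t) t w - phi 0 t w - n.scheme 0 (q / t) (phase_path.E (phi 0)) t n w))) ----> 0"
   using phase_pair.relative_scheme[OF s.phase_pair t, of "q / t" 0] unfolding s.scheme_0 n.scheme_0 by simp
 qed (auto intro: exI[of _ 0])
qed

section \<open>Point sets of increasing functions\<close>

text \<open>The point where an increasing path passes the level \<open>u + 2 * pi * k\<close>, read off from the rational points and therefore a
 measurable function of countably many random variables.\<close>

definition crossings :: "(real => real) => real => int => real" where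
 "crossings a u k = real_of_ereal (SUP q\<in>\<rat>. if a q < u + 2 * pi * of_int k then ereal q else - \<infinity>)"

text \<open>Counting points through their indices requires an injective enumeration; the degenerate case is sent to the empty set to keep
 the map measurable everywhere.\<close>

definition points :: "(int => real) => real set" where
 "points p = (if inj p then range p else {})"

lemma SUP_below:
 assumes "!!q. q \<in> \<rat> ==> P q \<longleftrightarrow> q < x \<or> (c & q = x)"
 shows "real_of_ereal (SUP q\<in>\<rat>. if P q then ereal q else - \<infinity>) = x"
proof -
 let ?S = "SUP q\<in>\<rat>. if P q then ereal q else - \<infinity>"
 have "?S = ereal x"
 proof (rule antisym)
  show "?S <= ereal x" using assms by (intro SUP_least) auto
  show "ereal x <= ?S"
  proof (rule dense_le)
   fix y assume "y < ereal x"
   then obtain z where z: "y < ereal z" "z < x" by (metis ereal_dense2 ereal_less_eq(3) less_ereal.simps(1))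
   obtain q where q: "q \<in> \<rat>" "z < q" "q < x" using Rats_dense_in_real[OF z(2)] by blast
   have "ereal q <= ?S"
    using assms[OF q(1)] q by (intro SUP_upper2[OF q(1)]) auto
   thus "y <= ?S" using z(1) q(2) by (meson ereal_less_eq(3) less_imp_le order_trans)
  qed
 qed
 thus ?thesis by simp
qed

locale increasing_bijection =
 fixes f :: "real => real"
 assumes cont: "continuous_on UNIV f" and mono: "strict_mono f" and above: "!!c. EX x. c <= f x" and below: "!!c. EX x. f x <= c"
begin

lemma onto: obtains x where "f x = c"
proof -
 obtain x y where "c <= f x" "f y <= c" using above below by blast
 moreover hence "y <= x" using mono by (meson dual_order.trans strict_mono_less_eq)
 ultimately show ?thesis using IVT'[of f y c x] continuous_on_subset[OF cont, of "{y..x}"] that by blast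
qed

lemma f_crossings:
 assumes "!!q. q \<in> \<rat> ==> a q = f q"
 shows "f (crossings a u k) = u + 2 * pi * of_int k"
proof -
 obtain x where x: "f x = u + 2 * pi * of_int k" by (rule onto)
 have "crossings a u k = x" unfolding crossings_def
  by (rule SUP_below[where c=False]) (simp add: assms x[symmetric] strict_mono_less[OF mono])
 thus ?thesis using x by simp
qed

lemma crossings_less:
 assumes "!!q. q \<in> \<rat> ==> a q = f q"
 shows "crossings a u j < crossings a u k \<longleftrightarrow> j < k"
proof -
 have fc: "f (crossings a u k) = u + 2 * pi * of_int k" for k by (rule f_crossings) (rule assms)
 have "f (crossings a u j) < f (crossings a u k) \<longleftrightarrow> j < k" unfolding fc by simp
 thus ?thesis by (simp add: strict_mono_less[OF mono])
qed

lemma points_crossings: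
 assumes "!!q. q \<in> \<rat> ==> a q = f q"
 shows "points (crossings a u) = {l. \<exists>k::int. f l = u + 2 * pi * of_int k}"
proof -
 have fc: "f (crossings a u k) = u + 2 * pi * of_int k" for k by (rule f_crossings) (rule assms)
 have cl: "crossings a u j < crossings a u k \<longleftrightarrow> j < k" for j k by (rule crossings_less) (rule assms)
 have "inj (crossings a u)" using cl by (intro injI) (metis linorder_neqE_linordered_idom less_irrefl)
 moreover have "range (crossings a u) = {l. \<exists>k::int. f l = u + 2 * pi * of_int k}"
 proof (intro set_eqI iffI)
  fix l assume "l \<in> {l. \<exists>k::int. f l = u + 2 * pi * of_int k}"
  then obtain k :: int where "f l = f (crossings a u k)" unfolding fc by blast
  hence "l = crossings a u k" using strict_mono_eq[OF mono] by blast
  thus "l \<in> range (crossings a u)" by blast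
 qed (use fc in auto)
 ultimately show ?thesis by (simp add: points_def)
qed

lemma locally_finite: "finite ({l. \<exists>k::int. f l = u + 2 * pi * of_int k} Int {c..d})"
proof -
 let ?K = "{\<lfloor>(f c - u) / (2 * pi)\<rfloor> .. \<lceil>(f d - u) / (2 * pi)\<rceil>}"
 have "\<exists>k\<in>?K. l = crossings f u k" if l: "f l = u + 2 * pi * of_int k" "c <= l" "l <= d" for l and k :: int
 proof
  have "f c <= f l" "f l <= f d" by (simp_all only: strict_mono_less_eq[OF mono] l(2,3))
  hence "(f c - u) / (2 * pi) <= of_int k" "of_int k <= (f d - u) / (2 * pi)" using l(1) by (simp_all add: field_simps)
  thus "k \<in> ?K" by (simp add: floor_le_iff le_ceiling_iff)
  have "f l = f (crossings f u k)" using l(1) f_crossings[of f u k] by simp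
  thus "l = crossings f u k" using strict_mono_eq[OF mono] by blast
 qed
 hence "{l. \<exists>k::int. f l = u + 2 * pi * of_int k} Int {c..d} \<subseteq> crossings f u ` ?K" by force
 thus ?thesis by (rule finite_subset) simp
qed

end

lemma crossings_subtract: "crossings (%q. a q - c) (u - c) = crossings a u"
 unfolding crossings_def by (simp add: fun_eq_iff less_diff_eq diff_add_eq)

lemma points_reindex:
 assumes "bij g" shows "points (p \<circ> g) = points p"
proof -
 have "range (p \<circ> g) = range p" using bij_is_surj[OF assms] by (metis image_comp)
 moreover have "inj (p \<circ> g) \<longleftrightarrow> inj p"
  using comp_inj_on_iff[of g UNIV p] bij_is_inj[OF assms] bij_is_surj[OF assms] by simp
 ultimately show ?thesis by (simp add: points_def)
qed

text \<open>A change of the level by a multiple of \<open>2 * pi\<close> only renumbers the points.\<close>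

lemma points_crossings_periodic: "points (crossings a (u + 2 * pi * of_int j)) = points (crossings a u)"
proof -
 have e: "crossings a (u + 2 * pi * of_int j) = crossings a u \<circ> (%k. j + k)"
  by (simp add: crossings_def fun_eq_iff algebra_simps)
 have "bij (%k. j + k)" by (rule bij_betw_byWitness[where f'="%k. k - j"]) auto
 thus ?thesis unfolding e by (rule points_reindex)
qed

lemma crossings_measurable:
 assumes "!!q. q \<in> \<rat> ==> (%w. a w q) \<in> borel_measurable A" "u \<in> borel_measurable A"
 shows "(%w. crossings (a w) (u w) k) \<in> borel_measurable A"
proof -
 have "(%w. SUP q\<in>\<rat>. if a w q < u w + 2 * pi * of_int k then ereal q else - \<infinity>) \<in> borel_measurable A"
 proof (rule borel_measurable_SUP[OF countable_rat])
  fix q :: real assume "q \<in> \<rat>"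
  note [measurable] = assms(1)[OF this] assms(2)
  show "(%w. if a w q < u w + 2 * pi * of_int k then ereal q else - \<infinity>) \<in> borel_measurable A" by measurable
 qed
 thus ?thesis unfolding crossings_def by (rule borel_measurable_real_of_ereal)
qed

lemma config_event:
 assumes "A \<in> sets borel"
 shows "{S. finite (S Int A) & card (S Int A) = k} \<in> sets config_space"
 using assms unfolding config_space_def by (intro in_measure_of) auto

lemma sets_config_space: "sets config_space = sigma_sets UNIV {{S. finite (S Int A) & card (S Int A) = k} | A k. A \<in> sets (borel :: real measure)}"
 unfolding config_space_def by (rule sets_measure_of) simp

lemma space_config_space [simp]: "space config_space = UNIV"
 unfolding config_space_def by (rule space_measure_of) simp

lemma measurable_config_spaceI:
 assumes "!!A k. A \<in> sets (borel :: real measure) ==> {w\<in>space E. finite (f w Int A) & card (f w Int A) = k} \<in> sets E"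
 shows "f \<in> measurable E config_space"
proof (rule measurable_sigma_sets[OF sets_config_space])
 fix C assume "C \<in> {{S. finite (S Int A) & card (S Int A) = k} | A k. A \<in> sets (borel :: real measure)}"
 then obtain A k where C: "A \<in> sets (borel :: real measure)" "C = {S. finite (S Int A) & card (S Int A) = k}" by blast
 have "f -` C Int space E = {w\<in>space E. finite (f w Int A) & card (f w Int A) = k}" unfolding C(2) by auto
 thus "f -` C Int space E \<in> sets E" using assms[OF C(1)] by simp
qed auto

lemma points_measurable:
 assumes p: "!!k. (%w. p w k) \<in> borel_measurable E"
 shows "(%w. points (p w)) \<in> measurable E config_space"
proof (rule measurable_config_spaceI)
 fix A :: "real set" and n assume A [measurable]: "A \<in> sets borel"
 note [measurable] = p
 let ?K = "{K :: int set. finite K & card K = n}"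
 have e: "finite (points (p w) Int A) & card (points (p w) Int A) = n \<longleftrightarrow>
   (if ALL i j. i ~= j --> p w i ~= p w j then \<exists>K\<in>?K. ALL k. p w k \<in> A \<longleftrightarrow> k \<in> K else n = 0)" for w
 proof (cases "inj (p w)")
  case True
  hence i: "ALL i j. i ~= j --> p w i ~= p w j" by (auto simp: inj_def)
  have "points (p w) Int A = p w ` {k. p w k \<in> A}" using True by (auto simp: points_def)
  moreover have "inj_on (p w) {k. p w k \<in> A}" using True inj_on_subset by blast
  ultimately have "finite (points (p w) Int A) & card (points (p w) Int A) = n \<longleftrightarrow> {k. p w k \<in> A} \<in> ?K"
   by (simp add: finite_image_iff card_image)
  also have "... \<longleftrightarrow> (\<exists>K\<in>?K. ALL k. p w k \<in> A \<longleftrightarrow> k \<in> K)"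
  proof
   assume "\<exists>K\<in>?K. ALL k. p w k \<in> A \<longleftrightarrow> k \<in> K"
   then obtain K where "K \<in> ?K" "{k. p w k \<in> A} = K" by blast
   thus "{k. p w k \<in> A} \<in> ?K" by simp
  qed (rule bexI[rotated], auto)
  finally show ?thesis using i by simp
 next
  case False
  hence "~ (ALL i j. i ~= j --> p w i ~= p w j)" by (auto simp: inj_def)
  with False show ?thesis by (auto simp: points_def)
 qed
 have "countable ?K" by (rule countable_subset[OF _ countable_Collect_finite]) auto
 hence [measurable]: "Measurable.pred E (%w. \<exists>K\<in>?K. ALL k. p w k \<in> A \<longleftrightarrow> k \<in> K)"
  unfolding Measurable.pred_def by (rule sets.sets_Collect_countable_Ex'[rotated]) measurable
 show "{w\<in>space E. finite (points (p w) Int A) & card (points (p w) Int A) = n} \<in> sets E"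
  unfolding e by measurable
qed

section \<open>Enumeration of a configuration\<close>

text \<open>A step function that jumps by \<open>1\<close> at each point of \<open>S\<close>; so the points are the crossings of integer levels.\<close>

definition signed_count :: "real set => real => real" where
 "signed_count S q = (if 0 <= q then real (card (S Int {0..<q})) else - real (card (S Int {q..<0})))"

definition enumeration :: "real set => int => real" where
 "enumeration S = crossings (%q. 2 * pi * signed_count S q) 0"

lemma card_measurable:
 assumes A: "A \<in> sets borel"
 shows "(%S. card (S Int A)) \<in> measurable config_space (count_space UNIV)"
proof -
 have pos: "{S. card (S Int A) = k} \<in> sets config_space" if "0 < k" for k
 proof -
  have "{S. card (S Int A) = k} = {S. finite (S Int A) & card (S Int A) = k}"
   using that by (auto intro: card_ge_0_finite)
  thus ?thesis using config_event[OF A] by simp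
 qed
 have "{S. card (S Int A) = k} \<in> sets config_space" for k
 proof (cases "k = 0")
  case True
  have "{S. card (S Int A) = 0} = space config_space - (\<Union>i. {S. card (S Int A) = Suc i})"
   by auto (metis not0_implies_Suc)
  also have "... \<in> sets config_space" by (intro sets.compl_sets sets.countable_UN image_subsetI pos) simp
  finally show ?thesis using True by simp
 qed (simp add: pos)
 thus ?thesis by (intro measurable_count_space_eq2_countable[THEN iffD2]) (auto simp: vimage_def)
qed

lemma signed_count_measurable: "(%S. signed_count S q) \<in> borel_measurable config_space"
proof -
 have c: "(%S. real (card (S Int A))) \<in> borel_measurable config_space" if "A \<in> sets borel" for A
  by (rule measurable_compose[OF card_measurable[OF that]]) simp
 show ?thesis by (cases "0 <= q") (simp_all add: signed_count_def c)
qed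

lemma enumeration_measurable: "(%S. enumeration S k) \<in> borel_measurable config_space"
 unfolding enumeration_def by (intro crossings_measurable borel_measurable_times borel_measurable_const signed_count_measurable)

context increasing_bijection
begin

text \<open>The enumeration of the configuration and that of the path differ by an index shift, since the configuration does not know the
 value of \<open>f\<close> at \<open>0\<close>.\<close>

lemma enumeration_crossings:
 assumes S: "S = {l. \<exists>k::int. f l = 2 * pi * of_int k}"
 shows "enumeration S = crossings f 0 \<circ> (%k. \<lceil>f 0 / (2 * pi)\<rceil> - 1 + k)"
proof
 fix k :: int
 let ?c = "%q. \<lceil>f q / (2 * pi)\<rceil>" and ?p = "crossings f 0"
 have fp: "f (?p j) = 2 * pi * of_int j" for j using f_crossings[of f 0 j] by simp
 have Sp: "S = range ?p"
 proof -
  have "l \<in> range ?p" if "f l = 2 * pi * of_int j" for l and j :: int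
   using that strict_mono_eq[OF mono, of l "?p j"] by (simp add: fp)
  thus ?thesis unfolding S using fp by auto
 qed
 have inj: "inj ?p" using fp by (intro injI) (metis mult_left_cancel of_int_eq_iff pi_neq_zero mult_eq_0_iff zero_neq_numeral)
 have below: "?p j < q \<longleftrightarrow> j < ?c q" for j q
 proof -
  have "?p j < q \<longleftrightarrow> 2 * pi * of_int j < f q" unfolding fp[symmetric] by (simp add: strict_mono_less[OF mono])
  also have "... \<longleftrightarrow> of_int j < f q / (2 * pi)" by (simp add: field_simps)
  finally show ?thesis by (simp add: less_ceiling_iff)
 qed
 have card: "real (card (S Int {x..<y})) = of_int (?c y - ?c x)" if "x <= y" for x y
 proof -
  have "S Int {x..<y} = ?p ` {?c x..<?c y}"
   unfolding Sp using below[of _ y] below[of _ x] by (auto simp: not_less[symmetric])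
  hence "card (S Int {x..<y}) = nat (?c y - ?c x)" using inj by (simp add: card_image inj_on_subset)
  moreover have "?c x <= ?c y" using that by (intro ceiling_mono divide_right_mono) (simp_all add: strict_mono_less_eq[OF mono])
  ultimately show ?thesis by simp
 qed
 have count: "signed_count S q = of_int (?c q - ?c 0)" for q
  using card[of 0 q] card[of q 0] by (cases "0 <= q") (simp_all add: signed_count_def)
 show "enumeration S k = (?p \<circ> (%k. ?c 0 - 1 + k)) k"
  unfolding enumeration_def crossings_def[of "%q. 2 * pi * signed_count S q"] comp_apply
 proof (rule SUP_below[where c=True])
  fix q :: real
  have "2 * pi * signed_count S q < 0 + 2 * pi * of_int k \<longleftrightarrow> signed_count S q < of_int k" by simp
  also have "... \<longleftrightarrow> ~ ?c 0 - 1 + k < ?c q" unfolding count of_int_less_iff by linarith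
  also have "... \<longleftrightarrow> q <= ?p (?c 0 - 1 + k)" unfolding below[symmetric] by (rule not_less)
  finally show "2 * pi * signed_count S q < 0 + 2 * pi * of_int k \<longleftrightarrow> q < ?p (?c 0 - 1 + k) \<or> (True & q = ?p (?c 0 - 1 + k))"
   by (simp add: le_less)
 qed
qed

lemma shifted_enumeration:
 assumes S: "S = {l. \<exists>k::int. f l = 2 * pi * of_int k}"
 shows "points (%k. enumeration S k + u) = {l. \<exists>k::int. f (l - u) = 2 * pi * of_int k}"
proof -
 let ?g = "%k. \<lceil>f 0 / (2 * pi)\<rceil> - 1 + k"
 have g: "bij ?g" by (rule bij_betw_byWitness[where f'="%k. k - (\<lceil>f 0 / (2 * pi)\<rceil> - 1)"]) auto
 have e: "(%k. enumeration S k + u) = (%k. crossings f 0 k + u) \<circ> ?g"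
  unfolding enumeration_crossings[OF S] by (simp add: fun_eq_iff)
 have "inj (%k. crossings f 0 k + u) \<longleftrightarrow> inj (crossings f 0)" by (simp add: inj_def)
 moreover have "range (%k. crossings f 0 k + u) = (%l. l + u) ` range (crossings f 0)" by auto
 ultimately have "points (%k. crossings f 0 k + u) = (%l. l + u) ` points (crossings f 0)" by (simp add: points_def)
 also have "points (crossings f 0) = {l. \<exists>k::int. f l = 0 + 2 * pi * of_int k}" by (rule points_crossings) simp
 also have "(%l. l + u) ` ... = {l. \<exists>k::int. f (l - u) = 2 * pi * of_int k}"
  by (auto simp: image_iff) (metis diff_add_cancel)
 finally show ?thesis unfolding e points_reindex[OF g] .
qed

end

section \<open>Null sets and completion\<close>

lemma measurable_completion_AE:
 assumes g: "g \<in> measurable M E" and eq: "AE x in M. f x = g x" and f: "!!x. x \<in> space M ==> f x \<in> space E"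
 shows "f \<in> measurable (completion M) E" "distr (completion M) E f = distr M E g"
proof -
 show m: "f \<in> measurable (completion M) E"
 proof (rule measurableI)
  fix A assume A: "A \<in> sets E"
  from eq obtain N where N: "{x \<in> space M. ~ f x = g x} \<subseteq> N" "emeasure M N = 0" "N \<in> sets M" by (rule AE_E)
  have "f -` A Int space M = ((g -` A Int space M) - N) \<union> (N Int (f -` A Int space M))" using N(1) by auto
  moreover have "N Int (f -` A Int space M) \<in> sets (completion M)"
   using N by (intro sets_completionI_sub[of N]) auto
  moreover have "(g -` A Int space M) - N \<in> sets (completion M)"
   by (intro sets_completionI_sets sets.Diff measurable_sets[OF g A] N(3))
  ultimately show "f -` A Int space (completion M) \<in> sets (completion M)"
   unfolding space_completion by (metis sets.Un)
 qed (use f in simp)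
 have "distr (completion M) E f = distr (completion M) E g"
 proof (rule distr_cong_AE)
  show "AE x in completion M. f x = g x" using eq by (rule AE_completion)
 qed (use m g measurable_completion in auto)
 thus "distr (completion M) E f = distr M E g" using distr_completion[OF g] by simp
qed

section \<open>The argument of a uniform point\<close>

text \<open>An argument in \<open>{- pi..pi}\<close>, written with \<open>arccos\<close> to be evidently measurable.\<close>

definition circle_arg :: "complex => real" where
 "circle_arg z = (if 0 <= Im z then 1 else - 1) * arccos (max (- 1) (min 1 (Re z)))"

lemma circle_arg_measurable [measurable]: "circle_arg \<in> borel_measurable borel"
proof -
 have "continuous_on UNIV (%x::real. arccos (max (- 1) (min 1 x)))"
  by (intro continuous_on_compose2[OF continuous_on_arccos'] continuous_intros) auto
 hence [measurable]: "(%x::real. arccos (max (- 1) (min 1 x))) \<in> borel_measurable borel"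
  by (rule borel_measurable_continuous_onI)
 show ?thesis unfolding circle_arg_def[abs_def] by measurable
qed

lemma cis_circle_arg:
 assumes z: "cmod z = 1" shows "cis (circle_arg z) = z"
proof -
 have sq: "(Re z)^2 + (Im z)^2 = 1" using z by (simp add: cmod_def)
 have Re: "- 1 <= Re z" "Re z <= 1" using z abs_Re_le_cmod[of z] by auto
 hence m: "max (- 1) (min 1 (Re z)) = Re z" by simp
 have "1 - (Re z)^2 = (Im z)^2" using sq by simp
 hence "sin (arccos (Re z)) = \<bar>Im z\<bar>" using Re by (simp add: sin_arccos)
 thus ?thesis using Re unfolding circle_arg_def m by (simp add: complex_eq_iff)
qed

lemma cis_eq_iff: "cis x = cis y \<longleftrightarrow> (\<exists>k::int. x = y + 2 * pi * of_int k)"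
proof -
 have "cis x = cis y \<longleftrightarrow> sin x = sin y & cos x = cos y" by (auto simp: complex_eq_iff)
 also have "... \<longleftrightarrow> (\<exists>k::int. x = y + 2 * pi * of_int k)" by (rule sin_cos_eq_iff)
 finally show ?thesis .
qed

lemma points_circle_arg: "points (crossings a (circle_arg (cis u))) = points (crossings a u)"
proof -
 have "cis (circle_arg (cis u)) = cis u" by (rule cis_circle_arg) simp
 then obtain k :: int where "circle_arg (cis u) = u + 2 * pi * of_int k" unfolding cis_eq_iff by blast
 thus ?thesis by (simp only: points_crossings_periodic)
qed

lemma circle_rotation: "distr uniform_angle borel (%u. cis (u - c)) = circle"
proof (rule measure_eqI)
 interpret prob_space uniform_angle by (rule prob_space_uniform_angle)
 fix D assume "D \<in> sets (distr uniform_angle borel (%u. cis (u - c)))"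
 hence D: "D \<in> sets borel" by simp
 have Z: "(%u. cis (u - c)) \<in> borel_measurable uniform_angle" by measurable
 have "emeasure uniform_angle (UNIV Int (%u. cis (u - c)) -` D) = emeasure uniform_angle UNIV * emeasure circle D"
 proof (rule circle_law[OF Z _ _ _ D])
  fix k :: nat assume k: "1 <= k"
  have c: "integral\<^sup>L uniform_angle (%u. cis u ^ k) = 0"
   using circle_moment[OF k] unfolding circle_def by (subst (asm) integral_distr) simp_all
  have "mean (%u. indicator UNIV u * cis (u - c) ^ k) = mean (%u. cis (- c) ^ k * cis u ^ k)"
   by (intro integral_cong refl) (simp add: power_mult_distrib[symmetric] cis_mult)
  also have "... = 0" using c by simp
  finally show "mean (%u. indicator UNIV u * cis (u - c) ^ k) = 0" .
 qed auto
 moreover have "emeasure uniform_angle UNIV = 1" using emeasure_space_1 by simp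
 ultimately show "emeasure (distr uniform_angle borel (%u. cis (u - c))) D = emeasure circle D"
  using D Z by (simp add: emeasure_distr)
qed simp

lemma nn_integral_rotated_angle:
 assumes "g \<in> borel_measurable borel"
 shows "(\<integral>\<^sup>+u. g (cis (u - c)) \<partial>uniform_angle) = (\<integral>\<^sup>+z. g z \<partial>circle)"
 unfolding circle_rotation[of c, symmetric] using assms by (subst nn_integral_distr) simp_all

section \<open>Both point processes as crossings\<close>

text \<open>Monotonicity and unboundedness of a path are properties of its values at rational points.\<close>

definition proper_increasing :: "(real => real) => bool" where
 "proper_increasing a \<longleftrightarrow> (\<forall>p\<in>\<rat>. \<forall>q\<in>\<rat>. p < q --> a p < a q) & (\<forall>n::nat. \<exists>q\<in>\<rat>. real n <= a q) & (\<forall>n::nat. \<exists>q\<in>\<rat>. a q <= - real n)"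

lemma proper_increasing_event: "{a \<in> space (real_paths \<rat>). proper_increasing a} \<in> sets (real_paths \<rat>)"
proof -
 have [measurable]: "(%a. a q) \<in> borel_measurable (real_paths \<rat>)" if "q \<in> \<rat>" for q :: real
  using that by (rule measurable_component_singleton)
 show ?thesis unfolding proper_increasing_def
  by (intro sets.sets_Collect_conj sets.sets_Collect_countable_All sets.sets_Collect_countable_All' sets.sets_Collect_countable_Ex'
    countable_rat sets.sets_Collect_imp sets.sets_Collect_const) measurable
qed

lemma (in increasing_bijection) proper_increasing: "proper_increasing (%q. f q)"
 unfolding proper_increasing_def
proof (intro conjI ballI allI impI)
 fix n :: nat
 obtain x where x: "real n <= f x" using above by blast
 obtain q where q: "q \<in> \<rat>" "x < q" using Rats_dense_in_real[of x "x + 1"] by auto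
 thus "\<exists>q\<in>\<rat>. real n <= f q" using x strict_mono_less[OF mono, of x q] by (intro bexI[of _ q]) auto
 obtain x where x: "f x <= - real n" using below by blast
 obtain q where q: "q \<in> \<rat>" "q < x" using Rats_dense_in_real[of "x - 1" x] by auto
 thus "\<exists>q\<in>\<rat>. f q <= - real n" using x strict_mono_less[OF mono, of q x] by (intro bexI[of _ q]) auto
qed (simp add: strict_mono_less[OF mono])

lemma proper_increasing_bijection:
 fixes f :: "real => real"
 assumes c: "continuous_on UNIV f" and p: "proper_increasing a" and a: "!!q. q \<in> \<rat> ==> a q = f q - d"
 shows "increasing_bijection f"
proof
 have less: "f p < f q" if "p \<in> \<rat>" "q \<in> \<rat>" "p < q" for p q
 proof -
  have "a p < a q" using p that unfolding proper_increasing_def by blast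
  thus ?thesis using a[OF that(1)] a[OF that(2)] by linarith
 qed
 have near: "\<exists>e>0. ALL y. \<bar>y - x\<bar> < e --> \<bar>f y - f x\<bar> < h" if "0 < h" for x h
 proof -
  have "isCont f x" using c by (simp add: continuous_on_eq_continuous_at)
  thus ?thesis using that unfolding continuous_at_eps_delta by (auto simp: dist_real_def)
 qed
 have left: "f x <= f q" if q: "q \<in> \<rat>" "x < q" for x q
 proof (rule ccontr)
  assume "~ f x <= f q"
  then obtain e where e: "0 < e" "!!y. \<bar>y - x\<bar> < e ==> \<bar>f y - f x\<bar> < f x - f q" using near[of "f x - f q" x] by auto
  obtain y where y: "y \<in> \<rat>" "x < y" "y < min q (x + e)" using Rats_dense_in_real[of x "min q (x + e)"] q e by auto
  thus False using less[of y q] q(1) e(2)[of y] by auto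
 qed
 have right: "f q <= f x" if q: "q \<in> \<rat>" "q < x" for x q
 proof (rule ccontr)
  assume "~ f q <= f x"
  then obtain e where e: "0 < e" "!!y. \<bar>y - x\<bar> < e ==> \<bar>f y - f x\<bar> < f q - f x" using near[of "f q - f x" x] by auto
  obtain y where y: "y \<in> \<rat>" "max q (x - e) < y" "y < x" using Rats_dense_in_real[of "max q (x - e)" x] q e by auto
  thus False using less[of q y] q(1) e(2)[of y] by auto
 qed
 show "strict_mono f"
 proof (rule strict_monoI)
  fix x y :: real assume "x < y"
  then obtain z where "x < z" "z < y" using dense by blast
  then obtain p q where "p \<in> \<rat>" "x < p" "p < z" "q \<in> \<rat>" "z < q" "q < y" using Rats_dense_in_real by metis
  thus "f x < f y" using left[of p x] less[of p q] right[of q y] by linarith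
 qed
 show "EX x. b <= f x" for b
 proof -
  obtain n :: nat where n: "b - d <= real n" using real_arch_simple by blast
  obtain q where "q \<in> \<rat>" "real n <= a q" using p unfolding proper_increasing_def by blast
  thus ?thesis using n a[of q] by (intro exI[of _ q]) linarith
 qed
 show "EX x. f x <= b" for b
 proof -
  obtain n :: nat where n: "- (b - d) <= real n" using real_arch_simple by blast
  obtain q where "q \<in> \<rat>" "a q <= - real n" using p unfolding proper_increasing_def by blast
  thus ?thesis using n a[of q] by (intro exI[of _ q]) linarith
 qed
qed (rule c)


text \<open>The points where a path meets the level given by a point of the circle.\<close>

definition sample :: "(real => real) \<times> complex => real set" where
 "sample p = points (crossings (fst p) (circle_arg (snd p)))"

abbreviation path_space :: "(real => real) measure" where
 "path_space \<equiv> real_paths \<rat>"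

lemma path_component_measurable: "q \<in> \<rat> ==> (%a. a q) \<in> borel_measurable path_space"
 by (rule measurable_component_singleton)

lemma sample_measurable: "sample \<in> measurable (path_space \<Otimes>\<^sub>M borel) config_space"
 unfolding sample_def[abs_def]
proof (intro points_measurable crossings_measurable)
 show "(%p. fst p q) \<in> borel_measurable (path_space \<Otimes>\<^sub>M (borel :: complex measure))" if "q \<in> \<rat>" for q
  by (rule measurable_compose[OF measurable_fst path_component_measurable[OF that]])
 show "(%p. circle_arg (snd p)) \<in> borel_measurable (path_space \<Otimes>\<^sub>M borel)" by measurable
qed

lemma moebius_inject:
 assumes v: "cmod v < 1" and z: "cmod z = 1" "cmod w = 1"
 shows "moebius v z = moebius v w \<longleftrightarrow> z = w"
proof
 have n: "1 - cnj v * y ~= 0" if "cmod y = 1" for y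
 proof -
  have "cmod (cnj v * y) < 1" using v that by (simp add: norm_mult)
  thus ?thesis by auto
 qed
 assume "moebius v z = moebius v w"
 hence "(z - v) * (1 - cnj v * w) = (w - v) * (1 - cnj v * z)" using n[OF z(1)] n[OF z(2)] by (simp add: frac_eq_eq)
 hence "(z - w) * (1 - cnj v * v) = 0" by (simp add: algebra_simps)
 moreover have "cnj v * v ~= 1"
 proof
  assume "cnj v * v = 1"
  hence "cmod v * cmod v = 1" by (metis complex_mod_cnj norm_mult norm_one)
  hence "(cmod v)^2 = 1" by (simp add: power2_eq_square)
  hence "cmod v = 1" by (simp add: abs_square_eq_1)
  thus False using v by simp
 qed
 ultimately show "z = w" by simp
qed simp

context carousel
begin

definition path :: "real => 'w => real => real" where
 "path t w = (\<lambda>q\<in>\<rat>. alpha t (q / t) w)"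

text \<open>The end point of \<open>V\<close> seen from \<open>V t\<close>, in the frame in which the boundary point \<open>1\<close> has angle \<open>0\<close>.\<close>

definition Z :: "real => 'w => complex" where
 "Z t w = cis (- angle (W t w) 0) * (moebius (W t w) (end_point w))"

lemma V_infinity_eq: "AE w in M. V_infinity V w = end_point w"
 using V_end_point W_eq
proof eventually_elim
 case (elim w)
 have "\<forall>\<^sub>F t in at_top. W t w = V t w" using elim(2) unfolding eventually_at_top_linorder by blast
 from tendsto_cong[OF this] elim(1) have "((%t. V t w) \<longlongrightarrow> end_point w) at_top" by (rule iffD1)
 thus ?case unfolding V_infinity_def by (intro tendsto_Lim) simp_all
qed

lemma alpha_bijection:
 assumes t: "0 < t" shows "AE w in M. increasing_bijection (%l. alpha t (l / t) w)"
 using flow \<Gamma>_gamma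
proof eventually_elim
 case (elim w)
 interpret carousel_flow "%t. W t w" "%l t. gamma l t w" by (rule elim(1))
 let ?A = "angle (W t w)"
 have alpha: "alpha t l w = ?A (gamma l t w) - ?A 0" for l unfolding alpha_def using elim(2) t by simp
 note A = angle_strict_mono[OF W_disk[of t w]] angle_near[OF W_disk[of t w]]
 show ?case
 proof
  show "continuous_on UNIV (%l. alpha t (l / t) w)" unfolding alpha
   by (intro continuous_on_diff continuous_on_const continuous_on_compose2[OF angle_continuous[OF W_disk[of t w], of UNIV]]
     continuous_on_compose2[OF gamma_continuous[OF t]] continuous_intros) (use t in auto)
  show "strict_mono (%l. alpha t (l / t) w)" unfolding alpha
   by (intro strict_monoI diff_strict_right_mono strict_monoD[OF A(1)] gamma_mono t) (use t in \<open>simp add: divide_strict_right_mono\<close>)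
  show "EX l. c <= alpha t (l / t) w" for c
  proof -
   obtain l where "c + ?A 0 + 2 * pi <= gamma l t w" using gamma_unbounded(1)[OF t] by blast
   hence "c <= alpha t (t * l / t) w" unfolding alpha using A(2)[of "gamma l t w"] t by simp
   thus ?thesis by blast
  qed
  show "EX l. alpha t (l / t) w <= c" for c
  proof -
   obtain l where "gamma l t w <= c + ?A 0 - 2 * pi" using gamma_unbounded(2)[OF t] by blast
   hence "alpha t (t * l / t) w <= c" unfolding alpha using A(2)[of "gamma l t w"] t by simp
   thus ?thesis by blast
  qed
 qed
qed

lemma cmod_Z:
 assumes t: "0 <= t" shows "AE w in M. cmod (Z t w) = 1"
 using cmod_end_point
proof eventually_elim
 case (elim w)
 show ?case unfolding Z_def norm_mult cmod_moebius[OF W_disk elim] by simp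
qed

text \<open>Both sides compare, in one Moebius frame, the rotated boundary point with the end point.\<close>

lemma carousel_points:
 assumes t: "0 < t"
 shows "AE w in M. {l. carousel_point gamma (l / t) t w = V_infinity V w} = {l. \<exists>k::int. alpha t (l / t) w = circle_arg (Z t w) + 2 * pi * of_int k}"
 using V_infinity_eq cmod_end_point cmod_Z[OF less_imp_le[OF t]] \<Gamma>_gamma
proof eventually_elim
 case (elim w)
 have "carousel_point gamma l t w = V_infinity V w \<longleftrightarrow> (\<exists>k::int. alpha t l w = circle_arg (Z t w) + 2 * pi * of_int k)" for l
 proof -
  let ?z = "cis (gamma l t w)"
  have "cis (alpha t l w) = cis (- angle (W t w) 0) * cis (angle (W t w) (gamma l t w))"
   unfolding alpha_def using elim(4) t by (simp add: cis_mult)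
  hence c: "cis (alpha t l w) = cis (- angle (W t w) 0) * (moebius (W t w) ?z)"
   unfolding cis_angle[OF W_disk] .
  have "carousel_point gamma l t w = V_infinity V w \<longleftrightarrow> ?z = end_point w"
   unfolding elim(1) carousel_point_def cis_conv_exp ..
  also have "... \<longleftrightarrow> moebius (W t w) ?z = moebius (W t w) (end_point w)"
   by (rule moebius_inject[symmetric]) (use W_disk elim(2) in auto)
  also have "... \<longleftrightarrow> cis (alpha t l w) = Z t w" unfolding c Z_def mult_cancel_left using cis_neq_zero by blast
  also have "... \<longleftrightarrow> cis (alpha t l w) = cis (circle_arg (Z t w))" unfolding cis_circle_arg[OF elim(3)] ..
  finally show ?thesis unfolding cis_eq_iff .
 qed
 thus ?case by blast
qed

lemma path_adapted:
 assumes t: "0 <= t" shows "path t \<in> measurable (F t) path_space"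
 unfolding path_def[abs_def] by (intro measurable_restrict alpha_adapted t)

lemma Z_measurable:
 assumes t: "0 <= t" shows "Z t \<in> borel_measurable M"
proof -
 have [measurable]: "(%w. angle (W t w) 0) \<in> borel_measurable M"
  by (intro borel_measurable_angle V_meas t borel_measurable_const W_disk)
 note [measurable] = V_meas[OF t]
 show ?thesis unfolding Z_def[abs_def] by measurable
qed

lemma path_Z_law:
 assumes t: "0 <= t"
 shows "distr M (path_space \<Otimes>\<^sub>M borel) (%w. (path t w, Z t w)) = distr M path_space (path t) \<Otimes>\<^sub>M circle"
proof (rule pair_measure_eqI[symmetric])
 note pm = measurable_F_M[OF path_adapted[OF t]]
 interpret P: prob_space "distr M path_space (path t)" by (rule prob_space_distr[OF pm])
 interpret C: prob_space circle by (rule prob_space_circle)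
 show "sigma_finite_measure (distr M path_space (path t))" "sigma_finite_measure circle" ..
 show "sets (distr M path_space (path t) \<Otimes>\<^sub>M circle) = sets (distr M (path_space \<Otimes>\<^sub>M borel) (%w. (path t w, Z t w)))"
  by (simp cong: sets_pair_measure_cong)
 fix A D assume "A \<in> sets (distr M path_space (path t))" "D \<in> sets circle"
 hence A: "A \<in> sets path_space" and D: "D \<in> sets borel" by simp_all
 have kappa: "(%w. cis (- angle (W t w) 0)) \<in> borel_measurable (F t)"
 proof -
  have [measurable]: "(%w. angle (W t w) 0) \<in> borel_measurable (F t)"
   by (intro borel_measurable_angle W_adapted t borel_measurable_const W_disk)
  show ?thesis by measurable
 qed
 have AF: "path t -` A Int space M \<in> sets (F t)" using measurable_sets[OF path_adapted[OF t] A] by simp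
 have pair: "(%w. (path t w, Z t w)) \<in> measurable M (path_space \<Otimes>\<^sub>M borel)" by (rule measurable_Pair[OF pm Z_measurable[OF t]])
 have "emeasure (distr M (path_space \<Otimes>\<^sub>M borel) (%w. (path t w, Z t w))) (A \<times> D) = emeasure M ((%w. (path t w, Z t w)) -` (A \<times> D) Int space M)"
  by (rule emeasure_distr[OF pair pair_measureI[OF A D]])
 also have "(%w. (path t w, Z t w)) -` (A \<times> D) Int space M = (path t -` A Int space M) Int Z t -` D" by auto
 also have "emeasure M ... = emeasure M (path t -` A Int space M) * emeasure circle D"
  using harmonic_measure[OF t kappa _ AF D] unfolding Z_def[abs_def] by simp
 also have "emeasure M (path t -` A Int space M) = emeasure (distr M path_space (path t)) A"
  by (rule emeasure_distr[OF pm A, symmetric])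
 finally show "emeasure (distr M path_space (path t)) A * emeasure circle D = emeasure (distr M (path_space \<Otimes>\<^sub>M borel) (%w. (path t w, Z t w))) (A \<times> D)" ..
qed

lemma proper_increasing_path:
 assumes t: "0 < t" shows "AE a in distr M path_space (path t). proper_increasing a"
proof (rule AE_distr_iff[THEN iffD2])
 show "path t \<in> measurable M path_space" using measurable_F_M[OF path_adapted] t by simp
 show "{a \<in> space path_space. proper_increasing a} \<in> sets path_space" by (rule proper_increasing_event)
 show "AE w in M. proper_increasing (path t w)"
  using alpha_bijection[OF t]
 proof eventually_elim
  case (elim w)
  from increasing_bijection.proper_increasing[OF this] show ?case unfolding proper_increasing_def path_def by simp
 qed
qed

text \<open>The path is determined by the past of \<open>t\<close>, and \<open>Z\<close> is uniform and independent of this past.\<close>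

theorem carousel_law:
 assumes t: "0 < t"
 shows "point_process M (%w. {l. carousel_point gamma (l / t) t w = V_infinity V w})" (is "point_process M ?S")
  "pp_law M (%w. {l. carousel_point gamma (l / t) t w = V_infinity V w}) = distr (distr M path_space (path t) \<Otimes>\<^sub>M circle) config_space sample"
proof -
 have t0: "0 <= t" using t by simp
 have pair: "(%w. (path t w, Z t w)) \<in> measurable M (path_space \<Otimes>\<^sub>M borel)"
  by (rule measurable_Pair[OF measurable_F_M[OF path_adapted[OF t0]] Z_measurable[OF t0]])
 have g: "(%w. sample (path t w, Z t w)) \<in> measurable M config_space" by (rule measurable_compose[OF pair sample_measurable])
 have eq: "AE w in M. ?S w = sample (path t w, Z t w)"
  using carousel_points[OF t] alpha_bijection[OF t]
 proof eventually_elim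
  case (elim w)
  show ?case unfolding elim(1) sample_def fst_conv snd_conv
   by (rule increasing_bijection.points_crossings[OF elim(2), symmetric]) (simp add: path_def)
 qed
 note m = measurable_completion_AE[OF g eq]
 have "AE w in M. ALL a b. finite (?S w Int {a..b})"
  using carousel_points[OF t] alpha_bijection[OF t]
 proof eventually_elim
  case (elim w)
  show ?case unfolding elim(1) using increasing_bijection.locally_finite[OF elim(2)] by blast
 qed
 thus "point_process M ?S" unfolding point_process_def using m(1) by simp
 have "pp_law M ?S = distr M config_space (%w. sample (path t w, Z t w))" unfolding pp_law_def using m(2) by simp
 also have "... = distr (distr M (path_space \<Otimes>\<^sub>M borel) (%w. (path t w, Z t w))) config_space sample"
  by (subst distr_distr[OF sample_measurable pair]) (simp add: comp_def)
 finally show "pp_law M ?S = distr (distr M path_space (path t) \<Otimes>\<^sub>M circle) config_space sample" unfolding path_Z_law[OF t0] .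
qed

end

lemma crossings_restrict: "crossings (\<lambda>q\<in>\<rat>. a q) u = crossings a u"
 unfolding crossings_def by (intro ext arg_cong[where f=real_of_ereal] SUP_cong refl) simp

lemma nn_integral_image:
 assumes "T \<in> measurable A E" "f \<in> borel_measurable E"
 shows "integral\<^sup>N (distr A E T) f = (\<integral>\<^sup>+x. f (T x) \<partial>A)"
 using assms by (subst nn_integral_distr) simp_all

lemma emeasure_image:
 assumes T: "T \<in> measurable A E" and C: "C \<in> sets E"
 shows "emeasure (distr A E T) C = (\<integral>\<^sup>+x. indicator C (T x) \<partial>A)"
 using nn_integral_image[OF T borel_measurable_indicator[OF C]] C by simp

text \<open>Translation of a configuration in a form that is jointly measurable in the configuration and the shift.\<close>

definition shift :: "real set \<times> real => real set" where
 "shift p = points (%k. enumeration (fst p) k + snd p)"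

lemma shift_measurable: "shift \<in> measurable (config_space \<Otimes>\<^sub>M borel) config_space"
 unfolding shift_def[abs_def]
 by (intro points_measurable borel_measurable_add measurable_snd measurable_compose[OF measurable_fst enumeration_measurable])

lemma crossing_indicator_measurable:
 assumes "C \<in> sets config_space"
 shows "(%p. indicator C (points (crossings (fst p) (snd p))) :: ennreal) \<in> borel_measurable (path_space \<Otimes>\<^sub>M borel)"
proof -
 have "(%p. points (crossings (fst p) (snd p))) \<in> measurable (path_space \<Otimes>\<^sub>M borel) config_space"
  by (intro points_measurable crossings_measurable measurable_snd measurable_compose[OF measurable_fst path_component_measurable])
 thus ?thesis by (rule measurable_compose) (rule borel_measurable_indicator[OF assms])
qed

text \<open>Averaging over the level removes the initial value of the path.\<close>

lemma average_over_levels: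
 assumes C: "C \<in> sets config_space"
 shows "(\<integral>\<^sup>+u. indicator C (points (crossings a u)) \<partial>uniform_angle) = (\<integral>\<^sup>+z. indicator C (sample (\<lambda>q\<in>\<rat>. a q - a 0, z)) \<partial>circle)"
proof -
 let ?b = "\<lambda>q\<in>\<rat>. a q - a 0"
 have "points (crossings a u) = sample (?b, cis (u - a 0))" for u
  unfolding sample_def fst_conv snd_conv points_circle_arg crossings_restrict crossings_subtract ..
 moreover have "(%z. indicator C (sample (?b, z)) :: ennreal) \<in> borel_measurable borel"
 proof -
  have "?b \<in> space path_space" by (simp add: space_PiM)
  hence "(%z. sample (?b, z)) \<in> measurable borel config_space"
   by (intro measurable_compose[OF measurable_Pair1' sample_measurable])
  thus ?thesis by (rule measurable_compose) (rule borel_measurable_indicator[OF C])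
 qed
 ultimately show ?thesis using nn_integral_rotated_angle[of "%z. indicator C (sample (?b, z))" "a 0"] by simp
qed

context schroedinger
begin

lemma flow_continuous:
 assumes t: "0 < t" shows "AE w in N. continuous_on UNIV (%l. phi (l / t) t w)"
 using phi_facts(4)
proof eventually_elim
 case (elim w)
 hence "continuous_on UNIV (%l. phi l t w)" using t by simp
 thus ?case by (rule continuous_on_compose2) (use t in \<open>auto intro!: continuous_intros\<close>)
qed

definition path :: "real => 'w => real => real" where
 "path t w = (\<lambda>q\<in>\<rat>. phi (q / t) t w)"

lemma path_measurable: "0 <= t ==> path t \<in> measurable N path_space"
 unfolding path_def[abs_def] by (intro measurable_restrict phi_meas)

text \<open>A version of \<open>Sch\<close> that is measurable without completing the probability space.\<close>

definition zero_set :: "real => 'w => real set" where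
 "zero_set t w = points (crossings (path t w) 0)"

lemma zero_set_measurable:
 assumes "0 <= t" shows "zero_set t \<in> measurable N config_space"
 unfolding zero_set_def[abs_def]
 by (intro points_measurable crossings_measurable borel_measurable_const measurable_compose[OF path_measurable[OF assms] path_component_measurable])

lemma zero_set_eq:
 assumes "increasing_bijection (%l. phi (l / t) t w)"
 shows "zero_set t w = {l. \<exists>k::int. phi (l / t) t w = 2 * pi * of_int k}" "zero_set t w = Sch phi t w"
proof -
 have "zero_set t w = {l. \<exists>k::int. phi (l / t) t w = 0 + 2 * pi * of_int k}"
  unfolding zero_set_def by (rule increasing_bijection.points_crossings[OF assms]) (simp add: path_def)
 thus "zero_set t w = {l. \<exists>k::int. phi (l / t) t w = 2 * pi * of_int k}" by simp
 thus "zero_set t w = Sch phi t w" by (simp add: Sch_def)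
qed

lemma shift_zero_set:
 assumes "increasing_bijection (%l. phi (l / t) t w)"
 shows "shift (zero_set t w, u) = {l. \<exists>k::int. phi ((l - u) / t) t w = 2 * pi * of_int k}"
  "shift (zero_set t w, u) = (%l. l + u) ` Sch phi t w"
  "shift (zero_set t w, u) = points (crossings (\<lambda>q\<in>\<rat>. phi ((q - u) / t) t w + u) u)"
proof -
 interpret increasing_bijection "%l. phi (l / t) t w" by fact
 show e: "shift (zero_set t w, u) = {l. \<exists>k::int. phi ((l - u) / t) t w = 2 * pi * of_int k}"
  unfolding shift_def fst_conv snd_conv by (rule shifted_enumeration[OF zero_set_eq(1)[OF assms]])
 show "shift (zero_set t w, u) = (%l. l + u) ` Sch phi t w"
  unfolding e Sch_def by (auto simp: image_iff) (metis diff_add_cancel)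
 have "increasing_bijection (%l. phi ((l - u) / t) t w + u)"
 proof
  show "continuous_on UNIV (%l. phi ((l - u) / t) t w + u)"
   by (intro continuous_on_add continuous_on_const continuous_on_compose2[OF cont] continuous_intros) auto
  show "strict_mono (%l. phi ((l - u) / t) t w + u)"
   by (intro strict_monoI add_strict_right_mono strict_monoD[OF mono]) simp
  show "EX x. c <= phi ((x - u) / t) t w + u" for c
  proof -
   obtain x where "c - u <= phi (x / t) t w" using above by blast
   thus ?thesis by (intro exI[of _ "x + u"]) simp
  qed
  show "EX x. phi ((x - u) / t) t w + u <= c" for c
  proof -
   obtain x where "phi (x / t) t w <= c - u" using below by blast
   thus ?thesis by (intro exI[of _ "x + u"]) simp
  qed
 qed
 hence "points (crossings (\<lambda>q\<in>\<rat>. phi ((q - u) / t) t w + u) u) = {l. \<exists>k::int. phi ((l - u) / t) t w + u = u + 2 * pi * of_int k}"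
  by (rule increasing_bijection.points_crossings) simp
 also have "... = shift (zero_set t w, u)" unfolding e by (simp add: add.commute[of _ u])
 finally show "shift (zero_set t w, u) = points (crossings (\<lambda>q\<in>\<rat>. phi ((q - u) / t) t w + u) u)" ..
qed

text \<open>The independence is assumed for the completed space and for \<open>Sch\<close>; null sets do not affect it.\<close>

lemma zero_set_shift_law:
 assumes t: "0 < t" and good: "AE w in N. increasing_bijection (%l. phi (l / t) t w)"
  and U: "independent_uniform_shift N U (Sch phi t)"
 shows "distr N (config_space \<Otimes>\<^sub>M borel) (%w. (zero_set t w, U w)) = distr N config_space (zero_set t) \<Otimes>\<^sub>M uniform_angle"
proof (rule pair_measure_eqI[symmetric])
 let ?D = "distr N config_space (zero_set t)"
 let ?P = "distr N (config_space \<Otimes>\<^sub>M borel) (%w. (zero_set t w, U w))"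
 have Um: "U \<in> borel_measurable N" and Ud: "distr N borel U = uniform_angle"
  and ind: "prob_space.indep_set (completion N) {U -` A Int space N | A. A \<in> sets borel} {Sch phi t -` C Int space N | C. C \<in> sets config_space}"
  using U unfolding independent_uniform_shift_def uniform_angle_def by blast+
 have Zm: "zero_set t \<in> measurable N config_space" using t by (intro zero_set_measurable) simp
 interpret Z: prob_space "?D" by (rule prob_space_distr[OF Zm])
 interpret A: prob_space uniform_angle by (rule prob_space_uniform_angle)
 interpret C: prob_space "completion N" by (rule prob_space_completion)
 show "sigma_finite_measure ?D" "sigma_finite_measure uniform_angle" ..
 show "sets (?D \<Otimes>\<^sub>M uniform_angle) = sets ?P"
  by (simp cong: sets_pair_measure_cong)
 fix C D assume "C \<in> sets ?D" "D \<in> sets uniform_angle"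
 hence C: "C \<in> sets config_space" and D: "D \<in> sets borel" by simp_all
 let ?Z = "zero_set t -` C Int space N" and ?S = "Sch phi t -` C Int space N" and ?U = "U -` D Int space N"
 have Zs: "?Z \<in> sets N" and Us: "?U \<in> sets N" by (intro measurable_sets[OF Zm C] measurable_sets[OF Um D])+
 have S_Z: "AE w in completion N. w \<in> ?S \<longleftrightarrow> w \<in> ?Z"
  by (rule AE_completion) (use good in eventually_elim, simp add: zero_set_eq(2))
 have Ss: "?S \<in> sets (completion N)"
  using C.indep_setD_ev2[OF ind] C by blast
 have "C.prob (?U Int ?S) = C.prob ?U * C.prob ?S" using C D by (intro C.indep_setD[OF ind]) blast+
 moreover have "C.prob (?U Int ?S) = C.prob (?U Int ?Z)"
  by (rule C.finite_measure_eq_AE) (use S_Z Us Ss Zs in \<open>auto elim: eventually_mono\<close>)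
 moreover have "C.prob ?S = C.prob ?Z"
  by (rule C.finite_measure_eq_AE) (use S_Z Us Ss Zs in \<open>auto elim: eventually_mono\<close>)
 ultimately have ind': "prob (?U Int ?Z) = prob ?U * prob ?Z" using Us Zs by simp
 have pair: "(%w. (zero_set t w, U w)) \<in> measurable N (config_space \<Otimes>\<^sub>M borel)" by (rule measurable_Pair[OF Zm Um])
 have "emeasure ?P (C \<times> D) = emeasure N ((%w. (zero_set t w, U w)) -` (C \<times> D) Int space N)"
  by (rule emeasure_distr[OF pair pair_measureI[OF C D]])
 also have "(%w. (zero_set t w, U w)) -` (C \<times> D) Int space N = ?U Int ?Z" by auto
 also have "emeasure N ... = emeasure N ?Z * emeasure N ?U"
  unfolding emeasure_eq_measure ind' by (simp add: ennreal_mult mult.commute)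
 also have "... = emeasure ?D C * emeasure uniform_angle D"
  unfolding Ud[symmetric] by (simp only: emeasure_distr[OF Zm C] emeasure_distr[OF Um D])
 finally show "emeasure ?D C * emeasure uniform_angle D = emeasure ?P (C \<times> D)" ..
qed

text \<open>For a fixed shift \<open>u\<close>, the translation invariance of the flow turns the shift of the points into
 a change of the level.\<close>

lemma fixed_shift_law:
 assumes t: "0 < t" and good: "AE w in N. increasing_bijection (%l. phi (l / t) t w)" and C: "C \<in> sets config_space"
 shows "(\<integral>\<^sup>+w. indicator C (shift (zero_set t w, u)) \<partial>N) = (\<integral>\<^sup>+a. indicator C (points (crossings a u)) \<partial>distr N path_space (path t))"
proof -
 let ?q = "%w. \<lambda>q\<in>\<rat>. phi ((q - u) / t) t w + u"
 have g: "(%a. indicator C (points (crossings a u)) :: ennreal) \<in> borel_measurable path_space"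
  using measurable_compose[OF measurable_Pair2' crossing_indicator_measurable[OF C], of u] by simp
 have q: "?q \<in> measurable N path_space"
  using t by (intro measurable_restrict borel_measurable_add borel_measurable_const phi_meas) simp
 have "(\<integral>\<^sup>+w. indicator C (shift (zero_set t w, u)) \<partial>N) = (\<integral>\<^sup>+w. indicator C (points (crossings (?q w) u)) \<partial>N)"
  by (rule nn_integral_cong_AE) (use good in eventually_elim, simp only: shift_zero_set(3))
 also have "... = (\<integral>\<^sup>+a. indicator C (points (crossings a u)) \<partial>distr N path_space ?q)"
  by (rule nn_integral_image[OF q g, symmetric])
 also have "distr N path_space ?q = distr N path_space (path t)"
  using translation_invariance[OF t, of u] unfolding path_def[abs_def] .
 finally show ?thesis .
qed

text \<open>Integrate over the shift first: \<open>fixed_shift_law\<close> holds for each value of it, and afterwards \<open>average_over_levels\<close> applies to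
 each path.\<close>

lemma shifted_law:
 assumes t: "0 < t" and good: "AE w in N. increasing_bijection (%l. phi (l / t) t w)"
  and U: "independent_uniform_shift N U (Sch phi t)"
 shows "point_process N (Sch_star phi U t)"
  "pp_law N (Sch_star phi U t) = distr (distr N path_space (%w. \<lambda>q\<in>\<rat>. phi (q / t) t w - phi 0 t w) \<Otimes>\<^sub>M circle) config_space sample"
proof -
 have t0: "0 <= t" using t by simp
 have Um: "U \<in> borel_measurable N" using U unfolding independent_uniform_shift_def by blast
 note Zm = zero_set_measurable[OF t0]
 have pair: "(%w. (zero_set t w, U w)) \<in> measurable N (config_space \<Otimes>\<^sub>M borel)" by (rule measurable_Pair[OF Zm Um])
 have g: "(%w. shift (zero_set t w, U w)) \<in> measurable N config_space" by (rule measurable_compose[OF pair shift_measurable])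
 have eq: "AE w in N. Sch_star phi U t w = shift (zero_set t w, U w)"
  using good by eventually_elim (simp add: Sch_star_def shift_zero_set(2))
 note m = measurable_completion_AE[OF g eq]
 have "AE w in N. ALL a b. finite (Sch_star phi U t w Int {a..b})"
  using good
 proof eventually_elim
  case (elim w)
  have "finite ({l. \<exists>k::int. phi (l / t) t w = 0 + 2 * pi * of_int k} Int {a - U w..b - U w})" for a b
   by (rule increasing_bijection.locally_finite[OF elim])
  hence f: "finite (Sch phi t w Int {a - U w..b - U w})" for a b by (simp add: Sch_def)
  have "Sch_star phi U t w Int {a..b} \<subseteq> (%l. l + U w) ` (Sch phi t w Int {a - U w..b - U w})" for a b
   unfolding Sch_star_def by auto
  thus ?case using f by (meson finite_imageI finite_subset)
 qed
 thus "point_process N (Sch_star phi U t)" unfolding point_process_def using m(1) by simp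
 let ?P = "distr N config_space (zero_set t)" and ?Q = "distr N path_space (path t)"
 let ?rel = "%w. \<lambda>q\<in>\<rat>. phi (q / t) t w - phi 0 t w"
 let ?L = "distr N path_space ?rel"
 let ?PA = "?P \<Otimes>\<^sub>M uniform_angle"
 let ?LC = "?L \<Otimes>\<^sub>M circle"
 have relm: "?rel \<in> measurable N path_space" using t0 by (intro measurable_restrict borel_measurable_diff phi_meas)
 note pm = path_measurable[OF t0]
 interpret P: prob_space ?P by (rule prob_space_distr[OF Zm])
 interpret Q: prob_space ?Q by (rule prob_space_distr[OF pm])
 interpret L: prob_space ?L by (rule prob_space_distr[OF relm])
 interpret A: prob_space uniform_angle by (rule prob_space_uniform_angle)
 interpret K: prob_space circle by (rule prob_space_circle)
 interpret PA: pair_sigma_finite ?P uniform_angle ..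
 interpret QA: pair_sigma_finite ?Q uniform_angle ..
 have law: "pp_law N (Sch_star phi U t) = distr ?PA config_space shift"
 proof -
  have "pp_law N (Sch_star phi U t) = distr N config_space (%w. shift (zero_set t w, U w))" unfolding pp_law_def using m(2) by simp
  also have "... = distr (distr N (config_space \<Otimes>\<^sub>M borel) (%w. (zero_set t w, U w))) config_space shift"
   by (subst distr_distr[OF shift_measurable pair]) (simp add: comp_def)
  finally show ?thesis unfolding zero_set_shift_law[OF t good U] .
 qed
 show "pp_law N (Sch_star phi U t) = distr ?LC config_space sample" unfolding law
 proof (rule measure_eqI)
  fix C assume "C \<in> sets (distr ?PA config_space shift)"
  hence C: "C \<in> sets config_space" by simp
  let ?i = "indicator C :: real set => ennreal"
  have sm: "shift \<in> measurable ?PA config_space"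
   using shift_measurable by (simp cong: measurable_cong_sets sets_pair_measure_cong)
  have am: "sample \<in> measurable ?LC config_space"
   using sample_measurable by (simp cong: measurable_cong_sets sets_pair_measure_cong)
  have f1: "(%p. ?i (shift p)) \<in> borel_measurable ?PA"
   by (rule measurable_compose[OF sm borel_measurable_indicator[OF C]])
  have f2: "(%p. ?i (sample p)) \<in> borel_measurable ?LC"
   by (rule measurable_compose[OF am borel_measurable_indicator[OF C]])
  have f3: "(%p. ?i (points (crossings (fst p) (snd p)))) \<in> borel_measurable (?Q \<Otimes>\<^sub>M uniform_angle)"
   using crossing_indicator_measurable[OF C] by (simp cong: measurable_cong_sets sets_pair_measure_cong)
  have H: "(%b. \<integral>\<^sup>+z. ?i (sample (b, z)) \<partial>circle) \<in> borel_measurable path_space"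
   using K.borel_measurable_nn_integral_fst[OF f2] by simp
  have s1: "(%S. ?i (shift (S, u))) \<in> borel_measurable config_space" for u
   using measurable_compose[OF measurable_Pair2' measurable_compose[OF shift_measurable borel_measurable_indicator[OF C]], of u] by simp
  have "emeasure (distr ?PA config_space shift) C = (\<integral>\<^sup>+p. ?i (shift p) \<partial>?PA)"
   by (rule emeasure_image[OF sm C])
  also have "... = (\<integral>\<^sup>+u. \<integral>\<^sup>+S. ?i (shift (S, u)) \<partial>?P \<partial>uniform_angle)"
   by (rule PA.nn_integral_snd[OF f1, symmetric])
  also have "... = (\<integral>\<^sup>+u. \<integral>\<^sup>+w. ?i (shift (zero_set t w, u)) \<partial>N \<partial>uniform_angle)"
   by (simp only: nn_integral_image[OF Zm s1])
  also have "... = (\<integral>\<^sup>+u. \<integral>\<^sup>+a. ?i (points (crossings a u)) \<partial>?Q \<partial>uniform_angle)"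
   by (simp only: fixed_shift_law[OF t good C])
  also have "... = (\<integral>\<^sup>+a. \<integral>\<^sup>+u. ?i (points (crossings a u)) \<partial>uniform_angle \<partial>?Q)"
   using QA.Fubini[OF f3] by simp
  also have "... = (\<integral>\<^sup>+a. \<integral>\<^sup>+z. ?i (sample (\<lambda>q\<in>\<rat>. a q - a 0, z)) \<partial>circle \<partial>?Q)"
   by (simp only: average_over_levels[OF C])
  also have "... = (\<integral>\<^sup>+w. \<integral>\<^sup>+z. ?i (sample (?rel w, z)) \<partial>circle \<partial>N)"
  proof -
   have "(%a. \<lambda>q\<in>\<rat>. a q - a 0) \<in> measurable path_space path_space"
    by (intro measurable_restrict borel_measurable_diff path_component_measurable) auto
   from nn_integral_image[OF pm measurable_compose[OF this H]]
   have "(\<integral>\<^sup>+a. \<integral>\<^sup>+z. ?i (sample (\<lambda>q\<in>\<rat>. a q - a 0, z)) \<partial>circle \<partial>?Q) = (\<integral>\<^sup>+w. \<integral>\<^sup>+z. ?i (sample (\<lambda>q\<in>\<rat>. path t w q - path t w 0, z)) \<partial>circle \<partial>N)" .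
   moreover have "(\<lambda>q\<in>\<rat>. path t w q - path t w 0) = ?rel w" for w by (auto simp: path_def restrict_def)
   ultimately show ?thesis by (simp only:)
  qed
  also have "... = (\<integral>\<^sup>+b. \<integral>\<^sup>+z. ?i (sample (b, z)) \<partial>circle \<partial>?L)"
   by (rule nn_integral_image[OF relm H, symmetric])
  also have "... = (\<integral>\<^sup>+p. ?i (sample p) \<partial>?LC)"
   by (rule K.nn_integral_fst[OF f2])
  also have "... = emeasure (distr ?LC config_space sample) C"
   by (rule emeasure_image[OF am C, symmetric])
  finally show "emeasure (distr ?PA config_space shift) C = emeasure (distr ?LC config_space sample) C" .
 qed simp
qed

end

theorem theorem6:
  fixes \<tau> :: real
    and M :: "'v measure" and F :: "real \<Rightarrow> 'v measure"
    and Y :: "nat \<Rightarrow> real \<Rightarrow> 'v \<Rightarrow> real"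
    and V :: "real \<Rightarrow> 'v \<Rightarrow> complex"
    and \<gamma> :: "real \<Rightarrow> real \<Rightarrow> 'v \<Rightarrow> real"
    and N :: "'w measure" and G :: "real \<Rightarrow> 'w measure"
    and B :: "nat \<Rightarrow> real \<Rightarrow> 'w \<Rightarrow> real"
    and \<phi> :: "real \<Rightarrow> real \<Rightarrow> 'w \<Rightarrow> real"
    and U :: "'w \<Rightarrow> real"
  assumes "\<tau> > 0"
    and "prob_space M"
    and "hyperbolic_BM M F Y V"
    and "carousel_angle M V \<gamma>"
    and "prob_space N"
    and "sch_flow N G B \<phi>"
    and "independent_uniform_shift N U (Sch \<phi> \<tau>)"
  shows "pp_eq_law M (\<lambda>\<omega>. {l. carousel_point \<gamma> (l / \<tau>) \<tau> \<omega> = V_infinity V \<omega>})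
                   N (Sch_star \<phi> U \<tau>)"
proof -
 have c: "carousel M F Y V \<gamma>" using assms(2-4) by (rule carousel.intro)
 have s: "schroedinger N G B \<phi>" using assms(5,6) by (rule schroedinger.intro)
 interpret c: carousel M F Y V \<gamma> by (rule c)
 interpret s: schroedinger N G B \<phi> by (rule s)
 let ?rel = "%w. \<lambda>q\<in>\<rat>. \<phi> (q / \<tau>) \<tau> w - \<phi> 0 \<tau> w"
 have law: "distr M path_space (c.path \<tau>) = distr N path_space ?rel"
  using relative_law[OF c s assms(1)] unfolding c.path_def[abs_def] .
 have relm: "?rel \<in> measurable N path_space"
  using assms(1) by (intro measurable_restrict borel_measurable_diff s.phi_meas) simp_all
 have "AE w in N. proper_increasing (?rel w)"
  using c.proper_increasing_path[OF assms(1)] unfolding law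
  by (subst (asm) AE_distr_iff[OF relm proper_increasing_event])
 hence good: "AE w in N. increasing_bijection (%l. \<phi> (l / \<tau>) \<tau> w)"
  using s.flow_continuous[OF assms(1)]
  by eventually_elim (rule proper_increasing_bijection[where a="?rel _" and d="\<phi> 0 \<tau> _"], auto)
 show ?thesis unfolding pp_eq_law_def
  using c.carousel_law[OF assms(1)] s.shifted_law[OF assms(1) good assms(7)] unfolding law by simp
qed

end
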